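(* Let $2\leq l,l'<n$, $r,r'\in\mathbb{Z}_n$, $\eta\in\mathbb{P}^1(k)$ and $s\geq 1$. Assume that $t=l+l'-(n+1)\geq 0$. Let $l_1=\min\{l,l'\}$ and $l_2=\max\{l,l'\}$. Then, as $H_n(1,q)$-modules, $$\begin{aligned}P(l,r)\otimes M_s(l',r',\eta)\cong&\Big(\bigoplus_{i=c(t)}^{t}2sP(l+l'-1-2i,\,r+r'+i)\Big)\\&\oplus\Big(\bigoplus_{i=t+1}^{l_1-1}sP(l+l'-1-2i,\,r+r'+i)\Big)\\&\oplus\Big(\bigoplus_{i=l_2}^{n-1}sP(n+l+l'-1-2i,\,r+r'+i)\Big)\\&\oplus\Big(\bigoplus_{c(l+l'-1)\leq i\leq l_2-1}2sP(n+l+l'-1-2i,\,r+r'+i)\Big).\end{aligned}$$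
   Context: Setting: $k$ is an algebraically closed field, $n>2$ is a fixed integer, $q\in k$ is a primitive $n$-th root of unity, $\mathbb{Z}_n=\mathbb{Z}/n\mathbb{Z}$, and $(i)_q=1+q+\cdots+q^{i-1}$. $H_n(1,q)$ is the Hopf algebra over $k$ (isomorphic to the Drinfeld double of the Taft algebra $H_n(q)$) generated as an algebra by $a,b,c,d$ with relations $ba=qab$, $db=qbd$, $ca=qac$, $dc=qcd$, $bc=cb$, $a^n=0$, $b^n=1$, $c^n=1$, $d^n=0$, $da-qad=1-bc$, with comultiplication $\Delta(a)=a\otimes b+1\otimes a$, $\Delta(b)=b\otimes b$, $\Delta(c)=c\otimes c$, $\Delta(d)=d\otimes c+1\otimes d$, counit $\varepsilon(a)=\varepsilon(d)=0$, $\varepsilon(b)=\varepsilon(c)=1$, and antipode $S(a)=-ab^{-1}$, $S(b)=b^{-1}$, $S(c)=c^{-1}$, $S(d)=-dc^{-1}$. All modules are finite-dimensional left $H_n(1,q)$-modules, $\otimes=\otimes_k$ with action through $\Delta$, and $sM$ is the direct sum of $s$ copies of $M$ ($sM=0$ if $s=0$). Simple modules: for $1\leq l\leq n$, $r\in\mathbb{Z}_n$, $V(l,r)$ has basis $v_1,\dots,v_l$ with $av_i=v_{i+1}$ for $i<l$, $av_l=0$, $bv_i=q^{r+i-1}v_i$, $cv_i=q^{i-r-l}v_i$, $dv_1=0$, $dv_i=\alpha_{i-1}(l)v_{i-1}$ for $1<i\leq l$, where $\alpha_i(l)=(i)_q(1-q^{i-l})$. For $1\leq l<n$, $P(l,r)$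 is the projective cover of $V(l,r)$, and $P(n,r)=V(n,r)$ (which is projective). Band modules: $\mathbb{P}^1(k)$ is identified with $k\cup\{\infty\}$, with $\alpha\infty=\infty\alpha=\infty$ for $0\neq\alpha\in k$. For $1\leq l<n$, $r\in\mathbb{Z}_n$, $\eta\in\mathbb{P}^1(k)$, the module $M_1(l,r,\eta)$ has basis $v_1,\dots,v_n$ with $bv_i=q^{r+l+i-1}v_i$, $cv_i=q^{i-r}v_i$, $dv_i=\alpha_{i-1}(n-l)v_{i-1}$ for $1<i\leq n-l$, $dv_{n-l+1}=0$, $dv_i=\alpha_{i-n+l-1}(l)v_{i-1}$ for $n-l+1<i\leq n$, and: if $\eta=\infty$, $av_i=0$ for $i\in\{n-l,n\}$, $av_i=v_{i+1}$ otherwise, and $dv_1=v_n$; if $\eta\in k$, $av_i=v_{i+1}$ for $1\leq i<n$, $av_n=0$, and $dv_1=\eta q^lv_n$. With $M_0(l,r,\eta)=0$, the modules $M_s(l,r,\eta)$ are determined recursively (up to isomorphism) by the almost split sequences $0\to M_s(l,r,\eta)\to M_{s-1}(l,r,\eta)\oplus M_{s+1}(l,r,\eta)\to M_s(l,r,\eta)\to 0$, $s\geq 1$. Conventions: integers in the second argument of $V$, $P$ and $M_s$ are read modulo $n$; $c(t)=\lfloor (t+1)/2\rfloor$ for $t\in\mathbb{Z}$ (the function $c(\cdot)$ is not to be confused with the generator $c$); a direct sum over an empty range of indices is zero. *)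

theory Defs
  imports Jordan_Normal_Form.Matrix_Kernel
begin

section \<open>Finite-dimensional left modules over $H_n(1,q)$\<close>

text \<open>
  The Hopf algebra $H_n(1,q)$ is given by generators $a,b,c,d$ and relations, so a
  finite-dimensional left module is a finite-dimensional vector space with four endomorphisms that
  satisfy the relations.  The underlying space is \<^term>\<open>carrier_vec m\<close> (that is, a basis is fixed),
  the endomorphisms are \<open>m \<times> m\<close> matrices acting on column vectors, and modules are compared up to
  isomorphism.  Quantification over modules therefore ranges over all dimensions.
\<close>

datatype 'k hmod =
  HMod (hdim: nat) (opa: "'k mat") (opb: "'k mat") (opc: "'k mat") (opd: "'k mat")

definition is_hmod :: "nat \<Rightarrow> 'k::field \<Rightarrow> 'k hmod \<Rightarrow> bool" where
  "is_hmod n q M \<longleftrightarrow> (let m = hdim M; A = opa M; B = opb M; C = opc M; D = opd M in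
     A \<in> carrier_mat m m \<and> B \<in> carrier_mat m m \<and> C \<in> carrier_mat m m \<and> D \<in> carrier_mat m m \<and>
     B * A = q \<cdot>\<^sub>m (A * B) \<and>
     D * B = q \<cdot>\<^sub>m (B * D) \<and>
     C * A = q \<cdot>\<^sub>m (A * C) \<and>
     D * C = q \<cdot>\<^sub>m (C * D) \<and>
     B * C = C * B \<and>
     A ^\<^sub>m n = 0\<^sub>m m m \<and>
     B ^\<^sub>m n = 1\<^sub>m m \<and>
     C ^\<^sub>m n = 1\<^sub>m m \<and>
     D ^\<^sub>m n = 0\<^sub>m m m \<and>
     D * A - q \<cdot>\<^sub>m (A * D) = 1\<^sub>m m - B * C)"

definition is_hom :: "'k::field hmod \<Rightarrow> 'k hmod \<Rightarrow> 'k mat \<Rightarrow> bool" where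
  "is_hom M N f \<longleftrightarrow> f \<in> carrier_mat (hdim N) (hdim M) \<and>
     f * opa M = opa N * f \<and> f * opb M = opb N * f \<and>
     f * opc M = opc N * f \<and> f * opd M = opd N * f"

definition is_epi :: "'k::field hmod \<Rightarrow> 'k hmod \<Rightarrow> 'k mat \<Rightarrow> bool" where
  "is_epi M N f \<longleftrightarrow> is_hom M N f \<and>
     (\<lambda>v. f *\<^sub>v v) ` carrier_vec (hdim M) = carrier_vec (hdim N)"

definition is_mono :: "'k::field hmod \<Rightarrow> 'k hmod \<Rightarrow> 'k mat \<Rightarrow> bool" where
  "is_mono M N f \<longleftrightarrow> is_hom M N f \<and> inj_on (\<lambda>v. f *\<^sub>v v) (carrier_vec (hdim M))"

definition hmod_iso :: "'k::field hmod \<Rightarrow> 'k hmod \<Rightarrow> bool" (infix \<open>\<cong>\<^sub>H\<close> 50) where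
  "M \<cong>\<^sub>H N \<longleftrightarrow> (\<exists>f g. is_hom M N f \<and> is_hom N M g \<and> g * f = 1\<^sub>m (hdim M) \<and> f * g = 1\<^sub>m (hdim N))"

text \<open>The empty direct sum is the zero module.\<close>

definition hsum :: "'k::field hmod list \<Rightarrow> 'k hmod" where
  "hsum Ms = HMod (sum_list (map hdim Ms))
     (diag_block_mat (map opa Ms)) (diag_block_mat (map opb Ms))
     (diag_block_mat (map opc Ms)) (diag_block_mat (map opd Ms))"

definition copies :: "nat \<Rightarrow> 'k::field hmod \<Rightarrow> 'k hmod" where
  "copies s M = hsum (replicate s M)"

text \<open>Matrix of the tensor product of two linear maps; the basis vectors $v_i \otimes w_j$ of the
  tensor product of the underlying spaces are ordered lexicographically.\<close>

definition kron :: "'k::field mat \<Rightarrow> 'k mat \<Rightarrow> 'k mat" where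
  "kron X Y = mat (dim_row X * dim_row Y) (dim_col X * dim_col Y)
     (\<lambda>(i, j). X $$ (i div dim_row Y, j div dim_col Y) * Y $$ (i mod dim_row Y, j mod dim_col Y))"

text \<open>The action on a tensor product comes from the comultiplication
  $\Delta(a) = a \otimes b + 1 \otimes a$, $\Delta(b) = b \otimes b$, $\Delta(c) = c \otimes c$,
  $\Delta(d) = d \otimes c + 1 \otimes d$.\<close>

definition htensor :: "'k::field hmod \<Rightarrow> 'k hmod \<Rightarrow> 'k hmod" (infixl \<open>\<otimes>\<^sub>H\<close> 70) where
  "M \<otimes>\<^sub>H N = HMod (hdim M * hdim N)
     (kron (opa M) (opb N) + kron (1\<^sub>m (hdim M)) (opa N))
     (kron (opb M) (opb N))
     (kron (opc M) (opc N))
     (kron (opd M) (opc N) + kron (1\<^sub>m (hdim M)) (opd N))"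


section \<open>Projective covers and almost split sequences\<close>

definition is_projective :: "nat \<Rightarrow> 'k::field \<Rightarrow> 'k hmod \<Rightarrow> bool" where
  "is_projective n q P \<longleftrightarrow> is_hmod n q P \<and>
     (\<forall>X Y g f. is_hmod n q X \<and> is_hmod n q Y \<and> is_epi X Y g \<and> is_hom P Y f \<longrightarrow>
        (\<exists>h. is_hom P X h \<and> g * h = f))"

definition is_essential_epi :: "nat \<Rightarrow> 'k::field \<Rightarrow> 'k hmod \<Rightarrow> 'k hmod \<Rightarrow> 'k mat \<Rightarrow> bool" where
  "is_essential_epi n q M N f \<longleftrightarrow> is_epi M N f \<and>
     (\<forall>X g. is_hmod n q X \<and> is_hom X M g \<and> is_epi X N (f * g) \<longrightarrow> is_epi X M g)"

definition is_projective_cover :: "nat \<Rightarrow> 'k::field \<Rightarrow> 'k hmod \<Rightarrow> 'k hmod \<Rightarrow> bool" where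
  "is_projective_cover n q P V \<longleftrightarrow> is_projective n q P \<and> (\<exists>f. is_essential_epi n q P V f)"

definition is_short_exact ::
  "nat \<Rightarrow> 'k::field \<Rightarrow> 'k hmod \<Rightarrow> 'k mat \<Rightarrow> 'k hmod \<Rightarrow> 'k mat \<Rightarrow> 'k hmod \<Rightarrow> bool" where
  "is_short_exact n q L f M g N \<longleftrightarrow>
     is_hmod n q L \<and> is_hmod n q M \<and> is_hmod n q N \<and> is_mono L M f \<and> is_epi M N g \<and>
     (\<lambda>v. f *\<^sub>v v) ` carrier_vec (hdim L) = mat_kernel g"

definition is_split_mono :: "'k::field hmod \<Rightarrow> 'k hmod \<Rightarrow> 'k mat \<Rightarrow> bool" where
  "is_split_mono M N f \<longleftrightarrow> is_hom M N f \<and> (\<exists>h. is_hom N M h \<and> h * f = 1\<^sub>m (hdim M))"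

definition is_split_epi :: "'k::field hmod \<Rightarrow> 'k hmod \<Rightarrow> 'k mat \<Rightarrow> bool" where
  "is_split_epi M N f \<longleftrightarrow> is_hom M N f \<and> (\<exists>h. is_hom N M h \<and> f * h = 1\<^sub>m (hdim N))"

definition left_almost_split :: "nat \<Rightarrow> 'k::field \<Rightarrow> 'k hmod \<Rightarrow> 'k hmod \<Rightarrow> 'k mat \<Rightarrow> bool" where
  "left_almost_split n q L M f \<longleftrightarrow> is_hom L M f \<and> \<not> is_split_mono L M f \<and>
     (\<forall>Y u. is_hmod n q Y \<and> is_hom L Y u \<and> \<not> is_split_mono L Y u \<longrightarrow>
        (\<exists>h. is_hom M Y h \<and> h * f = u))"

definition right_almost_split :: "nat \<Rightarrow> 'k::field \<Rightarrow> 'k hmod \<Rightarrow> 'k hmod \<Rightarrow> 'k mat \<Rightarrow> bool" where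
  "right_almost_split n q M N g \<longleftrightarrow> is_hom M N g \<and> \<not> is_split_epi M N g \<and>
     (\<forall>X u. is_hmod n q X \<and> is_hom X N u \<and> \<not> is_split_epi X N u \<longrightarrow>
        (\<exists>h. is_hom X M h \<and> g * h = u))"

definition almost_split_sequence ::
  "nat \<Rightarrow> 'k::field \<Rightarrow> 'k hmod \<Rightarrow> 'k hmod \<Rightarrow> 'k hmod \<Rightarrow> bool" where
  "almost_split_sequence n q L M N \<longleftrightarrow>
     (\<exists>f g. is_short_exact n q L f M g N \<and> left_almost_split n q L M f \<and> right_almost_split n q M N g)"


section \<open>The modules $V(l,r)$, $P(l,r)$ and $M_s(l,r,\eta)$\<close>

text \<open>Residues modulo \<open>n\<close> are represented by arbitrary integers: \<open>r\<close> enters only through powers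
  of \<open>q\<close>, and $q^n = 1$.\<close>

definition primitive_root :: "nat \<Rightarrow> 'k::field \<Rightarrow> bool" where
  "primitive_root n q \<longleftrightarrow> n > 0 \<and> q ^ n = 1 \<and> (\<forall>j. 0 < j \<and> j < n \<longrightarrow> q ^ j \<noteq> 1)"

definition qint :: "'k::field \<Rightarrow> nat \<Rightarrow> 'k" where
  "qint q i = (\<Sum>j<i. q ^ j)"

definition alpha :: "'k::field \<Rightarrow> nat \<Rightarrow> nat \<Rightarrow> 'k" where
  "alpha q l i = qint q i * (1 - q powi (int i - int l))"

text \<open>The matrix of the endomorphism with $v_i \mapsto \sum_j g\,i\,j\; v_j$, where the basis
  $v_1, \dots, v_m$ is numbered from 1 whereas matrix entries are numbered from 0.\<close>

definition endo :: "nat \<Rightarrow> (nat \<Rightarrow> nat \<Rightarrow> 'k::field) \<Rightarrow> 'k mat" where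
  "endo m g = mat m m (\<lambda>(row, col). g (Suc col) (Suc row))"

definition simple_mod :: "'k::field \<Rightarrow> nat \<Rightarrow> int \<Rightarrow> 'k hmod" where
  "simple_mod q l r = HMod l
     (endo l (\<lambda>i j. if i < l \<and> j = i + 1 then 1 else 0))
     (endo l (\<lambda>i j. if j = i then q powi (r + int i - 1) else 0))
     (endo l (\<lambda>i j. if j = i then q powi (int i - r - int l) else 0))
     (endo l (\<lambda>i j. if 1 < i \<and> j = i - 1 then alpha q l (i - 1) else 0))"

definition is_P :: "nat \<Rightarrow> 'k::field \<Rightarrow> nat \<Rightarrow> int \<Rightarrow> 'k hmod \<Rightarrow> bool" where
  "is_P n q l r P \<longleftrightarrow>
     (1 \<le> l \<and> l < n \<and> is_projective_cover n q P (simple_mod q l r)) \<or>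
     (l = n \<and> P = simple_mod q n r)"

datatype 'k proj_line = Fin 'k | Infty

definition band1 :: "nat \<Rightarrow> 'k::field \<Rightarrow> nat \<Rightarrow> int \<Rightarrow> 'k proj_line \<Rightarrow> 'k hmod" where
  "band1 n q l r \<eta> = HMod n
     (endo n (\<lambda>i j. case \<eta> of
          Infty \<Rightarrow> if i \<notin> {n - l, n} \<and> j = i + 1 then 1 else 0
        | Fin _ \<Rightarrow> if i < n \<and> j = i + 1 then 1 else 0))
     (endo n (\<lambda>i j. if j = i then q powi (r + int l + int i - 1) else 0))
     (endo n (\<lambda>i j. if j = i then q powi (int i - r) else 0))
     (endo n (\<lambda>i j.
        if i = 1 then
          (if j = n then (case \<eta> of Infty \<Rightarrow> 1 | Fin x \<Rightarrow> x * q ^ l) else 0)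
        else if i \<le> n - l then (if j = i - 1 then alpha q (n - l) (i - 1) else 0)
        else if i = n - l + 1 then 0
        else (if j = i - 1 then alpha q l (i - (n - l) - 1) else 0)))"

text \<open>\<open>M\<close> is a module $M_s(l,r,\eta)$, which is determined up to isomorphism by
  the almost split sequences $0 \to M_i \to M_{i-1} \oplus M_{i+1} \to M_i \to 0$; those with
  \<open>1 \<le> i < s\<close> are the ones that lead from $M_0 = 0$ and $M_1$ to $M_s$.\<close>

definition is_band :: "nat \<Rightarrow> 'k::field \<Rightarrow> nat \<Rightarrow> int \<Rightarrow> 'k proj_line \<Rightarrow> nat \<Rightarrow> 'k hmod \<Rightarrow> bool" where
  "is_band n q l r \<eta> s M \<longleftrightarrow> is_hmod n q M \<and>
     (\<exists>N. N 0 = hsum [] \<and> N 1 = band1 n q l r \<eta> \<and>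
        (\<forall>i. 1 \<le> i \<and> i < s \<longrightarrow>
           is_hmod n q (N (i + 1)) \<and>
           almost_split_sequence n q (N i) (hsum [N (i - 1), N (i + 1)]) (N i)) \<and>
        M \<cong>\<^sub>H N s)"

definition ceil_half :: "int \<Rightarrow> int" where
  "ceil_half t = \<lfloor>(of_int (t + 1) :: rat) / 2\<rfloor>"

end

theory Submission
  imports Defs
begin

text \<open>
  Both sides are projective, and a projective module is determined up to isomorphism by the
  dimensions of its spaces of homomorphisms to the simple modules $V(j,u)$.  A short exact sequence
  splits after tensoring with $P(l,r)$, so $M_s(l',r',\eta)$ may be replaced by $s$ copies of
  $M_1(l',r',0)$, in which the powers of $a$ applied to a single weight vector form a basis.
  A homomorphism from $P(l,r) \otimes M_1(l',r',0)$ to $V(j,u)$ then amounts to a weight functional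
  $\xi$ on $P(l,r)$ with $\xi d^j = 0$.  As $P(l,r)$ is free over $k[d]$, the dimension of the space
  of these functionals is the sum of the dimensions of $j$ spaces of weight functionals killed
  by $d$.  The latter are computed from the action of a power of $a$, with kernel
  $\mathrm{Hom}(P(l,r), V(j',u'))$ and image $\mathrm{Hom}(P(l,r), V(n-j',u'+j'))$.
\<close>

section \<open>Matrix algebra\<close>

text \<open>Neither \<open>P(l,r)\<close> nor \<open>M_s\<close> comes with a basis: the first is
  known by a universal property, the second through almost split sequences. Hence only numbers are
  computed. The parameter \<open>s\<close> factors out because the dimensions \<open>m_s\<close>
  belonging to \<open>P \<otimes> M_s\<close> satisfy \<open>m_(s-1) + m_(s+1) = 2 m_s\<close> and
  \<open>m_0 = 0\<close>. The parameter \<eta> disappears because every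
  \<open>M_1(l',r',\<eta>)\<close> is an extension of \<open>V(n-l',r'+l')\<close> by
  \<open>V(l',r')\<close>, and \<eta> only affects how the two are glued; at \<eta> = 0 no arrow of
  \<open>d\<close> wraps around from \<open>v_1\<close> to \<open>v_n\<close>, while
  \<open>a\<close> still runs through the whole basis. A weight functional killed by
  \<open>d\<close> involves at most two simple modules, so \<open>P(l,r)\<close> leaves two
  congruences for each step of a filtration by powers of \<open>d\<close>; the coefficients
  \<open>s\<close> and \<open>2s\<close> of the result record how many of them are solvable. The
  field may have positive characteristic, so the projections to weight spaces, which need
  \<open>1/n\<close>, rest on a proof that \<open>n\<close> is nonzero in it.\<close>

lemma mult_assoc_dim: "dim_col A = dim_row B \<Longrightarrow> dim_col B = dim_row C \<Longrightarrow> A * B * C = A * (B * C)"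
  for A B C :: "'a::semiring_0 mat"
  by (rule assoc_mult_mat[of A "dim_row A" "dim_row B" B "dim_row C" C "dim_col C"]) auto

lemma add_mult_dim:
  "dim_row A = dim_row B \<Longrightarrow> dim_col A = dim_col B \<Longrightarrow> dim_col B = dim_row C \<Longrightarrow> (A + B) * C = A * C + B * C"
  for A B C :: "'a::semiring_0 mat"
  by (rule add_mult_distrib_mat[of A "dim_row A" "dim_col A" B C "dim_col C"]) auto

lemma mult_add_dim:
  "dim_row B = dim_row C \<Longrightarrow> dim_col B = dim_col C \<Longrightarrow> dim_col A = dim_row C \<Longrightarrow> A * (B + C) = A * B + A * C"
  for A B C :: "'a::semiring_0 mat"
  by (rule mult_add_distrib_mat[of A "dim_row A" "dim_col A" B "dim_col C" C]) auto

lemma minus_mult_dim: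
  "dim_row A = dim_row B \<Longrightarrow> dim_col A = dim_col B \<Longrightarrow> dim_col B = dim_row C \<Longrightarrow> (A - B) * C = A * C - B * C"
  for A B C :: "'a::ring mat"
  by (rule minus_mult_distrib_mat[of A "dim_row A" "dim_col A" B C "dim_col C"]) auto

lemma mult_minus_dim:
  "dim_row B = dim_row C \<Longrightarrow> dim_col B = dim_col C \<Longrightarrow> dim_col A = dim_row C \<Longrightarrow> A * (B - C) = A * B - A * C"
  for A B C :: "'a::ring mat"
  by (rule mult_minus_distrib_mat[of A "dim_row A" "dim_col A" B "dim_col C" C]) auto

lemma smult_mult_dim: "dim_col A = dim_row B \<Longrightarrow> (k \<cdot>\<^sub>m A) * B = k \<cdot>\<^sub>m (A * B)"
  for A B :: "'a::comm_semiring_0 mat"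
  by (rule mult_smult_assoc_mat[of A "dim_row A" "dim_col A" B "dim_col B"]) auto

lemma mult_smult_dim: "dim_col A = dim_row B \<Longrightarrow> A * (k \<cdot>\<^sub>m B) = k \<cdot>\<^sub>m (A * B)"
  for A B :: "'a::comm_semiring_0 mat"
  by (rule mult_smult_distrib[of A "dim_row A" "dim_col A" B "dim_col B"]) auto

lemma smult_smult_mat: "k \<cdot>\<^sub>m (l \<cdot>\<^sub>m A) = (k * l) \<cdot>\<^sub>m A" for A :: "'a::semigroup_mult mat"
  by (rule eq_matI) (auto simp: mult.assoc)

lemma one_smult_mat [simp]: "1 \<cdot>\<^sub>m A = A" for A :: "'a::monoid_mult mat"
  by (rule eq_matI) auto

lemma zero_smult_mat: "0 \<cdot>\<^sub>m A = 0\<^sub>m (dim_row A) (dim_col A)" for A :: "'a::mult_zero mat"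
  by (rule eq_matI) auto

lemma smult_cancel_mat: "k \<noteq> 0 \<Longrightarrow> k \<cdot>\<^sub>m A = k \<cdot>\<^sub>m B \<longleftrightarrow> A = B" for A B :: "'a::field mat"
proof
  assume "k \<noteq> 0" "k \<cdot>\<^sub>m A = k \<cdot>\<^sub>m B"
  then have "inverse k \<cdot>\<^sub>m (k \<cdot>\<^sub>m A) = inverse k \<cdot>\<^sub>m (k \<cdot>\<^sub>m B)" by simp
  with \<open>k \<noteq> 0\<close> show "A = B" by (simp add: smult_smult_mat)
qed simp

lemma smult_add_mat: "dim_row A = dim_row B \<Longrightarrow> dim_col A = dim_col B \<Longrightarrow>
    k \<cdot>\<^sub>m (A + B) = k \<cdot>\<^sub>m A + k \<cdot>\<^sub>m B" for A B :: "'a::semiring mat"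
  by (rule eq_matI) (auto simp: distrib_left)

lemma pow_mat_mult_left: "A \<in> carrier_mat m m \<Longrightarrow> A ^\<^sub>m Suc k = A * A ^\<^sub>m k" for A :: "'a::semiring_1 mat"
proof (induction k)
  case (Suc k)
  then have "A ^\<^sub>m Suc (Suc k) = A * A ^\<^sub>m k * A" by simp
  also have "\<dots> = A * A ^\<^sub>m Suc k" using Suc.prems by (simp add: mult_assoc_dim)
  finally show ?case .
qed simp

lemma pow_mat_add: "A \<in> carrier_mat m m \<Longrightarrow> A ^\<^sub>m (k + l) = A ^\<^sub>m k * A ^\<^sub>m l" for A :: "'a::semiring_1 mat"
  by (induction l) (simp_all add: mult_assoc_dim)

lemma pow_mat_intertwine:
  fixes A B :: "'a::semiring_1 mat"
  assumes "A \<in> carrier_mat m m" "B \<in> carrier_mat p p" "f \<in> carrier_mat p m" "f * A = B * f"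
  shows "f * A ^\<^sub>m k = B ^\<^sub>m k * f"
proof (induction k)
  case (Suc k)
  have "f * A ^\<^sub>m Suc k = (f * A ^\<^sub>m k) * A" using assms by (simp add: mult_assoc_dim)
  also have "\<dots> = B ^\<^sub>m k * (f * A)" using assms Suc by (simp add: mult_assoc_dim)
  also have "\<dots> = B ^\<^sub>m Suc k * f" using assms by (simp add: mult_assoc_dim)
  finally show ?case .
qed (use assms in simp)

lemma pow_mat_transpose: "A \<in> carrier_mat m m \<Longrightarrow> (A ^\<^sub>m k)\<^sup>T = A\<^sup>T ^\<^sub>m k" for A :: "'a::comm_semiring_1 mat"
proof (induction k)
  case (Suc k)
  then have "(A ^\<^sub>m Suc k)\<^sup>T = (A * A ^\<^sub>m k)\<^sup>T" by (metis pow_mat_mult_left)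
  also have "\<dots> = (A ^\<^sub>m k)\<^sup>T * A\<^sup>T" using Suc.prems by (intro transpose_mult[of _ m m _ m]) auto
  finally show ?case using Suc by simp
qed simp

lemma pow_mat_smult: "A \<in> carrier_mat m m \<Longrightarrow> (c \<cdot>\<^sub>m A) ^\<^sub>m k = c ^ k \<cdot>\<^sub>m A ^\<^sub>m k" for A :: "'a::comm_semiring_1 mat"
  by (induction k) (simp_all add: smult_mult_dim mult_smult_dim smult_smult_mat mult.commute)

lemma pow_mat_qcomm:
  fixes A B :: "'a::comm_semiring_1 mat"
  assumes "A \<in> carrier_mat m m" "B \<in> carrier_mat m m" "B * A = c \<cdot>\<^sub>m (A * B)"
  shows "B * A ^\<^sub>m k = c ^ k \<cdot>\<^sub>m (A ^\<^sub>m k * B)"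
proof (induction k)
  case (Suc k)
  have "B * A ^\<^sub>m Suc k = (B * A ^\<^sub>m k) * A" using assms by (simp add: mult_assoc_dim)
  also have "\<dots> = c ^ k \<cdot>\<^sub>m (A ^\<^sub>m k * (B * A))" 
    unfolding Suc using assms(1,2) by (simp add: mult_assoc_dim smult_mult_dim)
  also have "\<dots> = c ^ Suc k \<cdot>\<^sub>m (A ^\<^sub>m Suc k * B)" unfolding assms(3)
    using assms(1,2) by (simp add: mult_assoc_dim mult_smult_dim smult_smult_mat mult.commute)
  finally show ?case .
qed (use assms in simp)

lemma pow_mat_qcomm':
  fixes A B :: "'a::comm_semiring_1 mat"
  assumes "A \<in> carrier_mat m m" "B \<in> carrier_mat m m" "B * A = c \<cdot>\<^sub>m (A * B)"
  shows "B ^\<^sub>m k * A = c ^ k \<cdot>\<^sub>m (A * B ^\<^sub>m k)"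
proof (induction k)
  case (Suc k)
  have "B ^\<^sub>m Suc k * A = B ^\<^sub>m k * (B * A)" using assms(1,2) by (simp add: mult_assoc_dim)
  also have "\<dots> = c \<cdot>\<^sub>m ((B ^\<^sub>m k * A) * B)" unfolding assms(3)
    using assms(1,2) by (simp add: mult_assoc_dim mult_smult_dim)
  also have "\<dots> = c ^ Suc k \<cdot>\<^sub>m (A * B ^\<^sub>m Suc k)" unfolding Suc
    using assms(1,2) by (simp add: mult_assoc_dim smult_mult_dim smult_smult_mat)
  finally show ?case .
qed (use assms in simp)

text \<open>The normal form is a sum of products associated to the right with scalars in front. The
  premises of these rules mention only \<open>dim_row\<close> and \<open>dim_col\<close> of the
  matrices that occur, so the simplifier can discharge them.\<close>

lemmas mat_alg = mult_assoc_dim add_mult_dim mult_add_dim minus_mult_dim mult_minus_dim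
  smult_mult_dim mult_smult_dim smult_smult_mat

lemma delta_mult:
  "(if P then 1 else 0) * x = (if P then x else 0)" "x * (if P then 1 else 0) = (if P then x else 0)"
  for x :: "'a::semiring_1"
  by auto

lemma sum_delta_delta:
  "finite S \<Longrightarrow> (\<Sum>k\<in>S. (if k = i then 1 else 0) * (if k = j then 1 else 0)) = (if i = j \<and> i \<in> S then 1 else 0 :: 'a::semiring_1)"
  "finite S \<Longrightarrow> (\<Sum>k\<in>S. (if i = k then 1 else 0) * (if k = j then 1 else 0)) = (if i = j \<and> i \<in> S then 1 else 0 :: 'a::semiring_1)"
  by (subst sum.cong[OF refl, of _ _ "\<lambda>k. if i = k then (if i = j then 1 else 0) else 0"]; auto)+

subsection \<open>Unit rows and columns\<close>

text \<open>Vectors and functionals are matrices with one column or one row, so that they share a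
  single associative product with the homomorphisms; \<open>urow\<close> and \<open>ucol\<close> are
  coordinate functionals and basis vectors.\<close>

definition urow :: "nat \<Rightarrow> nat \<Rightarrow> 'a::zero_neq_one mat" where
  "urow m i = mat 1 m (\<lambda>(_, j). if j = i then 1 else 0)"

definition ucol :: "nat \<Rightarrow> nat \<Rightarrow> 'a::zero_neq_one mat" where
  "ucol m i = mat m 1 (\<lambda>(j, _). if j = i then 1 else 0)"

lemma dim_urow [simp]: "dim_row (urow m i) = 1" "dim_col (urow m i) = m"
  by (simp_all add: urow_def)

lemma dim_ucol [simp]: "dim_row (ucol m i) = m" "dim_col (ucol m i) = 1"
  by (simp_all add: ucol_def)

lemma urow_mult:
  "i < dim_row A \<Longrightarrow> urow (dim_row A) i * A = mat 1 (dim_col A) (\<lambda>(_, c). A $$ (i, c))"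
  for A :: "'a::semiring_1 mat"
  by (rule eq_matI) (auto simp: urow_def scalar_prod_def delta_mult sum.delta cong: if_cong)

lemma mult_ucol:
  "i < dim_col A \<Longrightarrow> A * ucol (dim_col A) i = mat (dim_row A) 1 (\<lambda>(r, _). A $$ (r, i))"
  for A :: "'a::semiring_1 mat"
  by (rule eq_matI) (auto simp: ucol_def scalar_prod_def delta_mult sum.delta cong: if_cong)

lemma urow_eqI:
  fixes A B :: "'a::semiring_1 mat"
  assumes "dim_row A = dim_row B" "dim_col A = dim_col B"
    and "\<And>i. i < dim_row B \<Longrightarrow> urow (dim_row B) i * A = urow (dim_row B) i * B"
  shows "A = B"
proof (rule eq_matI)
  fix i j assume "i < dim_row B" "j < dim_col B"
  moreover from this(1) have "(urow (dim_row A) i * A) $$ (0, j) = (urow (dim_row B) i * B) $$ (0, j)"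
    using assms by simp
  ultimately show "A $$ (i, j) = B $$ (i, j)"
    using assms(1,2) unfolding urow_mult[OF \<open>i < dim_row B\<close>[folded assms(1)]] urow_mult[OF \<open>i < dim_row B\<close>]
    by simp
qed (use assms in auto)

lemma ucol_eqI:
  fixes A B :: "'a::semiring_1 mat"
  assumes "dim_row A = dim_row B" "dim_col A = dim_col B"
    and "\<And>i. i < dim_col B \<Longrightarrow> A * ucol (dim_col B) i = B * ucol (dim_col B) i"
  shows "A = B"
proof (rule eq_matI)
  fix i j assume "i < dim_row B" "j < dim_col B"
  moreover from this(2) have "(A * ucol (dim_col A) j) $$ (i, 0) = (B * ucol (dim_col B) j) $$ (i, 0)"
    using assms by simp
  ultimately show "A $$ (i, j) = B $$ (i, j)"
    using assms(1,2) unfolding mult_ucol[OF \<open>j < dim_col B\<close>[folded assms(2)]] mult_ucol[OF \<open>j < dim_col B\<close>]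
    by simp
qed (use assms in auto)

definition rows_mat :: "nat \<Rightarrow> nat \<Rightarrow> (nat \<Rightarrow> 'a mat) \<Rightarrow> 'a mat" where
  "rows_mat j m F = mat j m (\<lambda>(i, c). F i $$ (0, c))"

definition cols_mat :: "nat \<Rightarrow> nat \<Rightarrow> (nat \<Rightarrow> 'a mat) \<Rightarrow> 'a mat" where
  "cols_mat m j F = mat m j (\<lambda>(r, i). F i $$ (r, 0))"

lemma dim_rows_mat [simp]: "dim_row (rows_mat j m F) = j" "dim_col (rows_mat j m F) = m"
  by (simp_all add: rows_mat_def)

lemma dim_cols_mat [simp]: "dim_row (cols_mat m j F) = m" "dim_col (cols_mat m j F) = j"
  by (simp_all add: cols_mat_def)

lemma urow_rows_mat: "i < j \<Longrightarrow> F i \<in> carrier_mat 1 m \<Longrightarrow> urow j i * rows_mat j m F = F i"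
  for F :: "nat \<Rightarrow> 'a::semiring_1 mat"
  using urow_mult[of i "rows_mat j m F"] by (auto simp: rows_mat_def intro!: eq_matI)

lemma cols_mat_ucol: "i < j \<Longrightarrow> F i \<in> carrier_mat m 1 \<Longrightarrow> cols_mat m j F * ucol j i = F i"
  for F :: "nat \<Rightarrow> 'a::semiring_1 mat"
  using mult_ucol[of i "cols_mat m j F"] by (auto simp: cols_mat_def intro!: eq_matI)

subsection \<open>Coordinate embeddings\<close>

text \<open>With \<open>inr\<close>, \<open>prl\<close> and \<open>prr\<close> these are the
  structure maps of a direct sum of coordinate spaces. Block matrices are written through them, so
  that block computations follow from the five relations \<open>embed_simps\<close> instead of index
  arithmetic.\<close>

definition inl :: "nat \<Rightarrow> nat \<Rightarrow> 'a::zero_neq_one mat" where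
  "inl a b = mat (a + b) a (\<lambda>(i, j). if i = j then 1 else 0)"

definition inr :: "nat \<Rightarrow> nat \<Rightarrow> 'a::zero_neq_one mat" where
  "inr a b = mat (a + b) b (\<lambda>(i, j). if i = a + j then 1 else 0)"

definition prl :: "nat \<Rightarrow> nat \<Rightarrow> 'a::zero_neq_one mat" where
  "prl a b = mat a (a + b) (\<lambda>(i, j). if i = j then 1 else 0)"

definition prr :: "nat \<Rightarrow> nat \<Rightarrow> 'a::zero_neq_one mat" where
  "prr a b = mat b (a + b) (\<lambda>(i, j). if j = a + i then 1 else 0)"

lemma dim_embed [simp]:
  "dim_row (inl a b) = a + b" "dim_col (inl a b) = a" "dim_row (inr a b) = a + b" "dim_col (inr a b) = b"
  "dim_row (prl a b) = a" "dim_col (prl a b) = a + b" "dim_row (prr a b) = b" "dim_col (prr a b) = a + b"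
  by (simp_all add: inl_def inr_def prl_def prr_def)

lemma embed_simps [simp]:
  "prl a b * inl a b = (1\<^sub>m a :: 'a::semiring_1 mat)"
  "prr a b * inr a b = (1\<^sub>m b :: 'a::semiring_1 mat)"
  "prl a b * inr a b = (0\<^sub>m a b :: 'a::semiring_1 mat)"
  "prr a b * inl a b = (0\<^sub>m b a :: 'a::semiring_1 mat)"
  "inl a b * prl a b + inr a b * prr a b = (1\<^sub>m (a + b) :: 'a::semiring_1 mat)"
proof -
  show "prl a b * inl a b = (1\<^sub>m a :: 'a mat)" "prr a b * inr a b = (1\<^sub>m b :: 'a mat)"
    "prl a b * inr a b = (0\<^sub>m a b :: 'a mat)" "prr a b * inl a b = (0\<^sub>m b a :: 'a mat)"
    by (rule eq_matI; auto simp: inl_def inr_def prl_def prr_def scalar_prod_def sum_delta_delta)+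
  show "inl a b * prl a b + inr a b * prr a b = (1\<^sub>m (a + b) :: 'a mat)"
  proof (rule eq_matI)
    fix i j assume "i < dim_row (1\<^sub>m (a + b) :: 'a mat)" "j < dim_col (1\<^sub>m (a + b) :: 'a mat)"
    then have ij: "i < a + b" "j < a + b" by auto
    have "(inl a b * prl a b :: 'a mat) $$ (i, j) = (if i = j \<and> i < a then 1 else 0)"
      using ij by (simp add: inl_def prl_def scalar_prod_def sum_delta_delta)
    moreover have "(inr a b * prr a b :: 'a mat) $$ (i, j) = (\<Sum>k = 0..<b. if k = j - a then (if i = j \<and> a \<le> j then 1 else 0) else 0)"
    proof -
      have "(inr a b * prr a b :: 'a mat) $$ (i, j) = (\<Sum>k = 0..<b. (if i = a + k then 1 else 0) * (if j = a + k then 1 else 0))"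
        using ij by (simp add: inr_def prr_def scalar_prod_def)
      also have "\<dots> = (\<Sum>k = 0..<b. if k = j - a then (if i = j \<and> a \<le> j then 1 else 0) else 0)"
        by (rule sum.cong) auto
      finally show ?thesis .
    qed
    ultimately show "(inl a b * prl a b + inr a b * prr a b :: 'a mat) $$ (i, j) = (1\<^sub>m (a + b) :: 'a mat) $$ (i, j)"
      using ij by (auto simp: sum.delta)
  qed auto
qed

subsection \<open>Kronecker products\<close>

lemma dim_kron [simp]:
  "dim_row (kron A B) = dim_row A * dim_row B" "dim_col (kron A B) = dim_col A * dim_col B"
  by (simp_all add: kron_def)

lemma index_less_mult: "i * b + j < a * b" if "i < a" "j < b" for a b :: nat
proof -
  have "i * b + j < Suc i * b" using that by simp
  also have "\<dots> \<le> a * b" using that by (intro mult_le_mono1) simp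
  finally show ?thesis .
qed

text \<open>An index \<open>k\<close> of a tensor product encodes the pair
  \<open>(k div b, k mod b)\<close>; all entrywise computations with \<open>kron\<close> rest on
  this change of variables.\<close>

lemma sum_div_mod:
  "(\<Sum>k = 0..<a * b. h (k div b) (k mod b)) = (\<Sum>i = 0..<a. \<Sum>j = 0..<b. h i j)" for a b :: nat
proof (cases "b = 0")
  case False
  show ?thesis
  proof (induction a)
    case (Suc a)
    have "(\<Sum>k = 0..<Suc a * b. h (k div b) (k mod b))
        = (\<Sum>k = 0..<a * b. h (k div b) (k mod b)) + (\<Sum>k = a * b..<a * b + b. h (k div b) (k mod b))"
      by (subst sum.atLeastLessThan_concat) (auto simp: add.commute)
    also have "(\<Sum>k = a * b..<a * b + b. h (k div b) (k mod b)) = (\<Sum>j = 0..<b. h a j)"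
    proof (rule sum.reindex_bij_witness[of _ "\<lambda>j. a * b + j" "\<lambda>k. k - a * b"])
      fix k assume k: "k \<in> {a * b..<a * b + b}"
      then obtain j where "k = a * b + j" "j < b" by (metis atLeastLessThan_iff le_Suc_ex nat_add_left_cancel_less)
      then show "h a (k - a * b) = h (k div b) (k mod b)" by simp
    qed auto
    finally show ?case using Suc by simp
  qed simp
qed simp

lemma kron_mult:
  fixes A B C D :: "'a::field mat"
  assumes "dim_col A = dim_row C" "dim_col B = dim_row D"
  shows "kron A B * kron C D = kron (A * C) (B * D)"
proof (rule eq_matI)
  fix i j assume "i < dim_row (kron (A * C) (B * D))" "j < dim_col (kron (A * C) (B * D))"
  then have i: "i < dim_row A * dim_row B" and j: "j < dim_col C * dim_col D" by auto
  then have b: "i div dim_row B < dim_row A" "i mod dim_row B < dim_row B" 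
    "j div dim_col D < dim_col C" "j mod dim_col D < dim_col D"
    by (auto simp: less_mult_imp_div_less intro!: mod_less_divisor gr0I)
  have "(kron A B * kron C D) $$ (i, j) = (\<Sum>k = 0..<dim_row C * dim_row D.
      kron A B $$ (i, k) * kron C D $$ (k, j))"
    using i j assms by (simp add: scalar_prod_def)
  also have "\<dots> = (\<Sum>k = 0..<dim_row C * dim_row D.
      (A $$ (i div dim_row B, k div dim_row D) * B $$ (i mod dim_row B, k mod dim_row D)) *
      (C $$ (k div dim_row D, j div dim_col D) * D $$ (k mod dim_row D, j mod dim_col D)))"
    using i j assms by (auto simp: kron_def intro!: sum.cong)
  also have "\<dots> = (\<Sum>x = 0..<dim_row C. \<Sum>y = 0..<dim_row D.
      (A $$ (i div dim_row B, x) * B $$ (i mod dim_row B, y)) *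
      (C $$ (x, j div dim_col D) * D $$ (y, j mod dim_col D)))"
    by (rule sum_div_mod)
  also have "\<dots> = (\<Sum>x = 0..<dim_row C. A $$ (i div dim_row B, x) * C $$ (x, j div dim_col D)) *
      (\<Sum>y = 0..<dim_row D. B $$ (i mod dim_row B, y) * D $$ (y, j mod dim_col D))"
    unfolding sum_product by (intro sum.cong refl) (simp add: mult_ac)
  also have "\<dots> = kron (A * C) (B * D) $$ (i, j)"
    using i j b assms by (simp add: kron_def scalar_prod_def)
  finally show "(kron A B * kron C D) $$ (i, j) = kron (A * C) (B * D) $$ (i, j)" .
qed (use assms in auto)

lemma kron_one [simp]: "kron (1\<^sub>m a) (1\<^sub>m b) = (1\<^sub>m (a * b) :: 'a::field mat)"
proof (rule eq_matI)
  fix i j assume "i < dim_row (1\<^sub>m (a * b) :: 'a mat)" "j < dim_col (1\<^sub>m (a * b) :: 'a mat)"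
  then have ij: "i < a * b" "j < a * b" by auto
  then have "b > 0" by (auto intro: gr0I)
  with ij have "i div b < a" "j div b < a" "i mod b < b" "j mod b < b"
    by (auto simp: less_mult_imp_div_less)
  moreover have "i = j \<longleftrightarrow> i div b = j div b \<and> i mod b = j mod b"
    by (metis div_mult_mod_eq)
  ultimately show "kron (1\<^sub>m a) (1\<^sub>m b) $$ (i, j) = (1\<^sub>m (a * b) :: 'a mat) $$ (i, j)"
    using ij by (simp add: kron_def)
qed auto

lemma kron_index_bounds:
  assumes "i < a * b" shows "i div b < a" "i mod b < (b::nat)"
  using assms by (auto simp: less_mult_imp_div_less intro!: mod_less_divisor gr0I)

lemma eq_mat_prodI:
  assumes "dim_row A = a * b" "dim_col A = c * d" "dim_row B = a * b" "dim_col B = c * d"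
    and "\<And>i j. \<lbrakk>i < a * b; j < c * d; 0 < b; 0 < d; i div b < a; j div d < c\<rbrakk> \<Longrightarrow> A $$ (i, j) = B $$ (i, j)"
  shows "A = B"
  by (rule eq_matI) (use assms kron_index_bounds in \<open>auto intro!: assms(5) gr0I\<close>)

lemma kron_add_left: "dim_row A = dim_row B \<Longrightarrow> dim_col A = dim_col B \<Longrightarrow> kron (A + B) C = kron A C + kron B C"
  and kron_add_right: "dim_row A = dim_row B \<Longrightarrow> dim_col A = dim_col B \<Longrightarrow> kron C (A + B) = kron C A + kron C B"
  and kron_minus_left: "dim_row A = dim_row B \<Longrightarrow> dim_col A = dim_col B \<Longrightarrow> kron (A - B) C = kron A C - kron B C"
  and kron_minus_right: "dim_row A = dim_row B \<Longrightarrow> dim_col A = dim_col B \<Longrightarrow> kron C (A - B) = kron C A - kron C B"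
  and kron_smult_left: "kron (k \<cdot>\<^sub>m A) C = k \<cdot>\<^sub>m kron A C"
  and kron_smult_right: "kron C (k \<cdot>\<^sub>m A) = k \<cdot>\<^sub>m kron C A"
  and kron_uminus_right: "kron C (- A) = - kron C A"
  for A B C :: "'a::field mat"
  by (rule eq_mat_prodI[of _ "dim_row A" "dim_row C" "dim_col A" "dim_col C"]
      eq_mat_prodI[of _ "dim_row C" "dim_row A" "dim_col C" "dim_col A"];
      force simp: kron_def algebra_simps)+

lemma kron_zero_left [simp]: "kron (0\<^sub>m a b) C = 0\<^sub>m (a * dim_row C) (b * dim_col C)"
  and kron_zero_right [simp]: "kron C (0\<^sub>m a b) = 0\<^sub>m (dim_row C * a) (dim_col C * b)"
  for C :: "'a::field mat"
  by (rule eq_mat_prodI[of _ a "dim_row C" b "dim_col C"] eq_mat_prodI[of _ "dim_row C" a "dim_col C" b];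
      force simp: kron_def)+

lemma kron_one_dim1_left [simp]: "kron (1\<^sub>m (Suc 0)) A = A"
  and kron_one_dim1_right [simp]: "kron A (1\<^sub>m (Suc 0)) = A" for A :: "'a::field mat"
  by (rule eq_matI; auto simp: kron_def)+

lemma kron_carrier [simp, intro]:
  "A \<in> carrier_mat a b \<Longrightarrow> B \<in> carrier_mat c d \<Longrightarrow> kron A B \<in> carrier_mat (a * c) (b * d)"
  by (auto simp: kron_def)

lemma kron_pow: "A \<in> carrier_mat a a \<Longrightarrow> B \<in> carrier_mat b b \<Longrightarrow> kron A B ^\<^sub>m k = kron (A ^\<^sub>m k) (B ^\<^sub>m k)"
  for A B :: "'a::field mat"
  by (induction k) (simp_all add: kron_mult)

text \<open>Currying $\mathrm{Hom}(P \otimes M, Y) \to \mathrm{Hom}(P, Y \otimes M^*)$ in coordinates.\<close>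

definition curry_mat :: "nat \<Rightarrow> nat \<Rightarrow> nat \<Rightarrow> 'a mat \<Rightarrow> 'a mat" where
  "curry_mat y p m F = mat (y * m) p (\<lambda>(i, c). F $$ (i div m, c * m + i mod m))"

definition uncurry_mat :: "nat \<Rightarrow> nat \<Rightarrow> nat \<Rightarrow> 'a mat \<Rightarrow> 'a mat" where
  "uncurry_mat y p m G = mat y (p * m) (\<lambda>(r, c). G $$ (r * m + c mod m, c div m))"

lemma dim_curry_mat [simp]:
  "dim_row (curry_mat y p m F) = y * m" "dim_col (curry_mat y p m F) = p"
  "dim_row (uncurry_mat y p m G) = y" "dim_col (uncurry_mat y p m G) = p * m"
  by (simp_all add: curry_mat_def uncurry_mat_def)

lemma curry_uncurry: "G \<in> carrier_mat (y * m) p \<Longrightarrow> curry_mat y p m (uncurry_mat y p m G) = G"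
  by (rule eq_mat_prodI[of _ y m p 1])
    (auto simp: curry_mat_def uncurry_mat_def index_less_mult)

lemma uncurry_curry: "F \<in> carrier_mat y (p * m) \<Longrightarrow> uncurry_mat y p m (curry_mat y p m F) = F"
  by (rule eq_mat_prodI[of _ y 1 p m])
    (auto simp: curry_mat_def uncurry_mat_def index_less_mult)

lemma curry_add: "F \<in> carrier_mat y (p * m) \<Longrightarrow> G \<in> carrier_mat y (p * m) \<Longrightarrow>
    curry_mat y p m (F + G) = curry_mat y p m F + curry_mat y p m G"
  by (rule eq_mat_prodI[of _ y m p 1]) (auto simp: curry_mat_def index_less_mult)

text \<open>Naturality of currying in all three arguments; \<open>B\<close> turns up transposed on
  the left because the second tensor factor has been moved to its dual.\<close>

lemma curry_mult_kron:
  fixes C F A B :: "'a::field mat"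
  assumes "C \<in> carrier_mat z y" "F \<in> carrier_mat y (p * m)" "A \<in> carrier_mat p p'" "B \<in> carrier_mat m m'"
  shows "curry_mat z p' m' (C * F * kron A B) = kron C B\<^sup>T * curry_mat y p m F * A"
proof (rule eq_matI)
  fix i j assume "i < dim_row (kron C B\<^sup>T * curry_mat y p m F * A)" "j < dim_col (kron C B\<^sup>T * curry_mat y p m F * A)"
  then have i: "i < z * m'" and j: "j < p'" using assms by auto
  note b = kron_index_bounds[OF i]
  have jb: "j * m' + i mod m' < p' * m'" using b j by (intro index_less_mult)
  have m': "m' > 0" using b(2) by auto
  have dv: "(j * m' + i mod m') div m' = j" "(j * m' + i mod m') mod m' = i mod m'"
    using b m' by auto
  have "curry_mat z p' m' (C * F * kron A B) $$ (i, j)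
     = (C * F * kron A B) $$ (i div m', j * m' + i mod m')"
    using i j by (simp add: curry_mat_def)
  also have "\<dots> = (\<Sum>k = 0..<p * m. (\<Sum>r = 0..<y. C $$ (i div m', r) * F $$ (r, (k div m) * m + k mod m))
      * (A $$ (k div m, j) * B $$ (k mod m, i mod m')))"
    using assms b jb dv by (auto simp: scalar_prod_def kron_def intro!: sum.cong)
  also have "\<dots> = (\<Sum>s = 0..<p. \<Sum>t = 0..<m. (\<Sum>r = 0..<y. C $$ (i div m', r) * F $$ (r, s * m + t))
      * (A $$ (s, j) * B $$ (t, i mod m')))"
    by (rule sum_div_mod)
  also have "\<dots> = (\<Sum>s = 0..<p. (\<Sum>r = 0..<y. \<Sum>t = 0..<m. C $$ (i div m', r) * B $$ (t, i mod m') * F $$ (r, s * m + t)) * A $$ (s, j))"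
    unfolding sum_distrib_right
    by (rule sum.cong[OF refl], rule trans[OF sum.swap]) (simp only: mult_ac)
  also have "\<dots> = (\<Sum>s = 0..<p. (\<Sum>k = 0..<y * m. C $$ (i div m', k div m) * B $$ (k mod m, i mod m') * F $$ (k div m, s * m + k mod m)) * A $$ (s, j))"
    by (intro sum.cong refl arg_cong2[where f = "(*)"] sum_div_mod[symmetric])
  also have "\<dots> = (kron C B\<^sup>T * curry_mat y p m F * A) $$ (i, j)"
    using assms i j b by (auto simp: scalar_prod_def kron_def curry_mat_def kron_index_bounds intro!: sum.cong)
  finally show "curry_mat z p' m' (C * F * kron A B) $$ (i, j) = (kron C B\<^sup>T * curry_mat y p m F * A) $$ (i, j)" .
qed (use assms in auto)

subsection \<open>Slices of a map out of a tensor product\<close>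

lemma kron_one_ucol_mult: "S \<in> carrier_mat p p' \<Longrightarrow> kron (1\<^sub>m p) (ucol n k) * S = kron S (ucol n k)" 
  for S :: "'a::field mat"
  using kron_mult[of "1\<^sub>m p" S "ucol n k" "1\<^sub>m (Suc 0)"] by auto

text \<open>A map on a tensor product with an \<open>n\<close>-dimensional space amounts to its
  \<open>n\<close> restrictions to the subspaces of all \<open>x \<otimes> e_k\<close>. This
  reassembles it from them; \<open>kron (1\<^sub>m p) (ucol n k)\<close> is the inclusion of the
  \<open>k\<close>-th subspace.\<close>

definition slice_mat :: "nat \<Rightarrow> nat \<Rightarrow> nat \<Rightarrow> (nat \<Rightarrow> 'a mat) \<Rightarrow> 'a mat" where
  "slice_mat v p n F = mat v (p * n) (\<lambda>(r, c). F (c mod n) $$ (r, c div n))"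

lemma dim_slice_mat [simp]: "dim_row (slice_mat v p n F) = v" "dim_col (slice_mat v p n F) = p * n"
  by (simp_all add: slice_mat_def)

lemma mult_kron_ucol:
  fixes f :: "'a::field mat"
  assumes "f \<in> carrier_mat v (p * n)" "k < n"
  shows "f * kron (1\<^sub>m p) (ucol n k) = mat v p (\<lambda>(r, c). f $$ (r, c * n + k))"
proof (rule eq_matI)
  fix r c assume "r < dim_row (mat v p (\<lambda>(r, c). f $$ (r, c * n + k)))" "c < dim_col (mat v p (\<lambda>(r, c). f $$ (r, c * n + k)))"
  then have r: "r < v" and c: "c < p" by auto
  have "(f * kron (1\<^sub>m p) (ucol n k)) $$ (r, c) = (\<Sum>t = 0..<p * n. f $$ (r, (t div n) * n + t mod n) * 
     ((if t div n = c then 1 else 0) * (if t mod n = k then 1 else 0)))"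
    using assms r c by (auto simp: scalar_prod_def kron_def ucol_def kron_index_bounds intro!: sum.cong)
  also have "\<dots> = (\<Sum>s = 0..<p. \<Sum>t = 0..<n. f $$ (r, s * n + t) * ((if s = c then 1 else 0) * (if t = k then 1 else 0)))"
    by (rule sum_div_mod)
  also have "\<dots> = (\<Sum>s = 0..<p. if s = c then f $$ (r, s * n + k) else 0)"
    using assms(2) by (intro sum.cong refl) (auto simp: delta_mult sum.delta cong: if_cong)
  also have "\<dots> = f $$ (r, c * n + k)" using c by (simp add: sum.delta)
  finally show "(f * kron (1\<^sub>m p) (ucol n k)) $$ (r, c) = mat v p (\<lambda>(r, c). f $$ (r, c * n + k)) $$ (r, c)"
    using r c by simp
qed (use assms in auto)

lemma slice_mat_ucol:
  fixes F :: "nat \<Rightarrow> 'a::field mat"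
  assumes "k < n" "F k \<in> carrier_mat v p"
  shows "slice_mat v p n F * kron (1\<^sub>m p) (ucol n k) = F k"
  unfolding mult_kron_ucol[OF carrier_matI[OF dim_slice_mat] assms(1)] using assms
  by (auto simp: slice_mat_def index_less_mult intro!: eq_matI)

lemma slice_eqI:
  fixes f g :: "'a::field mat"
  assumes "f \<in> carrier_mat v (p * n)" "g \<in> carrier_mat v (p * n)"
    and "\<And>k. k < n \<Longrightarrow> f * kron (1\<^sub>m p) (ucol n k) = g * kron (1\<^sub>m p) (ucol n k)"
  shows "f = g"
proof (rule eq_matI)
  fix r c assume "r < dim_row g" "c < dim_col g"
  then have r: "r < v" and c: "c < p * n" using assms by auto
  note b = kron_index_bounds[OF c]
  have "mat v p (\<lambda>(r, c'). f $$ (r, c' * n + c mod n)) = mat v p (\<lambda>(r, c'). g $$ (r, c' * n + c mod n))"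
    using assms(3)[OF b(2)] unfolding mult_kron_ucol[OF assms(1) b(2)] mult_kron_ucol[OF assms(2) b(2)] .
  from arg_cong[OF this, of "\<lambda>M. M $$ (r, c div n)"] show "f $$ (r, c) = g $$ (r, c)" using r b by simp
qed (use assms in auto)

declare One_nat_def [simp del]

lemma add_assoc_dim: "dim_row A = dim_row B \<Longrightarrow> dim_col A = dim_col B \<Longrightarrow> dim_row B = dim_row C \<Longrightarrow>
    dim_col B = dim_col C \<Longrightarrow> A + B + C = A + (B + C)"
  and add_commute_dim: "dim_row A = dim_row B \<Longrightarrow> dim_col A = dim_col B \<Longrightarrow> A + B = B + A"
  and add_left_commute_dim: "dim_row A = dim_row B \<Longrightarrow> dim_col A = dim_col B \<Longrightarrow> dim_row B = dim_row C \<Longrightarrow>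
    dim_col B = dim_col C \<Longrightarrow> A + (B + C) = B + (A + C)" for A B C :: "'a::ab_semigroup_add mat"
  by (rule eq_matI; auto simp: ac_simps)+

lemmas mat_add_ac = add_assoc_dim add_commute_dim add_left_commute_dim

lemma scalar_mult_row: "u \<in> carrier_mat 1 1 \<Longrightarrow> w \<in> carrier_mat 1 m \<Longrightarrow> u * w = u $$ (0, 0) \<cdot>\<^sub>m w"
  for u :: "'a::semiring_1 mat"
  by (rule eq_matI) (auto simp: scalar_prod_def One_nat_def)

lemma special_carrier [simp]:
  "urow m i \<in> carrier_mat 1 m" "ucol m i \<in> carrier_mat m 1" "rows_mat j m F \<in> carrier_mat j m"
  "cols_mat m j F \<in> carrier_mat m j" "slice_mat v p n F \<in> carrier_mat v (p * n)"
  "inl a b \<in> carrier_mat (a + b) a" "inr a b \<in> carrier_mat (a + b) b"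
  "prl a b \<in> carrier_mat a (a + b)" "prr a b \<in> carrier_mat b (a + b)"
  by (auto intro!: carrier_matI)

section \<open>Spaces of row vectors\<close>

definition row_subspace :: "nat \<Rightarrow> 'k::field mat set \<Rightarrow> bool" where
  "row_subspace m W \<longleftrightarrow> W \<subseteq> carrier_mat 1 m \<and> 0\<^sub>m 1 m \<in> W \<and>
     (\<forall>v\<in>W. \<forall>w\<in>W. v + w \<in> W) \<and> (\<forall>c. \<forall>v\<in>W. c \<cdot>\<^sub>m v \<in> W)"

text \<open>The rows of \<open>E\<close> form a basis of \<open>W\<close>; their linear independence is expressed by a right inverse.\<close>

definition row_basis :: "nat \<Rightarrow> 'k::field mat set \<Rightarrow> nat \<Rightarrow> 'k mat \<Rightarrow> 'k mat \<Rightarrow> bool" where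
  "row_basis m W p E E' \<longleftrightarrow> E \<in> carrier_mat p m \<and> E' \<in> carrier_mat m p \<and> E * E' = 1\<^sub>m p \<and>
     W = {u * E | u. u \<in> carrier_mat 1 p}"

text \<open>Meaningful on row subspaces, by \<open>row_basis_exists\<close> and
  \<open>row_basis_unique\<close>.\<close>

definition rdim :: "nat \<Rightarrow> 'k::field mat set \<Rightarrow> nat" where
  "rdim m W = (THE p. \<exists>E E'. row_basis m W p E E')"

text \<open>If \<open>p\<close> exceeded \<open>m\<close>, padding with zeros would make both
  factors square. A one-sided inverse of a square matrix is two-sided, but the padded product in the
  other order has zero rows.\<close>

lemma right_inverse_le:
  fixes E E' :: "'k::field mat"
  assumes "E \<in> carrier_mat p m" "E' \<in> carrier_mat m p" "E * E' = 1\<^sub>m p"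
  shows "p \<le> m"
proof (rule ccontr)
  assume "\<not> p \<le> m"
  then obtain d where p: "p = m + d" and d: "d > 0" using less_imp_add_positive by (metis not_le)
  have "(E * prl m d) * (inl m d * E') = E * (prl m d * inl m d) * E'"
    using assms p by (simp add: mat_alg del: embed_simps)
  also have "\<dots> = 1\<^sub>m p" using assms by simp
  finally have "(inl m d * E') * (E * prl m d) = 1\<^sub>m p"
    using assms p by (intro mat_mult_left_right_inverse[of "E * prl m d" p "inl m d * E'"]) auto
  then have "prr m d * ((inl m d * E') * (E * prl m d)) = prr m d" using p by simp
  moreover have "prr m d * ((inl m d * E') * (E * prl m d)) = (prr m d * inl m d) * E' * (E * prl m d)"
    using assms p by (simp add: mat_alg del: embed_simps)
  ultimately have "(prr m d :: 'k mat) = 0\<^sub>m d p" using assms p by simp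
  then have "(prr m d :: 'k mat) $$ (0, m) = 0\<^sub>m d p $$ (0, m)" by simp
  then show False using d p by (simp add: prr_def)
qed

lemma nonzero_row:
  assumes "w \<in> carrier_mat 1 m" "w \<noteq> 0\<^sub>m 1 m"
  obtains j where "j < m" "w $$ (0, j) \<noteq> 0"
proof (rule ccontr)
  assume "\<not> thesis"
  with that have "w $$ (0, j) = 0" if "j < m" for j using that by blast
  then have "w = 0\<^sub>m 1 m" using assms(1) by (auto intro!: eq_matI)
  with assms(2) show False by simp
qed

text \<open>Take an independent family of rows in \<open>W\<close> of maximal length, which is at
  most \<open>m\<close>. If it missed some \<open>w\<close>, that row could be adjoined, with an
  explicit right inverse of the longer family.\<close>

lemma row_basis_exists:
  assumes W: "row_subspace m W"
  shows "\<exists>p E E'. row_basis m W p E E'"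
proof -
  define good where "good p \<longleftrightarrow> (\<exists>E E'. E \<in> carrier_mat p m \<and> E' \<in> carrier_mat m p \<and> E * E' = 1\<^sub>m p \<and>
     {u * E | u. u \<in> carrier_mat 1 p} \<subseteq> W)" for p
  have z: "0\<^sub>m 1 m \<in> W" using W by (simp add: row_subspace_def)
  have "good 0" unfolding good_def
  proof (intro exI conjI)
    show "(0\<^sub>m 0 m :: 'a mat) * 0\<^sub>m m 0 = 1\<^sub>m 0" by (rule eq_matI) auto
    show "{u * 0\<^sub>m 0 m | u. u \<in> carrier_mat 1 0} \<subseteq> W" using z by auto
  qed auto
  moreover have bound: "\<And>p. good p \<Longrightarrow> p \<le> m" unfolding good_def using right_inverse_le by blast
  ultimately have "good (Greatest good)" by (rule GreatestI_nat)
  moreover have "p' \<le> Greatest good" if "good p'" for p' by (rule Greatest_le_nat[of good, OF that]) (rule bound)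
  ultimately obtain p where p: "good p" "\<And>p'. good p' \<Longrightarrow> p' \<le> p" by blast
  then obtain E E' where E: "E \<in> carrier_mat p m" "E' \<in> carrier_mat m p" "E * E' = 1\<^sub>m p"
    "{u * E | u. u \<in> carrier_mat 1 p} \<subseteq> W" unfolding good_def by blast
  have "w \<in> {u * E | u. u \<in> carrier_mat 1 p}" if w: "w \<in> W" for w
  proof (rule ccontr)
    assume neg: "\<not> ?thesis"
    have wc: "w \<in> carrier_mat 1 m" using w W by (auto simp: row_subspace_def)
    \<comment> \<open>\<open>E' * E\<close> projects onto the span of the rows of \<open>E\<close>;
      removing this part of \<open>w\<close> leaves a nonzero row that annihilates the columns of
      \<open>E'\<close>.\<close>
    define w' where "w' = w + (- 1) \<cdot>\<^sub>m (w * E' * E)"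
    have w'c: "w' \<in> carrier_mat 1 m" using wc E by (auto simp: w'_def)
    have wE': "w * E' \<in> carrier_mat 1 p" using wc E by simp
    then have "w * E' * E \<in> W" using E(4) by blast
    then have w'W: "w' \<in> W" using w W by (auto simp: row_subspace_def w'_def)
    have "w' \<noteq> 0\<^sub>m 1 m"
    proof
      assume 0: "w' = 0\<^sub>m 1 m"
      have "w = w * E' * E"
      proof (rule eq_matI)
        fix i j assume ij: "i < dim_row (w * E' * E)" "j < dim_col (w * E' * E)"
        then have "w' $$ (i, j) = 0" using 0 wc E by simp
        then show "w $$ (i, j) = (w * E' * E) $$ (i, j)"
          using ij wc E unfolding w'_def by (simp del: index_mult_mat(1))
      qed (use wc E in auto)
      with wE' show False using neg by blast
    qed
    then obtain j where j: "j < m" "w' $$ (0, j) \<noteq> 0"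
      using nonzero_row[OF w'c] by blast
    have w'E: "w' * E' = 0\<^sub>m 1 p"
    proof -
      have "w' * E' = w * E' + (- 1) \<cdot>\<^sub>m (w * E' * (E * E'))"
        unfolding w'_def using wc E(1,2) by (simp add: mat_alg)
      then have "w' * E' = w * E' + (- 1) \<cdot>\<^sub>m (w * E')" using wc E by simp
      then show ?thesis using wc E by (auto intro!: eq_matI simp del: index_mult_mat(1))
    qed
    \<comment> \<open>The new column of the right inverse: a unit column at a position where
      \<open>w'\<close> is nonzero, corrected so that the rows of \<open>E\<close> vanish on it and
      scaled so that \<open>w'\<close> takes the value 1 on it.\<close>
    define y where "y = inverse (w' $$ (0, j)) \<cdot>\<^sub>m (ucol m j + (- 1) \<cdot>\<^sub>m (E' * (E * ucol m j)))"
    have yc: "y \<in> carrier_mat m 1" using E by (auto simp: y_def)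
    have "E * y = inverse (w' $$ (0, j)) \<cdot>\<^sub>m (E * ucol m j + (- 1) \<cdot>\<^sub>m (E * E' * (E * ucol m j)))"
      unfolding y_def using E(1,2) by (simp add: mat_alg)
    then have Ey: "E * y = 0\<^sub>m p 1" unfolding E(3) using E(1)
      by (auto intro!: eq_matI simp del: index_mult_mat(1))
    have "w' * y = inverse (w' $$ (0, j)) \<cdot>\<^sub>m (w' * ucol m j + (- 1) \<cdot>\<^sub>m (w' * E' * (E * ucol m j)))"
      unfolding y_def using E(1,2) w'c by (simp add: mat_alg)
    also have "\<dots> = inverse (w' $$ (0, j)) \<cdot>\<^sub>m (w' * ucol m j)" 
      unfolding w'E using E(1) w'c by (auto intro!: eq_matI simp del: index_mult_mat(1))
    also have "w' * ucol m j = mat 1 1 (\<lambda>_. w' $$ (0, j))"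
      using mult_ucol[of j w'] w'c j(1) by (auto intro!: eq_matI)
    also have "inverse (w' $$ (0, j)) \<cdot>\<^sub>m mat 1 1 (\<lambda>_. w' $$ (0, j)) = 1\<^sub>m 1" using j(2) by auto
    finally have w'y: "w' * y = 1\<^sub>m 1" .
    define F where "F = inl p 1 * E + inr p 1 * w'"
    define F' where "F' = E' * prl p 1 + y * prr p 1"
    have "F * F' = inl p 1 * (E * E') * prl p 1 + inl p 1 * (E * y) * prr p 1 
        + (inr p 1 * (w' * E') * prl p 1 + inr p 1 * (w' * y) * prr p 1)"
      unfolding F_def F'_def using E(1,2) yc w'c by (simp add: mat_alg mat_add_ac)
    also have "\<dots> = inl p 1 * prl p 1 + inr p 1 * prr p 1"
      unfolding E(3) Ey w'E w'y 
      by (simp add: right_mult_one_mat'[of _ p] right_mult_one_mat'[of _ 1] right_mult_zero_mat'[of _ p] right_mult_zero_mat'[of _ 1] del: embed_simps)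
        (rule eq_matI; simp del: index_mult_mat(1) embed_simps)
    also have "\<dots> = 1\<^sub>m (p + 1)" by simp
    finally have FF: "F * F' = 1\<^sub>m (p + 1)" .
    have "good (p + 1)" unfolding good_def
    proof (intro exI conjI)
      show "F \<in> carrier_mat (p + 1) m" "F' \<in> carrier_mat m (p + 1)" "F * F' = 1\<^sub>m (p + 1)"
        using FF E w'c yc by (auto simp: F_def F'_def)
      show "{u * F | u. u \<in> carrier_mat 1 (p + 1)} \<subseteq> W"
      proof safe
        fix u :: "'a mat" assume u: "u \<in> carrier_mat 1 (p + 1)"
        have uF: "u * F = (u * inl p 1) * E + (u * inr p 1) * w'"
          unfolding F_def using u E w'c by (simp add: mat_alg)
        have "(u * inr p 1) * w' = ((u * inr p 1) $$ (0, 0)) \<cdot>\<^sub>m w'"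
          using u w'c by (intro scalar_mult_row) auto
        moreover have "u * inl p 1 \<in> carrier_mat 1 p" using u by auto
        then have "(u * inl p 1) * E \<in> W" using E(4) by blast
        ultimately show "u * F \<in> W" unfolding uF using w'W W by (auto simp: row_subspace_def)
      qed
    qed
    then show False using p(2) by fastforce
  qed
  with E show ?thesis unfolding row_basis_def by blast
qed

lemma row_basis_mem: "row_basis m W p E E' \<Longrightarrow> w \<in> W \<Longrightarrow> w = (w * E') * E"
proof -
  assume b: "row_basis m W p E E'" and "w \<in> W"
  then obtain u where u: "w = u * E" "u \<in> carrier_mat 1 p" unfolding row_basis_def by blast
  have E: "E \<in> carrier_mat p m" "E' \<in> carrier_mat m p" "E * E' = 1\<^sub>m p" using b by (auto simp: row_basis_def)
  have "w * E' = u * (E * E')" unfolding u(1) using u(2) E(1,2) by (rule assoc_mult_mat)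
  with u E show ?thesis by simp
qed

lemma row_basis_change:
  assumes b: "row_basis m W p E E'" and F: "F \<in> carrier_mat r m"
    and mem: "\<And>i. i < r \<Longrightarrow> urow r i * F \<in> W"
  shows "F = (F * E') * E"
proof (rule urow_eqI)
  have E: "E \<in> carrier_mat p m" "E' \<in> carrier_mat m p" using b by (auto simp: row_basis_def)
  show "urow (dim_row (F * E' * E)) i * F = urow (dim_row (F * E' * E)) i * (F * E' * E)"
    if "i < dim_row (F * E' * E)" for i
    using row_basis_mem[OF b mem[of i]] F E that by (simp add: mat_alg)
qed (use b F in \<open>auto simp: row_basis_def\<close>)

lemma urow_basis_mem: "row_basis m W p E E' \<Longrightarrow> i < p \<Longrightarrow> urow p i * E \<in> W"
  by (auto simp: row_basis_def intro!: exI[of _ "urow p i"])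

lemma row_basis_unique:
  assumes "row_basis m W p E E'" "row_basis m W r F F'"
  shows "p \<le> r"
proof -
  have c: "E \<in> carrier_mat p m" "E' \<in> carrier_mat m p" "F \<in> carrier_mat r m" "F' \<in> carrier_mat m r"
    "E * E' = 1\<^sub>m p" using assms by (auto simp: row_basis_def)
  have "E = (E * F') * F"
    using assms c by (intro row_basis_change[OF assms(2) c(1)] urow_basis_mem)
  then have "E * E' = (E * F') * F * E'" by simp
  also have "\<dots> = (E * F') * (F * E')" using c(1-4) by (simp add: mat_alg)
  finally have "E * E' = (E * F') * (F * E')" .
  then show ?thesis using c by (intro right_inverse_le[of "E * F'" p r "F * E'"]) auto
qed

lemma rdim_eqI:
  assumes "row_basis m W p E E'" shows "rdim m W = p"
  unfolding rdim_def
proof (rule the_equality)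
  show "\<exists>E E'. row_basis m W p E E'" using assms by blast
next
  fix p' assume "\<exists>E E'. row_basis m W p' E E'"
  then show "p' = p" using row_basis_unique assms by (meson le_antisym)
qed

lemma rdim_basis:
  assumes "row_subspace m W" obtains E E' where "row_basis m W (rdim m W) E E'"
  using row_basis_exists[OF assms] rdim_eqI by metis

lemma rdim_zero: "rdim m {0\<^sub>m 1 m :: 'k::field mat} = 0"
proof (rule rdim_eqI)
  show "row_basis m {0\<^sub>m 1 m :: 'k mat} 0 (0\<^sub>m 0 m) (0\<^sub>m m 0)"
    unfolding row_basis_def by (auto intro!: eq_matI exI[of _ "0\<^sub>m 1 0"])
qed

lemma rdim_eq_0_iff:
  assumes "row_subspace m W" shows "rdim m W = 0 \<longleftrightarrow> W = {0\<^sub>m 1 m}"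
proof
  assume "rdim m W = 0"
  then obtain E E' where "row_basis m W 0 E E'" using rdim_basis[OF assms] by metis
  then have W: "W = {u * E | u. u \<in> carrier_mat 1 0}" and E: "E \<in> carrier_mat 0 m"
    by (auto simp: row_basis_def)
  have "u * E = 0\<^sub>m 1 m" if "u \<in> carrier_mat 1 0" for u :: "'a mat"
    using that E by (auto intro!: eq_matI simp: scalar_prod_def)
  moreover have "0\<^sub>m 1 m \<in> W" using assms by (simp add: row_subspace_def)
  ultimately show "W = {0\<^sub>m 1 m}" unfolding W by blast
qed (simp add: rdim_zero)

lemma rdim_line:
  assumes w: "w \<in> carrier_mat 1 m" "w \<noteq> 0\<^sub>m 1 m"
  shows "rdim m {c \<cdot>\<^sub>m w | c :: 'k::field. True} = 1"
proof -
  obtain j where j: "j < m" "w $$ (0, j) \<noteq> 0"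
    using nonzero_row[OF w] by blast
  show ?thesis
  proof (rule rdim_eqI)
    show "row_basis m {c \<cdot>\<^sub>m w | c :: 'k. True} 1 w (inverse (w $$ (0, j)) \<cdot>\<^sub>m ucol m j)"
      unfolding row_basis_def
    proof (intro conjI)
      have "w * ucol m j = mat 1 1 (\<lambda>_. w $$ (0, j))"
        using mult_ucol[of j w] w j(1) by (auto intro!: eq_matI)
      then show "w * (inverse (w $$ (0, j)) \<cdot>\<^sub>m ucol m j) = 1\<^sub>m 1"
        using w j by (auto simp: mat_alg intro!: eq_matI)
      have "u * w = (u $$ (0, 0)) \<cdot>\<^sub>m w" if "u \<in> carrier_mat 1 1" for u :: "'k mat"
        using that w by (intro scalar_mult_row)
      moreover have "c \<cdot>\<^sub>m w = (c \<cdot>\<^sub>m 1\<^sub>m 1) * w" for c using w by (simp add: mat_alg)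
      moreover have "c \<cdot>\<^sub>m 1\<^sub>m 1 \<in> carrier_mat 1 1" for c :: 'k by simp
      ultimately show "{c \<cdot>\<^sub>m w | c :: 'k. True} = {u * w | u. u \<in> carrier_mat 1 1}" 
        by (intro equalityI subsetI) blast+
    qed (use w in auto)
  qed
qed

lemma row_subspaceI:
  assumes "\<And>w. w \<in> W \<Longrightarrow> w \<in> carrier_mat 1 m" "0\<^sub>m 1 m \<in> W"
    "\<And>v w. v \<in> W \<Longrightarrow> w \<in> W \<Longrightarrow> v + w \<in> W" "\<And>c v. v \<in> W \<Longrightarrow> c \<cdot>\<^sub>m v \<in> W"
  shows "row_subspace m W"
  using assms unfolding row_subspace_def by blast

lemma row_subspaceD:
  assumes "row_subspace m W"
  shows "w \<in> W \<Longrightarrow> w \<in> carrier_mat 1 m" "0\<^sub>m 1 m \<in> W"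
    "v \<in> W \<Longrightarrow> w \<in> W \<Longrightarrow> v + w \<in> W" "v \<in> W \<Longrightarrow> c \<cdot>\<^sub>m v \<in> W"
  using assms unfolding row_subspace_def by blast+

lemma row_subspace_image:
  assumes "row_subspace m W" "T \<in> carrier_mat m m'"
  shows "row_subspace m' {w * T | w. w \<in> W}"
proof (rule row_subspaceI)
  note W = row_subspaceD[OF assms(1)]
  show "v \<in> carrier_mat 1 m'" if "v \<in> {w * T | w. w \<in> W}" for v
    using that mult_carrier_mat[OF W(1) assms(2)] by blast
  have "0\<^sub>m 1 m' = 0\<^sub>m 1 m * T" using assms(2) by simp
  then show "0\<^sub>m 1 m' \<in> {w * T | w. w \<in> W}" using W(2) by blast
  fix v assume "v \<in> {w * T | w. w \<in> W}"
  then obtain v' where v': "v' \<in> W" "v = v' * T" by blast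
  show "c \<cdot>\<^sub>m v \<in> {w * T | w. w \<in> W}" for c
    using mult_smult_assoc_mat[OF W(1)[OF v'(1)] assms(2), of c] W(4)[OF v'(1), of c] v'(2) by (auto intro!: exI[of _ "c \<cdot>\<^sub>m v'"])
  fix w assume "w \<in> {w * T | w. w \<in> W}"
  then obtain w' where w': "w' \<in> W" "w = w' * T" by blast
  show "v + w \<in> {w * T | w. w \<in> W}"
    using add_mult_distrib_mat[OF W(1)[OF v'(1)] W(1)[OF w'(1)] assms(2)] W(3)[OF v'(1) w'(1)] v'(2) w'(2)
    by (auto intro!: exI[of _ "v' + w'"])
qed

lemma row_subspace_kernel:
  assumes "row_subspace m W" "T \<in> carrier_mat m m'"
  shows "row_subspace m {w \<in> W. w * T = 0\<^sub>m 1 m'}"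
proof (rule row_subspaceI)
  note W = row_subspaceD[OF assms(1)]
  show "v \<in> carrier_mat 1 m" if "v \<in> {w \<in> W. w * T = 0\<^sub>m 1 m'}" for v using that W(1) by blast
  show "0\<^sub>m 1 m \<in> {w \<in> W. w * T = 0\<^sub>m 1 m'}" using W(2) assms(2) by simp
  fix v assume v: "v \<in> {w \<in> W. w * T = 0\<^sub>m 1 m'}"
  then show "c \<cdot>\<^sub>m v \<in> {w \<in> W. w * T = 0\<^sub>m 1 m'}" for c
    using mult_smult_assoc_mat[OF W(1) assms(2), of v c] W(4)[of v c] by simp
  fix w assume w: "w \<in> {w \<in> W. w * T = 0\<^sub>m 1 m'}"
  with v show "v + w \<in> {w \<in> W. w * T = 0\<^sub>m 1 m'}"
    using add_mult_distrib_mat[OF W(1) W(1) assms(2), of v w] W(3)[of v w] by simp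
qed

text \<open>A basis \<open>E\<close> of the kernel and preimages \<open>L\<close> of a basis
  \<open>G\<close> of the image together form a basis of \<open>W\<close>; the work lies in
  exhibiting a right inverse of the stacked matrix.\<close>

theorem rdim_rank_nullity:
  assumes W: "row_subspace m W" and T: "T \<in> carrier_mat m m'"
  shows "rdim m W = rdim m {w \<in> W. w * T = 0\<^sub>m 1 m'} + rdim m' {w * T | w. w \<in> W}"
    (is "_ = rdim m ?K + rdim m' ?I")
proof -
  obtain p where p: "p = rdim m ?K" by simp
  obtain r where r: "r = rdim m' ?I" by simp
  obtain E E' where E: "row_basis m ?K p E E'"
    unfolding p by (rule rdim_basis[OF row_subspace_kernel[OF W T]])
  obtain G G' where G: "row_basis m' ?I r G G'"
    unfolding r by (rule rdim_basis[OF row_subspace_image[OF W T]])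
  obtain F F' where F: "row_basis m W (rdim m W) F F'" by (rule rdim_basis[OF W])
  define s where "s = rdim m W"
  note F = F[folded s_def]
  have c: "E \<in> carrier_mat p m" "E' \<in> carrier_mat m p" "E * E' = 1\<^sub>m p"
    "G \<in> carrier_mat r m'" "G' \<in> carrier_mat m' r" "G * G' = 1\<^sub>m r"
    "F \<in> carrier_mat s m" "F' \<in> carrier_mat m s" using E F G by (auto simp: row_basis_def)
  have "\<forall>i. \<exists>u. i < r \<longrightarrow> u \<in> carrier_mat 1 s \<and> urow r i * G = u * F * T"
    using urow_basis_mem[OF G] F unfolding row_basis_def by blast
  then obtain R where "\<forall>i. i < r \<longrightarrow> R i \<in> carrier_mat 1 s \<and> urow r i * G = R i * F * T"
    by (rule choice[THEN exE])
  then have R: "\<And>i. i < r \<Longrightarrow> R i \<in> carrier_mat 1 s" "\<And>i. i < r \<Longrightarrow> urow r i * G = R i * F * T" by blast+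
  define L where "L = rows_mat r s R * F"
  have L: "L \<in> carrier_mat r m" using c by (auto simp: L_def)
  have LT: "L * T = G"
  proof (rule urow_eqI)
    fix i assume "i < dim_row G"
    then have i: "i < r" using c by auto
    have "urow r i * (L * T) = (urow r i * rows_mat r s R) * F * T"
      unfolding L_def using c T by (simp add: mat_alg)
    also have "\<dots> = urow r i * G" using R i by (simp add: urow_rows_mat)
    finally show "urow (dim_row G) i * (L * T) = urow (dim_row G) i * G" using c by simp
  qed (use L T c in auto)
  have uL: "u * L \<in> W" if "u \<in> carrier_mat 1 r" for u
  proof -
    have "u * L = (u * rows_mat r s R) * F" unfolding L_def using that c by (simp add: mat_alg)
    moreover have "u * rows_mat r s R \<in> carrier_mat 1 s" using that by auto
    ultimately show ?thesis using F by (auto simp: row_basis_def)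
  qed
  have uE: "u * E \<in> ?K" if "u \<in> carrier_mat 1 p" for u using that E by (auto simp: row_basis_def)
  have ET: "E * T = 0\<^sub>m p m'"
  proof (rule urow_eqI)
    fix i assume "i < dim_row (0\<^sub>m p m')"
    then show "urow (dim_row (0\<^sub>m p m')) i * (E * T) = urow (dim_row (0\<^sub>m p m')) i * (0\<^sub>m p m')"
      using uE[of "urow p i"] c T by (auto simp: mat_alg)
  qed (use c T in auto)
  define B where "B = inl p r * E + inr p r * L"
  \<comment> \<open>\<open>T * G'\<close> is dual to \<open>L\<close> and \<open>E\<close> vanishes
    on it, so only \<open>E'\<close> has to be corrected, by its values under
    \<open>L\<close>.\<close>
  define B' where "B' = (E' + (- 1) \<cdot>\<^sub>m (T * G' * (L * E'))) * prl p r + T * G' * prr p r"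
  have "E * (T * G') = (E * T) * G'" "L * (T * G') = (L * T) * G'" using c(1,2,4,5) T L by (simp_all add: mat_alg)
  then have EG: "E * (T * G') = 0\<^sub>m p r" and LG: "L * (T * G') = 1\<^sub>m r" using ET LT c by simp_all
  have B: "B \<in> carrier_mat (p + r) m" "B' \<in> carrier_mat m (p + r)"
    using c L T by (auto simp: B_def B'_def)
  have EB: "E * (E' + (- 1) \<cdot>\<^sub>m (T * G' * (L * E'))) = 1\<^sub>m p"
  proof -
    have "E * (E' + (- 1) \<cdot>\<^sub>m (T * G' * (L * E'))) = E * E' + (- 1) \<cdot>\<^sub>m (E * (T * G') * (L * E'))"
      using c T L by (simp add: mat_alg)
    also have "\<dots> = 1\<^sub>m p" unfolding EG c(3) using c L by (auto intro!: eq_matI simp del: index_mult_mat(1))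
    finally show ?thesis .
  qed
  have LB: "L * (E' + (- 1) \<cdot>\<^sub>m (T * G' * (L * E'))) = 0\<^sub>m r p"
  proof -
    have "L * (E' + (- 1) \<cdot>\<^sub>m (T * G' * (L * E'))) = L * E' + (- 1) \<cdot>\<^sub>m (L * (T * G') * (L * E'))"
      using c(1,2,4,5,7,8) T L by (simp add: mat_alg)
    also have "\<dots> = 0\<^sub>m r p" unfolding LG using c L by (auto intro!: eq_matI simp del: index_mult_mat(1))
    finally show ?thesis .
  qed
  define X where "X = E' + (- 1) \<cdot>\<^sub>m (T * G' * (L * E'))"
  have X: "X \<in> carrier_mat m p" using c T L by (auto simp: X_def)
  have "B * B' = inl p r * (E * X) * prl p r + inl p r * (E * (T * G')) * prr p r
      + (inr p r * (L * X) * prl p r + inr p r * (L * (T * G')) * prr p r)"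
    unfolding B_def B'_def X_def[symmetric] using c(1,2,4,5) L T X by (simp add: mat_alg mat_add_ac)
  also have "\<dots> = inl p r * prl p r + inr p r * prr p r"
    unfolding EB[folded X_def] LB[folded X_def] EG LG
    by (simp add: right_mult_one_mat'[of _ p] right_mult_one_mat'[of _ r] right_mult_zero_mat'[of _ p] right_mult_zero_mat'[of _ r] del: embed_simps)
      (rule eq_matI; simp del: index_mult_mat(1) embed_simps)
  also have "\<dots> = 1\<^sub>m (p + r)" by simp
  finally have BB: "B * B' = 1\<^sub>m (p + r)" .
  have "row_basis m W (p + r) B B'" unfolding row_basis_def
  proof (intro conjI B BB equalityI subsetI)
    fix w assume "w \<in> {u * B | u. u \<in> carrier_mat 1 (p + r)}"
    then obtain u where u: "u \<in> carrier_mat 1 (p + r)" "w = u * B" by blast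
    have "w = (u * inl p r) * E + (u * inr p r) * L"
      unfolding u B_def using u(1) c L by (simp add: mat_alg)
    moreover have "(u * inl p r) * E \<in> W" "(u * inr p r) * L \<in> W"
      using uE[of "u * inl p r"] uL[of "u * inr p r"] u by auto
    ultimately show "w \<in> W" using W by (auto simp: row_subspace_def)
  next
    fix w assume w: "w \<in> W"
    then have wc: "w \<in> carrier_mat 1 m" using W by (auto simp: row_subspace_def)
    have "w * T \<in> ?I" using w by blast
    then obtain v where v: "v \<in> carrier_mat 1 r" "w * T = v * G" using G by (auto simp: row_basis_def)
    define x where "x = w + (- 1) \<cdot>\<^sub>m (v * L)"
    have xW: "x \<in> W" using W w uL[OF v(1)] by (auto simp: x_def row_subspace_def)
    have "x * T = w * T + (- 1) \<cdot>\<^sub>m (v * (L * T))"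
      unfolding x_def using wc v L T by (simp add: mat_alg)
    also have "\<dots> = 0\<^sub>m 1 m'" unfolding LT v(2) using v(1) c 
      by (auto intro!: eq_matI simp del: index_mult_mat(1))
    finally have "x \<in> ?K" using xW by simp
    then obtain u where u: "u \<in> carrier_mat 1 p" "x = u * E" using E by (auto simp: row_basis_def)
    have "w = x + v * L" unfolding x_def using wc v L by (auto intro!: eq_matI simp del: index_mult_mat(1))
    also have "\<dots> = (u * (prl p r * inl p r) + v * (prr p r * inl p r)) * E + 
        (u * (prl p r * inr p r) + v * (prr p r * inr p r)) * L"
      unfolding u using u(1) v c L by simp
    also have "\<dots> = (u * prl p r + v * prr p r) * B"
      unfolding B_def using u(1) v c L by (simp add: mat_alg del: embed_simps)
    finally have "w = (u * prl p r + v * prr p r) * B" .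
    moreover have "u * prl p r + v * prr p r \<in> carrier_mat 1 (p + r)" using u v by simp
    ultimately show "w \<in> {u * B | u. u \<in> carrier_mat 1 (p + r)}" by blast
  qed
  from rdim_eqI[OF this] show ?thesis using p r by simp
qed

lemma rdim_bij:
  assumes "row_subspace m W" "T \<in> carrier_mat m m'" "\<And>w. w \<in> W \<Longrightarrow> w * T = 0\<^sub>m 1 m' \<Longrightarrow> w = 0\<^sub>m 1 m"
  shows "rdim m' {w * T | w. w \<in> W} = rdim m W"
proof -
  have "0\<^sub>m 1 m * T = 0\<^sub>m 1 m'" using assms(2) by simp
  then have "{w \<in> W. w * T = 0\<^sub>m 1 m'} = {0\<^sub>m 1 m}" using assms(3) row_subspaceD(2)[OF assms(1)] by blast
  then show ?thesis using rdim_rank_nullity[OF assms(1,2)] by (simp add: rdim_zero)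
qed

lemma minus_eq_zeroD:
  fixes A B :: "'a::ab_group_add mat"
  assumes "A - B = 0\<^sub>m a b" "A \<in> carrier_mat a b" "B \<in> carrier_mat a b" shows "A = B"
proof (rule eq_matI)
  fix i j assume ij: "i < dim_row B" "j < dim_col B"
  then have "(A - B) $$ (i, j) = A $$ (i, j) - B $$ (i, j)" by simp
  moreover have "(A - B) $$ (i, j) = 0" unfolding assms(1) using ij assms(3) by simp
  ultimately show "A $$ (i, j) = B $$ (i, j)" by simp
qed (use assms in auto)

subsection \<open>Rank factorisation\<close>

text \<open>The rows of \<open>E\<close> are a basis of the row space of \<open>F\<close>. Each of
  \<open>E\<close> and \<open>F\<close> is a combination of the rows of the other, which gives both
  one-sided inverses.\<close>

lemma rank_factorisation:
  fixes F :: "'k::field mat"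
  assumes F: "F \<in> carrier_mat r m"
  obtains p L L' E E' where "L \<in> carrier_mat r p" "L' \<in> carrier_mat p r" "E \<in> carrier_mat p m"
    "E' \<in> carrier_mat m p" "F = L * E" "L' * L = 1\<^sub>m p" "E * E' = 1\<^sub>m p"
proof -
  define W where "W = {u * F | u. u \<in> carrier_mat 1 r}"
  have "row_subspace r (carrier_mat 1 r)" by (rule row_subspaceI) simp_all
  from row_subspace_image[OF this F] have "row_subspace m W" by (simp add: W_def)
  from row_basis_exists[OF this] obtain p E E' where b: "row_basis m W p E E'" by (elim exE)
  then have c: "E \<in> carrier_mat p m" "E' \<in> carrier_mat m p" "E * E' = 1\<^sub>m p" by (simp_all add: row_basis_def)
  have FE: "F = (F * E') * E"
  proof (rule row_basis_change[OF b F])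
    show "urow r i * F \<in> W" for i unfolding W_def by (intro CollectI exI[of _ "urow r i"]) simp
  qed
  have "\<exists>u. i < p \<longrightarrow> u \<in> carrier_mat 1 r \<and> urow p i * E = u * F" for i
  proof (cases "i < p")
    case True
    then obtain u where "u \<in> carrier_mat 1 r" "urow p i * E = u * F"
      using urow_basis_mem[OF b True] by (auto simp: W_def)
    then show ?thesis by blast
  qed simp
  then have "\<forall>i. \<exists>u. i < p \<longrightarrow> u \<in> carrier_mat 1 r \<and> urow p i * E = u * F" ..
  then obtain R where "\<forall>i. i < p \<longrightarrow> R i \<in> carrier_mat 1 r \<and> urow p i * E = R i * F"
    by (rule choice[THEN exE])
  then have R: "\<And>i. i < p \<Longrightarrow> R i \<in> carrier_mat 1 r" "\<And>i. i < p \<Longrightarrow> urow p i * E = R i * F" by blast+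
  have RF: "rows_mat p r R * F = E"
  proof (rule urow_eqI)
    fix i assume "i < dim_row E"
    then have i: "i < p" using c by auto
    have "urow p i * (rows_mat p r R * F) = (urow p i * rows_mat p r R) * F" using F by (simp add: mat_alg)
    then show "urow (dim_row E) i * (rows_mat p r R * F) = urow (dim_row E) i * E"
      using R i c by (simp add: urow_rows_mat)
  qed (use F c in auto)
  have "rows_mat p r R * (F * E') = (rows_mat p r R * F) * E'" using F c(1,2) by (simp add: mat_alg)
  then have "rows_mat p r R * (F * E') = 1\<^sub>m p" using RF c by simp
  moreover have "F * E' \<in> carrier_mat r p" using F c by simp
  ultimately show ?thesis using that[of "F * E'" p "rows_mat p r R" E E'] FE c by simp
qed

text \<open>For a rank factorisation \<open>e = L * E\<close>, cancelling the outer factors in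
  \<open>L * E * L * E = L * E\<close> leaves \<open>E * L = 1\<close>.\<close>

lemma split_idempotent:
  fixes e :: "'k::field mat"
  assumes e: "e \<in> carrier_mat m m" "e * e = e"
  obtains p i r where "i \<in> carrier_mat m p" "r \<in> carrier_mat p m" "e = i * r" "r * i = 1\<^sub>m p"
proof -
  obtain p L L' E E' where c: "L \<in> carrier_mat m p" "L' \<in> carrier_mat p m" "E \<in> carrier_mat p m"
    "E' \<in> carrier_mat m p" "e = L * E" "L' * L = 1\<^sub>m p" "E * E' = 1\<^sub>m p" by (rule rank_factorisation[OF e(1)])
  have "E * L = (L' * L) * (E * L) * (E * E')" using c by simp
  also have "\<dots> = L' * ((L * E) * (L * E)) * E'" using c(1-4) by (simp add: mat_alg)
  also have "\<dots> = L' * (L * E) * E'" using e c(5) by simp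
  also have "\<dots> = (L' * L) * (E * E')" using c(1-4) by (simp add: mat_alg)
  also have "\<dots> = 1\<^sub>m p" using c by simp
  finally show ?thesis using that[OF c(1,3,5)] by simp
qed

text \<open>In a rank factorisation \<open>F = L * E\<close> the rows of \<open>1 - L * L'\<close>
  annihilate \<open>F\<close>, hence vanish, so that \<open>L\<close> is invertible.\<close>

lemma right_invertible:
  fixes F :: "'k::field mat"
  assumes F: "F \<in> carrier_mat r m" and indep: "\<And>u. u \<in> carrier_mat 1 r \<Longrightarrow> u * F = 0\<^sub>m 1 m \<Longrightarrow> u = 0\<^sub>m 1 r"
  obtains G where "G \<in> carrier_mat m r" "F * G = 1\<^sub>m r"
proof -
  obtain p L L' E E' where c: "L \<in> carrier_mat r p" "L' \<in> carrier_mat p r" "E \<in> carrier_mat p m"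
    "E' \<in> carrier_mat m p" "F = L * E" "L' * L = 1\<^sub>m p" "E * E' = 1\<^sub>m p" by (rule rank_factorisation[OF F])
  have "(1\<^sub>m r - L * L') * F = L * E - L * (L' * L) * E" unfolding c(5) using c(1-4) by (simp add: mat_alg)
  also have "\<dots> = 0\<^sub>m r m" using c by simp
  finally have 0: "(1\<^sub>m r - L * L') * F = 0\<^sub>m r m" .
  have "1\<^sub>m r - L * L' = 0\<^sub>m r r"
  proof (rule urow_eqI)
    fix i assume "i < dim_row (0\<^sub>m r r)"
    have "urow r i * (1\<^sub>m r - L * L') * F = urow r i * ((1\<^sub>m r - L * L') * F)" 
      using F c(1,2) by (intro assoc_mult_mat[of _ 1 r _ r _ m]) auto
    also have "\<dots> = 0\<^sub>m 1 m" unfolding 0 by simp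
    finally have "urow r i * (1\<^sub>m r - L * L') = 0\<^sub>m 1 r" using c(1,2) by (intro indep) auto
    then show "urow (dim_row (0\<^sub>m r r)) i * (1\<^sub>m r - L * L') = urow (dim_row (0\<^sub>m r r)) i * 0\<^sub>m r r" by simp
  qed (use c in auto)
  then have "1\<^sub>m r = L * L'" by (rule minus_eq_zeroD) (use c in simp_all)
  then have "L * L' = 1\<^sub>m r" by (rule sym)
  moreover have "F * (E' * L') = L * (E * E') * L'" unfolding c(5) using c(1-4) by (simp add: mat_alg)
  ultimately have "F * (E' * L') = 1\<^sub>m r" using c by simp
  moreover have "E' * L' \<in> carrier_mat m r" using c by simp
  ultimately show ?thesis by (intro that)
qed

lemma left_invertible:
  fixes F :: "'k::field mat"
  assumes F: "F \<in> carrier_mat r m" and inj: "\<And>v. v \<in> carrier_mat m 1 \<Longrightarrow> F * v = 0\<^sub>m r 1 \<Longrightarrow> v = 0\<^sub>m m 1"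
  obtains G where "G \<in> carrier_mat m r" "G * F = 1\<^sub>m m"
proof -
  have "u = 0\<^sub>m 1 m" if u: "u \<in> carrier_mat 1 m" "u * F\<^sup>T = 0\<^sub>m 1 r" for u
  proof -
    have "(u * F\<^sup>T)\<^sup>T = F * u\<^sup>T" using u F by (subst transpose_mult[of _ 1 m _ r]) auto
    then have "F * u\<^sup>T = 0\<^sub>m r 1" using u by simp
    from inj[OF _ this] u have "u\<^sup>T = 0\<^sub>m m 1" by simp
    then have "(u\<^sup>T)\<^sup>T = (0\<^sub>m m 1)\<^sup>T" by (rule arg_cong)
    then show ?thesis by simp
  qed
  note indep = this
  have "F\<^sup>T \<in> carrier_mat m r" using F by simp
  from right_invertible[OF this indep] obtain G where G: "G \<in> carrier_mat r m" "F\<^sup>T * G = 1\<^sub>m m" .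
  have "(F\<^sup>T * G)\<^sup>T = G\<^sup>T * F" using F G by (subst transpose_mult[of _ m r _ m]) auto
  then show ?thesis using G by (intro that[of "G\<^sup>T"]) simp_all
qed

section \<open>Linear combinations and $q$-commuting matrices\<close>

text \<open>Given entrywise, so that products can be pulled through the sum; shared by the
  q-binomial formula and the weight projectors.\<close>

definition lincomb_mat :: "nat \<Rightarrow> nat \<Rightarrow> (nat \<Rightarrow> 'k::field) \<Rightarrow> (nat \<Rightarrow> 'k mat) \<Rightarrow> 'k mat" where
  "lincomb_mat N m c W = mat N N (\<lambda>ij. \<Sum>k\<le>m. c k * W k $$ ij)"

lemma lincomb_mat_carrier [simp]: "lincomb_mat N m c W \<in> carrier_mat N N"
  by (simp add: lincomb_mat_def)

lemma dim_lincomb_mat [simp]: "dim_row (lincomb_mat N m c W) = N" "dim_col (lincomb_mat N m c W) = N"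
  by (simp_all add: lincomb_mat_def)

lemma mult_lincomb_mat_index:
  fixes Z :: "'k::field mat"
  assumes Z: "Z \<in> carrier_mat r N" and W: "\<And>k. W k \<in> carrier_mat N N" and ij: "i < r" "j < N"
  shows "(Z * lincomb_mat N m c W) $$ (i, j) = (\<Sum>k\<le>m. c k * (Z * W k) $$ (i, j))"
proof -
  have "(Z * lincomb_mat N m c W) $$ (i, j) = (\<Sum>s = 0..<N. \<Sum>k\<le>m. c k * (Z $$ (i, s) * W k $$ (s, j)))"
    using Z ij by (simp add: scalar_prod_def lincomb_mat_def sum_distrib_left mult_ac)
  also have "\<dots> = (\<Sum>k\<le>m. \<Sum>s = 0..<N. c k * (Z $$ (i, s) * W k $$ (s, j)))" by (rule sum.swap)
  also have "\<dots> = (\<Sum>k\<le>m. c k * (Z * W k) $$ (i, j))"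
    using Z ij carrier_matD[OF W] by (simp add: scalar_prod_def sum_distrib_left)
  finally show ?thesis .
qed

lemma lincomb_mat_mult_index:
  fixes Z :: "'k::field mat"
  assumes Z: "Z \<in> carrier_mat N r" and W: "\<And>k. W k \<in> carrier_mat N N" and ij: "i < N" "j < r"
  shows "(lincomb_mat N m c W * Z) $$ (i, j) = (\<Sum>k\<le>m. c k * (W k * Z) $$ (i, j))"
proof -
  have "(lincomb_mat N m c W * Z) $$ (i, j) = (\<Sum>s = 0..<N. \<Sum>k\<le>m. c k * (W k $$ (i, s) * Z $$ (s, j)))"
    using Z ij by (simp add: scalar_prod_def lincomb_mat_def sum_distrib_right mult.assoc)
  also have "\<dots> = (\<Sum>k\<le>m. \<Sum>s = 0..<N. c k * (W k $$ (i, s) * Z $$ (s, j)))" by (rule sum.swap)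
  also have "\<dots> = (\<Sum>k\<le>m. c k * (W k * Z) $$ (i, j))"
    using Z ij carrier_matD[OF W] by (simp add: scalar_prod_def sum_distrib_left)
  finally show ?thesis .
qed

section \<open>Gaussian binomial coefficients and sums of q-commuting nilpotent matrices\<close>

fun gauss_binomial :: "'k::field \<Rightarrow> nat \<Rightarrow> nat \<Rightarrow> 'k" where
  "gauss_binomial q m 0 = 1"
| "gauss_binomial q 0 (Suc k) = 0"
| "gauss_binomial q (Suc m) (Suc k) = gauss_binomial q m k + q ^ Suc k * gauss_binomial q m (Suc k)"

lemma gauss_binomial_eq_0: "m < k \<Longrightarrow> gauss_binomial q m k = 0"
  by (induction q m k rule: gauss_binomial.induct) auto

text \<open>The two absorption identities have to be proved by a simultaneous induction.\<close>

lemma gauss_binomial_absorb: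
  "(1 - q ^ Suc k) * gauss_binomial q (Suc m) (Suc k) = (1 - q ^ Suc m) * gauss_binomial q m k \<and>
   (k \<le> Suc m \<longrightarrow> (1 - q ^ (Suc m - k)) * gauss_binomial q (Suc m) k = (1 - q ^ Suc m) * gauss_binomial q m k)"
proof (induction m arbitrary: k)
  case 0
  show ?case by (cases k rule: nat.exhaust; cases "k - 1") auto
next
  case (Suc m)
  let ?g = "gauss_binomial q"
  have A: "(1 - q ^ Suc k) * ?g (Suc (Suc m)) (Suc k) = (1 - q ^ Suc (Suc m)) * ?g (Suc m) k" for k
  proof (cases "k \<le> Suc m")
    case True
    have "(1 - q ^ Suc k) * ?g (Suc (Suc m)) (Suc k)
        = (1 - q ^ Suc k) * ?g (Suc m) k + q ^ Suc k * ((1 - q ^ Suc k) * ?g (Suc m) (Suc k))"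
      by (simp add: algebra_simps)
    also have "(1 - q ^ Suc k) * ?g (Suc m) (Suc k) = (1 - q ^ (Suc m - k)) * ?g (Suc m) k"
      using Suc[of k] True by simp
    also have "(1 - q ^ Suc k) * ?g (Suc m) k + q ^ Suc k * ((1 - q ^ (Suc m - k)) * ?g (Suc m) k)
        = (1 - q ^ (Suc k + (Suc m - k))) * ?g (Suc m) k"
      by (simp add: algebra_simps power_add)
    finally show ?thesis using True by simp
  qed (simp add: gauss_binomial_eq_0)
  have "(1 - q ^ (Suc (Suc m) - k)) * ?g (Suc (Suc m)) k = (1 - q ^ Suc (Suc m)) * ?g (Suc m) k"
    if k: "k \<le> Suc (Suc m)" for k
  proof (cases k)
    case (Suc j)
    show ?thesis
    proof (cases "j \<le> m")
      case True
      have "(1 - q ^ (Suc (Suc m) - k)) * ?g (Suc (Suc m)) k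
         = (1 - q ^ (Suc m - j)) * ?g (Suc m) j + q ^ Suc j * ((1 - q ^ (Suc m - j)) * ?g (Suc m) (Suc j))"
        unfolding Suc by (simp add: algebra_simps)
      also have "(1 - q ^ (Suc m - j)) * ?g (Suc m) j = (1 - q ^ Suc j) * ?g (Suc m) (Suc j)"
        using Suc.IH[of j] True by simp
      also have "(1 - q ^ Suc j) * ?g (Suc m) (Suc j) + q ^ Suc j * ((1 - q ^ (Suc m - j)) * ?g (Suc m) (Suc j))
         = (1 - q ^ (Suc j + (Suc m - j))) * ?g (Suc m) (Suc j)"
        by (simp add: algebra_simps power_add)
      finally show ?thesis using True Suc by simp
    next
      case False
      then have "k = Suc (Suc m)" using k Suc by simp
      then show ?thesis by (simp add: gauss_binomial_eq_0)
    qed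
  qed simp
  with A show ?case by blast
qed

lemma primitive_rootD:
  assumes "primitive_root n q"
  shows "n > 0" "q ^ n = 1" "q \<noteq> 0" "\<And>j. 0 < j \<Longrightarrow> j < n \<Longrightarrow> q ^ j \<noteq> 1"
proof -
  show *: "n > 0" "q ^ n = 1" "\<And>j. 0 < j \<Longrightarrow> j < n \<Longrightarrow> q ^ j \<noteq> 1"
    using assms by (auto simp: primitive_root_def)
  show "q \<noteq> 0"
  proof
    assume "q = 0"
    then have "q ^ n = 0" using *(1) by (simp add: power_0_left)
    with *(2) show False by simp
  qed
qed

text \<open>Absorption turns \<open>(1 - q^k)\<close> times the coefficient into a multiple of
  \<open>1 - q^n = 0\<close>, and \<open>q^k \<noteq> 1\<close>.\<close>

lemma gauss_binomial_root:
  assumes "primitive_root n q" "0 < k" "k < n"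
  shows "gauss_binomial q n k = 0"
proof -
  obtain m where m: "n = Suc m" using assms by (cases n) auto
  obtain j where j: "k = Suc j" using assms by (cases k) auto
  have "(1 - q ^ k) * gauss_binomial q n k = 0"
    using gauss_binomial_absorb[of q j m] primitive_rootD[OF assms(1)] m j by simp
  then show ?thesis using primitive_rootD(4)[OF assms(1,2,3)] by simp
qed

text \<open>The bookkeeping when an expansion of degree \<open>m\<close> is multiplied by
  \<open>X + Y\<close> from the left: \<open>a k\<close> stands for an entry of
  \<open>X^k Y^(m+1-k)\<close>, the factor \<open>X\<close> shifts the index, and moving
  \<open>Y\<close> past \<open>X^k\<close> costs \<open>q^k\<close>.\<close>

lemma gauss_binomial_sum:
  "(\<Sum>k\<le>m. gauss_binomial q m k * a (Suc k)) + (\<Sum>k\<le>m. gauss_binomial q m k * (q ^ k * a k))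
    = (\<Sum>k\<le>Suc m. gauss_binomial q (Suc m) k * a k)"
proof -
  have "(\<Sum>k\<le>Suc m. gauss_binomial q (Suc m) k * a k)
    = a 0 + (\<Sum>k\<le>m. (gauss_binomial q m k + q ^ Suc k * gauss_binomial q m (Suc k)) * a (Suc k))"
    by (simp add: sum.atMost_Suc_shift del: sum.atMost_Suc)
  also have "\<dots> = (\<Sum>k\<le>m. gauss_binomial q m k * a (Suc k))
     + (a 0 + (\<Sum>k\<le>m. gauss_binomial q m (Suc k) * (q ^ Suc k * a (Suc k))))"
    by (simp add: algebra_simps sum.distrib)
  also have "a 0 + (\<Sum>k\<le>m. gauss_binomial q m (Suc k) * (q ^ Suc k * a (Suc k)))
     = (\<Sum>k\<le>Suc m. gauss_binomial q m k * (q ^ k * a k))"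
    by (simp add: sum.atMost_Suc_shift del: sum.atMost_Suc)
  also have "\<dots> = (\<Sum>k\<le>m. gauss_binomial q m k * (q ^ k * a k))" by (simp add: gauss_binomial_eq_0)
  finally show ?thesis by simp
qed

lemma q_binomial_index:
  fixes X Y :: "'k::field mat"
  assumes X: "X \<in> carrier_mat N N" and Y: "Y \<in> carrier_mat N N" and YX: "Y * X = q \<cdot>\<^sub>m (X * Y)"
  shows "(X + Y) ^\<^sub>m m = lincomb_mat N m (gauss_binomial q m) (\<lambda>k. X ^\<^sub>m k * Y ^\<^sub>m (m - k))"
proof (induction m)
  case 0
  show ?case using X Y by (auto simp: lincomb_mat_def intro!: eq_matI)
next
  case (Suc m)
  let ?W = "\<lambda>k. X ^\<^sub>m k * Y ^\<^sub>m (m - k)"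
  have W: "?W k \<in> carrier_mat N N" for k using X Y by (intro mult_carrier_mat[of _ N N] pow_carrier_mat)
  have s: "X + Y \<in> carrier_mat N N" using X Y by simp
  have "(X + Y) ^\<^sub>m Suc m = (X + Y) * (X + Y) ^\<^sub>m m" by (rule pow_mat_mult_left[OF s])
  also have "\<dots> = X * (X + Y) ^\<^sub>m m + Y * (X + Y) ^\<^sub>m m"
    using X Y by (intro add_mult_distrib_mat[of _ N N _ _ N]) auto
  finally have eq: "(X + Y) ^\<^sub>m Suc m = X * (X + Y) ^\<^sub>m m + Y * (X + Y) ^\<^sub>m m" .
  have XW: "X * ?W k = X ^\<^sub>m Suc k * Y ^\<^sub>m (Suc m - Suc k)" for k
  proof -
    have "X * ?W k = (X * X ^\<^sub>m k) * Y ^\<^sub>m (m - k)" using X Y by (simp add: mat_alg)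
    then show ?thesis using pow_mat_mult_left[OF X] by simp
  qed
  have YW: "Y * ?W k = q ^ k \<cdot>\<^sub>m (X ^\<^sub>m k * Y ^\<^sub>m (Suc m - k))" if "k \<le> m" for k
  proof -
    have "Y * ?W k = (Y * X ^\<^sub>m k) * Y ^\<^sub>m (m - k)" using X Y by (simp add: mat_alg)
    also have "\<dots> = q ^ k \<cdot>\<^sub>m (X ^\<^sub>m k * (Y * Y ^\<^sub>m (m - k)))"
      unfolding pow_mat_qcomm[OF X Y YX] using X Y by (simp add: mat_alg)
    also have "Y * Y ^\<^sub>m (m - k) = Y ^\<^sub>m (Suc m - k)"
      using pow_mat_mult_left[OF Y, of "m - k"] that by (simp add: Suc_diff_le)
    finally show ?thesis .
  qed
  show ?case
  proof (rule eq_matI)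
    fix i j assume "i < dim_row (lincomb_mat N (Suc m) (gauss_binomial q (Suc m)) (\<lambda>k. X ^\<^sub>m k * Y ^\<^sub>m (Suc m - k)))"
      "j < dim_col (lincomb_mat N (Suc m) (gauss_binomial q (Suc m)) (\<lambda>k. X ^\<^sub>m k * Y ^\<^sub>m (Suc m - k)))"
    then have ij: "i < N" "j < N" by auto
    let ?a = "\<lambda>k. (X ^\<^sub>m k * Y ^\<^sub>m (Suc m - k)) $$ (i, j)"
    have "((X + Y) ^\<^sub>m Suc m) $$ (i, j)
      = (X * lincomb_mat N m (gauss_binomial q m) ?W) $$ (i, j) + (Y * lincomb_mat N m (gauss_binomial q m) ?W) $$ (i, j)"
      unfolding eq Suc using X Y ij by (simp del: index_mult_mat(1))
    also have "(X * lincomb_mat N m (gauss_binomial q m) ?W) $$ (i, j) = (\<Sum>k\<le>m. gauss_binomial q m k * ?a (Suc k))"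
      by (subst mult_lincomb_mat_index[OF X W ij]) (simp only: XW)
    also have "(Y * lincomb_mat N m (gauss_binomial q m) ?W) $$ (i, j) = (\<Sum>k\<le>m. gauss_binomial q m k * (q ^ k * ?a k))"
      by (subst mult_lincomb_mat_index[OF Y W ij], rule sum.cong)
        (use X Y ij in \<open>auto simp: YW simp del: index_mult_mat(1)\<close>)
    also have "(\<Sum>k\<le>m. gauss_binomial q m k * ?a (Suc k)) + (\<Sum>k\<le>m. gauss_binomial q m k * (q ^ k * ?a k))
       = (\<Sum>k\<le>Suc m. gauss_binomial q (Suc m) k * ?a k)" by (rule gauss_binomial_sum)
    also have "\<dots> = lincomb_mat N (Suc m) (gauss_binomial q (Suc m)) (\<lambda>k. X ^\<^sub>m k * Y ^\<^sub>m (Suc m - k)) $$ (i, j)"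
      using ij by (simp add: lincomb_mat_def)
    finally show "((X + Y) ^\<^sub>m Suc m) $$ (i, j)
       = lincomb_mat N (Suc m) (gauss_binomial q (Suc m)) (\<lambda>k. X ^\<^sub>m k * Y ^\<^sub>m (Suc m - k)) $$ (i, j)" .
  qed (use X Y in \<open>auto simp: pow_mat_dim\<close>)
qed

text \<open>In the expansion of the \<open>n\<close>-th power the inner coefficients vanish at a
  primitive \<open>n\<close>-th root of unity, and the outer terms are the \<open>n\<close>-th
  powers of \<open>X\<close> and \<open>Y\<close>. This gives \<open>a^n = 0\<close> and
  \<open>d^n = 0\<close> on tensor products and ends the recursion in
  \<open>slice_recursion_stops\<close>.\<close>

lemma q_commuting_nilpotent:
  fixes X Y :: "'k::field mat"
  assumes q: "primitive_root n q"
    and X: "X \<in> carrier_mat N N" and Y: "Y \<in> carrier_mat N N" and YX: "Y * X = q \<cdot>\<^sub>m (X * Y)"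
    and Xn: "X ^\<^sub>m n = 0\<^sub>m N N" and Yn: "Y ^\<^sub>m n = 0\<^sub>m N N"
  shows "(X + Y) ^\<^sub>m n = 0\<^sub>m N N"
proof (rule eq_matI)
  fix i j assume "i < dim_row (0\<^sub>m N N :: 'k mat)" "j < dim_col (0\<^sub>m N N :: 'k mat)"
  then have ij: "i < N" "j < N" by auto
  have "gauss_binomial q n k * (X ^\<^sub>m k * Y ^\<^sub>m (n - k)) $$ (i, j) = 0" if kn: "k \<le> n" for k
  proof -
    consider "k = 0" | "k = n" | "0 < k" "k < n" using kn by linarith
    then show ?thesis
    proof cases
      case 1 then show ?thesis using X Y ij by (simp add: Yn del: index_mult_mat(1))
    next
      case 2 then show ?thesis using X Y ij by (simp add: Xn del: index_mult_mat(1))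
    next
      case 3 then show ?thesis by (simp add: gauss_binomial_root[OF q])
    qed
  qed
  then show "((X + Y) ^\<^sub>m n) $$ (i, j) = 0\<^sub>m N N $$ (i, j)"
    unfolding q_binomial_index[OF X Y YX] using ij by (simp add: lincomb_mat_def sum.neutral)
qed (use X Y in \<open>auto simp: pow_mat_dim\<close>)

section \<open>Tensor products and duals\<close>

lemma kron_one_left [simp]: "kron (1\<^sub>m 1) A = A" and kron_one_right [simp]: "kron A (1\<^sub>m 1) = A"
  for A :: "'a::field mat"
  by (simp_all add: One_nat_def)

lemma hmod_carrier:
  assumes "is_hmod n q M"
  shows "opa M \<in> carrier_mat (hdim M) (hdim M)" "opb M \<in> carrier_mat (hdim M) (hdim M)"
    "opc M \<in> carrier_mat (hdim M) (hdim M)" "opd M \<in> carrier_mat (hdim M) (hdim M)"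
  using assms by (auto simp: is_hmod_def Let_def)

lemma hmod_dim:
  assumes "is_hmod n q M"
  shows "dim_row (opa M) = hdim M" "dim_row (opb M) = hdim M" "dim_row (opc M) = hdim M" "dim_row (opd M) = hdim M"
    "dim_col (opa M) = hdim M" "dim_col (opb M) = hdim M" "dim_col (opc M) = hdim M" "dim_col (opd M) = hdim M"
  using hmod_carrier[OF assms] by auto

lemma hmod_relations:
  assumes "is_hmod n q M"
  shows "opb M * opa M = q \<cdot>\<^sub>m (opa M * opb M)" "opd M * opb M = q \<cdot>\<^sub>m (opb M * opd M)"
    "opc M * opa M = q \<cdot>\<^sub>m (opa M * opc M)" "opd M * opc M = q \<cdot>\<^sub>m (opc M * opd M)"
    "opc M * opb M = opb M * opc M"
  using assms by (simp_all add: is_hmod_def Let_def)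

lemma hmod_powers:
  assumes "is_hmod n q M"
  shows "opa M ^\<^sub>m n = 0\<^sub>m (hdim M) (hdim M)" "opb M ^\<^sub>m n = 1\<^sub>m (hdim M)"
    "opc M ^\<^sub>m n = 1\<^sub>m (hdim M)" "opd M ^\<^sub>m n = 0\<^sub>m (hdim M) (hdim M)"
  using assms by (simp_all add: is_hmod_def Let_def)

lemma hmod_da:
  assumes "is_hmod n q M"
  shows "opd M * opa M = q \<cdot>\<^sub>m (opa M * opd M) + (1\<^sub>m (hdim M) - opb M * opc M)"
proof (rule eq_matI)
  note c = hmod_dim[OF assms]
  have eq: "opd M * opa M - q \<cdot>\<^sub>m (opa M * opd M) = 1\<^sub>m (hdim M) - opb M * opc M"
    using assms by (simp add: is_hmod_def Let_def)
  fix i j assume "i < dim_row (q \<cdot>\<^sub>m (opa M * opd M) + (1\<^sub>m (hdim M) - opb M * opc M))"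
    "j < dim_col (q \<cdot>\<^sub>m (opa M * opd M) + (1\<^sub>m (hdim M) - opb M * opc M))"
  then have ij: "i < hdim M" "j < hdim M" using c by auto
  have "(opd M * opa M - q \<cdot>\<^sub>m (opa M * opd M)) $$ (i, j) = (opd M * opa M) $$ (i, j) - (q \<cdot>\<^sub>m (opa M * opd M)) $$ (i, j)"
    using ij c by (simp del: index_mult_mat(1) index_smult_mat(1))
  then show "(opd M * opa M) $$ (i, j) = (q \<cdot>\<^sub>m (opa M * opd M) + (1\<^sub>m (hdim M) - opb M * opc M)) $$ (i, j)"
    unfolding eq using ij c by (simp del: index_mult_mat(1) index_smult_mat(1))
qed (use hmod_dim[OF assms] in auto)

lemma is_hmodI:
  assumes "opa M \<in> carrier_mat (hdim M) (hdim M)" "opb M \<in> carrier_mat (hdim M) (hdim M)"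
    "opc M \<in> carrier_mat (hdim M) (hdim M)" "opd M \<in> carrier_mat (hdim M) (hdim M)"
    "opb M * opa M = q \<cdot>\<^sub>m (opa M * opb M)" "opd M * opb M = q \<cdot>\<^sub>m (opb M * opd M)"
    "opc M * opa M = q \<cdot>\<^sub>m (opa M * opc M)" "opd M * opc M = q \<cdot>\<^sub>m (opc M * opd M)"
    "opc M * opb M = opb M * opc M"
    "opa M ^\<^sub>m n = 0\<^sub>m (hdim M) (hdim M)" "opb M ^\<^sub>m n = 1\<^sub>m (hdim M)"
    "opc M ^\<^sub>m n = 1\<^sub>m (hdim M)" "opd M ^\<^sub>m n = 0\<^sub>m (hdim M) (hdim M)"
    "opd M * opa M = q \<cdot>\<^sub>m (opa M * opd M) + (1\<^sub>m (hdim M) - opb M * opc M)"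
  shows "is_hmod n q M"
proof -
  have "opd M * opa M - q \<cdot>\<^sub>m (opa M * opd M) = 1\<^sub>m (hdim M) - opb M * opc M"
    unfolding assms(14) using assms(1-4) by (auto intro!: eq_matI simp del: index_mult_mat(1))
  then show ?thesis using assms by (simp add: is_hmod_def Let_def)
qed

lemma htensor_sel [simp]:
  "hdim (M \<otimes>\<^sub>H N) = hdim M * hdim N"
  "opa (M \<otimes>\<^sub>H N) = kron (opa M) (opb N) + kron (1\<^sub>m (hdim M)) (opa N)"
  "opb (M \<otimes>\<^sub>H N) = kron (opb M) (opb N)" "opc (M \<otimes>\<^sub>H N) = kron (opc M) (opc N)"
  "opd (M \<otimes>\<^sub>H N) = kron (opd M) (opc N) + kron (1\<^sub>m (hdim M)) (opd N)"
  by (simp_all add: htensor_def)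

theorem htensor_hmod:
  assumes q: "primitive_root n q" and M: "is_hmod n q M" and N: "is_hmod n q N"
  shows "is_hmod n q (M \<otimes>\<^sub>H N)"
proof (rule is_hmodI)
  note [simp] = hmod_dim[OF M] hmod_dim[OF N]
  note cM = hmod_carrier[OF M] and cN = hmod_carrier[OF N]
  note rel = hmod_relations[OF M] hmod_relations[OF N]
  note alg = mat_alg kron_mult rel kron_smult_left kron_smult_right smult_add_mat
  let ?M = "M \<otimes>\<^sub>H N"
  show "opa ?M \<in> carrier_mat (hdim ?M) (hdim ?M)" "opb ?M \<in> carrier_mat (hdim ?M) (hdim ?M)"
    "opc ?M \<in> carrier_mat (hdim ?M) (hdim ?M)" "opd ?M \<in> carrier_mat (hdim ?M) (hdim ?M)"
    by (auto intro!: carrier_matI)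
  show "opb ?M * opa ?M = q \<cdot>\<^sub>m (opa ?M * opb ?M)" "opd ?M * opb ?M = q \<cdot>\<^sub>m (opb ?M * opd ?M)"
    "opc ?M * opa ?M = q \<cdot>\<^sub>m (opa ?M * opc ?M)" "opd ?M * opc ?M = q \<cdot>\<^sub>m (opc ?M * opd ?M)"
    "opc ?M * opb ?M = opb ?M * opc ?M"
    by (simp_all add: alg)
  show "opb ?M ^\<^sub>m n = 1\<^sub>m (hdim ?M)" "opc ?M ^\<^sub>m n = 1\<^sub>m (hdim ?M)"
    by (simp_all add: kron_pow[OF cM(2) cN(2)] kron_pow[OF cM(3) cN(3)] hmod_powers[OF M] hmod_powers[OF N])
  \<comment> \<open>The summands are swapped: since \<open>(a \<otimes> b)(1 \<otimes> a) = q (1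
    \<otimes> a)(a \<otimes> b)\<close>, the term \<open>1 \<otimes> a\<close> has to play the part
    of \<open>X\<close>. For \<open>d\<close> the order in the comultiplication already
    fits.\<close>
  have "(kron (1\<^sub>m (hdim M)) (opa N) + kron (opa M) (opb N)) ^\<^sub>m n = 0\<^sub>m (hdim ?M) (hdim ?M)"
    by (rule q_commuting_nilpotent[OF q])
      (auto intro!: carrier_matI simp: alg kron_pow[OF cM(1) cN(2)] kron_pow[OF one_carrier_mat cN(1)]
         hmod_powers[OF M] hmod_powers[OF N])
  moreover have "kron (1\<^sub>m (hdim M)) (opa N) + kron (opa M) (opb N) = opa ?M"
    by (simp add: add_commute_dim)
  ultimately show "opa ?M ^\<^sub>m n = 0\<^sub>m (hdim ?M) (hdim ?M)" by simp
  show "opd ?M ^\<^sub>m n = 0\<^sub>m (hdim ?M) (hdim ?M)" unfolding htensor_sel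
    by (rule q_commuting_nilpotent[OF q])
      (auto intro!: carrier_matI simp: alg kron_pow[OF cM(4) cN(3)] kron_pow[OF one_carrier_mat cN(4)]
         hmod_powers[OF M] hmod_powers[OF N])
  show "opd ?M * opa ?M = q \<cdot>\<^sub>m (opa ?M * opd ?M) + (1\<^sub>m (hdim ?M) - opb ?M * opc ?M)"
  proof -
    have "opd ?M * opa ?M = kron (opd M * opa M) (opb N * opc N) + q \<cdot>\<^sub>m kron (opd M) (opa N * opc N)
        + (q \<cdot>\<^sub>m kron (opa M) (opb N * opd N) + kron (1\<^sub>m (hdim M)) (opd N * opa N))"
      by (simp add: alg mat_add_ac)
    also have "\<dots> = q \<cdot>\<^sub>m kron (opa M * opd M) (opb N * opc N)
        + (kron (1\<^sub>m (hdim M)) (opb N * opc N) - kron (opb M * opc M) (opb N * opc N))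
        + q \<cdot>\<^sub>m kron (opd M) (opa N * opc N) + (q \<cdot>\<^sub>m kron (opa M) (opb N * opd N) +
        (q \<cdot>\<^sub>m kron (1\<^sub>m (hdim M)) (opa N * opd N) + (1\<^sub>m (hdim ?M) - kron (1\<^sub>m (hdim M)) (opb N * opc N))))"
      unfolding hmod_da[OF M] hmod_da[OF N]
      by (simp add: kron_add_left kron_add_right kron_minus_left kron_minus_right kron_smult_left kron_smult_right)
    also have "\<dots> = q \<cdot>\<^sub>m (kron (opa M * opd M) (opb N * opc N) + kron (opa M) (opb N * opd N)
        + (kron (opd M) (opa N * opc N) + kron (1\<^sub>m (hdim M)) (opa N * opd N)))
        + (1\<^sub>m (hdim ?M) - kron (opb M * opc M) (opb N * opc N))"
      by (rule eq_matI) (simp_all add: algebra_simps del: index_mult_mat(1))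
    also have "kron (opa M * opd M) (opb N * opc N) + kron (opa M) (opb N * opd N)
        + (kron (opd M) (opa N * opc N) + kron (1\<^sub>m (hdim M)) (opa N * opd N)) = opa ?M * opd ?M"
      by (simp add: alg mat_add_ac)
    also have "kron (opb M * opc M) (opb N * opc N) = opb ?M * opc ?M" by (simp add: kron_mult)
    finally show ?thesis .
  qed
qed

subsection \<open>Duals\<close>

lemma transpose_mult_dim: "dim_col A = dim_row B \<Longrightarrow> (A * B)\<^sup>T = B\<^sup>T * A\<^sup>T" for A B :: "'a::comm_semiring_0 mat"
  by (rule transpose_mult[of A "dim_row A" "dim_row B" B "dim_col B"]) auto

lemma transpose_smult: "(k \<cdot>\<^sub>m A)\<^sup>T = k \<cdot>\<^sub>m A\<^sup>T"
  by (rule eq_matI) auto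

lemma smult_uminus_mat: "k \<cdot>\<^sub>m (- A) = - (k \<cdot>\<^sub>m A)" for A :: "'a::ring mat"
  by (rule eq_matI) auto

lemma hmod_inverses:
  assumes q: "primitive_root n q" and M: "is_hmod n q M"
  shows "opb M * opb M ^\<^sub>m (n - 1) = 1\<^sub>m (hdim M)" "opb M ^\<^sub>m (n - 1) * opb M = 1\<^sub>m (hdim M)"
    "opc M * opc M ^\<^sub>m (n - 1) = 1\<^sub>m (hdim M)" "opc M ^\<^sub>m (n - 1) * opc M = 1\<^sub>m (hdim M)"
proof -
  have n: "Suc (n - 1) = n" using primitive_rootD(1)[OF q] by simp
  note c = hmod_carrier[OF M]
  show "opb M * opb M ^\<^sub>m (n - 1) = 1\<^sub>m (hdim M)" "opb M ^\<^sub>m (n - 1) * opb M = 1\<^sub>m (hdim M)"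
    using pow_mat_mult_left[OF c(2), of "n - 1"] pow_mat.simps(2)[of "opb M" "n - 1"] hmod_powers(2)[OF M]
    unfolding n by metis+
  show "opc M * opc M ^\<^sub>m (n - 1) = 1\<^sub>m (hdim M)" "opc M ^\<^sub>m (n - 1) * opc M = 1\<^sub>m (hdim M)"
    using pow_mat_mult_left[OF c(3), of "n - 1"] pow_mat.simps(2)[of "opc M" "n - 1"] hmod_powers(3)[OF M]
    unfolding n by metis+
qed

text \<open>The dual space with the action through the antipode, \<open>S(a) = -a b^(-1)\<close> and
  \<open>S(d) = -d c^(-1)\<close>; the inverses of \<open>b\<close> and \<open>c\<close> are written
  as powers with exponent \<open>n - 1\<close>.\<close>

definition hdual :: "nat \<Rightarrow> 'k::field hmod \<Rightarrow> 'k hmod" where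
  "hdual n M = HMod (hdim M) (- (opa M * opb M ^\<^sub>m (n - 1))\<^sup>T) ((opb M ^\<^sub>m (n - 1))\<^sup>T)
     ((opc M ^\<^sub>m (n - 1))\<^sup>T) (- (opd M * opc M ^\<^sub>m (n - 1))\<^sup>T)"

lemma hdual_sel [simp]:
  "hdim (hdual n M) = hdim M" "opa (hdual n M) = - (opa M * opb M ^\<^sub>m (n - 1))\<^sup>T"
  "opb (hdual n M) = (opb M ^\<^sub>m (n - 1))\<^sup>T" "opc (hdual n M) = (opc M ^\<^sub>m (n - 1))\<^sup>T"
  "opd (hdual n M) = - (opd M * opc M ^\<^sub>m (n - 1))\<^sup>T"
  by (simp_all add: hdual_def)

text \<open>Reordering the factors costs a power of \<open>c\<close>, left existential since the
  formula serves to show that \<open>a b^(-1)\<close> and \<open>d c^(-1)\<close> are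
  nilpotent.\<close>

lemma pow_mat_qcomm_mult:
  fixes A B :: "'a::comm_semiring_1 mat"
  assumes "A \<in> carrier_mat m m" "B \<in> carrier_mat m m" "B * A = c \<cdot>\<^sub>m (A * B)"
  shows "\<exists>e. (A * B) ^\<^sub>m k = e \<cdot>\<^sub>m (A ^\<^sub>m k * B ^\<^sub>m k)"
proof (induction k)
  case 0
  show ?case using assms by (intro exI[of _ 1]) simp
next
  case (Suc k)
  then obtain e where e: "(A * B) ^\<^sub>m k = e \<cdot>\<^sub>m (A ^\<^sub>m k * B ^\<^sub>m k)" by blast
  have "(A * B) ^\<^sub>m Suc k = e \<cdot>\<^sub>m (A ^\<^sub>m k * (B ^\<^sub>m k * A) * B)"
    using assms(1,2) by (simp add: e mat_alg)
  also have "\<dots> = (e * c ^ k) \<cdot>\<^sub>m (A ^\<^sub>m Suc k * B ^\<^sub>m Suc k)"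
    unfolding pow_mat_qcomm'[OF assms] using assms(1,2) by (simp add: mat_alg)
  finally show ?case by blast
qed

lemma uminus_pow_mat_zero:
  fixes A :: "'a::comm_ring_1 mat"
  assumes "A \<in> carrier_mat m m" "A ^\<^sub>m k = 0\<^sub>m m m"
  shows "(- A) ^\<^sub>m k = 0\<^sub>m m m"
proof -
  have "- A = (- 1) \<cdot>\<^sub>m A" by (rule eq_matI) auto
  then show ?thesis using pow_mat_smult[OF assms(1), of "- 1" k] assms(2) by simp
qed

text \<open>The antipode reverses products and so does transposition, hence the transposed matrices
  satisfy the relations in their original order.\<close>

theorem hdual_hmod:
  assumes q: "primitive_root n q" and M: "is_hmod n q M"
  shows "is_hmod n q (hdual n M)"
proof -
  define m A B C D where d: "m = hdim M" "A = opa M" "B = opb M ^\<^sub>m (n - 1)" "C = opc M ^\<^sub>m (n - 1)" "D = opd M"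
  define w where "w = q ^ (n - 1)"
  have n: "Suc (n - 1) = n" using primitive_rootD(1)[OF q] by simp
  have "q * w = q ^ Suc (n - 1)" by (simp add: w_def)
  then have wq: "q * w = 1" "w * q = 1" unfolding n using primitive_rootD(2)[OF q] by (simp_all add: mult.commute)
  note cM = hmod_carrier[OF M]
  have c: "A \<in> carrier_mat m m" "B \<in> carrier_mat m m" "C \<in> carrier_mat m m" "D \<in> carrier_mat m m"
    using cM by (simp_all add: d)
  then have [simp]: "dim_row A = m" "dim_row B = m" "dim_row C = m" "dim_row D = m"
     "dim_col A = m" "dim_col B = m" "dim_col C = m" "dim_col D = m" by auto
  note rel = hmod_relations[OF M]
  have BA: "B * A = w \<cdot>\<^sub>m (A * B)" unfolding d w_def by (rule pow_mat_qcomm'[OF cM(1,2) rel(1)])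
  have CA: "C * A = w \<cdot>\<^sub>m (A * C)" unfolding d w_def by (rule pow_mat_qcomm'[OF cM(1,3) rel(3)])
  have "D * B = w \<cdot>\<^sub>m (B * D)" unfolding d w_def by (rule pow_mat_qcomm[OF cM(2,4) rel(2)])
  then have BD: "B * D = q \<cdot>\<^sub>m (D * B)" by (simp add: smult_smult_mat wq)
  have "D * C = w \<cdot>\<^sub>m (C * D)" unfolding d w_def by (rule pow_mat_qcomm[OF cM(3,4) rel(4)])
  then have CD: "C * D = q \<cdot>\<^sub>m (D * C)" by (simp add: smult_smult_mat wq)
  have "opc M * opb M = 1 \<cdot>\<^sub>m (opb M * opc M)" using rel(5) by simp
  from pow_mat_qcomm'[OF cM(2,3) this, of "n - 1"] have "C * opb M = 1 \<cdot>\<^sub>m (opb M * C)" by (simp add: d)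
  from pow_mat_qcomm[OF cM(2) c(3)[unfolded d(1)] this, of "n - 1"] have CB: "C * B = B * C" by (simp add: d)
  have left: "X * (Y * Z) = k \<cdot>\<^sub>m (Y * (X * Z))" 
    if "X * Y = k \<cdot>\<^sub>m (Y * X)" "X \<in> carrier_mat m m" "Y \<in> carrier_mat m m" "Z \<in> carrier_mat m m" for X Y Z :: "'a mat" and k
  proof -
    have "X * (Y * Z) = (X * Y) * Z" using that(2-) by (simp add: mat_alg)
    then show ?thesis unfolding that(1) using that(2-) by (simp add: mat_alg)
  qed
  have BB: "opb M * B = 1\<^sub>m m" "opc M * C = 1\<^sub>m m" using hmod_inverses[OF q M] by (simp_all add: d)
  have Bn: "B ^\<^sub>m n = 1\<^sub>m m" "C ^\<^sub>m n = 1\<^sub>m m"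
  proof -
    have pp: "(X ^\<^sub>m a) ^\<^sub>m k = (X ^\<^sub>m k) ^\<^sub>m a" if "X \<in> carrier_mat m m" for X :: "'a mat" and a k
    proof -
      have *: "(X ^\<^sub>m a) ^\<^sub>m k = X ^\<^sub>m (a * k)" for a k
        using that by (induction k) (simp_all add: pow_mat_add[OF that, symmetric] add.commute)
      show ?thesis unfolding * by (simp add: mult.commute)
    qed
    have one: "1\<^sub>m m ^\<^sub>m k = (1\<^sub>m m :: 'a mat)" for k by (induction k) simp_all
    show "B ^\<^sub>m n = 1\<^sub>m m" "C ^\<^sub>m n = 1\<^sub>m m"
      using pp[of "opb M" "n - 1" n] pp[of "opc M" "n - 1" n] hmod_powers[OF M] cM one by (simp_all add: d)
  qed
  have An: "A ^\<^sub>m n = 0\<^sub>m m m" "D ^\<^sub>m n = 0\<^sub>m m m" using hmod_powers[OF M] by (simp_all add: d)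
  obtain e where "(A * B) ^\<^sub>m n = e \<cdot>\<^sub>m (A ^\<^sub>m n * B ^\<^sub>m n)" using pow_mat_qcomm_mult[OF c(1,2) BA] by blast
  then have ABn: "(A * B) ^\<^sub>m n = 0\<^sub>m m m" using An Bn by simp
  obtain e where "(D * C) ^\<^sub>m n = e \<cdot>\<^sub>m (D ^\<^sub>m n * C ^\<^sub>m n)" using pow_mat_qcomm_mult[OF c(4,3) CD] by blast
  then have DCn: "(D * C) ^\<^sub>m n = 0\<^sub>m m m" using An Bn by simp
  note rules = BA CA BD CD CB left[OF BA] left[OF CA] left[OF BD] left[OF CD]
    mat_alg c wq
  have DA: "D * A = q \<cdot>\<^sub>m (A * D) + (1\<^sub>m m - opb M * opc M)" using hmod_da[OF M] by (simp add: d)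
  \<comment> \<open>The image of \<open>da - qad = 1 - bc\<close> under the antipode, with
    \<open>B\<close> and \<open>C\<close> the inverses of \<open>b\<close> and \<open>c\<close>; the
    signs of \<open>S(a)\<close> and \<open>S(d)\<close> cancel.\<close>
  have main: "A * B * (D * C) = q \<cdot>\<^sub>m (D * C * (A * B)) + (1\<^sub>m m - C * B)"
  proof -
    have dims: "dim_row (opb M) = m" "dim_col (opb M) = m" "dim_row (opc M) = m" "dim_col (opc M) = m" 
      using cM by (auto simp: d)
    have "(opb M * opc M) * (C * B) = opb M * ((opc M * C) * B)" using dims by (simp add: mat_alg)
    then have bc: "(opb M * opc M) * (C * B) = 1\<^sub>m m" using BB by simp
    have "q \<cdot>\<^sub>m (D * C * (A * B)) = (D * A) * (C * B)" 
      by (simp add: rules) 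
    also have "\<dots> = q \<cdot>\<^sub>m (A * D * (C * B)) + (C * B - 1\<^sub>m m)"
      unfolding DA using bc dims by (simp add: mat_alg)
    finally have 1: "q \<cdot>\<^sub>m (D * C * (A * B)) = q \<cdot>\<^sub>m (A * D * (C * B)) + (C * B - 1\<^sub>m m)" .
    have 2: "A * B * (D * C) = q \<cdot>\<^sub>m (A * D * (C * B))" by (simp add: rules)
    show ?thesis unfolding 1 2 by (rule eq_matI) (simp_all del: index_mult_mat(1))
  qed
  show ?thesis
  proof (rule is_hmodI; unfold hdual_sel; fold d)
    show "- (A * B)\<^sup>T \<in> carrier_mat m m" "B\<^sup>T \<in> carrier_mat m m" "C\<^sup>T \<in> carrier_mat m m" "- (D * C)\<^sup>T \<in> carrier_mat m m"
      by (auto intro!: carrier_matI)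
    show "(- (A * B)\<^sup>T) ^\<^sub>m n = 0\<^sub>m m m" "(- (D * C)\<^sup>T) ^\<^sub>m n = 0\<^sub>m m m"
      using c ABn DCn by (auto intro!: uminus_pow_mat_zero simp: pow_mat_transpose[of _ m, symmetric])
    show "B\<^sup>T ^\<^sub>m n = 1\<^sub>m m" "C\<^sup>T ^\<^sub>m n = 1\<^sub>m m"
      by (simp_all add: pow_mat_transpose[OF c(2), symmetric] pow_mat_transpose[OF c(3), symmetric] Bn)
    show "B\<^sup>T * - (A * B)\<^sup>T = q \<cdot>\<^sub>m (- (A * B)\<^sup>T * B\<^sup>T)"
      "- (D * C)\<^sup>T * B\<^sup>T = q \<cdot>\<^sub>m (B\<^sup>T * - (D * C)\<^sup>T)"
      "C\<^sup>T * - (A * B)\<^sup>T = q \<cdot>\<^sub>m (- (A * B)\<^sup>T * C\<^sup>T)"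
      "- (D * C)\<^sup>T * C\<^sup>T = q \<cdot>\<^sub>m (C\<^sup>T * - (D * C)\<^sup>T)"
      by (simp_all add: transpose_mult_dim[symmetric] transpose_smult smult_uminus_mat rules)
    show "C\<^sup>T * B\<^sup>T = B\<^sup>T * C\<^sup>T"
      by (simp add: transpose_mult_dim[symmetric] CB)
    have "(A * B * (D * C))\<^sup>T = (q \<cdot>\<^sub>m (D * C * (A * B)) + (1\<^sub>m m - C * B))\<^sup>T" using main by simp
    also have "\<dots> = q \<cdot>\<^sub>m (D * C * (A * B))\<^sup>T + (1\<^sub>m m - (C * B)\<^sup>T)"
      by (rule eq_matI) (simp_all del: index_mult_mat(1))
    finally show "- (D * C)\<^sup>T * - (A * B)\<^sup>T = q \<cdot>\<^sub>m (- (A * B)\<^sup>T * - (D * C)\<^sup>T) + (1\<^sub>m m - B\<^sup>T * C\<^sup>T)"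
      by (simp add: transpose_mult_dim[symmetric])
  qed
qed

lemma add_zero_dim [simp]:
  "dim_row A = a \<Longrightarrow> dim_col A = b \<Longrightarrow> 0\<^sub>m a b + A = A"
  "dim_row A = a \<Longrightarrow> dim_col A = b \<Longrightarrow> A + 0\<^sub>m a b = A" for A :: "'a::monoid_add mat"
  by (rule eq_matI; simp)+

lemma col_carrier_vec_dim: "A \<in> carrier_mat m r \<Longrightarrow> col A i \<in> carrier_vec m"
  by (simp add: carrier_vecI)

lemma add_eq_iff_eq_minus:
  fixes A B C :: "'a::ab_group_add mat"
  assumes "A \<in> carrier_mat r c" "B \<in> carrier_mat r c" "C \<in> carrier_mat r c"
  shows "A + B = C \<longleftrightarrow> A = C - B"
proof
  show "A + B = C \<Longrightarrow> A = C - B" using assms by (intro eq_matI) auto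
  show "A = C - B \<Longrightarrow> A + B = C" using assms by (intro eq_matI) auto
qed

section \<open>Homomorphisms\<close>

text \<open>Only the shapes of the four matrices. They suffice for the calculus of homomorphisms and
  biproducts and are available before any relation has been verified.\<close>

definition square_mod :: "'k hmod \<Rightarrow> bool" where
  "square_mod M \<longleftrightarrow> opa M \<in> carrier_mat (hdim M) (hdim M) \<and> opb M \<in> carrier_mat (hdim M) (hdim M) \<and>
     opc M \<in> carrier_mat (hdim M) (hdim M) \<and> opd M \<in> carrier_mat (hdim M) (hdim M)"

lemma square_modD:
  assumes "square_mod M"
  shows "opa M \<in> carrier_mat (hdim M) (hdim M)" "opb M \<in> carrier_mat (hdim M) (hdim M)"
    "opc M \<in> carrier_mat (hdim M) (hdim M)" "opd M \<in> carrier_mat (hdim M) (hdim M)"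
  using assms by (auto simp: square_mod_def)

lemma square_mod_dim:
  assumes "square_mod M"
  shows "dim_row (opa M) = hdim M" "dim_row (opb M) = hdim M" "dim_row (opc M) = hdim M" "dim_row (opd M) = hdim M"
    "dim_col (opa M) = hdim M" "dim_col (opb M) = hdim M" "dim_col (opc M) = hdim M" "dim_col (opd M) = hdim M"
  using square_modD[OF assms] by auto

lemma hmod_square: "is_hmod n q M \<Longrightarrow> square_mod M"
  unfolding square_mod_def using hmod_carrier by blast

lemma homD:
  assumes "is_hom M N f"
  shows "f \<in> carrier_mat (hdim N) (hdim M)" "f * opa M = opa N * f" "f * opb M = opb N * f"
    "f * opc M = opc N * f" "f * opd M = opd N * f"
  using assms by (auto simp: is_hom_def)

lemma hom_dim: "is_hom M N f \<Longrightarrow> dim_row f = hdim N" "is_hom M N f \<Longrightarrow> dim_col f = hdim M"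
  using homD(1) by blast+

lemma hom_id: "square_mod M \<Longrightarrow> is_hom M M (1\<^sub>m (hdim M))"
  using square_mod_dim[of M] by (simp add: is_hom_def)

lemma hom_comp:
  assumes "is_hom M N f" "is_hom N L g" "square_mod M" "square_mod N" "square_mod L"
  shows "is_hom M L (g * f)"
proof -
  have *: "(g * f) * X = Z * (g * f)" if "f * X = Y * f" "g * Y = Z * g"
    "X \<in> carrier_mat (hdim M) (hdim M)" "Y \<in> carrier_mat (hdim N) (hdim N)" "Z \<in> carrier_mat (hdim L) (hdim L)" for X Y Z
  proof -
    have "(g * f) * X = g * (f * X)" using that(3-) homD(1)[OF assms(1)] homD(1)[OF assms(2)] by (simp add: mat_alg)
    also have "\<dots> = (g * Y) * f" unfolding that(1)
      using that(3-) homD(1)[OF assms(1)] homD(1)[OF assms(2)] by (simp add: mat_alg)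
    also have "\<dots> = Z * (g * f)" unfolding that(2)
      using that(3-) homD(1)[OF assms(1)] homD(1)[OF assms(2)] by (simp add: mat_alg)
    finally show ?thesis .
  qed
  note h = homD[OF assms(1)] homD[OF assms(2)]
  show ?thesis unfolding is_hom_def
    using h(1,6) *[OF h(2,7)] *[OF h(3,8)] *[OF h(4,9)] *[OF h(5,10)]
      square_modD[OF assms(3)] square_modD[OF assms(4)] square_modD[OF assms(5)]
    by simp
qed

lemma hom_add:
  assumes "is_hom M N f" "is_hom M N g" "square_mod M" "square_mod N"
  shows "is_hom M N (f + g)"
  using homD[OF assms(1)] homD[OF assms(2)] square_mod_dim[OF assms(3)] square_mod_dim[OF assms(4)]
  by (simp add: is_hom_def mat_alg)

lemma hom_zero: "square_mod M \<Longrightarrow> square_mod N \<Longrightarrow> is_hom M N (0\<^sub>m (hdim N) (hdim M))"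
  using square_mod_dim[of M] square_mod_dim[of N] by (simp add: is_hom_def)

text \<open>Over a field surjectivity means having a linear right inverse, in general not
  equivariant; epimorphisms enter all later matrix computations in this form.\<close>

lemma epi_right_inverse:
  "is_epi M N f \<longleftrightarrow> is_hom M N f \<and> (\<exists>g\<in>carrier_mat (hdim M) (hdim N). f * g = 1\<^sub>m (hdim N))"
proof
  assume "is_epi M N f"
  then have h: "is_hom M N f" and s: "(\<lambda>v. f *\<^sub>v v) ` carrier_vec (hdim M) = carrier_vec (hdim N)"
    by (auto simp: is_epi_def)
  have "\<exists>v. v \<in> carrier_vec (hdim M) \<and> f *\<^sub>v v = unit_vec (hdim N) i" for i
  proof -
    have "unit_vec (hdim N) i \<in> (\<lambda>v. f *\<^sub>v v) ` carrier_vec (hdim M)" unfolding s by simp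
    then show ?thesis by (auto simp: image_iff)
  qed
  then have "\<forall>i. \<exists>v. v \<in> carrier_vec (hdim M) \<and> f *\<^sub>v v = unit_vec (hdim N) i" ..
  then obtain v where "\<forall>i. v i \<in> carrier_vec (hdim M) \<and> f *\<^sub>v v i = unit_vec (hdim N) i"
    by (rule choice[THEN exE])
  then have v: "\<And>i. v i \<in> carrier_vec (hdim M)" "\<And>i. f *\<^sub>v v i = unit_vec (hdim N) i" by blast+
  define g where "g = mat (hdim M) (hdim N) (\<lambda>(r, c). v c $ r)"
  have "f * g = 1\<^sub>m (hdim N)"
  proof (rule eq_matI)
    fix i j assume "i < dim_row (1\<^sub>m (hdim N) :: 'a mat)" "j < dim_col (1\<^sub>m (hdim N) :: 'a mat)"
    then have ij: "i < hdim N" "j < hdim N" by auto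
    have "col g j = v j" using v(1)[of j] ij by (auto simp: g_def)
    then have "(f * g) $$ (i, j) = (f *\<^sub>v v j) $ i" using ij hom_dim[OF h] by (simp add: g_def)
    then show "(f * g) $$ (i, j) = 1\<^sub>m (hdim N) $$ (i, j)" unfolding v(2) using ij by simp
  qed (use hom_dim[OF h] in \<open>auto simp: g_def\<close>)
  then show "is_hom M N f \<and> (\<exists>g\<in>carrier_mat (hdim M) (hdim N). f * g = 1\<^sub>m (hdim N))"
    using h by (intro conjI bexI[of _ g]) (auto simp: g_def)
next
  assume "is_hom M N f \<and> (\<exists>g\<in>carrier_mat (hdim M) (hdim N). f * g = 1\<^sub>m (hdim N))"
  then obtain g where h: "is_hom M N f" and g: "g \<in> carrier_mat (hdim M) (hdim N)" "f * g = 1\<^sub>m (hdim N)" by blast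
  note fc = homD(1)[OF h]
  show "is_epi M N f" unfolding is_epi_def
  proof (intro conjI h equalityI subsetI)
    fix w :: "'a vec" assume "w \<in> carrier_vec (hdim N)"
    moreover from this have "f *\<^sub>v (g *\<^sub>v w) = (f * g) *\<^sub>v w" using fc g(1) by (simp add: assoc_mult_mat_vec)
    ultimately have "w = f *\<^sub>v (g *\<^sub>v w)" "g *\<^sub>v w \<in> carrier_vec (hdim M)" using g by simp_all
    then show "w \<in> (\<lambda>v. f *\<^sub>v v) ` carrier_vec (hdim M)" by (rule image_eqI)
  next
    fix w :: "'a vec" assume "w \<in> (\<lambda>v. f *\<^sub>v v) ` carrier_vec (hdim M)"
    then obtain v where "v \<in> carrier_vec (hdim M)" "w = f *\<^sub>v v" by (rule imageE)
    then show "w \<in> carrier_vec (hdim N)" using fc by simp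
  qed
qed

lemma mat_of_col_mult_vec:
  "F \<in> carrier_mat r m \<Longrightarrow> v \<in> carrier_mat m 1 \<Longrightarrow> F *\<^sub>v col v 0 = col (F * v) 0" for F :: "'a::semiring_0 mat"
  by (rule eq_vecI) auto

lemma mono_left_inverse:
  assumes "is_mono M N f"
  obtains g where "g \<in> carrier_mat (hdim M) (hdim N)" "g * f = 1\<^sub>m (hdim M)"
proof -
  have h: "is_hom M N f" and i: "inj_on (\<lambda>v. f *\<^sub>v v) (carrier_vec (hdim M))"
    using assms by (auto simp: is_mono_def)
  note fc = homD(1)[OF h]
  have ker: "v = 0\<^sub>m (hdim M) 1" if v: "v \<in> carrier_mat (hdim M) 1" "f * v = 0\<^sub>m (hdim N) 1" for v
  proof -
    have "f *\<^sub>v col v 0 = f *\<^sub>v 0\<^sub>v (hdim M)"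
      unfolding mat_of_col_mult_vec[OF fc v(1)] v(2) using fc by (auto intro!: eq_vecI)
    then have c0: "col v 0 = 0\<^sub>v (hdim M)" by (rule inj_onD[OF i]) (use v(1) col_carrier_vec_dim in auto)
    have "v $$ (k, 0) = 0" if "k < hdim M" for k
    proof -
      have "v $$ (k, 0) = col v 0 $ k" using that v(1) by simp
      then show ?thesis unfolding c0 using that by simp
    qed
    then show ?thesis using v(1) by (intro eq_matI) auto
  qed
  show ?thesis by (rule left_invertible[OF fc ker that])
qed

text \<open>An exact sequence splits as a sequence of vector spaces. Exactness is used later only
  through these matrix identities, which survive \<open>kron (1\<^sub>m p)\<close>.\<close>

lemma short_exact_splitting:
  assumes ex: "is_short_exact n q L f M g N"
  obtains f' g' where "f' \<in> carrier_mat (hdim L) (hdim M)" "g' \<in> carrier_mat (hdim M) (hdim N)"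
    "f' * f = 1\<^sub>m (hdim L)" "g * g' = 1\<^sub>m (hdim N)" "g * f = 0\<^sub>m (hdim N) (hdim L)" 
    "f * f' + g' * g = 1\<^sub>m (hdim M)"
proof -
  have f: "is_mono L M f" and g: "is_epi M N g" and im: "(\<lambda>v. f *\<^sub>v v) ` carrier_vec (hdim L) = mat_kernel g"
    using ex by (auto simp: is_short_exact_def)
  have fc: "f \<in> carrier_mat (hdim M) (hdim L)" using f homD(1) by (auto simp: is_mono_def)
  have gc: "g \<in> carrier_mat (hdim N) (hdim M)" using g homD(1) by (auto simp: is_epi_def)
  obtain f0 where f0: "f0 \<in> carrier_mat (hdim L) (hdim M)" "f0 * f = 1\<^sub>m (hdim L)" by (rule mono_left_inverse[OF f])
  obtain g' where g': "g' \<in> carrier_mat (hdim M) (hdim N)" "g * g' = 1\<^sub>m (hdim N)" using g epi_right_inverse by blast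
  have gf: "g * f = 0\<^sub>m (hdim N) (hdim L)"
  proof (rule mat_col_eqI)
    fix i assume "i < dim_col (0\<^sub>m (hdim N) (hdim L) :: 'a mat)"
    then have i: "i < hdim L" by simp
    have "f *\<^sub>v unit_vec (hdim L) i \<in> mat_kernel g" unfolding im[symmetric] by simp
    then have "g *\<^sub>v (f *\<^sub>v unit_vec (hdim L) i) = 0\<^sub>v (hdim N)" using gc by (simp add: mat_kernel_def)
    moreover have "f *\<^sub>v unit_vec (hdim L) i = col f i" using i fc by (auto intro!: eq_vecI)
    moreover have "col (g * f) i = g *\<^sub>v col f i" using i fc gc by (intro eq_vecI) simp_all
    ultimately show "col (g * f) i = col (0\<^sub>m (hdim N) (hdim L)) i" using i by simp
  qed (use fc gc in auto)
  have ker: "w = f * (f0 * w)" if w: "w \<in> carrier_mat (hdim M) 1" "g * w = 0\<^sub>m (hdim N) 1" for w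
  proof -
    have "g *\<^sub>v col w 0 = 0\<^sub>v (hdim N)"
      unfolding mat_of_col_mult_vec[OF gc w(1)] w(2) by (auto intro!: eq_vecI)
    then have "col w 0 \<in> mat_kernel g" using gc w by (simp add: mat_kernel_def col_carrier_vec_dim)
    then obtain v where v: "v \<in> carrier_vec (hdim L)" "col w 0 = f *\<^sub>v v" unfolding im[symmetric] by blast
    define V where "V = mat (hdim L) 1 (\<lambda>(i, _). v $ i)"
    have V: "V \<in> carrier_mat (hdim L) 1" by (simp add: V_def)
    have cV: "col V 0 = v" using v by (auto simp: V_def)
    have "w = f * V"
    proof (rule mat_col_eqI)
      fix i assume "i < dim_col (f * V)"
      then have "i = 0" using V by simp
      then show "col w i = col (f * V) i" using v(2) mat_of_col_mult_vec[OF fc V] cV by simp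
    qed (use w fc V in auto)
    moreover have "f * (f0 * (f * V)) = f * (f0 * f) * V" using fc f0(1) V by (simp add: mat_alg)
    ultimately show ?thesis using f0 fc V by simp
  qed
  \<comment> \<open>The projection onto the kernel of \<open>g\<close> along the image of
    \<open>g'\<close>. By exactness its columns lie in the image of \<open>f\<close>, and
    \<open>f0 * e\<close> is the retraction of \<open>f\<close> that vanishes on the image of
    \<open>g'\<close>.\<close>
  define e where "e = 1\<^sub>m (hdim M) - g' * g"
  have e: "e \<in> carrier_mat (hdim M) (hdim M)" using g' gc by (auto simp: e_def)
  have ge: "g * e = 0\<^sub>m (hdim N) (hdim M)"
  proof -
    have "g * e = g - (g * g') * g" unfolding e_def using gc g'(1) by (simp add: mat_alg)
    then show ?thesis using gc g' by simp
  qed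
  have fe: "e = f * (f0 * e)"
  proof (rule ucol_eqI)
    fix i assume "i < dim_col (f * (f0 * e))"
    then have i: "i < hdim M" using e by simp
    have "g * (e * ucol (hdim M) i) = (g * e) * ucol (hdim M) i" using gc e by (simp add: mat_alg)
    then have "e * ucol (hdim M) i = f * (f0 * (e * ucol (hdim M) i))" using ge e by (intro ker) auto
    then show "e * ucol (dim_col (f * (f0 * e))) i = f * (f0 * e) * ucol (dim_col (f * (f0 * e))) i"
      using fc f0 e by (simp add: mat_alg)
  qed (use fc e in auto)
  show ?thesis
  proof (rule that[of "f0 * e" g'])
    have "f0 * e * f = f0 * f - f0 * (g' * (g * f))" unfolding e_def using f0(1) fc gc g'(1) by (simp add: mat_alg)
    then show "f0 * e * f = 1\<^sub>m (hdim L)" unfolding gf f0(2) using g'(1) f0(1) by (auto intro!: eq_matI)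
    have "f * (f0 * e) + g' * g = e + g' * g" using fe by simp
    also have "\<dots> = 1\<^sub>m (hdim M)" unfolding e_def using g' gc by (auto intro!: eq_matI simp del: index_mult_mat(1))
    finally show "f * (f0 * e) + g' * g = 1\<^sub>m (hdim M)" .
  qed (use f0 g' e gf in auto)
qed

subsection \<open>Biproducts\<close>

text \<open>A direct sum given by its structure maps instead of block matrices; these equations are
  preserved by tensoring and translate directly into statements about functionals.\<close>

definition biprod :: "'k::field hmod \<Rightarrow> 'k hmod \<Rightarrow> 'k hmod \<Rightarrow> 'k mat \<Rightarrow> 'k mat \<Rightarrow> 'k mat \<Rightarrow> 'k mat \<Rightarrow> bool" where
  "biprod S X Y i1 i2 p1 p2 \<longleftrightarrow> is_hom X S i1 \<and> is_hom Y S i2 \<and> is_hom S X p1 \<and> is_hom S Y p2 \<and>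
     p1 * i1 = 1\<^sub>m (hdim X) \<and> p2 * i2 = 1\<^sub>m (hdim Y) \<and>
     p1 * i2 = 0\<^sub>m (hdim X) (hdim Y) \<and> p2 * i1 = 0\<^sub>m (hdim Y) (hdim X) \<and>
     i1 * p1 + i2 * p2 = 1\<^sub>m (hdim S)"

lemma biprodD:
  assumes "biprod S X Y i1 i2 p1 p2"
  shows "is_hom X S i1" "is_hom Y S i2" "is_hom S X p1" "is_hom S Y p2"
    "p1 * i1 = 1\<^sub>m (hdim X)" "p2 * i2 = 1\<^sub>m (hdim Y)"
    "p1 * i2 = 0\<^sub>m (hdim X) (hdim Y)" "p2 * i1 = 0\<^sub>m (hdim Y) (hdim X)"
    "i1 * p1 + i2 * p2 = 1\<^sub>m (hdim S)"
  using assms by (simp_all add: biprod_def)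

lemma biprod_iso:
  assumes S: "biprod S X Y i1 i2 p1 p2" and S': "biprod S' X' Y' i1' i2' p1' p2'"
    and XY: "X \<cong>\<^sub>H X'" "Y \<cong>\<^sub>H Y'"
    and sq: "square_mod S" "square_mod X" "square_mod Y" "square_mod S'" "square_mod X'" "square_mod Y'"
  shows "S \<cong>\<^sub>H S'"
proof -
  obtain f f' where f: "is_hom X X' f" "is_hom X' X f'" "f' * f = 1\<^sub>m (hdim X)" "f * f' = 1\<^sub>m (hdim X')"
    using XY(1) unfolding hmod_iso_def by blast
  obtain g g' where g: "is_hom Y Y' g" "is_hom Y' Y g'" "g' * g = 1\<^sub>m (hdim Y)" "g * g' = 1\<^sub>m (hdim Y')"
    using XY(2) unfolding hmod_iso_def by blast
  note d = biprodD[OF S] and d' = biprodD[OF S']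
  define F where "F = i1' * (f * p1) + i2' * (g * p2)"
  define F' where "F' = i1 * (f' * p1') + i2 * (g' * p2')"
  have hF: "is_hom S S' F" unfolding F_def
    by (intro hom_add hom_comp[of S X' _ S'] hom_comp[of S X _ X'] hom_comp[of S Y' _ S'] hom_comp[of S Y _ Y'] d d' f g sq)
  have hF': "is_hom S' S F'" unfolding F'_def
    by (intro hom_add hom_comp[of S' X _ S] hom_comp[of S' X' _ X] hom_comp[of S' Y _ S] hom_comp[of S' Y' _ Y] d d' f g sq)
  note c = homD(1)[OF d(1)] homD(1)[OF d(2)] homD(1)[OF d(3)] homD(1)[OF d(4)]
    homD(1)[OF d'(1)] homD(1)[OF d'(2)] homD(1)[OF d'(3)] homD(1)[OF d'(4)]
    homD(1)[OF f(1)] homD(1)[OF f(2)] homD(1)[OF g(1)] homD(1)[OF g(2)]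
  have "F' * F = (i1 * f') * (p1' * i1') * (f * p1) + (i1 * f') * (p1' * i2') * (g * p2)
      + ((i2 * g') * (p2' * i1') * (f * p1) + (i2 * g') * (p2' * i2') * (g * p2))"
    unfolding F_def F'_def using c by (simp add: mat_alg mat_add_ac)
  also have "\<dots> = i1 * (f' * f) * p1 + i2 * (g' * g) * p2"
    unfolding d'(5-8) using c by (simp add: mat_alg)
  also have "\<dots> = 1\<^sub>m (hdim S)" unfolding f(3) g(3) using c d(9) by simp
  finally have 1: "F' * F = 1\<^sub>m (hdim S)" .
  have "F * F' = (i1' * f) * (p1 * i1) * (f' * p1') + (i1' * f) * (p1 * i2) * (g' * p2')
      + ((i2' * g) * (p2 * i1) * (f' * p1') + (i2' * g) * (p2 * i2) * (g' * p2'))"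
    unfolding F_def F'_def using c by (simp add: mat_alg mat_add_ac)
  also have "\<dots> = i1' * (f * f') * p1' + i2' * (g * g') * p2'"
    unfolding d(5-8) using c by (simp add: mat_alg)
  also have "\<dots> = 1\<^sub>m (hdim S')" unfolding f(4) g(4) using c d'(9) by simp
  finally show ?thesis unfolding hmod_iso_def using hF hF' 1 by blast
qed

text \<open>The binary block sum in terms of the coordinate embeddings; \<open>hsum_Cons\<close>
  connects it with the block-diagonal form of \<open>hsum\<close>.\<close>

definition hplus :: "'k::field hmod \<Rightarrow> 'k hmod \<Rightarrow> 'k hmod" where
  "hplus X Y = (let a = hdim X; b = hdim Y in HMod (a + b)
     (inl a b * opa X * prl a b + inr a b * opa Y * prr a b)
     (inl a b * opb X * prl a b + inr a b * opb Y * prr a b)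
     (inl a b * opc X * prl a b + inr a b * opc Y * prr a b)
     (inl a b * opd X * prl a b + inr a b * opd Y * prr a b))"

lemma block_diag_mult:
  fixes A A' B B' :: "'k::field mat"
  assumes "A \<in> carrier_mat a a" "A' \<in> carrier_mat a a" "B \<in> carrier_mat b b" "B' \<in> carrier_mat b b"
  shows "(inl a b * A * prl a b + inr a b * B * prr a b) * (inl a b * A' * prl a b + inr a b * B' * prr a b)
    = inl a b * (A * A') * prl a b + inr a b * (B * B') * prr a b"
proof -
  have "(inl a b * A * prl a b + inr a b * B * prr a b) * (inl a b * A' * prl a b + inr a b * B' * prr a b)
    = inl a b * A * (prl a b * inl a b) * A' * prl a b + inl a b * A * (prl a b * inr a b) * B' * prr a b
     + (inr a b * B * (prr a b * inl a b) * A' * prl a b + inr a b * B * (prr a b * inr a b) * B' * prr a b)"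
    using assms by (simp add: mat_alg mat_add_ac del: embed_simps)
  also have "\<dots> = inl a b * (A * A') * prl a b + inr a b * (B * B') * prr a b"
    using assms by (simp add: mat_alg)
  finally show ?thesis .
qed

lemma block_diag_pow:
  fixes A B :: "'k::field mat"
  assumes "A \<in> carrier_mat a a" "B \<in> carrier_mat b b"
  shows "(inl a b * A * prl a b + inr a b * B * prr a b) ^\<^sub>m k
    = inl a b * A ^\<^sub>m k * prl a b + inr a b * B ^\<^sub>m k * prr a b"
proof (induction k)
  case (Suc k)
  have "(inl a b * A * prl a b + inr a b * B * prr a b) ^\<^sub>m Suc k
    = (inl a b * A ^\<^sub>m k * prl a b + inr a b * B ^\<^sub>m k * prr a b) * (inl a b * A * prl a b + inr a b * B * prr a b)"
    using Suc by simp
  also have "\<dots> = inl a b * (A ^\<^sub>m k * A) * prl a b + inr a b * (B ^\<^sub>m k * B) * prr a b"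
    using assms by (intro block_diag_mult) simp_all
  finally show ?case by simp
qed (use assms in simp)

lemma hplus_sel:
  "hdim (hplus X Y) = hdim X + hdim Y"
  "opa (hplus X Y) = inl (hdim X) (hdim Y) * opa X * prl (hdim X) (hdim Y) + inr (hdim X) (hdim Y) * opa Y * prr (hdim X) (hdim Y)"
  "opb (hplus X Y) = inl (hdim X) (hdim Y) * opb X * prl (hdim X) (hdim Y) + inr (hdim X) (hdim Y) * opb Y * prr (hdim X) (hdim Y)"
  "opc (hplus X Y) = inl (hdim X) (hdim Y) * opc X * prl (hdim X) (hdim Y) + inr (hdim X) (hdim Y) * opc Y * prr (hdim X) (hdim Y)"
  "opd (hplus X Y) = inl (hdim X) (hdim Y) * opd X * prl (hdim X) (hdim Y) + inr (hdim X) (hdim Y) * opd Y * prr (hdim X) (hdim Y)"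
  by (simp_all add: hplus_def Let_def)

lemma hplus_square: "square_mod (hplus X Y)"
  unfolding square_mod_def hplus_sel by (auto intro!: carrier_matI)

lemma hplus_hmod:
  assumes X: "is_hmod n q X" and Y: "is_hmod n q Y"
  shows "is_hmod n q (hplus X Y)"
proof (rule is_hmodI)
  note cX = hmod_carrier[OF X] and cY = hmod_carrier[OF Y]
  note [simp] = hmod_dim[OF X] hmod_dim[OF Y]
  let ?M = "hplus X Y" and ?a = "hdim X" and ?b = "hdim Y"
  note mult = block_diag_mult[OF cX(1) cX(2) cY(1) cY(2)] block_diag_mult[OF cX(2) cX(1) cY(2) cY(1)]
    block_diag_mult[OF cX(4) cX(2) cY(4) cY(2)] block_diag_mult[OF cX(2) cX(4) cY(2) cY(4)]
    block_diag_mult[OF cX(3) cX(1) cY(3) cY(1)] block_diag_mult[OF cX(1) cX(3) cY(1) cY(3)]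
    block_diag_mult[OF cX(4) cX(3) cY(4) cY(3)] block_diag_mult[OF cX(3) cX(4) cY(3) cY(4)]
    block_diag_mult[OF cX(2) cX(3) cY(2) cY(3)] block_diag_mult[OF cX(3) cX(2) cY(3) cY(2)]
    block_diag_mult[OF cX(4) cX(1) cY(4) cY(1)] block_diag_mult[OF cX(1) cX(4) cY(1) cY(4)]
  show "opa ?M \<in> carrier_mat (hdim ?M) (hdim ?M)" "opb ?M \<in> carrier_mat (hdim ?M) (hdim ?M)"
    "opc ?M \<in> carrier_mat (hdim ?M) (hdim ?M)" "opd ?M \<in> carrier_mat (hdim ?M) (hdim ?M)"
    using hplus_square[of X Y] by (auto simp: square_mod_def)
  show "opb ?M * opa ?M = q \<cdot>\<^sub>m (opa ?M * opb ?M)" "opd ?M * opb ?M = q \<cdot>\<^sub>m (opb ?M * opd ?M)"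
    "opc ?M * opa ?M = q \<cdot>\<^sub>m (opa ?M * opc ?M)" "opd ?M * opc ?M = q \<cdot>\<^sub>m (opc ?M * opd ?M)"
    "opc ?M * opb ?M = opb ?M * opc ?M"
    unfolding hplus_sel mult by (simp_all add: hmod_relations[OF X] hmod_relations[OF Y] mat_alg smult_add_mat)
  show "opa ?M ^\<^sub>m n = 0\<^sub>m (hdim ?M) (hdim ?M)" "opb ?M ^\<^sub>m n = 1\<^sub>m (hdim ?M)"
    "opc ?M ^\<^sub>m n = 1\<^sub>m (hdim ?M)" "opd ?M ^\<^sub>m n = 0\<^sub>m (hdim ?M) (hdim ?M)"
    unfolding hplus_sel block_diag_pow[OF cX(1) cY(1)] block_diag_pow[OF cX(2) cY(2)]
      block_diag_pow[OF cX(3) cY(3)] block_diag_pow[OF cX(4) cY(4)] hmod_powers[OF X] hmod_powers[OF Y] by simp_all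
  have one: "(1\<^sub>m (hdim ?M) :: 'a mat) = inl ?a ?b * 1\<^sub>m ?a * prl ?a ?b + inr ?a ?b * 1\<^sub>m ?b * prr ?a ?b"
    by (simp add: hplus_sel)
  show "opd ?M * opa ?M = q \<cdot>\<^sub>m (opa ?M * opd ?M) + (1\<^sub>m (hdim ?M) - opb ?M * opc ?M)"
    unfolding one unfolding hplus_sel mult hmod_da[OF X] hmod_da[OF Y]
    by (simp add: mat_alg smult_add_mat del: embed_simps)
      (rule eq_matI; simp add: algebra_simps del: index_mult_mat(1) embed_simps)
qed

lemma hplus_biprod:
  assumes "square_mod X" "square_mod Y"
  shows "biprod (hplus X Y) X Y (inl (hdim X) (hdim Y)) (inr (hdim X) (hdim Y)) (prl (hdim X) (hdim Y)) (prr (hdim X) (hdim Y))"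
proof -
  let ?a = "hdim X" and ?b = "hdim Y"
  note cX = square_modD[OF assms(1)] and cY = square_modD[OF assms(2)]
  have l: "(inl ?a ?b * A * prl ?a ?b + inr ?a ?b * B * prr ?a ?b) * inl ?a ?b = inl ?a ?b * A"
    "(inl ?a ?b * A * prl ?a ?b + inr ?a ?b * B * prr ?a ?b) * inr ?a ?b = inr ?a ?b * B"
    "prl ?a ?b * (inl ?a ?b * A * prl ?a ?b + inr ?a ?b * B * prr ?a ?b) = A * prl ?a ?b"
    "prr ?a ?b * (inl ?a ?b * A * prl ?a ?b + inr ?a ?b * B * prr ?a ?b) = B * prr ?a ?b"
    if "A \<in> carrier_mat ?a ?a" "B \<in> carrier_mat ?b ?b" for A B :: "'a mat"
  proof -
    note [simp] = carrier_matD[OF that(1)] carrier_matD[OF that(2)]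
    have e: "prl ?a ?b * (inl ?a ?b * Z) = Z" "prr ?a ?b * (inl ?a ?b * Z) = 0\<^sub>m ?b c"
      if "Z \<in> carrier_mat ?a c" for Z :: "'a mat" and c
      using that by (simp_all add: mult_assoc_dim[symmetric])
    have e': "prr ?a ?b * (inr ?a ?b * Z) = Z" "prl ?a ?b * (inr ?a ?b * Z) = 0\<^sub>m ?a c"
      if "Z \<in> carrier_mat ?b c" for Z :: "'a mat" and c
      using that by (simp_all add: mult_assoc_dim[symmetric])
    show "(inl ?a ?b * A * prl ?a ?b + inr ?a ?b * B * prr ?a ?b) * inl ?a ?b = inl ?a ?b * A"
      "(inl ?a ?b * A * prl ?a ?b + inr ?a ?b * B * prr ?a ?b) * inr ?a ?b = inr ?a ?b * B"
      by (simp_all add: mat_alg)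
    show "prl ?a ?b * (inl ?a ?b * A * prl ?a ?b + inr ?a ?b * B * prr ?a ?b) = A * prl ?a ?b"
      "prr ?a ?b * (inl ?a ?b * A * prl ?a ?b + inr ?a ?b * B * prr ?a ?b) = B * prr ?a ?b"
      using that by (simp_all add: mat_alg e[where c = "?a + ?b"] e'[where c = "?a + ?b"])
  qed
  show ?thesis unfolding biprod_def is_hom_def hplus_sel using cX cY by (simp add: l)
qed

subsection \<open>Tensoring with a projective module\<close>

lemma tensor_hom:
  assumes f: "is_hom M N f" and sq: "square_mod P" "square_mod M" "square_mod N"
  shows "is_hom (P \<otimes>\<^sub>H M) (P \<otimes>\<^sub>H N) (kron (1\<^sub>m (hdim P)) f)"
  using homD[OF f] square_mod_dim[OF sq(1)] square_mod_dim[OF sq(2)] square_mod_dim[OF sq(3)]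
  by (simp add: is_hom_def kron_mult mult_add_dim add_mult_dim)

lemma htensor_square: "square_mod M \<Longrightarrow> square_mod N \<Longrightarrow> square_mod (M \<otimes>\<^sub>H N)"
  unfolding square_mod_def htensor_sel by auto

lemma tensor_iso:
  assumes "M \<cong>\<^sub>H N" "square_mod P" "square_mod M" "square_mod N"
  shows "P \<otimes>\<^sub>H M \<cong>\<^sub>H P \<otimes>\<^sub>H N"
proof -
  obtain f g where f: "is_hom M N f" "is_hom N M g" "g * f = 1\<^sub>m (hdim M)" "f * g = 1\<^sub>m (hdim N)"
    using assms(1) unfolding hmod_iso_def by blast
  have "kron (1\<^sub>m (hdim P)) g * kron (1\<^sub>m (hdim P)) f = 1\<^sub>m (hdim (P \<otimes>\<^sub>H M))"
    "kron (1\<^sub>m (hdim P)) f * kron (1\<^sub>m (hdim P)) g = 1\<^sub>m (hdim (P \<otimes>\<^sub>H N))"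
    using f hom_dim[OF f(1)] hom_dim[OF f(2)] by (simp_all add: kron_mult)
  then show ?thesis unfolding hmod_iso_def
    using tensor_hom[OF f(1) assms(2-4)] tensor_hom[OF f(2) assms(2,4,3)] by blast
qed

lemma projectiveD:
  assumes "is_projective n q P" "is_hmod n q X" "is_hmod n q Y" "is_hom P Y f" "is_hom X Y g"
    "g' \<in> carrier_mat (hdim X) (hdim Y)" "g * g' = 1\<^sub>m (hdim Y)"
  obtains h where "is_hom P X h" "g * h = f"
proof -
  have "is_epi X Y g" unfolding epi_right_inverse using assms(5-7) by blast
  then show ?thesis using assms(1-4) that unfolding is_projective_def by blast
qed

text \<open>The adjunction between tensoring on the right with \<open>M\<close> and with its dual.
  For each generator the equation for \<open>f\<close> is transported by currying and then solved by
  inverting the action of \<open>b\<close> or \<open>c\<close> on \<open>M\<close>; this inversion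
  produces the antipode.\<close>

lemma curry_hom_iff:
  assumes q: "primitive_root n q" and P: "square_mod P" and M: "is_hmod n q M" and Y: "square_mod Y"
    and f: "f \<in> carrier_mat (hdim Y) (hdim P * hdim M)"
  shows "is_hom (P \<otimes>\<^sub>H M) Y f \<longleftrightarrow> is_hom P (Y \<otimes>\<^sub>H hdual n M) (curry_mat (hdim Y) (hdim P) (hdim M) f)"
proof -
  define p m y where d: "p = hdim P" "m = hdim M" "y = hdim Y"
  define B C where BC: "B = opb M ^\<^sub>m (n - 1)" "C = opc M ^\<^sub>m (n - 1)"
  let ?g = "curry_mat y p m f"
  note cM = hmod_carrier[OF M, folded d] and cP = square_modD[OF P, folded d] and cY = square_modD[OF Y, folded d]
  note [simp] = hmod_dim[OF M, folded d] square_mod_dim[OF P, folded d] square_mod_dim[OF Y, folded d]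
  have c: "B \<in> carrier_mat m m" "C \<in> carrier_mat m m" using cM by (simp_all add: BC)
  then have [simp]: "dim_row B = m" "dim_row C = m" "dim_col B = m" "dim_col C = m" by auto
  have f': "f \<in> carrier_mat y (p * m)" using f by (simp add: d)
  then have [simp]: "dim_row f = y" "dim_col f = p * m" by auto
  have inv: "opb M * B = 1\<^sub>m m" "B * opb M = 1\<^sub>m m" "opc M * C = 1\<^sub>m m" "C * opc M = 1\<^sub>m m"
    using hmod_inverses[OF q M] by (simp_all add: BC d)
  have right: "curry_mat y p m (f * kron X Z) = kron (1\<^sub>m y) Z\<^sup>T * ?g * X"
    if "X \<in> carrier_mat p p" "Z \<in> carrier_mat m m" for X Z
    using curry_mult_kron[OF one_carrier_mat f' that] by simp
  have left: "curry_mat y p m (X * f) = kron X (1\<^sub>m m) * ?g" if "X \<in> carrier_mat y y" for X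
    using curry_mult_kron[OF that f' one_carrier_mat one_carrier_mat] that by simp
  have inj: "F = G \<longleftrightarrow> curry_mat y p m F = curry_mat y p m G"
    if "F \<in> carrier_mat y (p * m)" "G \<in> carrier_mat y (p * m)" for F G :: "'a mat"
    using arg_cong[of "curry_mat y p m F" "curry_mat y p m G" "uncurry_mat y p m"]
    unfolding uncurry_curry[OF that(1)] uncurry_curry[OF that(2)] by blast
  text \<open>Multiplying an equation from the left by the invertible matrix $1 \otimes Z^T$.\<close>
  have cancel: "kron (1\<^sub>m y) Z\<^sup>T * ?g * X = W \<longleftrightarrow> ?g * X = kron (1\<^sub>m y) Z'\<^sup>T * W"
    if Z: "Z \<in> carrier_mat m m" "Z' \<in> carrier_mat m m" "Z * Z' = 1\<^sub>m m" "Z' * Z = 1\<^sub>m m"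
      and X: "X \<in> carrier_mat p p" and W: "W \<in> carrier_mat (y * m) p" for X Z Z' W
  proof -
    have 1: "kron (1\<^sub>m y) Z\<^sup>T * kron (1\<^sub>m y) Z'\<^sup>T = 1\<^sub>m (y * m)" "kron (1\<^sub>m y) Z'\<^sup>T * kron (1\<^sub>m y) Z\<^sup>T = 1\<^sub>m (y * m)"
      using Z by (simp_all add: kron_mult transpose_mult_dim[symmetric])
    have dims: "dim_row Z = m" "dim_col Z = m" "dim_row Z' = m" "dim_col Z' = m" using Z by auto
    show ?thesis
    proof
      assume eq: "kron (1\<^sub>m y) Z\<^sup>T * ?g * X = W"
      have "kron (1\<^sub>m y) Z'\<^sup>T * W = (kron (1\<^sub>m y) Z'\<^sup>T * kron (1\<^sub>m y) Z\<^sup>T) * (?g * X)"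
        unfolding eq[symmetric] using dims X by (simp add: mult_assoc_dim)
      then show "?g * X = kron (1\<^sub>m y) Z'\<^sup>T * W" unfolding 1 using X by simp
    next
      assume eq: "?g * X = kron (1\<^sub>m y) Z'\<^sup>T * W"
      have "kron (1\<^sub>m y) Z\<^sup>T * (?g * X) = (kron (1\<^sub>m y) Z\<^sup>T * kron (1\<^sub>m y) Z'\<^sup>T) * W"
        unfolding eq using dims X W by (simp add: mult_assoc_dim)
      then show "kron (1\<^sub>m y) Z\<^sup>T * ?g * X = W" unfolding 1 using X W dims by (simp add: mult_assoc_dim)
    qed
  qed
  have diag: "f * kron X Z = X' * f \<longleftrightarrow> ?g * X = kron X' Z'\<^sup>T * ?g"
    if "X \<in> carrier_mat p p" "X' \<in> carrier_mat y y" "Z \<in> carrier_mat m m" "Z' \<in> carrier_mat m m" 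
      "Z * Z' = 1\<^sub>m m" "Z' * Z = 1\<^sub>m m" for X X' Z Z'
  proof -
    have "kron (1\<^sub>m y) Z'\<^sup>T * (kron X' (1\<^sub>m m) * ?g) = (kron (1\<^sub>m y) Z'\<^sup>T * kron X' (1\<^sub>m m)) * ?g"
      using that(2,4) by (auto simp: mult_assoc_dim)
    also have "\<dots> = kron X' Z'\<^sup>T * ?g" using that(2,4) by (auto simp: kron_mult)
    finally have e: "kron (1\<^sub>m y) Z'\<^sup>T * (kron X' (1\<^sub>m m) * ?g) = kron X' Z'\<^sup>T * ?g" .
    have "f * kron X Z = X' * f \<longleftrightarrow> kron (1\<^sub>m y) Z\<^sup>T * ?g * X = kron X' (1\<^sub>m m) * ?g"
      using that by (subst inj) (auto simp: right left)
    also have "\<dots> \<longleftrightarrow> ?g * X = kron X' Z'\<^sup>T * ?g"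
      using that by (subst cancel[of Z Z']) (auto simp: e)
    finally show ?thesis .
  qed
  \<comment> \<open>The shape of the equations for \<open>a\<close> and \<open>d\<close>: the source
    acts by \<open>X \<otimes> Z + 1 \<otimes> U\<close>, with \<open>Z\<close> the action of
    \<open>b\<close> or \<open>c\<close> on \<open>M\<close>. Cancelling \<open>Z\<close> turns
    \<open>U\<close> into \<open>- U * Z'\<close>, the action of the antipode of the generator
    before transposing.\<close>
  have skew: "f * (kron X Z + kron (1\<^sub>m p) U) = X' * f \<longleftrightarrow>
      ?g * X = (kron X' Z'\<^sup>T + kron (1\<^sub>m y) (- (U * Z')\<^sup>T)) * ?g"
    if X: "X \<in> carrier_mat p p" "X' \<in> carrier_mat y y" and Z: "Z \<in> carrier_mat m m" "Z' \<in> carrier_mat m m" 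
      "Z * Z' = 1\<^sub>m m" "Z' * Z = 1\<^sub>m m" and U: "U \<in> carrier_mat m m" for X X' Z Z' U
  proof -
    have [simp]: "dim_row X' = y" "dim_col X' = y" "dim_row Z = m" "dim_col Z = m" "dim_row Z' = m" "dim_col Z' = m"
      "dim_row U = m" "dim_col U = m" "dim_row X = p" "dim_col X = p" using X Z U by auto
    have "f * (kron X Z + kron (1\<^sub>m p) U) = X' * f \<longleftrightarrow>
       kron (1\<^sub>m y) Z\<^sup>T * ?g * X + kron (1\<^sub>m y) U\<^sup>T * ?g = kron X' (1\<^sub>m m) * ?g"
    proof -
      have "curry_mat y p m (f * (kron X Z + kron (1\<^sub>m p) U)) = kron (1\<^sub>m y) Z\<^sup>T * ?g * X + kron (1\<^sub>m y) U\<^sup>T * ?g"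
        using X Z U f' by (simp add: mult_add_dim curry_add right)
      then show ?thesis using X Z U f' by (subst inj) (auto simp: left)
    qed
    also have "\<dots> \<longleftrightarrow> kron (1\<^sub>m y) Z\<^sup>T * ?g * X = kron X' (1\<^sub>m m) * ?g - kron (1\<^sub>m y) U\<^sup>T * ?g"
      by (rule add_eq_iff_eq_minus[of _ "y * m" p]) (use X Z U in \<open>auto intro!: carrier_matI\<close>)
    also have "\<dots> \<longleftrightarrow> ?g * X = kron (1\<^sub>m y) Z'\<^sup>T * (kron X' (1\<^sub>m m) * ?g - kron (1\<^sub>m y) U\<^sup>T * ?g)"
      by (rule cancel[OF Z X(1)]) (rule carrier_matI; simp)
    also have "kron (1\<^sub>m y) Z'\<^sup>T * (kron X' (1\<^sub>m m) * ?g - kron (1\<^sub>m y) U\<^sup>T * ?g)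
       = (kron (1\<^sub>m y) Z'\<^sup>T * kron X' (1\<^sub>m m) - kron (1\<^sub>m y) Z'\<^sup>T * kron (1\<^sub>m y) U\<^sup>T) * ?g"
      by (simp add: mult_assoc_dim minus_mult_dim mult_minus_dim)
    also have "\<dots> = (kron X' Z'\<^sup>T - kron (1\<^sub>m y) (U * Z')\<^sup>T) * ?g"
      by (simp add: kron_mult transpose_mult_dim)
    also have "kron X' Z'\<^sup>T - kron (1\<^sub>m y) (U * Z')\<^sup>T = kron X' Z'\<^sup>T + kron (1\<^sub>m y) (- (U * Z')\<^sup>T)"
      unfolding kron_uminus_right by (rule eq_matI) (simp_all del: index_mult_mat(1))
    finally show ?thesis .
  qed
  note iffs = skew[OF cP(1) cY(1) cM(2) c(1) inv(1,2) cM(1)] diag[OF cP(2) cY(2) cM(2) c(1) inv(1,2)]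
    diag[OF cP(3) cY(3) cM(3) c(2) inv(3,4)] skew[OF cP(4) cY(4) cM(3) c(2) inv(3,4) cM(4)]
  have "?g \<in> carrier_mat (y * m) p" by (simp add: carrier_matI)
  then show ?thesis unfolding is_hom_def htensor_sel hdual_sel d[symmetric] BC[symmetric] iffs
    using f' by simp
qed

text \<open>By adjunction, lifting a map \<open>P \<otimes> M \<rightarrow> Y\<close> along
  \<open>g\<close> means lifting a map from \<open>P\<close> to \<open>Y\<close> tensored with the
  dual of \<open>M\<close> along \<open>g \<otimes> 1\<close>, which is surjective as well.\<close>

theorem projective_tensor:
  assumes q: "primitive_root n q" and P: "is_projective n q P" and M: "is_hmod n q M"
  shows "is_projective n q (P \<otimes>\<^sub>H M)"
  unfolding is_projective_def
proof (intro conjI allI impI)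
  have hP: "is_hmod n q P" using P by (simp add: is_projective_def)
  show "is_hmod n q (P \<otimes>\<^sub>H M)" by (rule htensor_hmod[OF q hP M])
  fix X Y g f
  assume *: "is_hmod n q X \<and> is_hmod n q Y \<and> is_epi X Y g \<and> is_hom (P \<otimes>\<^sub>H M) Y f"
  then have X: "is_hmod n q X" and Y: "is_hmod n q Y" and g: "is_hom X Y g" and f: "is_hom (P \<otimes>\<^sub>H M) Y f" 
    by (auto simp: is_epi_def)
  obtain g' where g': "g' \<in> carrier_mat (hdim X) (hdim Y)" "g * g' = 1\<^sub>m (hdim Y)" using * epi_right_inverse by blast
  note M' = hdual_hmod[OF q M]
  let ?m = "hdim M" and ?p = "hdim P" and ?x = "hdim X" and ?y = "hdim Y"
  have fc: "f \<in> carrier_mat ?y (?p * ?m)" using homD(1)[OF f] by simp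
  have gc: "g \<in> carrier_mat ?y ?x" by (rule homD(1)[OF g])
  have gh: "is_hom (X \<otimes>\<^sub>H hdual n M) (Y \<otimes>\<^sub>H hdual n M) (kron g (1\<^sub>m ?m))"
    using homD[OF g] hmod_dim[OF X] hmod_dim[OF Y] hmod_dim[OF M']
    by (simp add: is_hom_def kron_mult mult_add_dim add_mult_dim)
  have fh: "is_hom P (Y \<otimes>\<^sub>H hdual n M) (curry_mat ?y ?p ?m f)"
    using curry_hom_iff[OF q hmod_square[OF hP] M hmod_square[OF Y] fc] f by simp
  have "kron g' (1\<^sub>m ?m) \<in> carrier_mat (hdim (X \<otimes>\<^sub>H hdual n M)) (hdim (Y \<otimes>\<^sub>H hdual n M))" using g' by simp
  moreover have "kron g (1\<^sub>m ?m) * kron g' (1\<^sub>m ?m) = 1\<^sub>m (hdim (Y \<otimes>\<^sub>H hdual n M))" using g' gc by (simp add: kron_mult)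
  ultimately obtain h where h: "is_hom P (X \<otimes>\<^sub>H hdual n M) h" "kron g (1\<^sub>m ?m) * h = curry_mat ?y ?p ?m f"
    by (rule projectiveD[OF P htensor_hmod[OF q X M'] htensor_hmod[OF q Y M'] fh gh])
  have hc: "h \<in> carrier_mat (?x * ?m) ?p" using homD(1)[OF h(1)] by simp
  define k where "k = uncurry_mat ?x ?p ?m h"
  have kc: "k \<in> carrier_mat ?x (?p * ?m)" by (simp add: k_def carrier_matI)
  have ck: "curry_mat ?x ?p ?m k = h" unfolding k_def by (rule curry_uncurry[OF hc])
  have "is_hom (P \<otimes>\<^sub>H M) X k"
    using curry_hom_iff[OF q hmod_square[OF hP] M hmod_square[OF X] kc] h(1) unfolding ck by simp
  moreover have "g * k = f"
  proof -
    have "curry_mat ?y ?p ?m (g * k) = curry_mat ?y ?p ?m f"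
      using curry_mult_kron[OF gc kc one_carrier_mat one_carrier_mat] h(2) hc gc kc unfolding ck by simp
    then have "uncurry_mat ?y ?p ?m (curry_mat ?y ?p ?m (g * k)) = uncurry_mat ?y ?p ?m (curry_mat ?y ?p ?m f)" by simp
    then show ?thesis using uncurry_curry[OF fc] uncurry_curry[of "g * k" ?y ?p ?m] gc kc by simp
  qed
  ultimately show "\<exists>h. is_hom (P \<otimes>\<^sub>H M) X h \<and> g * h = f" by blast
qed

text \<open>Inserting \<open>i1 * p1 + i2 * p2\<close> to the right of \<open>p1 * s\<close> and
  using that the images of \<open>i1\<close> and \<open>i2\<close> are stable shows that a linear
  projection complementary to an equivariant one is equivariant itself.\<close>

lemma biprod_hom_projection:
  assumes "is_hom X S i1" "is_hom Y S i2" "is_hom S Y p2" "p1 \<in> carrier_mat (hdim X) (hdim S)"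
    "p1 * i1 = 1\<^sub>m (hdim X)" "p1 * i2 = 0\<^sub>m (hdim X) (hdim Y)" "i1 * p1 + i2 * p2 = 1\<^sub>m (hdim S)"
    and sq: "square_mod X" "square_mod Y" "square_mod S"
  shows "is_hom S X p1"
proof -
  have *: "p1 * s = x * p1" if "i1 * x = s * i1" "i2 * y = s * i2" "p2 * s = y * p2"
    "x \<in> carrier_mat (hdim X) (hdim X)" "y \<in> carrier_mat (hdim Y) (hdim Y)" "s \<in> carrier_mat (hdim S) (hdim S)" for s x y
  proof -
    note c = that(4-6) homD(1)[OF assms(1)] homD(1)[OF assms(2)] homD(1)[OF assms(3)] assms(4)
    have "p1 * s = p1 * s * (i1 * p1 + i2 * p2)" unfolding assms(7) using c by simp
    also have "\<dots> = p1 * (s * i1) * p1 + p1 * (s * i2) * p2" using c by (simp add: mat_alg)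
    also have "\<dots> = (p1 * i1) * x * p1 + (p1 * i2) * y * p2"
      unfolding that(1,2)[symmetric] using c by (simp add: mat_alg)
    also have "\<dots> = x * p1" unfolding assms(5,6) using c by simp
    finally show ?thesis .
  qed
  note h = homD[OF assms(1)] homD[OF assms(2)] homD[OF assms(3)]
  show ?thesis unfolding is_hom_def
    using assms(4) *[OF h(2,7,12)] *[OF h(3,8,13)] *[OF h(4,9,14)] *[OF h(5,10,15)]
      square_modD[OF sq(1)] square_modD[OF sq(2)] square_modD[OF sq(3)] by simp
qed

text \<open>The sequence splits after tensoring because $P \otimes N$ is again projective.\<close>

theorem tensor_short_exact:
  assumes q: "primitive_root n q" and P: "is_projective n q P" and ex: "is_short_exact n q L f M g N"
  obtains i1 i2 p1 p2 where "biprod (P \<otimes>\<^sub>H M) (P \<otimes>\<^sub>H L) (P \<otimes>\<^sub>H N) i1 i2 p1 p2"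
proof -
  have hP: "is_hmod n q P" using P by (simp add: is_projective_def)
  have hL: "is_hmod n q L" and hM: "is_hmod n q M" and hN: "is_hmod n q N" 
    and f: "is_hom L M f" and g: "is_hom M N g" using ex by (auto simp: is_short_exact_def is_mono_def is_epi_def)
  obtain f' g' where s: "f' \<in> carrier_mat (hdim L) (hdim M)" "g' \<in> carrier_mat (hdim M) (hdim N)"
    "f' * f = 1\<^sub>m (hdim L)" "g * g' = 1\<^sub>m (hdim N)" "g * f = 0\<^sub>m (hdim N) (hdim L)" 
    "f * f' + g' * g = 1\<^sub>m (hdim M)" by (rule short_exact_splitting[OF ex])
  have fc: "f \<in> carrier_mat (hdim M) (hdim L)" and gc: "g \<in> carrier_mat (hdim N) (hdim M)"
    using homD(1)[OF f] homD(1)[OF g] .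
  define p F F' G G' where d: "p = hdim P" "F = kron (1\<^sub>m p) f" "F' = kron (1\<^sub>m p) f'" "G = kron (1\<^sub>m p) g" "G' = kron (1\<^sub>m p) g'"
  let ?L = "P \<otimes>\<^sub>H L" and ?M = "P \<otimes>\<^sub>H M" and ?N = "P \<otimes>\<^sub>H N"
  have hL': "is_hmod n q ?L" and hM': "is_hmod n q ?M" and hN': "is_hmod n q ?N"
    using htensor_hmod[OF q hP] hL hM hN by blast+
  note sq = hmod_square[OF hL'] hmod_square[OF hM'] hmod_square[OF hN']
  have hF: "is_hom ?L ?M F" and hG: "is_hom ?M ?N G" unfolding d
    by (intro tensor_hom f g hmod_square[OF hP] hmod_square[OF hL] hmod_square[OF hM] hmod_square[OF hN])+
  have c: "F \<in> carrier_mat (hdim ?M) (hdim ?L)" "F' \<in> carrier_mat (hdim ?L) (hdim ?M)"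
    "G \<in> carrier_mat (hdim ?N) (hdim ?M)" "G' \<in> carrier_mat (hdim ?M) (hdim ?N)"
    unfolding d htensor_sel using fc gc s by (auto intro!: kron_carrier)
  have FF: "F' * F = 1\<^sub>m (hdim ?L)" "G * G' = 1\<^sub>m (hdim ?N)" "G * F = 0\<^sub>m (hdim ?N) (hdim ?L)"
    unfolding d htensor_sel using s fc gc by (simp_all add: kron_mult)
  have "F * F' + G' * G = kron (1\<^sub>m p) (f * f' + g' * g)"
    unfolding d using s(1,2) fc gc by (simp add: kron_mult kron_add_right)
  then have one: "F * F' + G' * G = 1\<^sub>m (hdim ?M)" unfolding s(6) by (simp add: d)
  have "is_projective n q ?N" by (rule projective_tensor[OF q P hN])
  then obtain t where t: "is_hom ?N ?M t" "G * t = 1\<^sub>m (hdim ?N)"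
    by (rule projectiveD[OF _ hM' hN' hom_id[OF sq(3)] hG c(4) FF(2)])
  have tc: "t \<in> carrier_mat (hdim ?M) (hdim ?N)" by (rule homD(1)[OF t(1)])
  \<comment> \<open>The linear retraction \<open>F'\<close> corrected so as to vanish on the
    equivariant section \<open>t\<close>; as the complementary projection it is then equivariant
    too.\<close>
  define p1 where "p1 = F' - F' * t * G"
  have p1c: "p1 \<in> carrier_mat (hdim ?L) (hdim ?M)" using c tc by (auto simp: p1_def)
  have "p1 * F = F' * F - F' * t * (G * F)" unfolding p1_def using c tc by (simp add: mat_alg)
  also have "\<dots> = 1\<^sub>m (hdim ?L)" unfolding FF using c tc by (auto intro!: eq_matI simp del: index_mult_mat(1) htensor_sel(1))
  finally have 1: "p1 * F = 1\<^sub>m (hdim ?L)" .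
  have "p1 * t = F' * t - F' * t * (G * t)" unfolding p1_def using c tc by (simp add: mat_alg)
  also have "\<dots> = 0\<^sub>m (hdim ?L) (hdim ?N)" unfolding t(2) using c tc by (auto intro!: eq_matI simp del: index_mult_mat(1))
  finally have 2: "p1 * t = 0\<^sub>m (hdim ?L) (hdim ?N)" .
  have FF': "F * F' = 1\<^sub>m (hdim ?M) - G' * G"
    unfolding one[symmetric] using c by (auto intro!: eq_matI simp del: index_mult_mat(1))
  have "F * p1 + t * G = F * F' - (F * F') * t * G + t * G" unfolding p1_def using c tc by (simp add: mat_alg)
  also have "(F * F') * t * G = t * G - G' * (G * t) * G" unfolding FF' using c tc by (simp add: mat_alg)
  also have "\<dots> = t * G - G' * G" unfolding t(2) using c by simp
  also have "F * F' - (t * G - G' * G) + t * G = F * F' + G' * G"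
    using c tc by (intro eq_matI) (simp_all del: index_mult_mat(1))
  finally have 3: "F * p1 + t * G = 1\<^sub>m (hdim ?M)" unfolding one .
  have "is_hom ?M ?L p1"
    by (rule biprod_hom_projection[OF hF t(1) hG p1c 1 2 3 sq(1,3,2)])
  then have "biprod ?M ?L ?N F t p1 G" unfolding biprod_def using hF t hG 1 2 3 FF(3) by simp
  then show ?thesis by (rule that)
qed

section \<open>Powers of the primitive root\<close>

lemma powi_mod:
  assumes q: "primitive_root n q"
  shows "q powi x = q ^ nat (x mod int n)"
proof -
  note p = primitive_rootD[OF q]
  have "q powi x = q powi (int n * (x div int n) + x mod int n)" by simp
  also have "\<dots> = (q powi int n) powi (x div int n) * q powi (x mod int n)"
    using p(3) by (subst power_int_add) (simp_all only: power_int_mult simp_thms)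
  also have "q powi int n = 1" using p(2) by simp
  also have "q powi (x mod int n) = q ^ nat (x mod int n)"
    using p(1) by (simp add: power_int_def)
  finally show ?thesis by simp
qed

text \<open>Turns equality of weights into a congruence modulo \<open>n\<close>, which is how
  integer parameters are compared from here on.\<close>

lemma powi_eq_iff:
  assumes q: "primitive_root n q"
  shows "q powi x = q powi y \<longleftrightarrow> x mod int n = y mod int n"
proof
  note p = primitive_rootD[OF q]
  assume eq: "q powi x = q powi y"
  have "q powi (x - y) = q powi x / q powi y" using p(3) by (simp add: power_int_diff)
  then have "q powi (x - y) = 1" using eq p(3) by simp
  then have "q ^ nat ((x - y) mod int n) = 1" by (simp add: powi_mod[OF q])
  then have "nat ((x - y) mod int n) = 0"
    using p(4)[of "nat ((x - y) mod int n)"] p(1) by (metis gr0I nat_less_iff of_nat_0_less_iff pos_mod_bound pos_mod_sign)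
  moreover have "0 \<le> (x - y) mod int n" using p(1) by simp
  ultimately have "(x - y) mod int n = 0" by linarith
  then show "x mod int n = y mod int n" by (simp add: mod_eq_dvd_iff mod_0_imp_dvd)
qed (simp add: powi_mod[OF q])

text \<open>If \<open>n\<close> were zero in the field, \<open>1 + x + ... + x^(n-1)\<close> would
  vanish at all \<open>n\<close> distinct powers of \<open>q\<close>, including 1, although its
  degree is at most \<open>n - 1\<close>.\<close>

lemma of_nat_root_order_nonzero:
  fixes q :: "'k::field"
  assumes q: "primitive_root n q" shows "(of_nat n :: 'k) \<noteq> 0"
proof
  note p = primitive_rootD[OF q]
  assume 0: "(of_nat n :: 'k) = 0"
  define f :: "'k poly" where "f = (\<Sum>i<n. monom 1 i)"
  have "coeff f 0 = 1" using p(1) by (simp add: f_def coeff_sum)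
  then have f0: "f \<noteq> 0" by auto
  have "degree f \<le> n - 1" unfolding f_def using p(1)
    by (intro degree_sum_le) (auto simp: degree_monom_eq)
  have ev: "poly f x = (\<Sum>i<n. x ^ i)" for x by (simp add: f_def poly_sum poly_monom)
  have "poly f (q ^ j) = 0" if "j < n" for j
  proof (cases "j = 0")
    case False
    then have "q ^ j \<noteq> 1" using p(4) that by simp
    moreover have "(q ^ j) ^ n = 1" using p(2) by (metis power_mult mult.commute power_one)
    ultimately show ?thesis unfolding ev using geometric_sum[of "q ^ j" n] by simp
  qed (simp add: ev 0)
  then have sub: "(\<lambda>j. q ^ j) ` {..<n} \<subseteq> {x. poly f x = 0}" by auto
  have "inj_on (\<lambda>j. q ^ j) {..<n}"
  proof (rule inj_onI)
    fix i j assume ij: "i \<in> {..<n}" "j \<in> {..<n}" "q ^ i = q ^ j"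
    then have "q powi int i = q powi int j" by simp
    then show "i = j" using ij unfolding powi_eq_iff[OF q] by simp
  qed
  then have "n = card ((\<lambda>j. q ^ j) ` {..<n})" by (simp add: card_image)
  also have "\<dots> \<le> card {x. poly f x = 0}" by (rule card_mono[OF poly_roots_finite[OF f0] sub])
  also have "\<dots> \<le> degree f" by (rule card_poly_roots_bound[OF f0])
  finally show False using \<open>degree f \<le> n - 1\<close> p(1) by simp
qed

section \<open>Spaces of weight functionals\<close>

text \<open>Functionals are row vectors; $a, b, c, d$ act on them from the right.\<close>

definition fsp :: "'k::field \<Rightarrow> 'k hmod \<Rightarrow> int \<Rightarrow> int \<Rightarrow> nat \<Rightarrow> nat \<Rightarrow> 'k mat set" where
  "fsp q X x y i j = {w \<in> carrier_mat 1 (hdim X). w * opb X = q powi x \<cdot>\<^sub>m w \<and> w * opc X = q powi y \<cdot>\<^sub>m w \<and>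
     w * opd X ^\<^sub>m i = 0\<^sub>m 1 (hdim X) \<and> w * opa X ^\<^sub>m j = 0\<^sub>m 1 (hdim X)}"

lemma fspD:
  assumes "w \<in> fsp q X x y i j"
  shows "w \<in> carrier_mat 1 (hdim X)" "w * opb X = q powi x \<cdot>\<^sub>m w" "w * opc X = q powi y \<cdot>\<^sub>m w"
    "w * opd X ^\<^sub>m i = 0\<^sub>m 1 (hdim X)" "w * opa X ^\<^sub>m j = 0\<^sub>m 1 (hdim X)"
  using assms by (simp_all add: fsp_def)

lemma fspI:
  assumes "w \<in> carrier_mat 1 (hdim X)" "w * opb X = q powi x \<cdot>\<^sub>m w" "w * opc X = q powi y \<cdot>\<^sub>m w"
    "w * opd X ^\<^sub>m i = 0\<^sub>m 1 (hdim X)" "w * opa X ^\<^sub>m j = 0\<^sub>m 1 (hdim X)"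
  shows "w \<in> fsp q X x y i j"
  using assms by (simp add: fsp_def)

lemma fsp_subspace:
  assumes X: "square_mod X" shows "row_subspace (hdim X) (fsp q X x y i j)"
proof (rule row_subspaceI)
  note [simp] = square_mod_dim[OF X] 
  note c = square_modD[OF X]
  show "w \<in> fsp q X x y i j \<Longrightarrow> w \<in> carrier_mat 1 (hdim X)" for w by (rule fspD(1))
  show "0\<^sub>m 1 (hdim X) \<in> fsp q X x y i j" using c by (intro fspI) auto
  fix v assume v: "v \<in> fsp q X x y i j"
  show "k \<cdot>\<^sub>m v \<in> fsp q X x y i j" for k
    using fspD[OF v] c by (intro fspI) (simp_all add: mat_alg mult.commute)
  fix w assume w: "w \<in> fsp q X x y i j"
  show "v + w \<in> fsp q X x y i j"
    using fspD[OF v] fspD[OF w] c by (intro fspI) (simp_all add: mat_alg smult_add_mat)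
qed

lemma fsp_cong:
  assumes "primitive_root n q" "x mod int n = x' mod int n" "y mod int n = y' mod int n"
  shows "fsp q X x y i j = fsp q X x' y' i j"
proof -
  have "q powi x = q powi x'" "q powi y = q powi y'" using assms(2,3) powi_eq_iff[OF assms(1)] by blast+
  then show ?thesis by (simp add: fsp_def)
qed

lemma fsp_hom:
  assumes f: "is_hom X Y f" and w: "w \<in> fsp q Y x y i j" and sq: "square_mod X" "square_mod Y"
  shows "w * f \<in> fsp q X x y i j"
proof (rule fspI)
  note h = homD[OF f] and s = square_modD[OF sq(1)] and s' = square_modD[OF sq(2)] and d = fspD[OF w]
  note [simp] = carrier_matD[OF h(1)] carrier_matD[OF d(1)] square_mod_dim[OF sq(1)] square_mod_dim[OF sq(2)]
  show "w * f \<in> carrier_mat 1 (hdim X)" using d(1) h(1) by simp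
  have *: "(w * f) * S = k \<cdot>\<^sub>m (w * f)" 
    if "f * S = S' * f" "w * S' = k \<cdot>\<^sub>m w" "S \<in> carrier_mat (hdim X) (hdim X)" "S' \<in> carrier_mat (hdim Y) (hdim Y)" for S S' k
  proof -
    have "(w * f) * S = (w * S') * f" using that(3,4) that(1) by (simp add: mult_assoc_dim)
    then show ?thesis unfolding that(2) by (simp add: mat_alg)
  qed
  show "w * f * opb X = q powi x \<cdot>\<^sub>m (w * f)" by (rule *[OF h(3) d(2) s(2) s'(2)])
  show "w * f * opc X = q powi y \<cdot>\<^sub>m (w * f)" by (rule *[OF h(4) d(3) s(3) s'(3)])
  have z: "w * f * S = 0\<^sub>m 1 (hdim X)"
    if "f * S = S' * f" "w * S' = 0\<^sub>m 1 (hdim Y)" "S \<in> carrier_mat (hdim X) (hdim X)" "S' \<in> carrier_mat (hdim Y) (hdim Y)" for S S'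
  proof -
    have "(w * f) * S = (w * S') * f" using that(3,4) that(1) by (simp add: mult_assoc_dim)
    then show ?thesis unfolding that(2) by simp
  qed
  show "w * f * opd X ^\<^sub>m i = 0\<^sub>m 1 (hdim X)"
    by (rule z[OF pow_mat_intertwine[OF s(4) s'(4) h(1,5)] d(4) pow_carrier_mat[OF s(4)] pow_carrier_mat[OF s'(4)]])
  show "w * f * opa X ^\<^sub>m j = 0\<^sub>m 1 (hdim X)"
    by (rule z[OF pow_mat_intertwine[OF s(1) s'(1) h(1,2)] d(5) pow_carrier_mat[OF s(1)] pow_carrier_mat[OF s'(1)]])
qed

text \<open>Restriction to \<open>Y\<close> is onto, and restriction to \<open>X\<close> maps its
  kernel bijectively to the functionals on \<open>X\<close>.\<close>

lemma rdim_fsp_biprod: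
  assumes b: "biprod S X Y i1 i2 p1 p2" and sq: "square_mod S" "square_mod X" "square_mod Y"
  shows "rdim (hdim S) (fsp q S x y i j) = rdim (hdim X) (fsp q X x y i j) + rdim (hdim Y) (fsp q Y x y i j)"
proof -
  let ?W = "fsp q S x y i j"
  note d = biprodD[OF b]
  note c = homD(1)[OF d(1)] homD(1)[OF d(2)] homD(1)[OF d(3)] homD(1)[OF d(4)]
  have c': "w \<in> carrier_mat 1 (hdim Z)" if "w \<in> fsp q Z x y i j" for w and Z :: "'a hmod" using that by (rule fspD(1))
  have im2: "{w * i2 | w. w \<in> ?W} = fsp q Y x y i j"
  proof (intro equalityI subsetI)
    fix v assume v: "v \<in> fsp q Y x y i j"
    have "v = (v * p2) * i2" using c'[OF v] c d(6) by (simp add: mult_assoc_dim)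
    moreover have "v * p2 \<in> ?W" by (rule fsp_hom[OF d(4) v sq(1,3)])
    ultimately show "v \<in> {w * i2 | w. w \<in> ?W}" by blast
  qed (use fsp_hom[OF d(2) _ sq(3,1)] in blast)
  let ?K = "{w \<in> ?W. w * i2 = 0\<^sub>m 1 (hdim Y)}"
  have im1: "{w * i1 | w. w \<in> ?K} = fsp q X x y i j"
  proof (intro equalityI subsetI)
    fix v assume v: "v \<in> fsp q X x y i j"
    have "v = (v * p1) * i1" "(v * p1) * i2 = 0\<^sub>m 1 (hdim Y)" using c'[OF v] c d(5,7) by (simp_all add: mult_assoc_dim)
    moreover have "v * p1 \<in> ?W" by (rule fsp_hom[OF d(3) v sq(1,2)])
    ultimately show "v \<in> {w * i1 | w. w \<in> ?K}" by blast
  qed (use fsp_hom[OF d(1) _ sq(2,1)] in blast)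
  have "rdim (hdim X) {w * i1 | w. w \<in> ?K} = rdim (hdim S) ?K"
  proof (rule rdim_bij[OF row_subspace_kernel[OF fsp_subspace[OF sq(1)] c(2)] c(1)])
    fix w assume w: "w \<in> ?K" "w * i1 = 0\<^sub>m 1 (hdim X)"
    then have wc: "w \<in> carrier_mat 1 (hdim S)" using c' by blast
    have "w = w * (i1 * p1 + i2 * p2)" unfolding d(9) using wc by simp
    also have "\<dots> = (w * i1) * p1 + (w * i2) * p2" using wc c by (simp add: mat_alg)
    also have "\<dots> = 0\<^sub>m 1 (hdim S)" using w c by simp
    finally show "w = 0\<^sub>m 1 (hdim S)" .
  qed
  then show ?thesis
    using rdim_rank_nullity[OF fsp_subspace[OF sq(1)] c(2), of q x y i j] unfolding im1 im2 by simp
qed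

lemma rdim_fsp_iso:
  assumes iso: "X \<cong>\<^sub>H Y" and sq: "square_mod X" "square_mod Y"
  shows "rdim (hdim X) (fsp q X x y i j) = rdim (hdim Y) (fsp q Y x y i j)"
proof -
  obtain f g where f: "is_hom X Y f" "is_hom Y X g" "g * f = 1\<^sub>m (hdim X)" "f * g = 1\<^sub>m (hdim Y)"
    using iso unfolding hmod_iso_def by blast
  note c = homD(1)[OF f(1)] homD(1)[OF f(2)]
  have im: "{w * f | w. w \<in> fsp q Y x y i j} = fsp q X x y i j"
  proof (intro equalityI subsetI)
    fix v assume v: "v \<in> fsp q X x y i j"
    have "v = (v * g) * f" using fspD(1)[OF v] c f(3) by (simp add: mult_assoc_dim)
    moreover have "v * g \<in> fsp q Y x y i j" by (rule fsp_hom[OF f(2) v sq(2,1)])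
    ultimately show "v \<in> {w * f | w. w \<in> fsp q Y x y i j}" by blast
  qed (use fsp_hom[OF f(1) _ sq] in blast)
  have "rdim (hdim X) {w * f | w. w \<in> fsp q Y x y i j} = rdim (hdim Y) (fsp q Y x y i j)"
  proof (rule rdim_bij[OF fsp_subspace[OF sq(2)] c(1)])
    fix w assume w: "w \<in> fsp q Y x y i j" "w * f = 0\<^sub>m 1 (hdim X)"
    have "w = (w * f) * g" using fspD(1)[OF w(1)] c f(4) by (simp add: mult_assoc_dim)
    then show "w = 0\<^sub>m 1 (hdim Y)" unfolding w(2) using c by simp
  qed
  then show ?thesis unfolding im .
qed

text \<open>Acting on functionals from the right, \<open>a\<close> lowers both weights and
  \<open>d\<close> raises them, opposite to the action on vectors:
  \<open>w a b = q^(-1) w b a\<close>.\<close>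

lemma functional_power_weights:
  assumes q: "q \<noteq> 0" and X: "is_hmod n q X" and w: "w \<in> carrier_mat 1 (hdim X)"
    and wB: "w * opb X = q powi x \<cdot>\<^sub>m w" and wC: "w * opc X = q powi y \<cdot>\<^sub>m w"
  shows "w * opa X ^\<^sub>m k * opb X = q powi (x - int k) \<cdot>\<^sub>m (w * opa X ^\<^sub>m k)"
    "w * opa X ^\<^sub>m k * opc X = q powi (y - int k) \<cdot>\<^sub>m (w * opa X ^\<^sub>m k)"
    "w * opd X ^\<^sub>m k * opb X = q powi (x + int k) \<cdot>\<^sub>m (w * opd X ^\<^sub>m k)"
    "w * opd X ^\<^sub>m k * opc X = q powi (y + int k) \<cdot>\<^sub>m (w * opd X ^\<^sub>m k)"
proof -
  note c = hmod_carrier[OF X] and rel = hmod_relations[OF X]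
  note [simp] = hmod_dim[OF X] carrier_matD[OF w]
  have *: "w * opa X ^\<^sub>m k * Z = q powi (z - int k) \<cdot>\<^sub>m (w * opa X ^\<^sub>m k)"
    if "w * Z = q powi z \<cdot>\<^sub>m w" "Z * opa X = q \<cdot>\<^sub>m (opa X * Z)" "Z \<in> carrier_mat (hdim X) (hdim X)" for Z z
  proof -
    have "opa X ^\<^sub>m k * Z = (inverse q) ^ k \<cdot>\<^sub>m (Z * opa X ^\<^sub>m k)"
      unfolding pow_mat_qcomm[OF c(1) that(3,2)] using q by (simp add: smult_smult_mat power_inverse)
    then have "w * opa X ^\<^sub>m k * Z = (inverse q) ^ k \<cdot>\<^sub>m (w * Z * opa X ^\<^sub>m k)"
      using c(1) that(3) by (simp add: mat_alg)
    also have "\<dots> = ((inverse q) ^ k * q powi z) \<cdot>\<^sub>m (w * opa X ^\<^sub>m k)" unfolding that(1) using c(1) by (simp add: mat_alg)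
    also have "(inverse q) ^ k * q powi z = q powi (z - int k)"
      using q by (simp add: power_int_diff power_inverse divide_simps)
    finally show ?thesis .
  qed
  show "w * opa X ^\<^sub>m k * opb X = q powi (x - int k) \<cdot>\<^sub>m (w * opa X ^\<^sub>m k)"
    "w * opa X ^\<^sub>m k * opc X = q powi (y - int k) \<cdot>\<^sub>m (w * opa X ^\<^sub>m k)"
    by (rule *[OF wB rel(1) c(2)], rule *[OF wC rel(3) c(3)])
  have *: "w * opd X ^\<^sub>m k * Z = q powi (z + int k) \<cdot>\<^sub>m (w * opd X ^\<^sub>m k)"
    if "w * Z = q powi z \<cdot>\<^sub>m w" "opd X * Z = q \<cdot>\<^sub>m (Z * opd X)" "Z \<in> carrier_mat (hdim X) (hdim X)" for Z z
  proof -
    have "w * opd X ^\<^sub>m k * Z = w * (opd X ^\<^sub>m k * Z)" using c(4) that(3) by (simp add: mat_alg)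
    also have "\<dots> = q ^ k \<cdot>\<^sub>m (w * Z * opd X ^\<^sub>m k)"
      unfolding pow_mat_qcomm'[OF that(3) c(4) that(2)] using c(4) that(3) by (simp add: mat_alg)
    also have "\<dots> = (q ^ k * q powi z) \<cdot>\<^sub>m (w * opd X ^\<^sub>m k)" unfolding that(1) using c(4) by (simp add: mat_alg)
    also have "q ^ k * q powi z = q powi (z + int k)" using q by (simp add: power_int_add)
    finally show ?thesis .
  qed
  show "w * opd X ^\<^sub>m k * opb X = q powi (x + int k) \<cdot>\<^sub>m (w * opd X ^\<^sub>m k)"
    "w * opd X ^\<^sub>m k * opc X = q powi (y + int k) \<cdot>\<^sub>m (w * opd X ^\<^sub>m k)"
    by (rule *[OF wB rel(2) c(2)], rule *[OF wC rel(4) c(3)])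
qed

section \<open>Chain modules\<close>

text \<open>Basis vectors are numbered from 0: $a v_i = x_i v_{i+1}$, $d v_i = y_i v_{i-1}$.  The modules
  $V(l,r)$ and $M_1(l,r,0)$ are instances with $x_i = 1$.\<close>

definition chain_mod :: "'k::field \<Rightarrow> nat \<Rightarrow> int \<Rightarrow> int \<Rightarrow> (nat \<Rightarrow> 'k) \<Rightarrow> (nat \<Rightarrow> 'k) \<Rightarrow> 'k hmod" where
  "chain_mod q m e f x y = HMod m
     (mat m m (\<lambda>(r, c). if r = Suc c then x c else 0))
     (mat m m (\<lambda>(r, c). if r = c then q powi (e + int c) else 0))
     (mat m m (\<lambda>(r, c). if r = c then q powi (f + int c) else 0))
     (mat m m (\<lambda>(r, c). if c = Suc r then y c else 0))"

lemma chain_mod_dim [simp]: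
  "hdim (chain_mod q m e f x y) = m"
  "dim_row (opa (chain_mod q m e f x y)) = m" "dim_col (opa (chain_mod q m e f x y)) = m"
  "dim_row (opb (chain_mod q m e f x y)) = m" "dim_col (opb (chain_mod q m e f x y)) = m"
  "dim_row (opc (chain_mod q m e f x y)) = m" "dim_col (opc (chain_mod q m e f x y)) = m"
  "dim_row (opd (chain_mod q m e f x y)) = m" "dim_col (opd (chain_mod q m e f x y)) = m"
  by (simp_all add: chain_mod_def)

lemma chain_mod_square [simp]: "square_mod (chain_mod q m e f x y)"
  by (auto simp: square_mod_def intro!: carrier_matI)

lemma chain_mod_col:
  assumes "c < m"
  shows "opa (chain_mod q m e f x y) * ucol m c = (if Suc c < m then x c \<cdot>\<^sub>m ucol m (Suc c) else 0\<^sub>m m 1)"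
    "opb (chain_mod q m e f x y) * ucol m c = q powi (e + int c) \<cdot>\<^sub>m ucol m c"
    "opc (chain_mod q m e f x y) * ucol m c = q powi (f + int c) \<cdot>\<^sub>m ucol m c"
    "opd (chain_mod q m e f x y) * ucol m c = (if c = 0 then 0\<^sub>m m 1 else y c \<cdot>\<^sub>m ucol m (c - 1))"
  using assms mult_ucol[of c "opa (chain_mod q m e f x y)"] mult_ucol[of c "opb (chain_mod q m e f x y)"]
    mult_ucol[of c "opc (chain_mod q m e f x y)"] mult_ucol[of c "opd (chain_mod q m e f x y)"]
  by (auto simp: chain_mod_def ucol_def intro!: eq_matI)

lemma chain_mod_row:
  assumes "r < m"
  shows "urow m r * opa (chain_mod q m e f x y) = (if r = 0 then 0\<^sub>m 1 m else x (r - 1) \<cdot>\<^sub>m urow m (r - 1))"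
    "urow m r * opb (chain_mod q m e f x y) = q powi (e + int r) \<cdot>\<^sub>m urow m r"
    "urow m r * opc (chain_mod q m e f x y) = q powi (f + int r) \<cdot>\<^sub>m urow m r"
    "urow m r * opd (chain_mod q m e f x y) = (if Suc r < m then y (Suc r) \<cdot>\<^sub>m urow m (Suc r) else 0\<^sub>m 1 m)"
proof -
  let ?C = "chain_mod q m e f x y"
  have *: "urow m r * Z = mat 1 m (\<lambda>(_, c). Z $$ (r, c))" if "Z \<in> carrier_mat m m" for Z :: "'a mat"
    using urow_mult[of r Z] assms that by simp
  note c = square_modD[OF chain_mod_square[of q m e f x y], unfolded chain_mod_dim]
  show "urow m r * opa ?C = (if r = 0 then 0\<^sub>m 1 m else x (r - 1) \<cdot>\<^sub>m urow m (r - 1))"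
    unfolding *[OF c(1)] using assms by (cases r; intro eq_matI; simp add: chain_mod_def urow_def)
  show "urow m r * opb ?C = q powi (e + int r) \<cdot>\<^sub>m urow m r" "urow m r * opc ?C = q powi (f + int r) \<cdot>\<^sub>m urow m r"
    unfolding *[OF c(2)] *[OF c(3)] using assms by (intro eq_matI; auto simp: chain_mod_def urow_def)+
  show "urow m r * opd ?C = (if Suc r < m then y (Suc r) \<cdot>\<^sub>m urow m (Suc r) else 0\<^sub>m 1 m)"
    unfolding *[OF c(4)] using assms by (cases "Suc r < m"; intro eq_matI; simp add: chain_mod_def urow_def)
qed

text \<open>\<open>\<delta> c\<close> is the scalar by which \<open>a d\<close> acts on
  \<open>v_c\<close>, and \<open>\<delta> (Suc c)\<close> the one for \<open>d a\<close>. The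
  recursion is the relation \<open>da - qad = 1 - bc\<close> on \<open>v_c\<close>, where
  \<open>b c\<close> acts by \<open>q^(s + 2c)\<close> with \<open>s = e + f\<close>; the end values
  say that the chain stops on both sides.\<close>

definition chain_rec :: "'k::field \<Rightarrow> nat \<Rightarrow> int \<Rightarrow> (nat \<Rightarrow> 'k) \<Rightarrow> bool" where
  "chain_rec q m s \<delta> \<longleftrightarrow> \<delta> 0 = 0 \<and> \<delta> m = 0 \<and> (\<forall>c<m. \<delta> (Suc c) = q * \<delta> c + (1 - q powi (s + 2 * int c)))"

text \<open>Only the products \<open>x c * y (Suc c)\<close> enter the relations, so the same
  \<delta> may be carried by \<open>d\<close>, as in \<open>V(l,r)\<close>, or by \<open>a\<close>,
  as in the proof of \<open>projective_d_divisible\<close>.\<close>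

lemma chain_mod_hmod:
  assumes q: "primitive_root n q" and m: "m \<le> n" and rec: "chain_rec q m (e + f) \<delta>"
    and xy: "\<And>c. Suc c < m \<Longrightarrow> x c * y (Suc c) = \<delta> (Suc c)"
  shows "is_hmod n q (chain_mod q m e f x y)"
proof -
  let ?M = "chain_mod q m e f x y"
  note p = primitive_rootD[OF q]
  note c = square_modD[OF chain_mod_square[of q m e f x y], unfolded chain_mod_dim]
  note col = chain_mod_col[of _ m q e f x y]
  have pi: "q powi (z + (1 + int k)) = q * q powi (z + int k)" for z k
    using p(3) by (simp add: power_int_add algebra_simps)
  have eq: "F = G" if "F \<in> carrier_mat m m" "G \<in> carrier_mat m m" 
    "\<And>k. k < m \<Longrightarrow> F * ucol m k = G * ucol m k" for F G :: "'a mat"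
    by (rule ucol_eqI) (use that in auto)
  have An: "opa ?M ^\<^sub>m k * ucol m i = 0\<^sub>m m 1" if "i < m" "m \<le> i + k" for i k
    using that
  proof (induction k arbitrary: i)
    case (Suc k)
    have "opa ?M ^\<^sub>m Suc k * ucol m i = opa ?M ^\<^sub>m k * (opa ?M * ucol m i)" using c by (simp add: mult_assoc_dim)
    then show ?case using Suc c by (simp add: col mult_smult_dim)
  qed simp
  have Dn: "opd ?M ^\<^sub>m k * ucol m i = 0\<^sub>m m 1" if "i < m" "i < k" for i k
    using that
  proof (induction k arbitrary: i)
    case (Suc k)
    have "opd ?M ^\<^sub>m Suc k * ucol m i = opd ?M ^\<^sub>m k * (opd ?M * ucol m i)" using c by (simp add: mult_assoc_dim)
    then show ?case using Suc c by (simp add: col mult_smult_dim)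
  qed simp
  have diag: "Z ^\<^sub>m k * ucol m i = (q powi (z + int i)) ^ k \<cdot>\<^sub>m ucol m i"
    if "Z \<in> carrier_mat m m" "Z * ucol m i = q powi (z + int i) \<cdot>\<^sub>m ucol m i" for Z z i k
    using that(1)
  proof (induction k)
    case (Suc k)
    have "Z ^\<^sub>m Suc k * ucol m i = Z ^\<^sub>m k * (Z * ucol m i)" using that(1) by (simp add: mult_assoc_dim)
    then show ?case using Suc that by (simp add: mat_alg)
  qed simp
  have qn: "(q powi z) ^ n = 1" for z
    using p(2,3) by (metis power_int_mult power_int_of_nat mult.commute power_int_1_left)
  show ?thesis
  proof (rule is_hmodI; (unfold chain_mod_dim)?)
    have rel: "opb ?M * opa ?M * ucol m k = q \<cdot>\<^sub>m (opa ?M * opb ?M) * ucol m k"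
      "opc ?M * opa ?M * ucol m k = q \<cdot>\<^sub>m (opa ?M * opc ?M) * ucol m k"
      "opd ?M * opb ?M * ucol m k = q \<cdot>\<^sub>m (opb ?M * opd ?M) * ucol m k"
      "opd ?M * opc ?M * ucol m k = q \<cdot>\<^sub>m (opc ?M * opd ?M) * ucol m k"
      "opc ?M * opb ?M * ucol m k = opb ?M * opc ?M * ucol m k" if k: "k < m" for k
    proof -
      show "opb ?M * opa ?M * ucol m k = q \<cdot>\<^sub>m (opa ?M * opb ?M) * ucol m k"
        "opc ?M * opa ?M * ucol m k = q \<cdot>\<^sub>m (opa ?M * opc ?M) * ucol m k"
        using k by (simp_all add: mat_alg col pi mult_ac)
      show "opd ?M * opb ?M * ucol m k = q \<cdot>\<^sub>m (opb ?M * opd ?M) * ucol m k"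
        "opd ?M * opc ?M * ucol m k = q \<cdot>\<^sub>m (opc ?M * opd ?M) * ucol m k"
        using k by (cases k; simp add: mat_alg col pi mult_ac)+
      show "opc ?M * opb ?M * ucol m k = opb ?M * opc ?M * ucol m k" using k by (simp add: mat_alg col mult_ac)
    qed
    show "opb ?M * opa ?M = q \<cdot>\<^sub>m (opa ?M * opb ?M)" by (rule eq[OF _ _ rel(1)]) (use c in auto)
    show "opd ?M * opb ?M = q \<cdot>\<^sub>m (opb ?M * opd ?M)" by (rule eq[OF _ _ rel(3)]) (use c in auto)
    show "opc ?M * opa ?M = q \<cdot>\<^sub>m (opa ?M * opc ?M)" by (rule eq[OF _ _ rel(2)]) (use c in auto)
    show "opd ?M * opc ?M = q \<cdot>\<^sub>m (opc ?M * opd ?M)" by (rule eq[OF _ _ rel(4)]) (use c in auto)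
    show "opc ?M * opb ?M = opb ?M * opc ?M" by (rule eq[OF _ _ rel(5)]) (use c in auto)
    show "opa ?M ^\<^sub>m n = 0\<^sub>m m m" by (rule eq) (use c m in \<open>simp_all add: An\<close>)
    show "opd ?M ^\<^sub>m n = 0\<^sub>m m m" by (rule eq) (use c m in \<open>simp_all add: Dn\<close>)
    show "opb ?M ^\<^sub>m n = 1\<^sub>m m" by (rule eq) (use c in \<open>simp_all add: col diag[OF c(2)] qn\<close>)
    show "opc ?M ^\<^sub>m n = 1\<^sub>m m" by (rule eq) (use c in \<open>simp_all add: col diag[OF c(3)] qn\<close>)
    show "opd ?M * opa ?M = q \<cdot>\<^sub>m (opa ?M * opd ?M) + (1\<^sub>m m - opb ?M * opc ?M)"
    proof (rule eq)
      fix k assume k: "k < m"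
      have da: "opd ?M * (opa ?M * ucol m k) = \<delta> (Suc k) \<cdot>\<^sub>m ucol m k"
      proof (cases "Suc k < m")
        case False
        then have "Suc k = m" using k by simp
        then show ?thesis using k rec by (auto simp: col chain_rec_def zero_smult_mat)
      qed (use k in \<open>simp add: col mat_alg xy\<close>)
      have ad: "opa ?M * (opd ?M * ucol m k) = \<delta> k \<cdot>\<^sub>m ucol m k"
      proof (cases k)
        case 0
        then show ?thesis using k rec by (auto simp: col chain_rec_def zero_smult_mat)
      qed (use k in \<open>simp add: col mat_alg xy mult.commute\<close>)
      have bc: "opb ?M * (opc ?M * ucol m k) = q powi (e + f + 2 * int k) \<cdot>\<^sub>m ucol m k"
        using k p(3) by (simp add: col mat_alg power_int_add[symmetric] algebra_simps)
      have "(q \<cdot>\<^sub>m (opa ?M * opd ?M) + (1\<^sub>m m - opb ?M * opc ?M)) * ucol m k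
        = q \<cdot>\<^sub>m (opa ?M * (opd ?M * ucol m k)) + (ucol m k - opb ?M * (opc ?M * ucol m k))"
        by (simp add: mat_alg)
      also have "\<dots> = (q * \<delta> k + (1 - q powi (e + f + 2 * int k))) \<cdot>\<^sub>m ucol m k"
        unfolding ad bc by (rule eq_matI) (auto simp: algebra_simps)
      also have "\<dots> = \<delta> (Suc k) \<cdot>\<^sub>m ucol m k" using rec k by (simp add: chain_rec_def)
      finally show "opd ?M * opa ?M * ucol m k = (q \<cdot>\<^sub>m (opa ?M * opd ?M) + (1\<^sub>m m - opb ?M * opc ?M)) * ucol m k"
        using da by (simp add: mult_assoc_dim)
    qed (auto intro!: carrier_matI)
  qed (use c in auto)
qed

text \<open>The solution of the recursion in \<open>chain_rec\<close> with initial value 0. For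
  \<open>s = 1 - l\<close> it is the given \<open>alpha q l\<close>; it vanishes at \<open>m\<close>
  if \<open>q^m = 1\<close> or \<open>q^(m+s-1) = 1\<close>, the two ways in which a chain can
  end.\<close>

definition chain_coeff :: "'k::field \<Rightarrow> int \<Rightarrow> nat \<Rightarrow> 'k" where
  "chain_coeff q s c = (1 - q ^ c) * (1 - q powi (int c + s - 1)) / (1 - q)"

lemma chain_rec_coeff:
  assumes "q \<noteq> 0" "q \<noteq> 1" and "q ^ m = 1 \<or> q powi (int m + s - 1) = 1"
  shows "chain_rec q m s (chain_coeff q s)"
  unfolding chain_rec_def
proof (intro conjI allI impI)
  show "chain_coeff q s 0 = 0" "chain_coeff q s m = 0" using assms by (auto simp: chain_coeff_def)
  fix c
  \<comment> \<open>In these terms the recursion is the polynomial identity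
    \<open>(1 - qz)(1 - qt) = q(1 - z)(1 - t) + (1 - q)(1 - qzt)\<close>.\<close>
  define z t where zt: "z = q ^ c" "t = q powi (int c + s - 1)"
  have 1: "q powi (int (Suc c) + s - 1) = q * t"
    using assms(1) by (simp add: zt power_int_add power_int_diff)
  have "q powi (s + 2 * int c) = q powi ((int c + s - 1) + (1 + int c))" by (simp add: algebra_simps)
  also have "\<dots> = t * (q * z)" using assms(1) unfolding zt by (subst power_int_add) (simp_all add: power_int_add)
  finally have 2: "q powi (s + 2 * int c) = t * (q * z)" .
  show "chain_coeff q s (Suc c) = q * chain_coeff q s c + (1 - q powi (s + 2 * int c))"
    using assms(2) unfolding chain_coeff_def 1 2 zt[symmetric] power_Suc by (simp add: field_simps)
qed

lemma alpha_chain_coeff: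
  assumes "q \<noteq> 1"
  shows "alpha q l c = chain_coeff q (1 - int l) c"
proof -
  have "qint q c = (q ^ c - 1) / (q - 1)" unfolding qint_def by (rule geometric_sum[OF assms])
  then have "qint q c = (1 - q ^ c) / (1 - q)" by (metis minus_diff_eq minus_divide_divide)
  then show ?thesis by (simp add: alpha_def chain_coeff_def algebra_simps)
qed

lemma root_ne_1: "primitive_root n q \<Longrightarrow> n > 1 \<Longrightarrow> q \<noteq> 1"
  using primitive_rootD(4)[of n q 1] by auto

lemma simple_mod_chain:
  assumes "q \<noteq> 1"
  shows "simple_mod q l r = chain_mod q l r (1 - r - int l) (\<lambda>_. 1) (chain_coeff q (1 - int l))"
  unfolding simple_mod_def chain_mod_def endo_def hmod.inject alpha_chain_coeff[OF assms]
  by (intro conjI refl; rule cong_mat; auto simp: algebra_simps)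

text \<open>The coefficients of \<open>d\<close> on the two blocks, given by separate formulas, are
  values of one solution with \<open>s = 1 + l\<close>. It vanishes at \<open>n - l\<close>, which
  accounts for the gap of \<open>d\<close> between the blocks.\<close>

lemma band1_zero_chain:
  assumes q: "primitive_root n q" and n: "n > 1" and l: "l < n"
  shows "band1 n q l r (Fin 0) = chain_mod q n (r + int l) (1 - r) (\<lambda>_. 1) (chain_coeff q (1 + int l))"
proof -
  note q1 = root_ne_1[OF q n] and p = primitive_rootD[OF q]
  have qn: "q powi (x + int n) = q powi x" for x using p(2,3) by (simp add: power_int_add)
  have 1: "chain_coeff q (1 - int (n - l)) c = chain_coeff q (1 + int l) c" if "c < n" for c
  proof -
    have "q powi (int c + (1 - int (n - l)) - 1) = q powi (int c + (1 + int l) - 1)"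
      using qn[of "int c + (1 - int (n - l)) - 1"] l by (simp add: of_nat_diff algebra_simps)
    then show ?thesis by (simp add: chain_coeff_def)
  qed
  have 2: "chain_coeff q (1 - int l) (c - (n - l)) = chain_coeff q (1 + int l) c" if "c < n" "n - l < c" for c
  proof -
    have a: "q ^ (c - (n - l)) = q powi (int c + (1 + int l) - 1)"
    proof -
      have "int (c - (n - l)) + int n = int c + (1 + int l) - 1" using that l by (simp add: of_nat_diff)
      then have "q powi int (c - (n - l)) = q powi (int c + (1 + int l) - 1)"
        using qn[of "int (c - (n - l))"] by metis
      then show ?thesis by simp
    qed
    have "int (c - (n - l)) + (1 - int l) - 1 + int n = int c" using that l by (simp add: of_nat_diff)
    then have "q powi (int (c - (n - l)) + (1 - int l) - 1) = q ^ c"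
      using qn[of "int (c - (n - l)) + (1 - int l) - 1"] by simp
    then show ?thesis unfolding chain_coeff_def a by (simp add: mult.commute)
  qed
  have 3: "chain_coeff q (1 + int l) (n - l) = 0"
  proof -
    have "q powi (int (n - l) + (1 + int l) - 1) = q powi (int n)" using l by (simp add: of_nat_diff)
    then show ?thesis using p(2) by (simp add: chain_coeff_def)
  qed
  show ?thesis
    unfolding band1_def chain_mod_def endo_def hmod.inject alpha_chain_coeff[OF q1]
  proof (intro conjI refl; rule cong_mat; (intro refl)?; unfold prod.case)
    fix i j assume ij: "i < n" "j < n"
    show "(case Fin 0 of Fin x \<Rightarrow> if Suc j < n \<and> Suc i = Suc j + 1 then 1 else 0
       | Infty \<Rightarrow> if Suc j \<notin> {n - l, n} \<and> Suc i = Suc j + 1 then 1 else 0) = (if i = Suc j then 1 else 0)"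
      using ij by auto
    show "(if Suc i = Suc j then q powi (r + int l + int (Suc j) - 1) else 0) = (if i = j then q powi (r + int l + int j) else 0)"
      by (simp add: add.assoc)
    show "(if Suc i = Suc j then q powi (int (Suc j) - r) else 0) = (if i = j then q powi (1 - r + int j) else 0)"
      by (simp add: algebra_simps)
    show "(if Suc j = 1 then if Suc i = n then case Fin 0 of Fin x \<Rightarrow> x * q ^ l | Infty \<Rightarrow> 1 else 0
        else if Suc j \<le> n - l then if Suc i = Suc j - 1 then chain_coeff q (1 - int (n - l)) (Suc j - 1) else 0
        else if Suc j = n - l + 1 then 0
        else if Suc i = Suc j - 1 then chain_coeff q (1 - int l) (Suc j - (n - l) - 1) else 0) =
       (if j = Suc i then chain_coeff q (1 + int l) j else 0)"
    proof (cases "j = Suc i")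
      case True
      consider "j < n - l" | "j = n - l" | "n - l < j" by linarith
      then show ?thesis
      proof cases
        case 3
        then have "Suc j - (n - l) - 1 = j - (n - l)" by simp
        then show ?thesis using True 3 2[OF ij(2) 3] by simp
      qed (use True 1[OF ij(2)] 3 in auto)
    qed auto
  qed
qed

lemma chain_rec_simple: "q \<noteq> 0 \<Longrightarrow> q \<noteq> 1 \<Longrightarrow> chain_rec q l (1 - int l) (chain_coeff q (1 - int l))"
  by (rule chain_rec_coeff) auto

lemma simple_mod_hmod:
  assumes q: "primitive_root n q" and n: "n > 1" and l: "l \<le> n"
  shows "is_hmod n q (simple_mod q l r)"
  unfolding simple_mod_chain[OF root_ne_1[OF q n]]
  using chain_rec_simple[OF primitive_rootD(3)[OF q] root_ne_1[OF q n]]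
  by (intro chain_mod_hmod[OF q l, where \<delta> = "chain_coeff q (1 - int l)"]) simp_all

lemma band1_zero_hmod:
  assumes q: "primitive_root n q" and n: "n > 1" and l: "l < n"
  shows "is_hmod n q (band1 n q l r (Fin 0))"
  unfolding band1_zero_chain[OF assms]
proof (rule chain_mod_hmod[OF q order.refl])
  have *: "r + int l + (1 - r) = 1 + int l" by simp
  show "chain_rec q n (r + int l + (1 - r)) (chain_coeff q (1 + int l))"
    unfolding * by (rule chain_rec_coeff[OF primitive_rootD(3)[OF q] root_ne_1[OF q n]])
      (use primitive_rootD(2)[OF q] in simp)
qed simp

text \<open>Neither \<open>q^c\<close> nor \<open>q^(c-l)\<close> is 1 for
  \<open>0 < c < l \<le> n\<close>; thus \<open>d\<close> connects all basis vectors of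
  \<open>V(l,r)\<close>.\<close>

lemma chain_coeff_simple_nonzero:
  assumes q: "primitive_root n q" and n: "n > 1" and c: "0 < c" "c < l" and l: "l \<le> n"
  shows "chain_coeff q (1 - int l) c \<noteq> 0"
proof -
  have "q ^ c \<noteq> 1" using primitive_rootD(4)[OF q] c l by simp
  moreover have "q powi (int c + (1 - int l) - 1) \<noteq> 1"
  proof
    assume "q powi (int c + (1 - int l) - 1) = 1"
    then have "q powi (int c - int l) = q powi 0" by simp
    then have "(int c - int l) mod int n = 0" unfolding powi_eq_iff[OF q] by simp
    then have "int n dvd int l - int c" by (metis dvd_minus_iff minus_diff_eq mod_0_imp_dvd)
    then have "int n \<le> int l - int c" using c by (intro zdvd_imp_le) auto
    then show False using c l by simp
  qed
  ultimately show ?thesis using root_ne_1[OF q n] by (simp add: chain_coeff_def)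
qed

lemma pow_mat_one [simp]: "A \<in> carrier_mat m m \<Longrightarrow> A ^\<^sub>m 1 = A" for A :: "'a::semiring_1 mat"
  by (simp add: One_nat_def)

section \<open>Homomorphisms into chain modules\<close>

text \<open>\<open>w\<close> has the weights of the last coordinate of the chain and is killed by
  \<open>d\<close> like that coordinate. Moving \<open>d\<close> through the powers of
  \<open>a\<close> with \<open>da = qad + 1 - bc\<close> reproduces the chain coefficients
  downwards, starting from \<open>\<delta> m = 0\<close>.\<close>

lemma functional_chain_action:
  assumes q: "primitive_root n q" and X: "is_hmod n q X" and w: "w \<in> carrier_mat 1 (hdim X)"
    and wB: "w * opb X = q powi (e + int m - 1) \<cdot>\<^sub>m w" and wC: "w * opc X = q powi (f + int m - 1) \<cdot>\<^sub>m w"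
    and wD: "w * opd X = 0\<^sub>m 1 (hdim X)" and rec: "chain_rec q m (e + f) \<delta>" and k: "k < m"
  shows "w * opa X ^\<^sub>m Suc k * opd X = \<delta> (m - Suc k) \<cdot>\<^sub>m (w * opa X ^\<^sub>m k)"
proof -
  note p = primitive_rootD[OF q]
  note c = hmod_carrier[OF X]
  note [simp] = hmod_dim[OF X] carrier_matD[OF w]
  note wt = functional_power_weights[OF p(3) X w wB wC]
  have step: "w * opa X ^\<^sub>m Suc k * opd X = \<delta> (m - Suc k) \<cdot>\<^sub>m (w * opa X ^\<^sub>m k)"
    if k: "k < m" and IH: "w * opa X ^\<^sub>m k * opd X * opa X = \<delta> (m - k) \<cdot>\<^sub>m (w * opa X ^\<^sub>m k)" for k
  proof -
    define v where "v = w * opa X ^\<^sub>m k"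
    have v: "v \<in> carrier_mat 1 (hdim X)" using w c by (simp add: v_def)
    then have [simp]: "dim_row v = 1" "dim_col v = hdim X" by auto
    define z where "z = q powi (e + f + 2 * int (m - Suc k))"
    have "v * opb X * opc X = (q powi (e + int m - 1 - int k) * q powi (f + int m - 1 - int k)) \<cdot>\<^sub>m v"
      using wt(1,2)[of k] unfolding v_def[symmetric] by (simp add: mat_alg)
    also have "q powi (e + int m - 1 - int k) * q powi (f + int m - 1 - int k) = z"
    proof -
      have "e + f + 2 * int (m - Suc k) = (e + int m - 1 - int k) + (f + int m - 1 - int k)"
        using k by (simp add: of_nat_diff)
      then show ?thesis unfolding z_def using p(3) by (metis power_int_add)
    qed
    finally have bc: "v * opb X * opc X = z \<cdot>\<^sub>m v" .
    have "\<delta> (m - k) \<cdot>\<^sub>m v = v * (opd X * opa X)"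
      using IH[folded v_def] by (simp add: mat_alg)
    also have "\<dots> = q \<cdot>\<^sub>m (v * opa X * opd X) + (v - v * opb X * opc X)"
      unfolding hmod_da[OF X] using v by (simp add: mat_alg)
    finally have eq: "\<delta> (m - k) \<cdot>\<^sub>m v = q \<cdot>\<^sub>m (v * opa X * opd X) + (v - z \<cdot>\<^sub>m v)" unfolding bc .
    have "m - k = Suc (m - Suc k)" using k by simp
    then have d: "\<delta> (m - k) = q * \<delta> (m - Suc k) + (1 - z)"
      using rec k unfolding chain_rec_def z_def by simp
    have "v * opa X * opd X = \<delta> (m - Suc k) \<cdot>\<^sub>m v"
    proof (rule eq_matI)
      fix i j assume ij: "i < dim_row (\<delta> (m - Suc k) \<cdot>\<^sub>m v)" "j < dim_col (\<delta> (m - Suc k) \<cdot>\<^sub>m v)"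
      have "(\<delta> (m - k) \<cdot>\<^sub>m v) $$ (i, j) = (q \<cdot>\<^sub>m (v * opa X * opd X) + (v - z \<cdot>\<^sub>m v)) $$ (i, j)" using eq by simp
      then have "\<delta> (m - k) * v $$ (i, j) = q * (v * opa X * opd X) $$ (i, j) + (v $$ (i, j) - z * v $$ (i, j))"
        using ij by (simp del: index_mult_mat(1))
      then have "q * (v * opa X * opd X) $$ (i, j) = q * (\<delta> (m - Suc k) * v $$ (i, j))"
        unfolding d by (auto simp: algebra_simps simp del: index_mult_mat(1))
      then have "(v * opa X * opd X) $$ (i, j) = \<delta> (m - Suc k) * v $$ (i, j)" using p(3) by (metis mult_left_cancel)
      then show "(v * opa X * opd X) $$ (i, j) = (\<delta> (m - Suc k) \<cdot>\<^sub>m v) $$ (i, j)"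
        using ij by (simp del: index_mult_mat(1))
    qed auto
    moreover have "w * opa X ^\<^sub>m Suc k = v * opa X" unfolding v_def using c by (simp add: mult_assoc_dim)
    ultimately show ?thesis by (simp only: v_def)
  qed
  have "w * opa X ^\<^sub>m k * opd X * opa X = \<delta> (m - k) \<cdot>\<^sub>m (w * opa X ^\<^sub>m k)" if "k < m" for k
    using that
  proof (induction k)
    case 0
    have "\<delta> m = 0" using rec by (simp add: chain_rec_def)
    then show ?case using c w wD by (simp add: zero_smult_mat)
  next
    case (Suc k)
    have "w * opa X ^\<^sub>m Suc k * opd X = \<delta> (m - Suc k) \<cdot>\<^sub>m (w * opa X ^\<^sub>m k)"
      using Suc by (intro step) auto
    then show ?case using c by (simp add: mat_alg)
  qed
  then show ?thesis using step[OF k] k by blast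
qed

text \<open>As \<open>a\<close> shifts the basis of the chain, the coordinates of a homomorphism
  come from the last one by powers of \<open>a\<close>. Compatibility with \<open>d\<close> is
  \<open>functional_chain_action\<close>; compatibility with \<open>a\<close> in the first
  coordinate is \<open>w a^m = 0\<close>.\<close>

lemma functional_hom:
  assumes q: "primitive_root n q" and X: "is_hmod n q X" and m: "m \<ge> 1" and rec: "chain_rec q m (e + f) \<delta>"
    and w: "w \<in> fsp q X (e + int m - 1) (f + int m - 1) 1 m"
  shows "is_hom X (chain_mod q m e f (\<lambda>_. 1) \<delta>) (rows_mat m (hdim X) (\<lambda>i. w * opa X ^\<^sub>m (m - 1 - i)))"
    (is "is_hom X ?V (rows_mat m (hdim X) ?F)")
proof -
  note p = primitive_rootD[OF q]
  note c = hmod_carrier[OF X]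
  note w = fspD[OF w]
  note [simp] = hmod_dim[OF X] carrier_matD[OF w(1)]
  have wD: "w * opd X = 0\<^sub>m 1 (hdim X)" using w(4) c by simp
  note wt = functional_power_weights[OF p(3) X w(1-3)]
  let ?f = "rows_mat m (hdim X) ?F"
  have F: "?F i \<in> carrier_mat 1 (hdim X)" for i using w(1) c by simp
  have ur: "urow m i * ?f = ?F i" if "i < m" for i using urow_rows_mat[of i m ?F, OF that F] .
  note row = chain_mod_row[of _ m q e f "\<lambda>_. 1" \<delta>]
  have R: "?f * Z = Z' * ?f" if "Z \<in> carrier_mat (hdim X) (hdim X)" "Z' \<in> carrier_mat m m"
    "\<And>i. i < m \<Longrightarrow> ?F i * Z = urow m i * Z' * ?f" for Z Z'
  proof (rule urow_eqI)
    fix i assume "i < dim_row (Z' * ?f)"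
    then have i: "i < m" using that by simp
    have "urow m i * (?f * Z) = ?F i * Z" using that(1) ur[OF i] by (simp add: mult_assoc_dim[symmetric])
    also have "\<dots> = urow m i * (Z' * ?f)" using that(2,3) i by (simp add: mult_assoc_dim)
    finally show "urow (dim_row (Z' * ?f)) i * (?f * Z) = urow (dim_row (Z' * ?f)) i * (Z' * ?f)" using that by simp
  qed (use that in auto)
  note sq = square_modD[OF chain_mod_square[of q m e f "\<lambda>_. 1" \<delta>], unfolded chain_mod_dim]
  show ?thesis unfolding is_hom_def chain_mod_dim
  proof (intro conjI)
    show "?f \<in> carrier_mat m (hdim X)" by simp
    show "?f * opa X = opa ?V * ?f"
    proof (rule R[OF c(1) sq(1)])
      fix i assume i: "i < m"
      show "?F i * opa X = urow m i * opa ?V * ?f"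
      proof (cases "i = 0")
        case True
        have "?F 0 * opa X = w * opa X ^\<^sub>m Suc (m - 1)" using c by (simp add: mult_assoc_dim)
        also have "\<dots> = 0\<^sub>m 1 (hdim X)" using w(5) m by simp
        finally show ?thesis using True i row(1)[OF i] by simp
      next
        case False
        have "?F i * opa X = w * opa X ^\<^sub>m Suc (m - 1 - i)" using c by (simp add: mult_assoc_dim)
        also have "Suc (m - 1 - i) = m - 1 - (i - 1)" using False i by simp
        also have "w * opa X ^\<^sub>m (m - 1 - (i - 1)) = urow m (i - 1) * ?f" using i by (subst ur) auto
        finally show ?thesis using False row(1)[OF i] by simp
      qed
    qed
    show "?f * opb X = opb ?V * ?f"
    proof (rule R[OF c(2) sq(2)])
      fix i assume i: "i < m"
      have "e + int m - 1 - int (m - 1 - i) = e + int i" using i by (simp add: of_nat_diff)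
      then show "?F i * opb X = urow m i * opb ?V * ?f"
        using wt(1)[of "m - 1 - i"] row(2)[OF i] ur[OF i] i by (simp add: smult_mult_dim)
    qed
    show "?f * opc X = opc ?V * ?f"
    proof (rule R[OF c(3) sq(3)])
      fix i assume i: "i < m"
      have "f + int m - 1 - int (m - 1 - i) = f + int i" using i by (simp add: of_nat_diff)
      then show "?F i * opc X = urow m i * opc ?V * ?f"
        using wt(2)[of "m - 1 - i"] row(3)[OF i] ur[OF i] i by (simp add: smult_mult_dim)
    qed
    show "?f * opd X = opd ?V * ?f"
    proof (rule R[OF c(4) sq(4)])
      fix i assume i: "i < m"
      show "?F i * opd X = urow m i * opd ?V * ?f"
      proof (cases "Suc i < m")
        case True
        define k where "k = m - 1 - Suc i"
        have k: "Suc k = m - 1 - i" "m - Suc k = Suc i" "k < m" using True by (auto simp: k_def)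
        have "w * opa X ^\<^sub>m (m - 1 - i) * opd X = \<delta> (Suc i) \<cdot>\<^sub>m (w * opa X ^\<^sub>m k)"
          using functional_chain_action[OF q X w(1-3) wD rec k(3)] unfolding k(2) unfolding k(1) .
        moreover have "urow m i * opd ?V * ?f = \<delta> (Suc i) \<cdot>\<^sub>m (urow m (Suc i) * ?f)"
          using row(4)[OF i] True by (simp add: smult_mult_dim)
        moreover have "urow m (Suc i) * ?f = w * opa X ^\<^sub>m k" unfolding k_def by (rule ur[OF True])
        ultimately show ?thesis by (simp only:)
      next
        case False
        then have "m - 1 - i = 0" using i by simp
        then show ?thesis using wD w(1) c row(4)[OF i] False by simp
      qed
    qed
  qed
qed

lemma urow_chain_pow:
  assumes "k < m"
  shows "urow m (m - 1) * opa (chain_mod q m e f (\<lambda>_. 1) y) ^\<^sub>m k = urow m (m - 1 - k)"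
  using assms
proof (induction k)
  case (Suc k)
  let ?A = "opa (chain_mod q m e f (\<lambda>_. 1) y)"
  have "urow m (m - 1) * ?A ^\<^sub>m Suc k = (urow m (m - 1) * ?A ^\<^sub>m k) * ?A"
    using Suc.prems square_modD(1)[OF chain_mod_square[of q m e f "\<lambda>_. 1" y]] by (simp add: mult_assoc_dim)
  also have "\<dots> = urow m (m - 1 - k) * ?A" using Suc by simp
  also have "\<dots> = urow m (m - 1 - k - 1)" using Suc.prems by (simp add: chain_mod_row)
  also have "m - 1 - k - 1 = m - 1 - Suc k" by simp
  finally show ?case .
qed (use square_modD(1)[OF chain_mod_square[of q m e f "\<lambda>_. 1" y]] in simp)

lemma urow_last_fsp:
  assumes m: "m \<ge> 1" and j: "m \<le> j"
  shows "urow m (m - 1) \<in> fsp q (chain_mod q m e f (\<lambda>_. 1) y) (e + int m - 1) (f + int m - 1) 1 j"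
proof (rule fspI; (unfold chain_mod_dim)?)
  let ?C = "chain_mod q m e f (\<lambda>_. 1) y"
  note sq = square_modD[OF chain_mod_square[of q m e f "\<lambda>_. 1" y], unfolded chain_mod_dim]
  have i: "m - 1 < m" using m by simp
  note row = chain_mod_row[OF i, of q e f "\<lambda>_. 1" y]
  have e: "int (m - 1) = int m - 1" using m by simp
  show "urow m (m - 1) * opb ?C = q powi (e + int m - 1) \<cdot>\<^sub>m urow m (m - 1)" 
    "urow m (m - 1) * opc ?C = q powi (f + int m - 1) \<cdot>\<^sub>m urow m (m - 1)"
    unfolding row e by (simp_all add: algebra_simps)
  show "urow m (m - 1) * opd ?C ^\<^sub>m 1 = 0\<^sub>m 1 m" using row(4) m by (simp add: One_nat_def)
  have "urow m (m - 1) * opa ?C ^\<^sub>m m = (urow m (m - 1) * opa ?C ^\<^sub>m (m - 1)) * opa ?C"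
    using m sq(1) pow_mat.simps(2)[of "opa ?C" "m - 1"] by (simp add: mult_assoc_dim)
  also have "\<dots> = 0\<^sub>m 1 m" using urow_chain_pow[OF i, of q e f y] chain_mod_row(1)[of 0 m q e f "\<lambda>_. 1" y] m by simp
  finally have "urow m (m - 1) * opa ?C ^\<^sub>m m = 0\<^sub>m 1 m" .
  moreover have "urow m (m - 1) * opa ?C ^\<^sub>m j = urow m (m - 1) * opa ?C ^\<^sub>m m * opa ?C ^\<^sub>m (j - m)"
    using j sq(1) pow_mat_add[OF sq(1), of m "j - m"] by (simp add: mult_assoc_dim)
  ultimately show "urow m (m - 1) * opa ?C ^\<^sub>m j = 0\<^sub>m 1 m" using sq(1) by simp
qed simp

lemma hom_rows:
  assumes h: "is_hom X (chain_mod q m e f (\<lambda>_. 1) y) h" and X: "square_mod X" and i: "i < m"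
  shows "urow m i * h = (urow m (m - 1) * h) * opa X ^\<^sub>m (m - 1 - i)"
proof -
  let ?C = "chain_mod q m e f (\<lambda>_. 1) y"
  note sq = square_modD[OF chain_mod_square[of q m e f "\<lambda>_. 1" y], unfolded chain_mod_dim]
  note hd = homD[OF h, unfolded chain_mod_dim]
  note c = square_modD[OF X]
  have "urow m i = urow m (m - 1) * opa ?C ^\<^sub>m (m - 1 - i)"
    using urow_chain_pow[of "m - 1 - i" m q e f y] i by simp
  then have "urow m i * h = urow m (m - 1) * (opa ?C ^\<^sub>m (m - 1 - i) * h)"
    using hd(1) sq(1) by (simp add: mult_assoc_dim)
  also have "opa ?C ^\<^sub>m (m - 1 - i) * h = h * opa X ^\<^sub>m (m - 1 - i)"
    by (rule pow_mat_intertwine[OF c(1) sq(1) hd(1,2), symmetric])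
  also have "urow m (m - 1) * (h * opa X ^\<^sub>m (m - 1 - i)) = (urow m (m - 1) * h) * opa X ^\<^sub>m (m - 1 - i)"
    using hd(1) c(1) by (simp add: mult_assoc_dim)
  finally show ?thesis .
qed

lemma hom_functional:
  assumes h: "is_hom X (chain_mod q m e f (\<lambda>_. 1) y) h" and X: "square_mod X" and m: "1 \<le> m" "m \<le> j"
  shows "urow m (m - 1) * h \<in> fsp q X (e + int m - 1) (f + int m - 1) 1 j"
  by (rule fsp_hom[OF h urow_last_fsp[OF m] X chain_mod_square])

text \<open>\<open>simple_fsp q X j u\<close> is $\mathrm{Hom}(X, V(j,u))$: a homomorphism is determined by its last coordinate.\<close>

definition simple_fsp :: "'k::field \<Rightarrow> 'k hmod \<Rightarrow> nat \<Rightarrow> int \<Rightarrow> 'k mat set" where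
  "simple_fsp q X j u = fsp q X (u + int j - 1) (- u) 1 j"

text \<open>Rebuilds a homomorphism into \<open>V(j,u)\<close> from its last coordinate
  \<open>w\<close>. The weights \<open>u + j - 1\<close> and \<open>- u\<close> in
  \<open>simple_fsp\<close> are those of the last basis vector.\<close>

definition simple_hom :: "'k::field hmod \<Rightarrow> nat \<Rightarrow> 'k mat \<Rightarrow> 'k mat" where
  "simple_hom X j w = rows_mat j (hdim X) (\<lambda>i. w * opa X ^\<^sub>m (j - 1 - i))"

lemma simple_hom:
  assumes q: "primitive_root n q" and n: "n > 1" and X: "is_hmod n q X" and j: "j \<ge> 1"
    and w: "w \<in> simple_fsp q X j u"
  shows "is_hom X (simple_mod q j u) (simple_hom X j w)" "urow j (j - 1) * simple_hom X j w = w"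
proof -
  note q1 = root_ne_1[OF q n]
  have "u + (1 - u - int j) = 1 - int j" by simp
  then have rec: "chain_rec q j (u + (1 - u - int j)) (chain_coeff q (1 - int j))"
    using chain_rec_simple[OF primitive_rootD(3)[OF q] q1] by metis
  have "1 - u - int j + int j - 1 = - u" by simp
  then have w': "w \<in> fsp q X (u + int j - 1) (1 - u - int j + int j - 1) 1 j" using w by (simp only: simple_fsp_def)
  show "is_hom X (simple_mod q j u) (simple_hom X j w)"
    unfolding simple_mod_chain[OF q1] simple_hom_def by (rule functional_hom[OF q X j rec w'])
  have "w \<in> carrier_mat 1 (hdim X)" using w fspD(1) unfolding simple_fsp_def by blast
  then show "urow j (j - 1) * simple_hom X j w = w"
    unfolding simple_hom_def using j hmod_carrier(1)[OF X] by (subst urow_rows_mat) auto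
qed

lemma simple_hom_functional:
  assumes q: "primitive_root n q" and n: "n > 1" and X: "is_hmod n q X" and j: "j \<ge> 1"
    and h: "is_hom X (simple_mod q j u) h"
  shows "urow j (j - 1) * h \<in> simple_fsp q X j u" "simple_hom X j (urow j (j - 1) * h) = h"
proof -
  note h' = h[unfolded simple_mod_chain[OF root_ne_1[OF q n]]]
  have "1 - u - int j + int j - 1 = - u" by simp
  then show "urow j (j - 1) * h \<in> simple_fsp q X j u"
    using hom_functional[OF h' hmod_square[OF X] j order.refl] by (simp only: simple_fsp_def)
  note hc = homD(1)[OF h', unfolded chain_mod_dim]
  show "simple_hom X j (urow j (j - 1) * h) = h"
  proof (rule urow_eqI)
    fix i assume "i < dim_row h"
    then have i: "i < j" using hc by simp
    have "urow j i * simple_hom X j (urow j (j - 1) * h) = (urow j (j - 1) * h) * opa X ^\<^sub>m (j - 1 - i)"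
      unfolding simple_hom_def using i hc hmod_carrier(1)[OF X] by (subst urow_rows_mat) auto
    then show "urow (dim_row h) i * simple_hom X j (urow j (j - 1) * h) = urow (dim_row h) i * h"
      using hom_rows[OF h' hmod_square[OF X] i] hc by simp
  qed (use hc in \<open>auto simp: simple_hom_def\<close>)
qed

lemma simple_fsp_cong:
  assumes "primitive_root n q" "u mod int n = u' mod int n"
  shows "simple_fsp q X j u = simple_fsp q X j u'"
  unfolding simple_fsp_def
proof (rule fsp_cong[OF assms(1)])
  show "(u + int j - 1) mod int n = (u' + int j - 1) mod int n" using assms(2) by (intro mod_diff_cong mod_add_cong refl)
  show "(- u) mod int n = (- u') mod int n" using assms(2) by (intro mod_minus_cong)
qed

lemma nonzero_power_killed:
  fixes w :: "'a::field mat"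
  assumes Z: "Z \<in> carrier_mat m m" and w: "w \<in> carrier_mat 1 m" "w \<noteq> 0\<^sub>m 1 m" and n: "w * Z ^\<^sub>m n = 0\<^sub>m 1 m"
  obtains k where "w * Z ^\<^sub>m k \<noteq> 0\<^sub>m 1 m" "w * Z ^\<^sub>m k * Z = 0\<^sub>m 1 m"
proof -
  define k where "k = (LEAST k. w * Z ^\<^sub>m k = 0\<^sub>m 1 m)"
  have k: "w * Z ^\<^sub>m k = 0\<^sub>m 1 m" unfolding k_def by (rule LeastI[of _ n]) (rule n)
  have "k \<noteq> 0"
  proof
    assume "k = 0"
    then show False using k w Z by simp
  qed
  then obtain j where j: "k = Suc j" by (cases k) auto
  have "w * Z ^\<^sub>m j \<noteq> 0\<^sub>m 1 m" using not_less_Least[of j "\<lambda>k. w * Z ^\<^sub>m k = 0\<^sub>m 1 m"] j by (simp add: k_def)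
  moreover have "w * Z ^\<^sub>m j * Z = 0\<^sub>m 1 m" using k j w Z by (simp add: mult_assoc_dim)
  ultimately show ?thesis by (rule that)
qed

text \<open>Since \<open>d\<close> is nilpotent, a nonzero functional vanishing on the image of
  \<open>F\<close> yields, after a suitable power of \<open>d\<close>, a nonzero one that is also
  killed by \<open>d\<close>. So surjectivity is tested on a small space of functionals.\<close>

lemma epi_by_killed_functionals:
  assumes F: "is_hom X S F" and S: "is_hmod n q S" and X: "square_mod X"
    and inj: "\<And>t. t \<in> carrier_mat 1 (hdim S) \<Longrightarrow> t * opd S = 0\<^sub>m 1 (hdim S) \<Longrightarrow> t * F = 0\<^sub>m 1 (hdim X) \<Longrightarrow> t = 0\<^sub>m 1 (hdim S)"
  obtains G where "G \<in> carrier_mat (hdim X) (hdim S)" "F * G = 1\<^sub>m (hdim S)"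
proof -
  note c = hmod_carrier[OF S] and h = homD[OF F] and cX = square_modD[OF X]
  have "u = 0\<^sub>m 1 (hdim S)" if u: "u \<in> carrier_mat 1 (hdim S)" "u * F = 0\<^sub>m 1 (hdim X)" for u
  proof (rule ccontr)
    assume "u \<noteq> 0\<^sub>m 1 (hdim S)"
    moreover have "u * opd S ^\<^sub>m n = 0\<^sub>m 1 (hdim S)" using hmod_powers(4)[OF S] u(1) by simp
    ultimately obtain k where k: "u * opd S ^\<^sub>m k \<noteq> 0\<^sub>m 1 (hdim S)" "u * opd S ^\<^sub>m k * opd S = 0\<^sub>m 1 (hdim S)"
      by (rule nonzero_power_killed[OF c(4) u(1)])
    have "u * opd S ^\<^sub>m k * F = u * (opd S ^\<^sub>m k * F)" using u(1) c h(1) by (simp add: mult_assoc_dim)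
    also have "opd S ^\<^sub>m k * F = F * opd X ^\<^sub>m k" by (rule pow_mat_intertwine[OF cX(4) c(4) h(1,5), symmetric])
    also have "u * (F * opd X ^\<^sub>m k) = (u * F) * opd X ^\<^sub>m k" using u(1) cX h(1) by (simp add: mult_assoc_dim)
    also have "\<dots> = 0\<^sub>m 1 (hdim X)" unfolding u(2) using cX by simp
    finally have "u * opd S ^\<^sub>m k = 0\<^sub>m 1 (hdim S)" using u(1) c by (intro inj[OF _ k(2)]) auto
    with k(1) show False by simp
  qed
  then show ?thesis by (rule right_invertible[OF h(1) _ that])
qed

text \<open>Evaluating \<open>t d = 0\<close> at the basis vector \<open>j + 1\<close> gives
  \<open>y (Suc j)\<close> times the \<open>j\<close>-th entry of \<open>t\<close>, so only the last
  entry can survive.\<close>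

lemma chain_killed_functional:
  assumes m: "m \<ge> 1" and y: "\<And>c. 0 < c \<Longrightarrow> c < m \<Longrightarrow> y c \<noteq> 0" and t: "t \<in> carrier_mat 1 m"
    and td: "t * opd (chain_mod q m e f x y) = 0\<^sub>m 1 m"
  shows "t = t $$ (0, m - 1) \<cdot>\<^sub>m urow m (m - 1)"
proof (rule eq_matI)
  fix i j assume "i < dim_row (t $$ (0, m - 1) \<cdot>\<^sub>m urow m (m - 1))" "j < dim_col (t $$ (0, m - 1) \<cdot>\<^sub>m urow m (m - 1))"
  then have i: "i = 0" and j: "j < m" by auto
  show "t $$ (i, j) = (t $$ (0, m - 1) \<cdot>\<^sub>m urow m (m - 1)) $$ (i, j)"
  proof (cases "Suc j < m")
    case True
    have "t * opd (chain_mod q m e f x y) * ucol m (Suc j) = t * (y (Suc j) \<cdot>\<^sub>m ucol m j)"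
      using t True by (simp add: mult_assoc_dim chain_mod_col)
    also have "\<dots> = y (Suc j) \<cdot>\<^sub>m mat 1 1 (\<lambda>_. t $$ (0, j))"
      using mult_ucol[of j t] t j by (auto simp: mult_smult_dim intro!: eq_matI)
    finally have "0\<^sub>m 1 1 = y (Suc j) \<cdot>\<^sub>m mat 1 1 (\<lambda>_. t $$ (0, j))" unfolding td using True by simp
    then have "(0\<^sub>m 1 1 :: 'a mat) $$ (0, 0) = (y (Suc j) \<cdot>\<^sub>m mat 1 1 (\<lambda>_. t $$ (0, j))) $$ (0, 0)" by (rule arg_cong)
    then have "t $$ (0, j) = 0" using y[OF _ True] by simp
    then show ?thesis using i j True by (simp add: urow_def)
  next
    case False
    then have "j = m - 1" using j by simp
    then show ?thesis using i m by (simp add: urow_def)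
  qed
qed (use t in auto)

lemma simple_killed_functional:
  assumes q: "primitive_root n q" and n: "n > 1" and j: "1 \<le> j" "j \<le> n" and t: "t \<in> carrier_mat 1 j"
    and td: "t * opd (simple_mod q j u) = 0\<^sub>m 1 j"
  shows "t = t $$ (0, j - 1) \<cdot>\<^sub>m urow j (j - 1)"
  by (rule chain_killed_functional[OF j(1) chain_coeff_simple_nonzero[OF q n _ _ j(2)] t
      td[unfolded simple_mod_chain[OF root_ne_1[OF q n]]]])

lemma simple_mod_sel [simp]: "hdim (simple_mod q j u) = j"
  by (simp add: simple_mod_def)

text \<open>This is the simplicity of \<open>V(j,u)\<close> in usable form: its functionals killed
  by \<open>d\<close> are multiples of the last coordinate, which pulls back to
  \<open>w \<noteq> 0\<close>.\<close>

lemma simple_hom_epi: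
  assumes q: "primitive_root n q" and n: "n > 1" and X: "is_hmod n q X" and j: "1 \<le> j" "j \<le> n"
    and w: "w \<in> simple_fsp q X j u" "w \<noteq> 0\<^sub>m 1 (hdim X)"
  obtains G where "G \<in> carrier_mat (hdim X) j" "simple_hom X j w * G = 1\<^sub>m j"
proof -
  note h = simple_hom[OF q n X j(1) w(1)]
  have V: "is_hmod n q (simple_mod q j u)" by (rule simple_mod_hmod[OF q n j(2)])
  have "t = 0\<^sub>m 1 j" if t: "t \<in> carrier_mat 1 j" "t * opd (simple_mod q j u) = 0\<^sub>m 1 j" "t * simple_hom X j w = 0\<^sub>m 1 (hdim X)" for t
  proof -
    define k where "k = t $$ (0, j - 1)"
    have tk: "t = k \<cdot>\<^sub>m urow j (j - 1)" unfolding k_def by (rule simple_killed_functional[OF q n j t(1,2)])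
    have "k \<cdot>\<^sub>m w = t * simple_hom X j w" unfolding tk using h(2) homD(1)[OF h(1)] by (simp add: smult_mult_dim)
    then have kw: "k \<cdot>\<^sub>m w = 0\<^sub>m 1 (hdim X)" using t(3) by simp
    have "k = 0"
    proof (rule ccontr)
      assume k0: "k \<noteq> 0"
      have "k \<cdot>\<^sub>m w = k \<cdot>\<^sub>m 0\<^sub>m 1 (hdim X)" using kw by simp
      then show False using w(2) smult_cancel_mat[OF k0] by blast
    qed
    then show ?thesis unfolding tk by (simp add: zero_smult_mat)
  qed
  then show ?thesis
    using epi_by_killed_functionals[OF h(1) V hmod_square[OF X], unfolded simple_mod_sel] that by blast
qed

section \<open>Weight projectors\<close>

text \<open>For \<open>B^n = 1\<close> this discrete Fourier sum is \<open>n\<close> times the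
  projection onto the eigenspace of \<open>B\<close> for \<open>q^x\<close>; the factor
  \<open>1/n\<close> is left out.\<close>

definition weight_proj :: "'k::field \<Rightarrow> nat \<Rightarrow> nat \<Rightarrow> int \<Rightarrow> 'k mat \<Rightarrow> 'k mat" where
  "weight_proj q n m x B = lincomb_mat m (n - 1) (\<lambda>s. q powi (- (x * int s))) (\<lambda>s. B ^\<^sub>m s)"

lemma weight_proj_carrier [simp]: "weight_proj q n m x B \<in> carrier_mat m m"
  by (simp add: weight_proj_def)

lemma dim_weight_proj [simp]: "dim_row (weight_proj q n m x B) = m" "dim_col (weight_proj q n m x B) = m"
  by (simp_all add: weight_proj_def)

lemma weight_proj_eigen:
  assumes q: "primitive_root n q" and B: "B \<in> carrier_mat m m" "B ^\<^sub>m n = 1\<^sub>m m"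
  shows "B * weight_proj q n m x B = q powi x \<cdot>\<^sub>m weight_proj q n m x B"
    "weight_proj q n m x B * B = q powi x \<cdot>\<^sub>m weight_proj q n m x B"
proof -
  note p = primitive_rootD[OF q]
  let ?c = "\<lambda>s. q powi (- (x * int s))"
  have W: "B ^\<^sub>m s \<in> carrier_mat m m" for s using B by simp
  have shift: "(\<Sum>s\<le>n - 1. ?c s * (B ^\<^sub>m Suc s) $$ (i, j)) = q powi x * (\<Sum>s\<le>n - 1. ?c s * (B ^\<^sub>m s) $$ (i, j))" for i j
  proof -
    let ?h = "\<lambda>s. ?c s * (B ^\<^sub>m s) $$ (i, j)"
    have step: "?c s = q powi x * ?c (Suc s)" for s
      using p(3) by (simp add: power_int_add[symmetric] algebra_simps)
    \<comment> \<open>Multiplication by \<open>B\<close> shifts the sum by one place; the terms at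
      \<open>s = 0\<close> and \<open>s = n\<close> agree since \<open>q^n = 1\<close> and
      \<open>B^n = 1\<close>.\<close>
    have "q powi (- (x * int n)) = 1"
      using powi_eq_iff[OF q, of "- (x * int n)" 0] by simp
    then have h0: "?h n = ?h 0" using B by simp
    have "(\<Sum>s\<le>n - 1. ?c s * (B ^\<^sub>m Suc s) $$ (i, j)) = q powi x * (\<Sum>s\<le>n - 1. ?h (Suc s))"
      unfolding sum_distrib_left by (intro sum.cong refl) (subst step, simp add: mult.assoc)
    also have "(\<Sum>s\<le>n - 1. ?h (Suc s)) = (\<Sum>s\<le>n. ?h s) - ?h 0"
      using p(1) sum.atMost_Suc_shift[of ?h "n - 1"] by simp
    also have "\<dots> = (\<Sum>s\<le>n - 1. ?h s)"
      using p(1) sum.atMost_Suc[of ?h "n - 1"] h0 by simp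
    finally show ?thesis .
  qed
  show "B * weight_proj q n m x B = q powi x \<cdot>\<^sub>m weight_proj q n m x B"
  proof (rule eq_matI)
    fix i j assume "i < dim_row (q powi x \<cdot>\<^sub>m weight_proj q n m x B)" "j < dim_col (q powi x \<cdot>\<^sub>m weight_proj q n m x B)"
    then have ij: "i < m" "j < m" by auto
    have "(B * weight_proj q n m x B) $$ (i, j) = (\<Sum>s\<le>n - 1. ?c s * (B * B ^\<^sub>m s) $$ (i, j))"
      unfolding weight_proj_def by (rule mult_lincomb_mat_index[OF B(1) W ij])
    also have "\<dots> = (\<Sum>s\<le>n - 1. ?c s * (B ^\<^sub>m Suc s) $$ (i, j))" by (simp only: pow_mat_mult_left[OF B(1)])
    also have "\<dots> = (q powi x \<cdot>\<^sub>m weight_proj q n m x B) $$ (i, j)"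
      unfolding shift using ij by (simp add: weight_proj_def lincomb_mat_def)
    finally show "(B * weight_proj q n m x B) $$ (i, j) = (q powi x \<cdot>\<^sub>m weight_proj q n m x B) $$ (i, j)" .
  qed (use B in auto)
  show "weight_proj q n m x B * B = q powi x \<cdot>\<^sub>m weight_proj q n m x B"
  proof (rule eq_matI)
    fix i j assume "i < dim_row (q powi x \<cdot>\<^sub>m weight_proj q n m x B)" "j < dim_col (q powi x \<cdot>\<^sub>m weight_proj q n m x B)"
    then have ij: "i < m" "j < m" by auto
    have "(weight_proj q n m x B * B) $$ (i, j) = (\<Sum>s\<le>n - 1. ?c s * (B ^\<^sub>m s * B) $$ (i, j))"
      unfolding weight_proj_def by (rule lincomb_mat_mult_index[OF B(1) W ij])
    also have "\<dots> = (\<Sum>s\<le>n - 1. ?c s * (B ^\<^sub>m Suc s) $$ (i, j))" by (simp only: pow_mat.simps)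
    also have "\<dots> = (q powi x \<cdot>\<^sub>m weight_proj q n m x B) $$ (i, j)"
      unfolding shift using ij by (simp add: weight_proj_def lincomb_mat_def)
    finally show "(weight_proj q n m x B * B) $$ (i, j) = (q powi x \<cdot>\<^sub>m weight_proj q n m x B) $$ (i, j)" .
  qed (use B in auto)
qed

lemma weight_proj_intertwine:
  fixes B B' f :: "'k::field mat"
  assumes B: "B \<in> carrier_mat m m" "B' \<in> carrier_mat p p" and f: "f \<in> carrier_mat p m" "f * B = B' * f"
  shows "f * weight_proj q n m x B = weight_proj q n p x B' * f"
proof (rule eq_matI)
  fix i j assume "i < dim_row (weight_proj q n p x B' * f)" "j < dim_col (weight_proj q n p x B' * f)"
  then have ij: "i < p" "j < m" using f by auto
  have W: "B ^\<^sub>m s \<in> carrier_mat m m" "B' ^\<^sub>m s \<in> carrier_mat p p" for s using B by simp_all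
  show "(f * weight_proj q n m x B) $$ (i, j) = (weight_proj q n p x B' * f) $$ (i, j)"
    unfolding weight_proj_def mult_lincomb_mat_index[OF f(1) W(1) ij] lincomb_mat_mult_index[OF f(1) W(2) ij]
      pow_mat_intertwine[OF B f] ..
qed (use f in auto)

lemma weight_proj_fixes:
  assumes q: "primitive_root n q" and B: "B \<in> carrier_mat m m" and v: "v \<in> carrier_mat m 1" "B * v = q powi x \<cdot>\<^sub>m v"
  shows "weight_proj q n m x B * v = of_nat n \<cdot>\<^sub>m v"
proof (rule eq_matI)
  note p = primitive_rootD[OF q]
  fix i j assume "i < dim_row (of_nat n \<cdot>\<^sub>m v)" "j < dim_col (of_nat n \<cdot>\<^sub>m v)"
  then have ij: "i < m" "j < 1" using v by auto
  have W: "B ^\<^sub>m s \<in> carrier_mat m m" for s using B by simp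
  have pw: "B ^\<^sub>m s * v = q powi (x * int s) \<cdot>\<^sub>m v" for s
  proof (induction s)
    case (Suc s)
    have "B ^\<^sub>m Suc s * v = B ^\<^sub>m s * (B * v)" using B v(1) by (simp add: mult_assoc_dim)
    also have "\<dots> = q powi x \<cdot>\<^sub>m (B ^\<^sub>m s * v)" unfolding v(2) using B v(1) by (simp add: mult_smult_dim)
    also have "\<dots> = q powi (x * int (Suc s)) \<cdot>\<^sub>m v"
      unfolding Suc using p(3) by (simp add: smult_smult_mat power_int_add[symmetric] algebra_simps)
    finally show ?case .
  qed (use B v in simp)
  have one: "q powi (- (x * int s)) * q powi (x * int s) = 1" for s
    using p(3) by (simp add: power_int_add[symmetric])
  have "(weight_proj q n m x B * v) $$ (i, j) = (\<Sum>s\<le>n - 1. q powi (- (x * int s)) * (B ^\<^sub>m s * v) $$ (i, j))"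
    unfolding weight_proj_def by (rule lincomb_mat_mult_index[OF v(1) W ij])
  also have "\<dots> = (\<Sum>s\<le>n - 1. v $$ (i, j))"
    unfolding pw using ij v(1) one by (intro sum.cong refl) (simp add: mult.assoc[symmetric])
  also have "\<dots> = of_nat n * v $$ (i, j)" using p(1) by simp
  finally show "(weight_proj q n m x B * v) $$ (i, j) = (of_nat n \<cdot>\<^sub>m v) $$ (i, j)" using ij v(1) by simp
qed (use v in auto)

text \<open>The projectors sum up to $n$ times the identity, and $n \neq 0$ in the field.\<close>

lemma weight_proj_nonzero:
  fixes w :: "'k::field mat"
  assumes q: "primitive_root n q" and B: "B \<in> carrier_mat m m" and w: "w \<in> carrier_mat 1 m" "w \<noteq> 0\<^sub>m 1 m"
  obtains x where "w * weight_proj q n m x B \<noteq> 0\<^sub>m 1 m"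
proof (rule ccontr)
  note p = primitive_rootD[OF q]
  assume "\<not> thesis"
  with that have z: "w * weight_proj q n m x B = 0\<^sub>m 1 m" for x by blast
  obtain j where j: "j < m" "w $$ (0, j) \<noteq> 0" using nonzero_row[OF w] by blast
  have W: "B ^\<^sub>m s \<in> carrier_mat m m" for s using B by simp
  let ?a = "\<lambda>s. (w * B ^\<^sub>m s) $$ (0, j)"
  have geo: "(\<Sum>x<n. q powi (- (int x * int s))) = (if s = 0 then of_nat n else 0)" if "s < n" for s
  proof (cases "s = 0")
    case False
    define r where "r = q powi (- int s)"
    have pw: "q powi (- (int x * int s)) = r ^ x" for x
      unfolding r_def using p(3) by (metis mult.commute mult_minus_left power_int_mult power_int_of_nat)
    have "r \<noteq> 1"
    proof
      assume "r = 1"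
      then have "q powi (- int s) = q powi 0" by (simp add: r_def)
      then have "int n dvd int s" unfolding powi_eq_iff[OF q] by (simp add: mod_eq_0_iff_dvd)
      then show False using that False by (auto dest: dvd_imp_le)
    qed
    moreover have "r ^ n = 1"
      using pw[of n, symmetric] powi_eq_iff[OF q, of "- (int n * int s)" 0] by simp
    ultimately have "(\<Sum>x<n. r ^ x) = 0" by (simp add: geometric_sum)
    then show ?thesis unfolding pw using False by simp
  qed simp
  have "0 = (\<Sum>x<n. (w * weight_proj q n m (int x) B) $$ (0, j))" using j by (simp add: z)
  also have "\<dots> = (\<Sum>x<n. \<Sum>s\<le>n - 1. q powi (- (int x * int s)) * ?a s)"
    unfolding weight_proj_def using mult_lincomb_mat_index[OF w(1) W, of 0 j] j by (intro sum.cong refl) simp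
  also have "\<dots> = (\<Sum>s\<le>n - 1. (\<Sum>x<n. q powi (- (int x * int s))) * ?a s)"
    unfolding sum_distrib_right by (rule sum.swap)
  also have "\<dots> = (\<Sum>s\<le>n - 1. (if s = 0 then of_nat n else 0) * ?a s)"
    using p(1) by (intro sum.cong refl arg_cong2[where f = "(*)"] geo) auto
  also have "\<dots> = (\<Sum>s\<le>n - 1. if s = 0 then of_nat n * ?a 0 else 0)" by (intro sum.cong refl) simp
  also have "\<dots> = of_nat n * ?a 0" by (simp add: sum.delta)
  also have "?a 0 = w $$ (0, j)" using w B by simp
  finally show False using j(2) of_nat_root_order_nonzero[OF q] by simp
qed

text \<open>A nonzero functional killed by \<open>d\<close> is projected to an eigenspace of
  \<open>b\<close> and then of \<open>c\<close>. It stays killed by \<open>d\<close>, because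
  \<open>d\<close> commutes with \<open>b\<close> and \<open>c\<close> up to a scalar.\<close>

lemma weight_vector_exists:
  assumes q: "primitive_root n q" and X: "is_hmod n q X" and dim: "hdim X > 0"
  obtains w x y where "w \<in> carrier_mat 1 (hdim X)" "w \<noteq> 0\<^sub>m 1 (hdim X)" "w * opb X = q powi x \<cdot>\<^sub>m w"
    "w * opc X = q powi y \<cdot>\<^sub>m w" "w * opd X = 0\<^sub>m 1 (hdim X)"
proof -
  note p = primitive_rootD[OF q]
  note c = hmod_carrier[OF X] and rel = hmod_relations[OF X] and pw = hmod_powers[OF X]
  let ?m = "hdim X"
  have "(urow ?m 0 :: 'a mat) \<noteq> 0\<^sub>m 1 ?m"
  proof
    assume "(urow ?m 0 :: 'a mat) = 0\<^sub>m 1 ?m"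
    then have "(urow ?m 0 :: 'a mat) $$ (0, 0) = 0\<^sub>m 1 ?m $$ (0, 0)" by simp
    then show False using dim by (simp add: urow_def)
  qed
  moreover have "urow ?m 0 * opd X ^\<^sub>m n = 0\<^sub>m 1 ?m" unfolding pw by simp
  ultimately obtain k where k: "urow ?m 0 * opd X ^\<^sub>m k \<noteq> 0\<^sub>m 1 ?m" "urow ?m 0 * opd X ^\<^sub>m k * opd X = 0\<^sub>m 1 ?m"
    by (rule nonzero_power_killed[OF c(4) special_carrier(1)])
  define w where "w = urow ?m 0 * opd X ^\<^sub>m k"
  have w: "w \<in> carrier_mat 1 ?m" "w \<noteq> 0\<^sub>m 1 ?m" "w * opd X = 0\<^sub>m 1 ?m" using k c by (auto simp: w_def)
  have killed: "v * weight_proj q n ?m x Z * opd X = 0\<^sub>m 1 ?m"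
    if v: "v \<in> carrier_mat 1 ?m" "v * opd X = 0\<^sub>m 1 ?m" and Z: "Z \<in> carrier_mat ?m ?m" "opd X * Z = q \<cdot>\<^sub>m (Z * opd X)" for v x Z
  proof -
    \<comment> \<open>Moving \<open>d\<close> to the left of the projector replaces \<open>Z\<close>
      by \<open>q^(-1) Z\<close> in it, after which \<open>d\<close> meets \<open>v\<close>.\<close>
    have "Z * opd X = opd X * (inverse q \<cdot>\<^sub>m Z)" using c Z p(3) by (simp add: mat_alg)
    then have "opd X * weight_proj q n ?m x (inverse q \<cdot>\<^sub>m Z) = weight_proj q n ?m x Z * opd X"
      using c Z by (intro weight_proj_intertwine) auto
    then have "v * weight_proj q n ?m x Z * opd X = v * (opd X * weight_proj q n ?m x (inverse q \<cdot>\<^sub>m Z))"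
      using v(1) c by (simp add: mult_assoc_dim)
    also have "\<dots> = (v * opd X) * weight_proj q n ?m x (inverse q \<cdot>\<^sub>m Z)" using v(1) c by (simp add: mult_assoc_dim)
    finally show ?thesis unfolding v(2) by simp
  qed
  obtain x where x: "w * weight_proj q n ?m x (opb X) \<noteq> 0\<^sub>m 1 ?m" by (rule weight_proj_nonzero[OF q c(2) w(1,2)])
  define v where "v = w * weight_proj q n ?m x (opb X)"
  have v: "v \<in> carrier_mat 1 ?m" "v \<noteq> 0\<^sub>m 1 ?m" using x w by (auto simp: v_def)
  have vD: "v * opd X = 0\<^sub>m 1 ?m" unfolding v_def by (rule killed[OF w(1,3) c(2) rel(2)])
  have vB: "v * opb X = q powi x \<cdot>\<^sub>m v"
    unfolding v_def using w(1) c weight_proj_eigen(2)[OF q c(2) pw(2)] by (simp add: mult_assoc_dim mult_smult_dim)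
  obtain y where y: "v * weight_proj q n ?m y (opc X) \<noteq> 0\<^sub>m 1 ?m" by (rule weight_proj_nonzero[OF q c(3) v])
  define u where "u = v * weight_proj q n ?m y (opc X)"
  have u: "u \<in> carrier_mat 1 ?m" "u \<noteq> 0\<^sub>m 1 ?m" using y v by (auto simp: u_def)
  have uD: "u * opd X = 0\<^sub>m 1 ?m" unfolding u_def by (rule killed[OF v(1) vD c(3) rel(4)])
  have uC: "u * opc X = q powi y \<cdot>\<^sub>m u"
    unfolding u_def using v(1) c weight_proj_eigen(2)[OF q c(3) pw(3)] by (simp add: mult_assoc_dim mult_smult_dim)
  have "opb X * weight_proj q n ?m y (opc X) = weight_proj q n ?m y (opc X) * opb X"
    using c rel(5) by (intro weight_proj_intertwine) auto
  then have "u * opb X = (v * opb X) * weight_proj q n ?m y (opc X)"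
    unfolding u_def using v(1) c by (simp add: mult_assoc_dim)
  also have "\<dots> = q powi x \<cdot>\<^sub>m u" unfolding vB u_def using v(1) by (simp add: smult_mult_dim)
  finally show ?thesis using that u uD uC by blast
qed

lemma simple_fspI:
  assumes q: "primitive_root n q" and w: "w \<in> carrier_mat 1 (hdim X)" "w * opb X = q powi x \<cdot>\<^sub>m w" "w * opc X = q powi y \<cdot>\<^sub>m w"
    and X: "square_mod X"
    and "w * opd X = 0\<^sub>m 1 (hdim X)" "w * opa X ^\<^sub>m j = 0\<^sub>m 1 (hdim X)"
    and xy: "(u + int j - 1) mod int n = x mod int n" "(- u) mod int n = y mod int n"
  shows "w \<in> simple_fsp q X j u"
  unfolding simple_fsp_def fsp_cong[OF q xy] using assms square_modD(4)[OF X] by (intro fspI) simp_all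

text \<open>The congruence for \<open>j\<close> makes the chain coefficient vanish after
  \<open>j\<close> steps, so \<open>w a^j\<close> is again killed by \<open>d\<close>, and its
  weights are those of the last coordinate of \<open>V(n - j, j - y)\<close>.\<close>

lemma killed_functional_shift:
  assumes q: "primitive_root n q" and n: "n > 1" and X: "is_hmod n q X" and w: "w \<in> carrier_mat 1 (hdim X)"
  and wB: "w * opb X = q powi x \<cdot>\<^sub>m w" and wC: "w * opc X = q powi y \<cdot>\<^sub>m w" and wD: "w * opd X = 0\<^sub>m 1 (hdim X)"
  and j1: "1 \<le> j" and jn: "j \<le> n" and dvd: "int n dvd x + y + 1 - int j"
  shows "w * opa X ^\<^sub>m j \<in> simple_fsp q X (n - j) (int j - y)"
proof -
  note p = primitive_rootD[OF q] and sq = hmod_square[OF X] and c = hmod_carrier[OF X]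
  define v where "v = w * opa X ^\<^sub>m j"
  have v: "v \<in> carrier_mat 1 (hdim X)" unfolding v_def by (rule mult_carrier_mat[OF w pow_carrier_mat[OF c(1)]])
  note wt = functional_power_weights[OF p(3) X w wB wC, of j, folded v_def]
  \<comment> \<open>The parameter \<open>e + f\<close> of a chain of length \<open>j\<close> whose
    last coordinate has the weights \<open>x\<close> and \<open>y\<close>.\<close>
  define s where "s = (x - int j + 1) + (y - int j + 1)"
  have rec: "chain_rec q j s (chain_coeff q s)"
  proof (rule chain_rec_coeff[OF p(3) root_ne_1[OF q n]])
    have "q powi (int j + s - 1) = q powi 0"
      unfolding powi_eq_iff[OF q] mod_eq_dvd_iff using dvd by (simp add: s_def algebra_simps)
    then show "q ^ j = 1 \<or> q powi (int j + s - 1) = 1" by simp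
  qed
  have e: "x - int j + 1 + int j - 1 = x" "y - int j + 1 + int j - 1 = y" by simp_all
  have "w * opa X ^\<^sub>m Suc (j - 1) * opd X = chain_coeff q s (j - Suc (j - 1)) \<cdot>\<^sub>m (w * opa X ^\<^sub>m (j - 1))"
    using j1 by (intro functional_chain_action[OF q X w _ _ wD rec[unfolded s_def], folded s_def])
      (simp_all add: e wB wC)
  then have vD: "v * opd X = 0\<^sub>m 1 (hdim X)"
    using j1 rec w c unfolding v_def chain_rec_def by (simp add: zero_smult_mat)
  have "v * opa X ^\<^sub>m (n - j) = w * opa X ^\<^sub>m n"
    unfolding v_def using w c jn pow_mat_add[OF c(1), of j "n - j"] by (simp add: mult_assoc_dim)
  then have vA: "v * opa X ^\<^sub>m (n - j) = 0\<^sub>m 1 (hdim X)" using hmod_powers(1)[OF X] w by simp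
  have "v \<in> simple_fsp q X (n - j) (int j - y)"
  proof (rule simple_fspI[OF q v wt(1,2) sq vD vA])
    have *: "int j - y + int (n - j) - 1 - (x - int j) = int n - (x + y + 1 - int j)" using jn by (simp add: of_nat_diff)
    show "(int j - y + int (n - j) - 1) mod int n = (x - int j) mod int n"
      unfolding mod_eq_dvd_iff * by (rule dvd_diff[OF dvd_refl dvd])
  qed simp
  then show ?thesis unfolding v_def .
qed

text \<open>The weights of a functional \<open>w\<close> killed by \<open>d\<close> single out the
  \<open>j\<close> between 1 and \<open>n\<close> with \<open>j \<equiv> x + y + 1\<close>. If
  \<open>w a^j = 0\<close>, then \<open>w\<close> is a homomorphism to \<open>V(j, -y)\<close>;
  otherwise \<open>w a^j\<close> is one to \<open>V(n - j, j - y)\<close>.\<close>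

theorem simple_quotient_exists:
  assumes q: "primitive_root n q" and n: "n > 1" and X: "is_hmod n q X" and dim: "hdim X > 0"
  obtains j u w where "1 \<le> j" "j \<le> n" "w \<in> simple_fsp q X j u" "w \<noteq> 0\<^sub>m 1 (hdim X)"
proof -
  note p = primitive_rootD[OF q] and sq = hmod_square[OF X]
  obtain w x y where w: "w \<in> carrier_mat 1 (hdim X)" "w \<noteq> 0\<^sub>m 1 (hdim X)" "w * opb X = q powi x \<cdot>\<^sub>m w"
    "w * opc X = q powi y \<cdot>\<^sub>m w" "w * opd X = 0\<^sub>m 1 (hdim X)" by (rule weight_vector_exists[OF q X dim])
  define j where "j = nat ((x + y) mod int n) + 1"
  have j1: "1 \<le> j" by (simp add: j_def)
  have "0 \<le> (x + y) mod int n" "(x + y) mod int n < int n" using p(1) by simp_all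
  then have jn: "j \<le> n" and ji: "int j = (x + y) mod int n + 1" by (auto simp: j_def)
  have dvd: "int n dvd x + y + 1 - int j" unfolding ji by (simp add: mod_eq_dvd_iff[symmetric])
  show ?thesis
  proof (cases "w * opa X ^\<^sub>m j = 0\<^sub>m 1 (hdim X)")
    case True
    have "w \<in> simple_fsp q X j (- y)"
      using dvd by (intro simple_fspI[OF q w(1,3,4) sq w(5) True])
        (auto simp: mod_eq_dvd_iff dvd_diff_commute algebra_simps)
    then show ?thesis using that j1 jn w(2) by blast
  next
    case False
    have "w * opa X ^\<^sub>m n = 0\<^sub>m 1 (hdim X)" using hmod_powers(1)[OF X] w(1) by simp
    with False have jn': "j < n" using jn by (cases "j = n") auto
    have "w * opa X ^\<^sub>m j \<in> simple_fsp q X (n - j) (int j - y)"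
      by (rule killed_functional_shift[OF q n X w(1,3,4,5) j1 jn dvd])
    then show ?thesis using that[of "n - j"] jn' False by simp
  qed
qed

section \<open>The projective simple modules\<close>

text \<open>The universal property of the chain of length \<open>n\<close>, which is generated by a
  weight vector killed by \<open>d\<close>: the length matches \<open>a^n = 0\<close>, and
  \<open>d a^(i+1) v\<close> follows by induction from \<open>da = qad + 1 - bc\<close>.\<close>

lemma column_hom:
  assumes q: "primitive_root n q" and X: "is_hmod n q X" and v: "v \<in> carrier_mat (hdim X) 1"
    and vB: "opb X * v = q powi e \<cdot>\<^sub>m v" and vC: "opc X * v = q powi f \<cdot>\<^sub>m v"
    and vD: "opd X * v = 0\<^sub>m (hdim X) 1" and rec: "chain_rec q n (e + f) \<delta>"
  shows "is_hom (chain_mod q n e f (\<lambda>_. 1) \<delta>) X (cols_mat (hdim X) n (\<lambda>i. opa X ^\<^sub>m i * v))"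
    (is "is_hom ?V X (cols_mat _ n ?F)")
proof -
  note p = primitive_rootD[OF q] and c = hmod_carrier[OF X] and rel = hmod_relations[OF X]
  note [simp] = hmod_dim[OF X] carrier_matD[OF v]
  let ?f = "cols_mat (hdim X) n ?F"
  have F: "?F i \<in> carrier_mat (hdim X) 1" for i by (rule mult_carrier_mat[OF pow_carrier_mat[OF c(1)] v])
  have uc: "?f * ucol n i = ?F i" if "i < n" for i using cols_mat_ucol[of i n ?F, OF that F] .
  note col = chain_mod_col[of _ n q e f "\<lambda>_. 1" \<delta>]
  note sq = square_modD[OF chain_mod_square[of q n e f "\<lambda>_. 1" \<delta>], unfolded chain_mod_dim]
  have R: "?f * Z = Z' * ?f" if "Z \<in> carrier_mat n n" "Z' \<in> carrier_mat (hdim X) (hdim X)"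
    "\<And>i. i < n \<Longrightarrow> ?f * (Z * ucol n i) = Z' * ?F i" for Z Z'
  proof (rule ucol_eqI)
    fix i assume "i < dim_col (Z' * ?f)"
    then have i: "i < n" using that by simp
    have "?f * Z * ucol n i = Z' * (?f * ucol n i)" using that(1,3) i uc[OF i] by (simp add: mult_assoc_dim)
    also have "\<dots> = Z' * ?f * ucol n i" using that(2) by (simp add: mult_assoc_dim)
    finally show "?f * Z * ucol (dim_col (Z' * ?f)) i = Z' * ?f * ucol (dim_col (Z' * ?f)) i" using that by simp
  qed (use that in auto)
  have wt: "Z * ?F i = q powi (z + int i) \<cdot>\<^sub>m ?F i"
    if "Z \<in> carrier_mat (hdim X) (hdim X)" "Z * opa X = q \<cdot>\<^sub>m (opa X * Z)" "Z * v = q powi z \<cdot>\<^sub>m v" for Z z i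
  proof -
    have "Z * ?F i = (Z * opa X ^\<^sub>m i) * v" using that(1) c by (simp add: mult_assoc_dim)
    also have "\<dots> = q ^ i \<cdot>\<^sub>m (opa X ^\<^sub>m i * (Z * v))"
      unfolding pow_mat_qcomm[OF c(1) that(1,2)] using that(1) c by (simp add: mat_alg)
    also have "\<dots> = (q ^ i * q powi z) \<cdot>\<^sub>m ?F i" unfolding that(3) using c by (simp add: mat_alg)
    also have "q ^ i * q powi z = q powi (z + int i)" using p(3) by (simp add: power_int_add)
    finally show ?thesis .
  qed
  have dF: "opd X * ?F (Suc i) = \<delta> (Suc i) \<cdot>\<^sub>m ?F i" if "i < n" for i
    using that
  proof (induction i)
    case (Suc i)
    have S: "?F (Suc k) = opa X * ?F k" for k unfolding pow_mat_mult_left[OF c(1)] using c by (simp add: mult_assoc_dim)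
    have bc: "opb X * (opc X * ?F (Suc i)) = q powi (e + f + 2 * int (Suc i)) \<cdot>\<^sub>m ?F (Suc i)"
    proof -
      have "e + f + 2 * int (Suc i) = (f + int (Suc i)) + (e + int (Suc i))" by simp
      then have "q powi (e + f + 2 * int (Suc i)) = q powi (f + int (Suc i)) * q powi (e + int (Suc i))"
        using p(3) by (metis power_int_add)
      then show ?thesis unfolding wt[OF c(3) rel(3) vC]
        using wt[OF c(2) rel(1) vB, of "Suc i"] c by (simp add: mult_smult_dim smult_smult_mat del: of_nat_Suc pow_mat.simps)
    qed
    have "opd X * ?F (Suc (Suc i)) = (opd X * opa X) * ?F (Suc i)" unfolding S[of "Suc i"] using c by (simp add: mult_assoc_dim)
    also have "\<dots> = q \<cdot>\<^sub>m (opa X * (opd X * ?F (Suc i))) + (?F (Suc i) - opb X * (opc X * ?F (Suc i)))"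
      unfolding hmod_da[OF X] using F[of "Suc i"] c by (simp add: mat_alg del: pow_mat.simps)
    also have "opa X * (opd X * ?F (Suc i)) = \<delta> (Suc i) \<cdot>\<^sub>m ?F (Suc i)"
      using Suc unfolding S[of i] using c by (simp add: mult_smult_dim)
    also have "q \<cdot>\<^sub>m (\<delta> (Suc i) \<cdot>\<^sub>m ?F (Suc i)) + (?F (Suc i) - opb X * (opc X * ?F (Suc i)))
        = (q * \<delta> (Suc i) + (1 - q powi (e + f + 2 * int (Suc i)))) \<cdot>\<^sub>m ?F (Suc i)"
      unfolding bc using F[of "Suc i"] by (intro eq_matI) (auto simp: algebra_simps simp del: index_mult_mat(1) pow_mat.simps)
    also have "q * \<delta> (Suc i) + (1 - q powi (e + f + 2 * int (Suc i))) = \<delta> (Suc (Suc i))"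
      using rec Suc.prems unfolding chain_rec_def by simp
    finally show ?case .
  next
    case 0
    have bc: "opb X * (opc X * v) = q powi (e + f) \<cdot>\<^sub>m v"
      unfolding vC using c p(3) by (simp add: mult_smult_dim vB smult_smult_mat power_int_add mult.commute)
    have "opd X * ?F (Suc 0) = (opd X * opa X) * v" using c by (simp add: mult_assoc_dim)
    also have "\<dots> = q \<cdot>\<^sub>m (opa X * (opd X * v)) + (v - opb X * (opc X * v))"
      unfolding hmod_da[OF X] using v c by (simp add: mat_alg)
    also have "\<dots> = (1 - q powi (e + f)) \<cdot>\<^sub>m v"
      unfolding bc vD using v c by (intro eq_matI) (auto simp: algebra_simps)
    also have "1 - q powi (e + f) = \<delta> (Suc 0)" using rec 0 unfolding chain_rec_def by auto
    finally show ?case using c by simp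
  qed
  show ?thesis unfolding is_hom_def chain_mod_dim
  proof (intro conjI)
    show "?f \<in> carrier_mat (hdim X) n" by simp
    show "?f * opa ?V = opa X * ?f"
    proof (rule R[OF sq(1) c(1)])
      fix i assume i: "i < n"
      have "opa X * ?F i = ?F (Suc i)" unfolding pow_mat_mult_left[OF c(1)] using c by (simp add: mult_assoc_dim)
      moreover have "?F n = 0\<^sub>m (hdim X) 1" using hmod_powers(1)[OF X] by simp
      ultimately show "?f * (opa ?V * ucol n i) = opa X * ?F i"
        using i uc[of "Suc i"] col(1)[OF i] by (cases "Suc i = n") (auto simp del: pow_mat.simps)
    qed
    show "?f * opb ?V = opb X * ?f"
      by (rule R[OF sq(2) c(2)]) (simp add: col mult_smult_dim uc wt[OF c(2) rel(1) vB])
    show "?f * opc ?V = opc X * ?f"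
      by (rule R[OF sq(3) c(3)]) (simp add: col mult_smult_dim uc wt[OF c(3) rel(3) vC])
    show "?f * opd ?V = opd X * ?f"
    proof (rule R[OF sq(4) c(4)])
      fix i assume i: "i < n"
      show "?f * (opd ?V * ucol n i) = opd X * ?F i"
      proof (cases i)
        case 0
        then show ?thesis using i col(4)[OF i] vD c by simp
      next
        case (Suc k)
        then show ?thesis using i col(4)[OF i] dF[of k] uc[of k] by (simp add: mult_smult_dim del: pow_mat.simps)
      qed
    qed
  qed
qed

text \<open>By \<open>column_hom\<close>, lifting a homomorphism out of \<open>V(n,u)\<close>
  amounts to lifting the image of the first basis vector to a weight vector that is still killed by
  \<open>d\<close>.\<close>

theorem simple_mod_n_projective:
  assumes q: "primitive_root n q" and n: "n > 1"
  shows "is_projective n q (simple_mod q n u)"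
  unfolding is_projective_def
proof (intro conjI allI impI)
  note p = primitive_rootD[OF q] and q1 = root_ne_1[OF q n]
  show "is_hmod n q (simple_mod q n u)" by (rule simple_mod_hmod[OF q n order.refl])
  fix X Y g h
  assume *: "is_hmod n q X \<and> is_hmod n q Y \<and> is_epi X Y g \<and> is_hom (simple_mod q n u) Y h"
  define e f where "e = u" and "f = 1 - u - int n"
  define \<delta> where "\<delta> = chain_coeff q (1 - int n)"
  define V where "V = chain_mod q n e f (\<lambda>_. 1) \<delta>"
  have Veq: "simple_mod q n u = V" unfolding V_def e_def f_def \<delta>_def by (rule simple_mod_chain[OF q1])
  have X: "is_hmod n q X" and Y: "is_hmod n q Y" and g: "is_hom X Y g" and h: "is_hom V Y h"
    using * by (auto simp: is_epi_def Veq)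
  obtain g' where g': "g' \<in> carrier_mat (hdim X) (hdim Y)" "g * g' = 1\<^sub>m (hdim Y)" using * epi_right_inverse by blast
  note cX = hmod_carrier[OF X] and cY = hmod_carrier[OF Y] and hg = homD[OF g] and hh = homD[OF h, unfolded V_def chain_mod_dim, folded V_def]
  note sqV = square_modD[OF chain_mod_square[of q n e f "\<lambda>_. 1" \<delta>], unfolded chain_mod_dim, folded V_def]
  have l: "n - 1 < n" using p(1) by simp
  note col = chain_mod_col[of _ n q e f "\<lambda>_. 1" \<delta>, folded V_def]
  let ?x = "e + int (n - 1)" and ?y = "f + int (n - 1)"
  let ?EX = "weight_proj q n (hdim X) ?x (opb X) * weight_proj q n (hdim X) ?y (opc X)"
  let ?EY = "weight_proj q n (hdim Y) ?x (opb Y) * weight_proj q n (hdim Y) ?y (opc Y)"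
  define y where "y = h * ucol n (n - 1)"
  have y: "y \<in> carrier_mat (hdim Y) 1" using hh(1) by (simp add: y_def)
  have yw: "opb Y * y = q powi ?x \<cdot>\<^sub>m y" "opc Y * y = q powi ?y \<cdot>\<^sub>m y"
  proof -
    have "opb Y * y = (h * opb V) * ucol n (n - 1)" unfolding hh(3) y_def using cY hh(1) by (simp add: mult_assoc_dim)
    then show "opb Y * y = q powi ?x \<cdot>\<^sub>m y" unfolding y_def using hh(1) sqV col(2)[OF l] by (simp add: mult_assoc_dim mult_smult_dim)
    have "opc Y * y = (h * opc V) * ucol n (n - 1)" unfolding hh(4) y_def using cY hh(1) by (simp add: mult_assoc_dim)
    then show "opc Y * y = q powi ?y \<cdot>\<^sub>m y" unfolding y_def using hh(1) sqV col(3)[OF l] by (simp add: mult_assoc_dim mult_smult_dim)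
  qed
  \<comment> \<open>A linear preimage of \<open>y\<close> moved into the right weight space; each of
    the two unnormalised projectors contributes a factor \<open>n\<close>, whence \<open>N\<close>
    below.\<close>
  define v where "v = ?EX * (g' * y)"
  have v: "v \<in> carrier_mat (hdim X) 1" unfolding v_def
    by (rule mult_carrier_mat[OF mult_carrier_mat[OF weight_proj_carrier weight_proj_carrier] mult_carrier_mat[OF g'(1) y]])
  have gE: "g * ?EX = ?EY * g"
  proof -
    have "g * ?EX = (g * weight_proj q n (hdim X) ?x (opb X)) * weight_proj q n (hdim X) ?y (opc X)"
      using hg(1) by (simp add: mult_assoc_dim)
    also have "\<dots> = weight_proj q n (hdim Y) ?x (opb Y) * (g * weight_proj q n (hdim X) ?y (opc X))"
      unfolding weight_proj_intertwine[OF cX(2) cY(2) hg(1,3)] using hg(1) by (simp add: mult_assoc_dim)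
    also have "\<dots> = ?EY * g"
      unfolding weight_proj_intertwine[OF cX(3) cY(3) hg(1,4)] using hg(1) by (simp add: mult_assoc_dim)
    finally show ?thesis .
  qed
  define N where "N = (of_nat n :: 'a) * of_nat n"
  have N: "N \<noteq> 0" using of_nat_root_order_nonzero[OF q] by (simp add: N_def)
  have gv: "g * v = N \<cdot>\<^sub>m y"
  proof -
    have "g * v = (g * ?EX) * (g' * y)" unfolding v_def using hg(1) g'(1) y by (simp add: mult_assoc_dim)
    also have "\<dots> = ?EY * ((g * g') * y)" unfolding gE using hg(1) g'(1) y by (simp add: mult_assoc_dim)
    also have "\<dots> = weight_proj q n (hdim Y) ?x (opb Y) * (weight_proj q n (hdim Y) ?y (opc Y) * y)"
      unfolding g'(2) using y by (simp add: mult_assoc_dim)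
    also have "\<dots> = N \<cdot>\<^sub>m y"
      unfolding weight_proj_fixes[OF q cY(3) y yw(2)] using y weight_proj_fixes[OF q cY(2) y yw(1)]
      by (simp add: mult_smult_dim smult_smult_mat N_def)
    finally show ?thesis .
  qed
  have vB: "opb X * v = q powi ?x \<cdot>\<^sub>m v"
  proof -
    have "opb X * v = (opb X * weight_proj q n (hdim X) ?x (opb X)) * (weight_proj q n (hdim X) ?y (opc X) * (g' * y))"
      unfolding v_def using cX g'(1) y by (simp add: mult_assoc_dim)
    then show ?thesis unfolding weight_proj_eigen(1)[OF q cX(2) hmod_powers(2)[OF X]] v_def
      using cX g'(1) y by (simp add: mat_alg)
  qed
  have vC: "opc X * v = q powi ?y \<cdot>\<^sub>m v"
  proof -
    have com: "opc X * weight_proj q n (hdim X) ?x (opb X) = weight_proj q n (hdim X) ?x (opb X) * opc X"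
      by (rule weight_proj_intertwine[OF cX(2) cX(2) cX(3) hmod_relations(5)[OF X]])
    have "opc X * v = (opc X * weight_proj q n (hdim X) ?x (opb X)) * (weight_proj q n (hdim X) ?y (opc X) * (g' * y))"
      unfolding v_def using cX g'(1) y by (simp add: mult_assoc_dim)
    also have "\<dots> = weight_proj q n (hdim X) ?x (opb X) * ((opc X * weight_proj q n (hdim X) ?y (opc X)) * (g' * y))"
      unfolding com using cX g'(1) y by (simp add: mult_assoc_dim)
    finally show ?thesis unfolding weight_proj_eigen(1)[OF q cX(3) hmod_powers(3)[OF X]] v_def
      using cX g'(1) y by (simp add: mat_alg)
  qed
  text \<open>The top weight vector of $V(n,u)$ is a multiple of $d^{n-1} v_n$, so it is lifted to a vector killed by $d$.\<close>
  have Dk: "\<exists>k. k \<noteq> 0 \<and> opd V ^\<^sub>m i * ucol n (n - 1) = k \<cdot>\<^sub>m ucol n (n - 1 - i)" if "i < n" for i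
    using that
  proof (induction i)
    case 0
    then show ?case using sqV by (intro exI[of _ 1]) simp
  next
    case (Suc i)
    then obtain k where k: "k \<noteq> 0" "opd V ^\<^sub>m i * ucol n (n - 1) = k \<cdot>\<^sub>m ucol n (n - 1 - i)" by auto
    have "opd V ^\<^sub>m Suc i * ucol n (n - 1) = opd V * (opd V ^\<^sub>m i * ucol n (n - 1))"
      unfolding pow_mat_mult_left[OF sqV(4)] using sqV by (simp add: mult_assoc_dim)
    also have "\<dots> = (k * \<delta> (n - 1 - i)) \<cdot>\<^sub>m ucol n (n - 1 - i - 1)"
      unfolding k using sqV Suc.prems by (simp add: mult_smult_dim col smult_smult_mat)
    also have "n - 1 - i - 1 = n - 1 - Suc i" by simp
    finally show ?case using k(1) chain_coeff_simple_nonzero[OF q n, of "n - 1 - i" n] Suc.prems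
      by (intro exI[of _ "k * \<delta> (n - 1 - i)"]) (simp add: \<delta>_def)
  qed
  from Dk[OF l] obtain k where k: "k \<noteq> 0" "opd V ^\<^sub>m (n - 1) * ucol n (n - 1) = k \<cdot>\<^sub>m ucol n 0" by auto
  \<comment> \<open>This vector is killed by \<open>d\<close> since \<open>d^n = 0\<close>. The
    scalar undoes \<open>N\<close> and the factor \<open>k\<close> by which \<open>d^(n-1)\<close>
    carries the last basis vector to the first.\<close>
  define t where "t = inverse (k * N) \<cdot>\<^sub>m (opd X ^\<^sub>m (n - 1) * v)"
  have t: "t \<in> carrier_mat (hdim X) 1" unfolding t_def
    by (intro smult_carrier_mat mult_carrier_mat[OF pow_carrier_mat[OF cX(4)] v])
  have tD: "opd X * t = 0\<^sub>m (hdim X) 1"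
  proof -
    have "opd X * opd X ^\<^sub>m (n - 1) = opd X ^\<^sub>m Suc (n - 1)" by (rule pow_mat_mult_left[OF cX(4), symmetric])
    also have "\<dots> = 0\<^sub>m (hdim X) (hdim X)" using p(1) hmod_powers(4)[OF X] by simp
    finally have "opd X * opd X ^\<^sub>m (n - 1) * v = 0\<^sub>m (hdim X) 1" using v by simp
    then show ?thesis unfolding t_def using cX v by (simp add: mult_smult_dim mult_assoc_dim)
  qed
  have tw: "Z * t = q powi z \<cdot>\<^sub>m t"
    if Z: "Z \<in> carrier_mat (hdim X) (hdim X)" "opd X * Z = q \<cdot>\<^sub>m (Z * opd X)" "Z * v = q powi (z + int (n - 1)) \<cdot>\<^sub>m v" for Z z
  proof -
    have "q ^ (n - 1) \<cdot>\<^sub>m (Z * (opd X ^\<^sub>m (n - 1) * v)) = opd X ^\<^sub>m (n - 1) * (Z * v)"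
    proof -
      have "opd X ^\<^sub>m (n - 1) * (Z * v) = (opd X ^\<^sub>m (n - 1) * Z) * v" using Z(1) cX v by (simp add: mult_assoc_dim)
      then show ?thesis unfolding pow_mat_qcomm'[OF Z(1) cX(4) Z(2)] using Z(1) cX v by (simp add: mat_alg)
    qed
    also have "\<dots> = q ^ (n - 1) \<cdot>\<^sub>m (q powi z \<cdot>\<^sub>m (opd X ^\<^sub>m (n - 1) * v))"
      unfolding Z(3) using cX v p(3) by (simp add: mat_alg power_int_add mult.commute)
    finally have "Z * (opd X ^\<^sub>m (n - 1) * v) = q powi z \<cdot>\<^sub>m (opd X ^\<^sub>m (n - 1) * v)"
      using smult_cancel_mat[of "q ^ (n - 1)"] p(3) by (metis power_not_zero)
    then show ?thesis unfolding t_def using Z(1) cX v by (simp add: mat_alg mult.commute)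
  qed
  note rel = hmod_relations[OF X]
  have "e + f = 1 - int n" by (simp add: e_def f_def)
  then have rec: "chain_rec q n (e + f) \<delta>" unfolding \<delta>_def using chain_rec_simple[OF p(3) q1] by metis
  define s where "s = cols_mat (hdim X) n (\<lambda>i. opa X ^\<^sub>m i * t)"
  have s: "is_hom V X s" unfolding V_def s_def
    by (rule column_hom[OF q X t tw[OF cX(2) rel(2) vB] tw[OF cX(3) rel(4) vC] tD rec])
  have "g * t = h * ucol n 0"
  proof -
    have "g * t = inverse (k * N) \<cdot>\<^sub>m ((g * opd X ^\<^sub>m (n - 1)) * v)"
      unfolding t_def using hg(1) cX v by (simp add: mult_smult_dim mult_assoc_dim)
    also have "g * opd X ^\<^sub>m (n - 1) = opd Y ^\<^sub>m (n - 1) * g" by (rule pow_mat_intertwine[OF cX(4) cY(4) hg(1,5)])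
    also have "opd Y ^\<^sub>m (n - 1) * g * v = N \<cdot>\<^sub>m ((opd Y ^\<^sub>m (n - 1) * h) * ucol n (n - 1))"
      using cY hg(1) v gv hh(1) unfolding y_def by (simp add: mult_assoc_dim mult_smult_dim)
    also have "opd Y ^\<^sub>m (n - 1) * h = h * opd V ^\<^sub>m (n - 1)" by (rule pow_mat_intertwine[OF sqV(4) cY(4) hh(1,5), symmetric])
    also have "h * opd V ^\<^sub>m (n - 1) * ucol n (n - 1) = k \<cdot>\<^sub>m (h * ucol n 0)"
      using hh(1) sqV k(2) by (simp add: mult_assoc_dim mult_smult_dim)
    finally have "g * t = (inverse (k * N) * (N * k)) \<cdot>\<^sub>m (h * ucol n 0)" by (simp only: smult_smult_mat mult.assoc)
    also have "inverse (k * N) * (N * k) = 1" using k(1) N by (simp add: field_simps)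
    finally show ?thesis by simp
  qed
  note gt = this
  have Ai: "opa V ^\<^sub>m i * ucol n 0 = ucol n i" if "i < n" for i
    using that
  proof (induction i)
    case (Suc i)
    have "opa V ^\<^sub>m Suc i * ucol n 0 = opa V * (opa V ^\<^sub>m i * ucol n 0)"
      unfolding pow_mat_mult_left[OF sqV(1)] using sqV by (simp add: mult_assoc_dim)
    then show ?case using Suc by (simp add: col)
  qed (use sqV in simp)
  have "g * s = h"
  proof (rule ucol_eqI)
    fix i assume "i < dim_col h"
    then have i: "i < n" using hh(1) by simp
    have "g * s * ucol n i = g * (s * ucol n i)" using hg(1) by (simp add: mult_assoc_dim s_def)
    also have "s * ucol n i = opa X ^\<^sub>m i * t" unfolding s_def using i t cX by (subst cols_mat_ucol) auto
    also have "g * (opa X ^\<^sub>m i * t) = (g * opa X ^\<^sub>m i) * t" using hg(1) cX t by (simp add: mult_assoc_dim)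
    also have "g * opa X ^\<^sub>m i = opa Y ^\<^sub>m i * g" by (rule pow_mat_intertwine[OF cX(1) cY(1) hg(1,2)])
    also have "opa Y ^\<^sub>m i * g * t = (opa Y ^\<^sub>m i * h) * ucol n 0"
      using cY hg(1) t gt hh(1) by (simp add: mult_assoc_dim)
    also have "opa Y ^\<^sub>m i * h = h * opa V ^\<^sub>m i" by (rule pow_mat_intertwine[OF sqV(1) cY(1) hh(1,2), symmetric])
    also have "h * opa V ^\<^sub>m i * ucol n 0 = h * ucol n i" using hh(1) sqV Ai[OF i] by (simp add: mult_assoc_dim)
    finally show "g * s * ucol (dim_col h) i = h * ucol (dim_col h) i" using hh(1) by simp
  qed (use hh(1) hg(1) in \<open>auto simp: s_def\<close>)
  then show "\<exists>k. is_hom (simple_mod q n u) X k \<and> g * k = h" unfolding Veq using s by blast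
qed

section \<open>Projective modules are determined by their simple quotients\<close>

text \<open>The dimension of the space of homomorphisms to \<open>V(j,u)\<close>; for projective
  \<open>X\<close> this is the multiplicity of the cover of \<open>V(j,u)\<close> as a direct
  summand.\<close>

definition mult :: "'k::field \<Rightarrow> 'k hmod \<Rightarrow> nat \<Rightarrow> int \<Rightarrow> nat" where
  "mult q X j u = rdim (hdim X) (simple_fsp q X j u)"

lemma simple_fsp_subspace: "square_mod X \<Longrightarrow> row_subspace (hdim X) (simple_fsp q X j u)"
  unfolding simple_fsp_def by (rule fsp_subspace)

lemma mult_biprod:
  "biprod S X Y i1 i2 p1 p2 \<Longrightarrow> square_mod S \<Longrightarrow> square_mod X \<Longrightarrow> square_mod Y \<Longrightarrow>
    mult q S j u = mult q X j u + mult q Y j u"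
  unfolding mult_def simple_fsp_def by (rule rdim_fsp_biprod)

lemma mult_iso: "X \<cong>\<^sub>H Y \<Longrightarrow> square_mod X \<Longrightarrow> square_mod Y \<Longrightarrow> mult q X j u = mult q Y j u"
  unfolding mult_def simple_fsp_def by (rule rdim_fsp_iso)

lemma essential_epi_lifts:
  assumes "is_essential_epi n q P V p" "is_hmod n q X" "is_hom X P x" "is_epi X V (p * x)"
  obtains y where "y \<in> carrier_mat (hdim X) (hdim P)" "x * y = 1\<^sub>m (hdim P)"
proof -
  have "is_epi X P x" using assms unfolding is_essential_epi_def by blast
  then show ?thesis using that unfolding epi_right_inverse by blast
qed

text \<open>A functional \<open>v\<close> independent of \<open>w\<close> would give a surjection
  \<open>(p, g)\<close> from \<open>P\<close> onto \<open>V(l,r) \<oplus> V(j,u)\<close>. Lifting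
  \<open>(p, 0)\<close> along it gives an endomorphism \<open>x\<close> with \<open>p x = p\<close>
  and \<open>g x = 0\<close>; it is surjective because \<open>p\<close> is essential, so
  \<open>g = 0\<close> and \<open>v = 0\<close>.\<close>

lemma cover_functional:
  assumes q: "primitive_root n q" and n: "n > 1" and l: "1 \<le> l" "l \<le> n"
    and P: "is_projective_cover n q P (simple_mod q l r)"
  obtains w where "w \<in> simple_fsp q P l r" "w \<noteq> 0\<^sub>m 1 (hdim P)"
    "\<And>j u v. 1 \<le> j \<Longrightarrow> j \<le> n \<Longrightarrow> v \<in> simple_fsp q P j u \<Longrightarrow> \<exists>c. v = c \<cdot>\<^sub>m w"
proof -
  let ?V = "simple_mod q l r"
  have pP: "is_projective n q P" using P by (simp add: is_projective_cover_def)
  then have hP: "is_hmod n q P" by (simp add: is_projective_def)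
  obtain p where ess: "is_essential_epi n q P ?V p" using P by (auto simp: is_projective_cover_def)
  then have pe: "is_epi P ?V p" by (simp add: is_essential_epi_def)
  then obtain p' where p': "p' \<in> carrier_mat (hdim P) l" "p * p' = 1\<^sub>m l"
    unfolding epi_right_inverse by auto
  have p: "is_hom P ?V p" using pe by (simp add: is_epi_def)
  note pc = homD(1)[OF p, unfolded simple_mod_sel]
  have V: "is_hmod n q ?V" by (rule simple_mod_hmod[OF q n l(2)])
  note cV = hmod_carrier[OF V, unfolded simple_mod_sel]
  define w where "w = urow l (l - 1) * p"
  have w: "w \<in> simple_fsp q P l r" unfolding w_def by (rule simple_hom_functional(1)[OF q n hP l(1) p])
  have wc: "w \<in> carrier_mat 1 (hdim P)" unfolding w_def by (rule mult_carrier_mat[OF special_carrier(1) pc])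
  have w0: "w \<noteq> 0\<^sub>m 1 (hdim P)"
  proof
    assume "w = 0\<^sub>m 1 (hdim P)"
    then have "w * p' = 0\<^sub>m 1 l" using p' by simp
    moreover have "w * p' = urow l (l - 1) * (p * p')" unfolding w_def using pc p'(1) by (simp add: mult_assoc_dim)
    ultimately have "(urow l (l - 1) :: 'a mat) = 0\<^sub>m 1 l" unfolding p'(2) by simp
    then have "(urow l (l - 1) :: 'a mat) $$ (0, l - 1) = 0\<^sub>m 1 l $$ (0, l - 1)" by simp
    then show False using l by (simp add: urow_def)
  qed
  have "\<exists>c. v = c \<cdot>\<^sub>m w" if j: "1 \<le> j" "j \<le> n" and v: "v \<in> simple_fsp q P j u" for j u v
  proof (rule ccontr)
    assume neg: "\<not> ?thesis"
    let ?V' = "simple_mod q j u"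
    have V': "is_hmod n q ?V'" by (rule simple_mod_hmod[OF q n j(2)])
    note cV' = hmod_carrier[OF V', unfolded simple_mod_sel]
    define g where "g = simple_hom P j v"
    have g: "is_hom P ?V' g" and gv: "urow j (j - 1) * g = v"
      unfolding g_def by (rule simple_hom[OF q n hP j(1) v])+
    note gc = homD(1)[OF g, unfolded simple_mod_sel]
    have vc: "v \<in> carrier_mat 1 (hdim P)" unfolding gv[symmetric] by (rule mult_carrier_mat[OF special_carrier(1) gc])
    let ?S = "hplus ?V ?V'"
    have S: "is_hmod n q ?S" by (rule hplus_hmod[OF V V'])
    note b = biprodD[OF hplus_biprod[OF hmod_square[OF V] hmod_square[OF V']], unfolded simple_mod_sel]
    note sq = hmod_square[OF V] hmod_square[OF V'] hmod_square[OF S] hmod_square[OF hP]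
    define F where "F = inl l j * p + inr l j * g"
    have i1p: "is_hom P ?S (inl l j * p)" by (rule hom_comp[OF p b(1) sq(4,1,3)])
    have F: "is_hom P ?S F" unfolding F_def
      by (rule hom_add[OF i1p hom_comp[OF g b(2) sq(4,2,3)] sq(4,3)])
    have Sd: "hdim ?S = l + j" by (simp add: hplus_sel)
    note cS = hmod_carrier[OF S, unfolded Sd]
    have inj: "t = 0\<^sub>m 1 (hdim ?S)"
      if t: "t \<in> carrier_mat 1 (hdim ?S)" "t * opd ?S = 0\<^sub>m 1 (hdim ?S)" "t * F = 0\<^sub>m 1 (hdim P)" for t
    proof -
      note t' = t[unfolded Sd]
      have "t * inl l j * opd ?V = (t * opd ?S) * inl l j"
        using t'(1) cS cV homD(5)[OF b(1)] by (simp add: mult_assoc_dim)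
      then have "(t * inl l j) * opd ?V = 0\<^sub>m 1 l" unfolding t'(2) by simp
      then obtain c where c: "t * inl l j = c \<cdot>\<^sub>m urow l (l - 1)"
        using simple_killed_functional[OF q n l, of "t * inl l j" r] t'(1) by auto
      have "t * inr l j * opd ?V' = (t * opd ?S) * inr l j"
        using t'(1) cS cV' homD(5)[OF b(2)] by (simp add: mult_assoc_dim)
      then have "(t * inr l j) * opd ?V' = 0\<^sub>m 1 j" unfolding t'(2) by simp
      then obtain c' where c': "t * inr l j = c' \<cdot>\<^sub>m urow j (j - 1)"
        using simple_killed_functional[OF q n j, of "t * inr l j" u] t'(1) by auto
      have "t * F = (t * inl l j) * p + (t * inr l j) * g"
        unfolding F_def using t'(1) pc gc by (simp add: mat_alg)
      also have "\<dots> = c \<cdot>\<^sub>m w + c' \<cdot>\<^sub>m v"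
        unfolding c c' w_def gv[symmetric] using pc gc by (simp add: smult_mult_dim)
      finally have z: "c \<cdot>\<^sub>m w + c' \<cdot>\<^sub>m v = 0\<^sub>m 1 (hdim P)" using t(3) by simp
      have entry: "c * w $$ (0, k) + c' * v $$ (0, k) = 0" if "k < hdim P" for k
      proof -
        have "(c \<cdot>\<^sub>m w + c' \<cdot>\<^sub>m v) $$ (0, k) = 0" unfolding z using that by simp
        then show ?thesis using that wc vc by simp
      qed
      have "c' = 0"
      proof (rule ccontr)
        assume c0: "c' \<noteq> 0"
        have "v = (- c / c') \<cdot>\<^sub>m w"
        proof (rule eq_matI)
          fix i k assume "i < dim_row ((- c / c') \<cdot>\<^sub>m w)" "k < dim_col ((- c / c') \<cdot>\<^sub>m w)"
          then show "v $$ (i, k) = ((- c / c') \<cdot>\<^sub>m w) $$ (i, k)"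
            using entry[of k] c0 wc by (simp add: field_simps add_eq_0_iff2)
        qed (use wc vc in auto)
        with neg show False by blast
      qed
      obtain k where k: "k < hdim P" "w $$ (0, k) \<noteq> 0" using nonzero_row[OF wc w0] by blast
      then have "c = 0" using entry[of k] \<open>c' = 0\<close> by simp
      have "t = t * (inl l j * prl l j + inr l j * prr l j)" using t'(1) by simp
      also have "\<dots> = (t * inl l j) * prl l j + (t * inr l j) * prr l j" using t'(1) by (simp add: mat_alg del: embed_simps)
      also have "\<dots> = 0\<^sub>m 1 (l + j)" unfolding c c' \<open>c = 0\<close> \<open>c' = 0\<close> by (simp add: zero_smult_mat)
      finally show ?thesis unfolding Sd .
    qed
    obtain G where G: "G \<in> carrier_mat (hdim P) (hdim ?S)" "F * G = 1\<^sub>m (hdim ?S)"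
      by (rule epi_by_killed_functionals[OF F S sq(4) inj])
    obtain x where x: "is_hom P P x" "F * x = inl l j * p"
      by (rule projectiveD[OF pP hP S i1p F G])
    note xc = homD(1)[OF x(1)]
    have "prl l j * (F * x) = (prl l j * inl l j) * p * x + (prl l j * inr l j) * g * x"
      unfolding F_def using pc gc xc by (simp add: mat_alg del: embed_simps)
    also have "\<dots> = p * x" using pc gc xc by simp
    finally have px: "p * x = p" unfolding x(2) using pc by (simp add: mult_assoc_dim[symmetric])
    have "prr l j * (F * x) = (prr l j * inl l j) * p * x + (prr l j * inr l j) * g * x"
      unfolding F_def using pc gc xc by (simp add: mat_alg del: embed_simps)
    also have "\<dots> = g * x" using pc gc xc by simp
    finally have gx: "g * x = 0\<^sub>m j (hdim P)" unfolding x(2) using pc by (simp add: mult_assoc_dim[symmetric])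
    obtain y where y: "y \<in> carrier_mat (hdim P) (hdim P)" "x * y = 1\<^sub>m (hdim P)"
      using essential_epi_lifts[OF ess hP x(1)] pe px by metis
    have "g = g * (x * y)" unfolding y(2) using gc by simp
    also have "\<dots> = (g * x) * y" using gc xc y(1) by (simp add: mult_assoc_dim)
    also have "\<dots> = 0\<^sub>m j (hdim P)" unfolding gx using y by simp
    finally have "v = 0 \<cdot>\<^sub>m w" using gv wc by (simp add: zero_smult_mat)
    with neg show False by blast
  qed
  with w w0 show ?thesis by (rule that)
qed

text \<open>All homomorphisms to simple modules come from multiples of one functional
  \<open>w\<close>, and the weights of \<open>w\<close> determine \<open>u\<close> modulo
  \<open>n\<close> and, since \<open>j\<close> and \<open>l\<close> lie between 1 and
  \<open>n\<close>, also \<open>j\<close>.\<close>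

lemma mult_cover:
  assumes q: "primitive_root n q" and n: "n > 1" and l: "1 \<le> l" "l \<le> n" and j: "1 \<le> j" "j \<le> n"
    and P: "is_projective_cover n q P (simple_mod q l r)"
  shows "mult q P j u = (if j = l \<and> u mod int n = r mod int n then 1 else 0)"
proof -
  obtain w where w: "w \<in> simple_fsp q P l r" "w \<noteq> 0\<^sub>m 1 (hdim P)"
    and line: "\<And>v. v \<in> simple_fsp q P j u \<Longrightarrow> \<exists>c. v = c \<cdot>\<^sub>m w"
    using cover_functional[OF q n l P] j by metis
  have hP: "is_hmod n q P" using P by (simp add: is_projective_cover_def is_projective_def)
  note sub = simple_fsp_subspace[OF hmod_square[OF hP], of q j u]
  note wc = w(1)[unfolded simple_fsp_def, THEN fspD(1)]
  show ?thesis
  proof (cases "j = l \<and> u mod int n = r mod int n")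
    case True
    then have "simple_fsp q P j u = simple_fsp q P l r" using simple_fsp_cong[OF q] by metis
    then have "w \<in> simple_fsp q P j u" using w(1) by simp
    then have "simple_fsp q P j u = {c \<cdot>\<^sub>m w | c. True}"
      using line row_subspaceD(4)[OF sub] by blast
    then show ?thesis using rdim_line[OF wc w(2)] True by (simp add: mult_def)
  next
    case False
    have "v = 0\<^sub>m 1 (hdim P)" if v: "v \<in> simple_fsp q P j u" for v
    proof (rule ccontr)
      assume v0: "v \<noteq> 0\<^sub>m 1 (hdim P)"
      obtain c where c: "v = c \<cdot>\<^sub>m w" using line[OF v] by blast
      with v0 have "c \<noteq> 0" using wc by (auto simp: zero_smult_mat)
      then have "w = inverse c \<cdot>\<^sub>m v" unfolding c by (simp add: smult_smult_mat)
      then have w': "w \<in> simple_fsp q P j u" using row_subspaceD(4)[OF sub v] by simp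
      note d = fspD[OF w(1)[unfolded simple_fsp_def]] and d' = fspD[OF w'[unfolded simple_fsp_def]]
      obtain k where k: "k < hdim P" "w $$ (0, k) \<noteq> 0" using nonzero_row[OF wc w(2)] by blast
      have eq: "a = b" if "a \<cdot>\<^sub>m w = b \<cdot>\<^sub>m w" for a b
        using arg_cong[OF that, of "\<lambda>M. M $$ (0, k)"] k wc by simp
      have "q powi (r + int l - 1) = q powi (u + int j - 1)" using d(2) d'(2) by (intro eq) simp
      then have 1: "int n dvd (r + int l - 1) - (u + int j - 1)" unfolding powi_eq_iff[OF q] mod_eq_dvd_iff .
      have "q powi (- r) = q powi (- u)" using d(3) d'(3) by (intro eq) simp
      then have 2: "int n dvd (- r) - (- u)" unfolding powi_eq_iff[OF q] mod_eq_dvd_iff .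
      have "l = j"
      proof -
        have "int n dvd int l - int j" using dvd_add[OF 1 2] by simp
        moreover have "\<bar>int l - int j\<bar> < int n" using l j by linarith
        ultimately have "int l - int j = 0" using dvd_imp_le_int[of "int l - int j" "int n"] by linarith
        then show ?thesis by simp
      qed
      moreover have "u mod int n = r mod int n" unfolding mod_eq_dvd_iff using 2 by simp
      ultimately show False using False by simp
    qed
    then have "simple_fsp q P j u = {0\<^sub>m 1 (hdim P)}" using row_subspaceD(2)[OF sub] by blast
    then show ?thesis using False by (simp add: mult_def rdim_zero)
  qed
qed

section \<open>Splitting projective covers off projective modules\<close>

lemma summand_projective:
  assumes b: "biprod S X Y i1 i2 p1 p2" and S: "is_projective n q S" and Y: "is_hmod n q Y"
  shows "is_projective n q Y"
  unfolding is_projective_def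
proof (intro conjI allI impI Y)
  note d = biprodD[OF b]
  have hS: "is_hmod n q S" using S by (simp add: is_projective_def)
  fix A B g f
  assume *: "is_hmod n q A \<and> is_hmod n q B \<and> is_epi A B g \<and> is_hom Y B f"
  then have A: "is_hmod n q A" and B: "is_hmod n q B" and g: "is_hom A B g" and f: "is_hom Y B f" by (auto simp: is_epi_def)
  obtain g' where g': "g' \<in> carrier_mat (hdim A) (hdim B)" "g * g' = 1\<^sub>m (hdim B)" using * epi_right_inverse by blast
  have "is_hom S B (f * p2)" by (rule hom_comp[OF d(4) f hmod_square[OF hS] hmod_square[OF Y] hmod_square[OF B]])
  then obtain h where h: "is_hom S A h" "g * h = f * p2" by (rule projectiveD[OF S A B _ g g'])
  have "is_hom Y A (h * i2)" by (rule hom_comp[OF d(2) h(1) hmod_square[OF Y] hmod_square[OF hS] hmod_square[OF A]])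
  moreover have "g * (h * i2) = (g * h) * i2"
    using homD(1)[OF g] homD(1)[OF h(1)] homD(1)[OF d(2)] by (simp add: mult_assoc_dim)
  then have "g * (h * i2) = f * (p2 * i2)" unfolding h(2)
    using homD(1)[OF f] homD(1)[OF d(4)] homD(1)[OF d(2)] by (simp add: mult_assoc_dim)
  then have "g * (h * i2) = f" using d(6) homD(1)[OF f] by simp
  ultimately show "\<exists>h. is_hom Y A h \<and> g * h = f" by blast
qed

text \<open>Sending \<open>Z\<close> to \<open>r * Z * i\<close> is multiplicative on matrices
  commuting with the idempotent \<open>i * r\<close> and preserves the identity, so it carries over
  all relations.\<close>

lemma idempotent_image_hmod:
  assumes X: "is_hmod n q X" and i: "i \<in> carrier_mat (hdim X) p" and r: "r \<in> carrier_mat p (hdim X)" and ri: "r * i = 1\<^sub>m p"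
    and com: "i * r * opa X = opa X * (i * r)" "i * r * opb X = opb X * (i * r)"
      "i * r * opc X = opc X * (i * r)" "i * r * opd X = opd X * (i * r)"
  defines "Y \<equiv> HMod p (r * opa X * i) (r * opb X * i) (r * opc X * i) (r * opd X * i)"
  shows "is_hmod n q Y" "is_hom Y X i" "is_hom X Y r"
proof -
  define m where "m = hdim X"
  note cX = hmod_carrier[OF X, folded m_def] and pX = hmod_powers[OF X, folded m_def] and rX = hmod_relations[OF X]
  define e where "e = i * r"
  have ir: "i \<in> carrier_mat m p" "r \<in> carrier_mat p m" "e = i * r" "r * i = 1\<^sub>m p"
    using i r ri by (simp_all add: e_def m_def)
  have e: "e \<in> carrier_mat m m" unfolding ir(3) by (rule mult_carrier_mat[OF ir(1,2)])
  note coms = com[folded e_def]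
  have ei: "e * i = i" unfolding ir(3) using ir(1,2,4) by (simp add: mult_assoc_dim)
  have re: "r * e = r" unfolding ir(3) using ir(1,2,4) by (simp add: mult_assoc_dim[symmetric])
  have inter: "i * (r * Z * i) = Z * i" "r * Z = (r * Z * i) * r"
    if "e * Z = Z * e" "Z \<in> carrier_mat m m" for Z
  proof -
    have "i * (r * Z * i) = (e * Z) * i" unfolding ir(3) using ir(1,2) that(2) by (simp add: mult_assoc_dim)
    also have "\<dots> = Z * (e * i)" unfolding that(1) using e ir(1) that(2) by (simp add: mult_assoc_dim)
    finally show "i * (r * Z * i) = Z * i" unfolding ei .
    have "(r * Z * i) * r = r * (Z * e)" unfolding ir(3) using ir(1,2) that(2) by (simp add: mult_assoc_dim)
    also have "\<dots> = (r * e) * Z" unfolding that(1)[symmetric] using e ir(2) that(2) by (simp add: mult_assoc_dim)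
    finally show "r * Z = (r * Z * i) * r" unfolding re by simp
  qed
  let ?c = "\<lambda>Z. r * Z * i"
  have mul: "?c Z * ?c W = ?c (Z * W)" if "e * W = W * e" "Z \<in> carrier_mat m m" "W \<in> carrier_mat m m" for Z W
  proof -
    have "?c Z * ?c W = r * Z * (i * (r * W * i))" using ir(1,2) that(2,3) by (simp add: mult_assoc_dim)
    then show ?thesis unfolding inter(1)[OF that(1,3)] using ir(1,2) that(2,3) by (simp add: mult_assoc_dim)
  qed
  have cc: "?c Z \<in> carrier_mat p p" if "Z \<in> carrier_mat m m" for Z using ir that by simp
  have pow: "?c Z ^\<^sub>m k = ?c (Z ^\<^sub>m k)" if "e * Z = Z * e" "Z \<in> carrier_mat m m" for Z k
  proof (induction k)
    case 0
    show ?case using ir that by simp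
  next
    case (Suc k)
    then show ?case using mul[OF that(1) pow_carrier_mat[OF that(2)] that(2)] by simp
  qed
  have c1: "?c (1\<^sub>m m) = 1\<^sub>m p" using ir by simp
  have c0: "?c (0\<^sub>m m m) = 0\<^sub>m p p" using ir by simp
  have Ys: "hdim Y = p" "opa Y = ?c (opa X)" "opb Y = ?c (opb X)" "opc Y = ?c (opc X)" "opd Y = ?c (opd X)"
    by (simp_all add: Y_def)
  have csm: "?c (k \<cdot>\<^sub>m Z) = k \<cdot>\<^sub>m ?c Z" if "Z \<in> carrier_mat m m" for k Z using ir that by (simp add: mat_alg)
  show "is_hmod n q Y"
  proof (rule is_hmodI; unfold Ys)
    note m = mul[OF coms(1)] mul[OF coms(2)] mul[OF coms(3)] mul[OF coms(4)]
    show "?c (opa X) \<in> carrier_mat p p" "?c (opb X) \<in> carrier_mat p p" "?c (opc X) \<in> carrier_mat p p" "?c (opd X) \<in> carrier_mat p p"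
      using cc cX by blast+
    show "?c (opb X) * ?c (opa X) = q \<cdot>\<^sub>m (?c (opa X) * ?c (opb X))"
      unfolding m(1)[OF cX(2,1)] m(2)[OF cX(1,2)] rX by (rule csm[OF mult_carrier_mat[OF cX(1,2)]])
    show "?c (opd X) * ?c (opb X) = q \<cdot>\<^sub>m (?c (opb X) * ?c (opd X))"
      unfolding m(2)[OF cX(4,2)] m(4)[OF cX(2,4)] rX by (rule csm[OF mult_carrier_mat[OF cX(2,4)]])
    show "?c (opc X) * ?c (opa X) = q \<cdot>\<^sub>m (?c (opa X) * ?c (opc X))"
      unfolding m(1)[OF cX(3,1)] m(3)[OF cX(1,3)] rX by (rule csm[OF mult_carrier_mat[OF cX(1,3)]])
    show "?c (opd X) * ?c (opc X) = q \<cdot>\<^sub>m (?c (opc X) * ?c (opd X))"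
      unfolding m(3)[OF cX(4,3)] m(4)[OF cX(3,4)] rX by (rule csm[OF mult_carrier_mat[OF cX(3,4)]])
    show "?c (opc X) * ?c (opb X) = ?c (opb X) * ?c (opc X)"
      unfolding m(2)[OF cX(3,2)] m(3)[OF cX(2,3)] rX ..
    show "?c (opa X) ^\<^sub>m n = 0\<^sub>m p p" "?c (opb X) ^\<^sub>m n = 1\<^sub>m p" "?c (opc X) ^\<^sub>m n = 1\<^sub>m p" "?c (opd X) ^\<^sub>m n = 0\<^sub>m p p"
      unfolding pow[OF coms(1) cX(1)] pow[OF coms(2) cX(2)] pow[OF coms(3) cX(3)] pow[OF coms(4) cX(4)] pX
      by (rule c0 c1)+
    show "?c (opd X) * ?c (opa X) = q \<cdot>\<^sub>m (?c (opa X) * ?c (opd X)) + (1\<^sub>m p - ?c (opb X) * ?c (opc X))"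
      unfolding m(1)[OF cX(4,1)] m(4)[OF cX(1,4)] m(3)[OF cX(2,3)] hmod_da[OF X, folded m_def] c1[symmetric]
      using ir(1,2) cX by (simp add: mat_alg)
  qed
  show "is_hom Y X i" unfolding is_hom_def Ys m_def[symmetric]
    using ir(1) inter(1)[OF coms(1) cX(1)] inter(1)[OF coms(2) cX(2)] inter(1)[OF coms(3) cX(3)] inter(1)[OF coms(4) cX(4)] by simp
  show "is_hom X Y r" unfolding is_hom_def Ys m_def[symmetric]
    using ir(2) inter(2)[OF coms(1) cX(1)] inter(2)[OF coms(2) cX(2)] inter(2)[OF coms(3) cX(3)] inter(2)[OF coms(4) cX(4)] by simp
qed

text \<open>The image of the complementary idempotent $1 - ts$ is realised as a module of smaller dimension.\<close>

lemma split_off_retract: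
  assumes X: "is_hmod n q X" and P: "is_hmod n q P" and s: "is_hom X P s" and t: "is_hom P X t"
    and st: "s * t = 1\<^sub>m (hdim P)"
  obtains Y i2 p2 where "is_hmod n q Y" "biprod X P Y t i2 s p2"
proof -
  define m where "m = hdim X"
  note cX = hmod_carrier[OF X, folded m_def]
  note hs = homD[OF s, folded m_def] and ht = homD[OF t, folded m_def]
  note cP = hmod_carrier[OF P]
  define e where "e = 1\<^sub>m m - t * s"
  have e: "e \<in> carrier_mat m m" using hs(1) ht(1) by (auto simp: e_def)
  have "t * s * (t * s) = t * (s * t) * s" using hs(1) ht(1) by (simp add: mult_assoc_dim)
  then have ts: "t * s * (t * s) = t * s" unfolding st using ht(1) by simp
  have "e * e = 1\<^sub>m m - t * s - (t * s - t * s * (t * s))" unfolding e_def using hs(1) ht(1) by (simp add: mat_alg)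
  also have "\<dots> = e" unfolding ts e_def using hs(1) ht(1) by (intro eq_matI) (simp_all del: index_mult_mat(1))
  finally have ee: "e * e = e" .
  obtain p i r where ir: "i \<in> carrier_mat m p" "r \<in> carrier_mat p m" "e = i * r" "r * i = 1\<^sub>m p"
    by (rule split_idempotent[OF e ee])
  have se: "s * e = 0\<^sub>m (hdim P) m"
  proof -
    have "s * e = s - (s * t) * s" unfolding e_def using hs(1) ht(1) by (simp add: mat_alg)
    then show ?thesis unfolding st using hs(1) by simp
  qed
  have et: "e * t = 0\<^sub>m m (hdim P)"
  proof -
    have "e * t = t - t * (s * t)" unfolding e_def using hs(1) ht(1) by (simp add: mat_alg)
    then show ?thesis unfolding st using ht(1) by simp
  qed
  have ei: "e * i = i" unfolding ir(3) using ir(1,2,4) by (simp add: mult_assoc_dim)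
  have re: "r * e = r" unfolding ir(3) using ir(1,2,4) by (simp add: mult_assoc_dim[symmetric])
  have si: "s * i = 0\<^sub>m (hdim P) p"
  proof -
    have "s * i = (s * e) * i" using ei hs(1) e ir(1) by (simp add: mult_assoc_dim)
    then show ?thesis unfolding se using ir(1) by simp
  qed
  have rt: "r * t = 0\<^sub>m p (hdim P)"
  proof -
    have "r * t = r * (e * t)" using re ht(1) e ir(2) by (simp add: mult_assoc_dim[symmetric])
    then show ?thesis unfolding et using ir(2) by simp
  qed
  have com: "e * Z = Z * e" if "s * Z = Z' * s" "t * Z' = Z * t" "Z \<in> carrier_mat m m" "Z' \<in> carrier_mat (hdim P) (hdim P)" for Z Z'
  proof -
    have "(t * s) * Z = t * (s * Z)" using hs(1) ht(1) that(3) by (simp add: mult_assoc_dim)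
    also have "\<dots> = (t * Z') * s" unfolding that(1) using hs(1) ht(1) that(4) by (simp add: mult_assoc_dim)
    also have "\<dots> = Z * (t * s)" unfolding that(2) using hs(1) ht(1) that(3) by (simp add: mult_assoc_dim)
    finally show ?thesis unfolding e_def using hs(1) ht(1) that(3) by (simp add: minus_mult_dim mult_minus_dim)
  qed
  note coms = com[OF hs(2) ht(2) cX(1) cP(1)] com[OF hs(3) ht(3) cX(2) cP(2)]
    com[OF hs(4) ht(4) cX(3) cP(3)] com[OF hs(5) ht(5) cX(4) cP(4)]
  note im = idempotent_image_hmod[OF X ir(1,2)[unfolded m_def] ir(4) coms[unfolded ir(3)]]
  define Y where "Y = HMod p (r * opa X * i) (r * opb X * i) (r * opc X * i) (r * opd X * i)"
  note hY = im[folded Y_def]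
  have "t * s + i * r = 1\<^sub>m m" unfolding ir(3)[symmetric] e_def using hs(1) ht(1)
    by (intro eq_matI) (simp_all del: index_mult_mat(1))
  moreover have "hdim Y = p" by (simp add: Y_def)
  ultimately have "biprod X P Y t i s r" unfolding biprod_def m_def[symmetric] using s t hY(2,3) st ir(4) si rt by simp
  with hY(1) show ?thesis by (rule that)
qed

text \<open>The map from \<open>X\<close> to \<open>V(j,u)\<close> lifts through the cover; the lift
  is surjective because the cover is essential, and it splits because \<open>P\<close> is
  projective.\<close>

lemma split_off_cover:
  assumes q: "primitive_root n q" and n: "n > 1" and j: "1 \<le> j" "j \<le> n"
    and X: "is_projective n q X" and w: "w \<in> simple_fsp q X j u" "w \<noteq> 0\<^sub>m 1 (hdim X)"
    and P: "is_projective_cover n q P (simple_mod q j u)"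
  obtains Y i1 i2 p1 p2 where "is_projective n q Y" "biprod X P Y i1 i2 p1 p2"
proof -
  let ?V = "simple_mod q j u"
  have hX: "is_hmod n q X" using X by (simp add: is_projective_def)
  have pP: "is_projective n q P" using P by (simp add: is_projective_cover_def)
  then have hP: "is_hmod n q P" by (simp add: is_projective_def)
  have V: "is_hmod n q ?V" by (rule simple_mod_hmod[OF q n j(2)])
  obtain p where ess: "is_essential_epi n q P ?V p" using P by (auto simp: is_projective_cover_def)
  then have "is_epi P ?V p" by (simp add: is_essential_epi_def)
  then obtain p' where p': "p' \<in> carrier_mat (hdim P) (hdim ?V)" "p * p' = 1\<^sub>m (hdim ?V)" and p: "is_hom P ?V p"
    unfolding epi_right_inverse by auto
  note f = simple_hom(1)[OF q n hX j(1) w(1)]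
  obtain G where G: "G \<in> carrier_mat (hdim X) j" "simple_hom X j w * G = 1\<^sub>m j" by (rule simple_hom_epi[OF q n hX j w])
  have fe: "is_epi X ?V (simple_hom X j w)" unfolding epi_right_inverse using f G by auto
  obtain s where s: "is_hom X P s" "p * s = simple_hom X j w" by (rule projectiveD[OF X hP V f p p'])
  obtain y where y: "y \<in> carrier_mat (hdim X) (hdim P)" "s * y = 1\<^sub>m (hdim P)"
    using essential_epi_lifts[OF ess hX s(1)] fe s(2) by metis
  obtain t where t: "is_hom P X t" "s * t = 1\<^sub>m (hdim P)"
    by (rule projectiveD[OF pP hX hP hom_id[OF hmod_square[OF hP]] s(1) y])
  obtain Y i2 p2 where Y: "is_hmod n q Y" "biprod X P Y t i2 s p2"
    by (rule split_off_retract[OF hX hP s(1) t])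
  show ?thesis by (rule that[OF summand_projective[OF Y(2) X Y(1)] Y(2)])
qed

lemma hmod_iso_refl: "square_mod X \<Longrightarrow> X \<cong>\<^sub>H X"
  unfolding hmod_iso_def using hom_id by fastforce

text \<open>Provides the drop in dimension that drives the induction in
  \<open>projective_iso\<close>.\<close>

lemma biprod_hdim:
  assumes b: "biprod S X Y i1 i2 p1 p2" and X: "hdim X > 0"
  shows "hdim Y < hdim S"
proof -
  note d = biprodD[OF b]
  note c = homD(1)[OF d(1)] homD(1)[OF d(2)] homD(1)[OF d(3)] homD(1)[OF d(4)]
  let ?x = "hdim X" and ?y = "hdim Y"
  have "(inl ?x ?y * p1 + inr ?x ?y * p2) * (i1 * prl ?x ?y + i2 * prr ?x ?y)
    = inl ?x ?y * (p1 * i1) * prl ?x ?y + inl ?x ?y * (p1 * i2) * prr ?x ?y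
      + (inr ?x ?y * (p2 * i1) * prl ?x ?y + inr ?x ?y * (p2 * i2) * prr ?x ?y)"
    using c by (simp add: mat_alg mat_add_ac del: embed_simps)
  also have "\<dots> = inl ?x ?y * prl ?x ?y + inr ?x ?y * prr ?x ?y"
    unfolding d(5-8) by (simp del: embed_simps)
  also have "\<dots> = 1\<^sub>m (?x + ?y)" by simp
  finally have "(inl ?x ?y * p1 + inr ?x ?y * p2) * (i1 * prl ?x ?y + i2 * prr ?x ?y) = 1\<^sub>m (?x + ?y)" .
  then have "?x + ?y \<le> hdim S" by (rule right_inverse_le[rotated 2]) (use c in auto)
  then show ?thesis using X by simp
qed

text \<open>A simple quotient of \<open>X\<close> is one of \<open>Y\<close> as well; its cover
  splits off both, and the complements again have equal multiplicities. In dimension 0 a nonzero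
  \<open>Y\<close> would have a simple quotient that \<open>X\<close> does not have.\<close>

theorem projective_iso:
  assumes q: "primitive_root n q" and n: "n > 1"
    and P: "\<And>j u. 1 \<le> j \<Longrightarrow> j \<le> n \<Longrightarrow> is_projective_cover n q (P j u) (simple_mod q j u)"
    and X: "is_projective n q X" and Y: "is_projective n q Y"
    and eq: "\<And>j u. 1 \<le> j \<Longrightarrow> j \<le> n \<Longrightarrow> mult q X j u = mult q Y j u"
  shows "X \<cong>\<^sub>H Y"
  using X Y eq
proof (induction "hdim X" arbitrary: X Y rule: less_induct)
  case less
  have hX: "is_hmod n q X" and hY: "is_hmod n q Y" using less.prems by (auto simp: is_projective_def)
  note sq = hmod_square[OF hX] hmod_square[OF hY]
  have pos: "mult q Z j u > 0" if "is_hmod n q Z" "w \<in> simple_fsp q Z j u" "w \<noteq> 0\<^sub>m 1 (hdim Z)" for Z j u w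
    using rdim_eq_0_iff[OF simple_fsp_subspace[OF hmod_square[OF that(1)], of q j u]] that(2,3)
    by (auto simp: mult_def intro!: gr0I)
  have wit: "\<exists>w. w \<in> simple_fsp q Z j u \<and> w \<noteq> 0\<^sub>m 1 (hdim Z)" if "is_hmod n q Z" "mult q Z j u > 0" for Z j u
  proof (rule ccontr)
    assume "\<not> ?thesis"
    then have "simple_fsp q Z j u = {0\<^sub>m 1 (hdim Z)}"
      using row_subspaceD(2)[OF simple_fsp_subspace[OF hmod_square[OF that(1)], of q j u]] by blast
    then show False using that(2) by (simp add: mult_def rdim_zero)
  qed
  show ?case
  proof (cases "hdim X = 0")
    case True
    have "hdim Y = 0"
    proof (rule ccontr)
      assume "hdim Y \<noteq> 0"
      then have "hdim Y > 0" by simp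
      from simple_quotient_exists[OF q n hY this]
      obtain j u w where j: "1 \<le> j" "j \<le> n" "w \<in> simple_fsp q Y j u" "w \<noteq> 0\<^sub>m 1 (hdim Y)" .
      then have "mult q X j u > 0" using pos[OF hY j(3,4)] less.prems(3) by simp
      then obtain v where "v \<in> simple_fsp q X j u" "v \<noteq> 0\<^sub>m 1 (hdim X)" using wit[OF hX] by blast
      moreover from this(1) have "v \<in> carrier_mat 1 (hdim X)" unfolding simple_fsp_def by (rule fspD(1))
      ultimately show False using True by (auto elim: nonzero_row)
    qed
    have "is_hom X Y (0\<^sub>m (hdim Y) (hdim X))" "is_hom Y X (0\<^sub>m (hdim X) (hdim Y))" using hom_zero sq by blast+
    moreover have "0\<^sub>m (hdim X) (hdim Y) * 0\<^sub>m (hdim Y) (hdim X) = (1\<^sub>m (hdim X) :: 'a mat)"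
      "0\<^sub>m (hdim Y) (hdim X) * 0\<^sub>m (hdim X) (hdim Y) = (1\<^sub>m (hdim Y) :: 'a mat)"
      using True \<open>hdim Y = 0\<close> by auto
    ultimately show ?thesis unfolding hmod_iso_def by blast
  next
    case False
    then have "hdim X > 0" by simp
    from simple_quotient_exists[OF q n hX this]
    obtain j u w where j: "1 \<le> j" "j \<le> n" and w: "w \<in> simple_fsp q X j u" "w \<noteq> 0\<^sub>m 1 (hdim X)" .
    have "mult q Y j u > 0" using pos[OF hX w] less.prems(3)[OF j] by simp
    then obtain v where v: "v \<in> simple_fsp q Y j u" "v \<noteq> 0\<^sub>m 1 (hdim Y)" using wit[OF hY] by blast
    note cov = P[OF j, of u]
    obtain X' i1 i2 p1 p2 where X': "is_projective n q X'" "biprod X (P j u) X' i1 i2 p1 p2"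
      by (rule split_off_cover[OF q n j less.prems(1) w cov])
    obtain Y' k1 k2 r1 r2 where Y': "is_projective n q Y'" "biprod Y (P j u) Y' k1 k2 r1 r2"
      by (rule split_off_cover[OF q n j less.prems(2) v cov])
    have h: "is_hmod n q (P j u)" "is_hmod n q X'" "is_hmod n q Y'"
      using cov X'(1) Y'(1) by (auto simp: is_projective_def is_projective_cover_def)
    note sq' = hmod_square[OF h(1)] hmod_square[OF h(2)] hmod_square[OF h(3)]
    have "hdim (P j u) \<noteq> 0"
    proof
      assume 0: "hdim (P j u) = 0"
      obtain z where "z \<in> simple_fsp q (P j u) j u" "z \<noteq> 0\<^sub>m 1 (hdim (P j u))"
        using cover_functional[OF q n j cov] by metis
      moreover from this(1) have "z \<in> carrier_mat 1 (hdim (P j u))" unfolding simple_fsp_def by (rule fspD(1))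
      ultimately show False using 0 by (auto elim: nonzero_row)
    qed
    then have "hdim X' < hdim X" by (intro biprod_hdim[OF X'(2)]) simp
    moreover have "mult q X' j' u' = mult q Y' j' u'" if "1 \<le> j'" "j' \<le> n" for j' u'
      using mult_biprod[OF X'(2) sq(1) sq'(1,2), of q j' u'] mult_biprod[OF Y'(2) sq(2) sq'(1,3), of q j' u']
        less.prems(3)[OF that, of u'] by simp
    ultimately have "X' \<cong>\<^sub>H Y'" using less.hyps X'(1) Y'(1) by blast
    then show ?thesis
      using biprod_iso[OF X'(2) Y'(2) hmod_iso_refl[OF sq'(1)] _ sq(1) sq'(1,2) sq(2) sq'(1,3)] by blast
  qed
qed

lemma simple_mod_n_cover:
  assumes q: "primitive_root n q" and n: "n > 1"
  shows "is_projective_cover n q (simple_mod q n u) (simple_mod q n u)"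
proof -
  let ?V = "simple_mod q n u"
  have V: "is_projective n q ?V" by (rule simple_mod_n_projective[OF q n])
  then have hV: "is_hmod n q ?V" by (simp add: is_projective_def)
  have i: "is_hom ?V ?V (1\<^sub>m n)" using hom_id[OF hmod_square[OF hV]] by simp
  have "is_essential_epi n q ?V ?V (1\<^sub>m n)" unfolding is_essential_epi_def
  proof (intro conjI allI impI)
    show "is_epi ?V ?V (1\<^sub>m n)" unfolding epi_right_inverse using i by (auto intro!: bexI[of _ "1\<^sub>m n"])
    fix X g assume *: "is_hmod n q X \<and> is_hom X ?V g \<and> is_epi X ?V (1\<^sub>m n * g)"
    then have "dim_row g = n" using hom_dim by fastforce
    with * show "is_epi X ?V g" by simp
  qed
  with V show ?thesis unfolding is_projective_cover_def by blast
qed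

lemma is_P_cover:
  assumes q: "primitive_root n q" and n: "n > 1" and P: "is_P n q j u P"
  shows "is_projective_cover n q P (simple_mod q j u)"
  using P simple_mod_n_cover[OF q n] unfolding is_P_def by auto

section \<open>Projective modules are free over $k[d]$\<close>

lemma mult_kron_one_row:
  fixes a :: "'k::field mat"
  assumes "dim_col a = p" "dim_row e = 1"
  shows "a * kron (1\<^sub>m p) e = kron a e"
proof -
  have "kron a (1\<^sub>m 1) * kron (1\<^sub>m p) e = kron (a * 1\<^sub>m p) (1\<^sub>m 1 * e)" using assms by (intro kron_mult) auto
  then show ?thesis using assms by simp
qed

text \<open>The module \<open>W\<close> below is free over $k[d]$ and has the trivial module as a quotient, so that
  \<open>P\<close> is a direct summand of \<open>P \<otimes> W\<close>.\<close>

lemma projective_d_divisible: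
  assumes q: "primitive_root n q" and n: "n > 1" and P: "is_projective n q P" and z: "z \<in> fsp q P x y 1 n"
  obtains w where "w \<in> carrier_mat 1 (hdim P)" "w * opb P = q powi (x + 1) \<cdot>\<^sub>m w" "w * opc P = q powi (y + 1) \<cdot>\<^sub>m w"
    "w * opd P ^\<^sub>m (n - 1) = z"
proof -
  note p = primitive_rootD[OF q] and q1 = root_ne_1[OF q n]
  have hP: "is_hmod n q P" using P by (simp add: is_projective_def)
  note c = hmod_carrier[OF hP] and zd = fspD[OF z]
  have zD: "z * opd P = 0\<^sub>m 1 (hdim P)" using zd(4) c(4) by simp
  \<comment> \<open>With both starting weights equal to \<open>q\<close> the last basis vector of
    \<open>W\<close> has weights \<open>q^n = 1\<close>, and \<open>q^n = 1\<close> also closes the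
    recursion at length \<open>n\<close>. The coefficients are put on \<open>a\<close>, so that
    \<open>d\<close> acts as one full Jordan block.\<close>
  define \<delta> where "\<delta> = chain_coeff q 2"
  define W where "W = chain_mod q n 1 1 (\<lambda>c. \<delta> (Suc c)) (\<lambda>_. 1)"
  have rec: "chain_rec q n (1 + 1) \<delta>" unfolding \<delta>_def one_add_one by (rule chain_rec_coeff[OF p(3) q1]) (simp add: p(2))
  have W: "is_hmod n q W" unfolding W_def by (rule chain_mod_hmod[OF q order.refl rec]) simp
  have Wd: "hdim W = n" by (simp add: W_def)
  note cW = hmod_carrier[OF W, unfolded Wd]
  note row = chain_mod_row[of _ n q 1 1 "\<lambda>c. \<delta> (Suc c)" "\<lambda>_. 1", folded W_def]
  have l: "n - 1 < n" and l0: "0 < n" using n by auto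
  let ?p = "hdim P"
  let ?e = "urow n (n - 1) :: 'a mat"
  \<comment> \<open>Hence \<open>a\<close> kills the last coordinate functional of \<open>W\<close>.
    As \<open>d\<close> kills it too and its weights are 1, it is a homomorphism to the trivial
    module.\<close>
  have "\<delta> (n - 1) = 0"
  proof -
    have "int (n - 1) + 2 - 1 = int n" using n by (simp add: of_nat_diff)
    then show ?thesis unfolding \<delta>_def chain_coeff_def using p(2) by simp
  qed
  then have eA: "?e * opa W = 0\<^sub>m 1 n" using row(1)[OF l] n Suc_diff_Suc[of 1 n] by (simp add: zero_smult_mat numeral_2_eq_2 One_nat_def)
  have pn: "q powi (1 + int (n - 1)) = 1"
  proof -
    have "1 + int (n - 1) = int n" using n by (simp add: of_nat_diff)
    then show ?thesis using p(2) by simp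
  qed
  have eB: "?e * opb W = ?e" "?e * opc W = ?e" using row(2,3)[OF l] by (simp_all add: pn)
  have eD: "?e * opd W = 0\<^sub>m 1 n" using row(4)[OF l] n by simp
  define g where "g = kron (1\<^sub>m ?p) ?e"
  have gc: "g \<in> carrier_mat ?p (?p * n)" unfolding g_def using kron_carrier[OF one_carrier_mat special_carrier(1)] by simp
  have PW: "is_hmod n q (P \<otimes>\<^sub>H W)" by (rule htensor_hmod[OF q hP W])
  have PWd: "hdim (P \<otimes>\<^sub>H W) = ?p * n" by (simp add: Wd)
  note [simp] = hmod_dim[OF hP] hmod_dim[OF W, unfolded Wd]
  have g: "is_hom (P \<otimes>\<^sub>H W) P g"
    unfolding is_hom_def PWd unfolding htensor_sel
    using gc c cW by (simp add: g_def mult_kron_one_row mult_add_dim kron_mult eA eB eD)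
  have "g * kron (1\<^sub>m ?p) (ucol n (n - 1)) = 1\<^sub>m ?p"
  proof -
    have "?e * ucol n (n - 1) = 1\<^sub>m 1" using mult_ucol[of "n - 1" ?e] l by (auto simp: urow_def intro!: eq_matI)
    then show ?thesis unfolding g_def by (simp add: kron_mult)
  qed
  moreover have "kron (1\<^sub>m ?p) (ucol n (n - 1)) \<in> carrier_mat (hdim (P \<otimes>\<^sub>H W)) ?p"
    unfolding PWd using kron_carrier[OF one_carrier_mat special_carrier(2)] by simp
  ultimately obtain h where h: "is_hom P (P \<otimes>\<^sub>H W) h" "g * h = 1\<^sub>m ?p"
    using projectiveD[OF P PW hP hom_id[OF hmod_square[OF hP]] g] by metis
  note hh = homD[OF h(1), unfolded PWd]
  note cPW = hmod_carrier[OF PW, unfolded PWd]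
  note zc = zd(1)
  have kc: "kron z (urow n i) \<in> carrier_mat 1 (?p * n)" for i
    using kron_carrier[OF zc special_carrier(1)] by simp
  \<comment> \<open>Since \<open>z d = 0\<close>, only the factor in \<open>W\<close> is moved by
    \<open>d\<close>.\<close>
  have Di: "kron z (urow n 0) * opd (P \<otimes>\<^sub>H W) ^\<^sub>m i = kron z (urow n i)" if "i < n" for i
    using that
  proof (induction i)
    case (Suc i)
    have "kron z (urow n 0) * opd (P \<otimes>\<^sub>H W) ^\<^sub>m Suc i = (kron z (urow n 0) * opd (P \<otimes>\<^sub>H W) ^\<^sub>m i) * opd (P \<otimes>\<^sub>H W)"
      using cPW(4) carrier_matD[OF kc[of 0]] by (simp add: mult_assoc_dim del: htensor_sel dim_kron)
    also have "\<dots> = kron z (urow n i) * opd (P \<otimes>\<^sub>H W)" using Suc by simp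
    also have "\<dots> = kron (z * opd P) (urow n i * opc W) + kron z (urow n i * opd W)"
      using zc by (simp add: mult_add_dim kron_mult)
    also have "\<dots> = kron z (urow n (Suc i))" unfolding zD using row(4)[of i] Suc.prems zc by simp
    finally show ?case .
  qed (use cPW(4) kc[of 0] in \<open>simp del: htensor_sel dim_kron\<close>)
  \<comment> \<open>\<open>d^(n-1)\<close> carries the functional \<open>z \<otimes> e_0\<close> to
    \<open>z \<otimes> e_(n-1)\<close>, which is \<open>z g\<close>; pulled back along the section
    \<open>h\<close> of \<open>g\<close> it becomes \<open>z\<close>.\<close>
  define w where "w = kron z (urow n 0) * h"
  have wc: "w \<in> carrier_mat 1 ?p" unfolding w_def by (rule mult_carrier_mat[OF kc hh(1)])
  have wt: "w * opb P = q powi (x + 1) \<cdot>\<^sub>m w" "w * opc P = q powi (y + 1) \<cdot>\<^sub>m w"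
  proof -
    have "w * opb P = kron z (urow n 0) * (h * opb P)" unfolding w_def using carrier_matD[OF kc[of 0]] hh(1) by (simp add: mult_assoc_dim del: dim_kron)
    also have "\<dots> = kron z (urow n 0) * opb (P \<otimes>\<^sub>H W) * h" unfolding hh(3)
      using carrier_matD[OF kc[of 0]] hh(1) cPW by (simp add: mult_assoc_dim del: dim_kron htensor_sel)
    also have "kron z (urow n 0) * opb (P \<otimes>\<^sub>H W) = q powi (x + 1) \<cdot>\<^sub>m kron z (urow n 0)"
      using zc row(2)[OF l0] p(3) by (simp add: kron_mult zd(2) kron_smult_left kron_smult_right smult_smult_mat power_int_add mult.commute)
    finally show "w * opb P = q powi (x + 1) \<cdot>\<^sub>m w" unfolding w_def
      using carrier_matD[OF kc[of 0]] hh(1) by (simp add: smult_mult_dim del: dim_kron)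
    have "w * opc P = kron z (urow n 0) * (h * opc P)" unfolding w_def using carrier_matD[OF kc[of 0]] hh(1) by (simp add: mult_assoc_dim del: dim_kron)
    also have "\<dots> = kron z (urow n 0) * opc (P \<otimes>\<^sub>H W) * h" unfolding hh(4)
      using carrier_matD[OF kc[of 0]] hh(1) cPW by (simp add: mult_assoc_dim del: dim_kron htensor_sel)
    also have "kron z (urow n 0) * opc (P \<otimes>\<^sub>H W) = q powi (y + 1) \<cdot>\<^sub>m kron z (urow n 0)"
      using zc row(3)[OF l0] p(3) by (simp add: kron_mult zd(3) kron_smult_left kron_smult_right smult_smult_mat power_int_add mult.commute)
    finally show "w * opc P = q powi (y + 1) \<cdot>\<^sub>m w" unfolding w_def
      using carrier_matD[OF kc[of 0]] hh(1) by (simp add: smult_mult_dim del: dim_kron)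
  qed
  have "w * opd P ^\<^sub>m (n - 1) = kron z (urow n 0) * (h * opd P ^\<^sub>m (n - 1))"
    unfolding w_def using carrier_matD[OF kc[of 0]] hh(1) c by (simp add: mult_assoc_dim del: dim_kron)
  also have "h * opd P ^\<^sub>m (n - 1) = opd (P \<otimes>\<^sub>H W) ^\<^sub>m (n - 1) * h"
    by (rule pow_mat_intertwine[OF c(4) cPW(4) hh(1,5)])
  also have "kron z (urow n 0) * (opd (P \<otimes>\<^sub>H W) ^\<^sub>m (n - 1) * h) = (kron z (urow n 0) * opd (P \<otimes>\<^sub>H W) ^\<^sub>m (n - 1)) * h"
    using carrier_matD[OF kc[of 0]] hh(1) cPW by (simp add: mult_assoc_dim del: dim_kron htensor_sel)
  also have "\<dots> = (z * g) * h" unfolding Di[OF l] g_def using zc by (simp add: mult_kron_one_row)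
  also have "\<dots> = z" using h(2) zc gc hh(1) by (simp add: mult_assoc_dim)
  finally show ?thesis using that wc wt by blast
qed

text \<open>On the functionals killed by \<open>d^(j+1)\<close>, the map \<open>d^j\<close> has
  kernel those killed by \<open>d^j\<close>. It reaches every functional killed by \<open>d\<close>
  of the shifted weights, because these are divisible by \<open>d^(n-1)\<close>.\<close>

lemma rdim_fsp_d_filtration:
  assumes q: "primitive_root n q" and n: "n > 1" and P: "is_projective n q P" and j: "j \<le> n"
  shows "rdim (hdim P) (fsp q P x y j n) = (\<Sum>i<j. rdim (hdim P) (fsp q P (x + int i) (y + int i) 1 n))"
  using j
proof (induction j)
  case 0
  have hP: "is_hmod n q P" using P by (simp add: is_projective_def)
  have "fsp q P x y 0 n = {0\<^sub>m 1 (hdim P)}"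
    using row_subspaceD(2)[OF fsp_subspace[OF hmod_square[OF hP], of q x y 0 n]] hmod_carrier[OF hP]
    by (auto simp: fsp_def)
  then show ?case by (simp add: rdim_zero)
next
  case (Suc j)
  have hP: "is_hmod n q P" using P by (simp add: is_projective_def)
  note sq = hmod_square[OF hP] and c = hmod_carrier[OF hP] and p = primitive_rootD[OF q]
  note [simp] = hmod_dim[OF hP]
  have An: "w * opa P ^\<^sub>m n = 0\<^sub>m 1 (hdim P)" if "w \<in> carrier_mat 1 (hdim P)" for w
    using hmod_powers(1)[OF hP] that by simp
  let ?T = "opd P ^\<^sub>m j"
  have Tc: "?T \<in> carrier_mat (hdim P) (hdim P)" using c by simp
  have ker: "{w \<in> fsp q P x y (Suc j) n. w * ?T = 0\<^sub>m 1 (hdim P)} = fsp q P x y j n"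
  proof (intro equalityI subsetI)
    fix w assume w: "w \<in> fsp q P x y j n"
    note d = fspD[OF w]
    have "w * opd P ^\<^sub>m Suc j = (w * opd P ^\<^sub>m j) * opd P" using d(1) c by (simp add: mult_assoc_dim)
    then have "w * opd P ^\<^sub>m Suc j = 0\<^sub>m 1 (hdim P)" unfolding d(4) by simp
    then show "w \<in> {w \<in> fsp q P x y (Suc j) n. w * ?T = 0\<^sub>m 1 (hdim P)}" using d fspI by blast
  next
    fix w assume "w \<in> {w \<in> fsp q P x y (Suc j) n. w * ?T = 0\<^sub>m 1 (hdim P)}"
    then have w: "w \<in> fsp q P x y (Suc j) n" "w * ?T = 0\<^sub>m 1 (hdim P)" by auto
    note d = fspD[OF w(1)]
    show "w \<in> fsp q P x y j n" by (rule fspI[OF d(1-3) w(2) d(5)])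
  qed
  have im: "{w * ?T | w. w \<in> fsp q P x y (Suc j) n} = fsp q P (x + int j) (y + int j) 1 n"
  proof (intro equalityI subsetI)
    fix v assume "v \<in> {w * ?T | w. w \<in> fsp q P x y (Suc j) n}"
    then obtain w where w: "w \<in> fsp q P x y (Suc j) n" "v = w * ?T" by blast
    note d = fspD[OF w(1)]
    note wt = functional_power_weights(3,4)[OF p(3) hP d(1-3), of j]
    have vc: "v \<in> carrier_mat 1 (hdim P)" unfolding w(2) by (rule mult_carrier_mat[OF d(1) Tc])
    have "v * opd P = w * opd P ^\<^sub>m Suc j" unfolding w(2) using d(1) c by (simp add: mult_assoc_dim)
    then have "v * opd P ^\<^sub>m 1 = 0\<^sub>m 1 (hdim P)" using d(4) c(4) by simp
    then show "v \<in> fsp q P (x + int j) (y + int j) 1 n"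
      using wt[folded w(2)] vc An[OF vc] by (intro fspI) auto
  next
    fix v assume v: "v \<in> fsp q P (x + int j) (y + int j) 1 n"
    obtain w where w: "w \<in> carrier_mat 1 (hdim P)" "w * opb P = q powi (x + int j + 1) \<cdot>\<^sub>m w"
      "w * opc P = q powi (y + int j + 1) \<cdot>\<^sub>m w" "w * opd P ^\<^sub>m (n - 1) = v"
      by (rule projective_d_divisible[OF q n P v])
    \<comment> \<open>Stopping at \<open>d^k\<close> leaves exactly \<open>j\<close> steps to reach
      \<open>v\<close>; the weights return to \<open>x\<close> and \<open>y\<close> because
      \<open>j + 1 + k = n\<close>.\<close>
    define k where "k = n - 1 - j"
    have k: "n - 1 = k + j" using Suc.prems by (simp add: k_def)
    note wt = functional_power_weights(3,4)[OF p(3) hP w(1-3), of k]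
    define t where "t = w * opd P ^\<^sub>m k"
    have tc: "t \<in> carrier_mat 1 (hdim P)" unfolding t_def by (rule mult_carrier_mat[OF w(1) pow_carrier_mat[OF c(4)]])
    have tT: "t * ?T = v" unfolding t_def w(4)[symmetric] k pow_mat_add[OF c(4)] using w(1) c by (simp add: mult_assoc_dim)
    have m: "(x + int j + 1 + int k) mod int n = x mod int n" "(y + int j + 1 + int k) mod int n = y mod int n"
    proof -
      have "int j + 1 + int k = int n" using k n by linarith
      then have "x + int j + 1 + int k = x + int n" "y + int j + 1 + int k = y + int n" by linarith+
      then show "(x + int j + 1 + int k) mod int n = x mod int n" "(y + int j + 1 + int k) mod int n = y mod int n"
        by (simp_all only: mod_add_self2)
    qed
    have "t * opd P ^\<^sub>m Suc j = v * opd P" unfolding tT[symmetric] using tc c by (simp add: mult_assoc_dim)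
    then have "t * opd P ^\<^sub>m Suc j = 0\<^sub>m 1 (hdim P)" using fspD(4)[OF v] c(4) by simp
    then have "t \<in> fsp q P (x + int j + 1 + int k) (y + int j + 1 + int k) (Suc j) n"
      using wt tc An[OF tc] unfolding t_def[symmetric] by (intro fspI) auto
    then have "t \<in> fsp q P x y (Suc j) n" unfolding fsp_cong[OF q m] .
    then show "v \<in> {w * ?T | w. w \<in> fsp q P x y (Suc j) n}" using tT by blast
  qed
  have "rdim (hdim P) (fsp q P x y (Suc j) n) = rdim (hdim P) (fsp q P x y j n) + rdim (hdim P) (fsp q P (x + int j) (y + int j) 1 n)"
    using rdim_rank_nullity[OF fsp_subspace[OF sq] Tc, of q x y "Suc j" n] unfolding ker im .
  then show ?case using Suc by simp
qed

section \<open>Homomorphisms out of $P \otimes Z$\<close>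

text \<open>Equivariance of \<open>f\<close> in terms of its restrictions \<open>F k\<close> to
  \<open>P \<otimes> z_k\<close>. The equation for \<open>a\<close> computes each slice from the
  previous one and becomes a closing condition at \<open>k = n - 1\<close>.\<close>

lemma slice_hom_iff:
  fixes f :: "'k::field mat"
  assumes P: "square_mod P" and V: "square_mod V" and f: "f \<in> carrier_mat (hdim V) (hdim P * n)"
    and F: "\<And>k. k < n \<Longrightarrow> F k = f * kron (1\<^sub>m (hdim P)) (ucol n k)"
  shows "is_hom (P \<otimes>\<^sub>H chain_mod q n e g (\<lambda>_. 1) \<delta>) V f \<longleftrightarrow> (\<forall>k<n.
     q powi (e + int k) \<cdot>\<^sub>m (F k * opa P) + (if Suc k < n then F (Suc k) else 0\<^sub>m (hdim V) (hdim P)) = opa V * F k \<and>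
     q powi (e + int k) \<cdot>\<^sub>m (F k * opb P) = opb V * F k \<and>
     q powi (g + int k) \<cdot>\<^sub>m (F k * opc P) = opc V * F k \<and>
     q powi (g + int k) \<cdot>\<^sub>m (F k * opd P) + (if k = 0 then 0\<^sub>m (hdim V) (hdim P) else \<delta> k \<cdot>\<^sub>m F (k - 1)) = opd V * F k)"
proof -
  let ?Z = "chain_mod q n e g (\<lambda>_. 1) \<delta>" and ?p = "hdim P" and ?v = "hdim V"
  note cP = square_modD[OF P] and cV = square_modD[OF V]
  note [simp] = square_mod_dim[OF P] square_mod_dim[OF V] carrier_matD[OF f]
  note col = chain_mod_col[of _ n q e g "\<lambda>_. 1" \<delta>]
  have kr: "f * kron S T * kron (1\<^sub>m ?p) (ucol n k) = f * kron S (T * ucol n k)"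
    if "S \<in> carrier_mat ?p ?p" "T \<in> carrier_mat n n" for S T k
    using that by (simp add: mult_assoc_dim kron_mult)
  have sl: "f * kron S (ucol n k) = F k * S" if "k < n" "S \<in> carrier_mat ?p ?p" for k S
    unfolding F[OF that(1)] kron_one_ucol_mult[OF that(2), symmetric] using that(2) by (simp add: mult_assoc_dim)
  have eqs: "G = H \<longleftrightarrow> (\<forall>k<n. G * kron (1\<^sub>m ?p) (ucol n k) = H * kron (1\<^sub>m ?p) (ucol n k))"
    if "G \<in> carrier_mat ?v (?p * n)" "H \<in> carrier_mat ?v (?p * n)" for G H :: "'k mat"
    using slice_eqI[OF that] by blast
  have R: "Z * f * kron (1\<^sub>m ?p) (ucol n k) = Z * F k" if "k < n" "Z \<in> carrier_mat ?v ?v" for Z k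
    unfolding F[OF that(1)] using that(2) by (simp add: mult_assoc_dim)
  note sqZ = square_modD[OF chain_mod_square[of q n e g "\<lambda>_. 1" \<delta>], unfolded chain_mod_dim]
  have fm: "f * kron S T \<in> carrier_mat ?v (?p * n)" if "S \<in> carrier_mat ?p ?p" "T \<in> carrier_mat n n" for S T
    using that f by (intro mult_carrier_mat[of _ _ "?p * n"] kron_carrier)
  have fU: "f * kron S T * kron (1\<^sub>m ?p) (ucol n k) = s k \<cdot>\<^sub>m (F k * S)"
    if S: "S \<in> carrier_mat ?p ?p" and T: "T \<in> carrier_mat n n"
      and Tk: "\<And>k. k < n \<Longrightarrow> T * ucol n k = s k \<cdot>\<^sub>m ucol n k" and k: "k < n" for S T s k
    unfolding kr[OF S T] Tk[OF k] kron_smult_right using S sl[OF k S] by (simp add: mult_smult_dim)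
  have Zf: "Z * f \<in> carrier_mat ?v (?p * n)" if "Z \<in> carrier_mat ?v ?v" for Z by (rule mult_carrier_mat[OF that f])
  have diag: "f * kron S T = Z * f \<longleftrightarrow> (\<forall>k<n. s k \<cdot>\<^sub>m (F k * S) = Z * F k)"
    if S: "S \<in> carrier_mat ?p ?p" and T: "T \<in> carrier_mat n n" and Z: "Z \<in> carrier_mat ?v ?v"
      and Tk: "\<And>k. k < n \<Longrightarrow> T * ucol n k = s k \<cdot>\<^sub>m ucol n k" for S T Z s
    unfolding eqs[OF fm[OF S T] Zf[OF Z]] using fU[OF S T Tk] R[OF _ Z] by simp
  have skew: "f * (kron S T + kron (1\<^sub>m ?p) U) = Z * f \<longleftrightarrow> (\<forall>k<n. s k \<cdot>\<^sub>m (F k * S) + H k = Z * F k)"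
    if S: "S \<in> carrier_mat ?p ?p" and T: "T \<in> carrier_mat n n" and U: "U \<in> carrier_mat n n" and Z: "Z \<in> carrier_mat ?v ?v"
      and Tk: "\<And>k. k < n \<Longrightarrow> T * ucol n k = s k \<cdot>\<^sub>m ucol n k"
      and Uk: "\<And>k. k < n \<Longrightarrow> f * kron (1\<^sub>m ?p) (U * ucol n k) = H k" for S T U Z s H
  proof -
    have add: "f * (kron S T + kron (1\<^sub>m ?p) U) = f * kron S T + f * kron (1\<^sub>m ?p) U"
      using S T U by (simp add: mult_add_dim)
    have "(f * kron S T + f * kron (1\<^sub>m ?p) U) * kron (1\<^sub>m ?p) (ucol n k) = s k \<cdot>\<^sub>m (F k * S) + H k" if k: "k < n" for k
    proof -
      have "(f * kron S T + f * kron (1\<^sub>m ?p) U) * kron (1\<^sub>m ?p) (ucol n k)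
         = f * kron S T * kron (1\<^sub>m ?p) (ucol n k) + f * kron (1\<^sub>m ?p) U * kron (1\<^sub>m ?p) (ucol n k)"
        using S T U by (simp add: add_mult_dim)
      moreover have "f * kron S T * kron (1\<^sub>m ?p) (ucol n k) = s k \<cdot>\<^sub>m (F k * S)" by (rule fU[OF S T _ k]) (rule Tk)
      ultimately show ?thesis unfolding kr[OF one_carrier_mat U] Uk[OF k] by simp
    qed
    note * = this
    have "f * kron S T + f * kron (1\<^sub>m ?p) U \<in> carrier_mat ?v (?p * n)"
      by (rule add_carrier_mat[OF fm[OF one_carrier_mat U]])
    from eqs[OF this Zf[OF Z]] show ?thesis unfolding add using * R[OF _ Z] by simp
  qed
  have a: "f * (kron (opa P) (opb ?Z) + kron (1\<^sub>m ?p) (opa ?Z)) = opa V * f \<longleftrightarrow>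
     (\<forall>k<n. q powi (e + int k) \<cdot>\<^sub>m (F k * opa P) + (if Suc k < n then F (Suc k) else 0\<^sub>m ?v ?p) = opa V * F k)"
    by (rule skew[OF cP(1) sqZ(2) sqZ(1) cV(1) col(2)]) (auto simp: col F)
  have d: "f * (kron (opd P) (opc ?Z) + kron (1\<^sub>m ?p) (opd ?Z)) = opd V * f \<longleftrightarrow>
     (\<forall>k<n. q powi (g + int k) \<cdot>\<^sub>m (F k * opd P) + (if k = 0 then 0\<^sub>m ?v ?p else \<delta> k \<cdot>\<^sub>m F (k - 1)) = opd V * F k)"
    by (rule skew[OF cP(4) sqZ(3) sqZ(4) cV(4) col(3)]) (auto simp: col F kron_smult_right mult_smult_dim)
  have b: "f * kron (opb P) (opb ?Z) = opb V * f \<longleftrightarrow> (\<forall>k<n. q powi (e + int k) \<cdot>\<^sub>m (F k * opb P) = opb V * F k)"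
    by (rule diag[OF cP(2) sqZ(2) cV(2)]) (rule col(2))
  have c: "f * kron (opc P) (opc ?Z) = opc V * f \<longleftrightarrow> (\<forall>k<n. q powi (g + int k) \<cdot>\<^sub>m (F k * opc P) = opc V * F k)"
    by (rule diag[OF cP(3) sqZ(3) cV(3)]) (rule col(3))
  have all4: "(\<forall>k<n. p k) \<and> (\<forall>k<n. p' k) \<and> (\<forall>k<n. p'' k) \<and> (\<forall>k<n. p''' k) \<longleftrightarrow> (\<forall>k<n. p k \<and> p' k \<and> p'' k \<and> p''' k)"
    for p p' p'' p''' by blast
  have conj_absorb: "p \<Longrightarrow> (p \<and> p') = p'" for p p' by blast
  show ?thesis unfolding is_hom_def htensor_sel chain_mod_dim a b c d all4 by (rule conj_absorb[OF f])
qed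

text \<open>The recursion $F_{k+1} = a F_k - q^{e+k} F_k a$ stops after $n$ steps: in vectorised form it is
  the sum of two $q$-commuting nilpotent operators.\<close>

lemma slice_recursion_stops:
  fixes F :: "nat \<Rightarrow> 'k::field mat"
  assumes q: "primitive_root n q" and P: "is_hmod n q P" and V: "is_hmod n q V"
    and F0: "F 0 \<in> carrier_mat (hdim V) (hdim P)"
    and Suc: "\<And>k. F (Suc k) = opa V * F k - q powi (e + int k) \<cdot>\<^sub>m (F k * opa P)"
    and B: "\<And>k. opb V * F k = q powi (e + int k) \<cdot>\<^sub>m (F k * opb P)"
  shows "F n = 0\<^sub>m (hdim V) (hdim P)"
proof -
  let ?p = "hdim P" and ?v = "hdim V"
  note p = primitive_rootD[OF q]
  note cP = hmod_carrier[OF P] and cV = hmod_carrier[OF V]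
  note [simp] = hmod_dim[OF P] hmod_dim[OF V]
  define Bi where "Bi = opb P ^\<^sub>m (n - 1)"
  have Bi: "Bi \<in> carrier_mat ?p ?p" unfolding Bi_def by (rule pow_carrier_mat[OF cP(2)])
  then have [simp]: "dim_row Bi = ?p" "dim_col Bi = ?p" by auto
  define w where "w = q ^ (n - 1)"
  have BiA: "Bi * opa P = w \<cdot>\<^sub>m (opa P * Bi)" unfolding Bi_def w_def
    by (rule pow_mat_qcomm'[OF cP(1,2) hmod_relations(1)[OF P]])
  have BB: "opb P * Bi = 1\<^sub>m ?p" unfolding Bi_def by (rule hmod_inverses(1)[OF q P])
  have Fc: "F k \<in> carrier_mat ?v ?p" for k
  proof (induction k)
    case (Suc k)
    then show ?case unfolding assms(5) by (intro carrier_matI) auto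
  qed (rule F0)
  then have [simp]: "dim_row (F k) = ?v" "dim_col (F k) = ?p" for k using carrier_matD by blast+
  \<comment> \<open>Inserting \<open>b b^(-1)\<close> and using the equation for \<open>b\<close>
    absorbs the scalar \<open>q^(e+k)\<close>, so that the same linear operator is applied in every
    step; here \<open>w = q^(-1)\<close>.\<close>
  have rec: "F (Suc k) = opa V * F k + (- w \<cdot>\<^sub>m opb V) * F k * (opa P * Bi)" for k
  proof -
    have "q powi (e + int k) \<cdot>\<^sub>m (F k * opa P) = q powi (e + int k) \<cdot>\<^sub>m (F k * (opb P * Bi * opa P))"
      unfolding BB using cP by simp
    also have "\<dots> = (q powi (e + int k) \<cdot>\<^sub>m (F k * opb P)) * (Bi * opa P)" by (simp add: mat_alg)
    also have "\<dots> = w \<cdot>\<^sub>m (opb V * F k * (opa P * Bi))" unfolding B[symmetric] BiA by (simp add: mat_alg)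
    finally have eq: "q powi (e + int k) \<cdot>\<^sub>m (F k * opa P) = w \<cdot>\<^sub>m (opb V * F k * (opa P * Bi))" .
    have "(- w \<cdot>\<^sub>m opb V) * F k * (opa P * Bi) = - w \<cdot>\<^sub>m (opb V * F k * (opa P * Bi))" by (simp add: mat_alg)
    then show ?thesis unfolding assms(5) eq by (intro eq_matI) (simp_all del: index_mult_mat(1))
  qed
  let ?c = "curry_mat ?v 1 ?p"
  define X where "X = kron (opa V) (1\<^sub>m ?p)"
  define Y where "Y = kron (- w \<cdot>\<^sub>m opb V) (opa P * Bi)\<^sup>T"
  have AB: "opa P * Bi \<in> carrier_mat ?p ?p" by (rule mult_carrier_mat[OF cP(1) Bi])
  have Bw: "- w \<cdot>\<^sub>m opb V \<in> carrier_mat ?v ?v" using cV by simp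
  have X: "X \<in> carrier_mat (?v * ?p) (?v * ?p)" unfolding X_def by (rule kron_carrier[OF cV(1) one_carrier_mat])
  have Y: "Y \<in> carrier_mat (?v * ?p) (?v * ?p)" unfolding Y_def using AB by (intro kron_carrier[OF Bw]) simp
  have YX: "Y * X = q \<cdot>\<^sub>m (X * Y)"
    unfolding X_def Y_def by (simp add: kron_mult mat_alg hmod_relations(1)[OF V] kron_smult_left mult_ac)
  have Xn: "X ^\<^sub>m n = 0\<^sub>m (?v * ?p) (?v * ?p)"
    unfolding X_def kron_pow[OF cV(1) one_carrier_mat] hmod_powers(1)[OF V] using pow_mat_dim by simp
  \<comment> \<open>Up to sign the second tensor factor of \<open>Y\<close> is the action of
    \<open>a\<close> on the dual of \<open>P\<close>.\<close>
  have Yn: "Y ^\<^sub>m n = 0\<^sub>m (?v * ?p) (?v * ?p)"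
  proof -
    have T: "(opa P * Bi)\<^sup>T \<in> carrier_mat ?p ?p" using AB by simp
    have "(- (opa P * Bi)\<^sup>T) ^\<^sub>m n = 0\<^sub>m ?p ?p"
      using hmod_powers(1)[OF hdual_hmod[OF q P]] unfolding Bi_def by simp
    moreover have "- (opa P * Bi)\<^sup>T \<in> carrier_mat ?p ?p" using T by simp
    ultimately have "(- (- (opa P * Bi)\<^sup>T)) ^\<^sub>m n = 0\<^sub>m ?p ?p" by (rule uminus_pow_mat_zero[rotated])
    moreover have "- (- (opa P * Bi)\<^sup>T) = (opa P * Bi)\<^sup>T" by (rule eq_matI) auto
    ultimately have "((opa P * Bi)\<^sup>T) ^\<^sub>m n = 0\<^sub>m ?p ?p" by simp
    then show ?thesis unfolding Y_def kron_pow[OF Bw T] using Bw by (simp add: carrier_matD[OF pow_carrier_mat[OF Bw]])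
  qed
  have step: "?c (F (Suc k)) = (X + Y) * ?c (F k)" for k
  proof -
    have f: "F k \<in> carrier_mat ?v (1 * ?p)" using Fc by simp
    have "?c (opa V * F k * kron (1\<^sub>m 1) (1\<^sub>m ?p)) = X * ?c (F k) * 1\<^sub>m 1"
      unfolding X_def using curry_mult_kron[OF cV(1) f one_carrier_mat one_carrier_mat] by simp
    then have 1: "?c (opa V * F k) = X * ?c (F k)" by (simp add: mult_assoc_dim X_def)
    have "?c ((- w \<cdot>\<^sub>m opb V) * F k * kron (1\<^sub>m 1) (opa P * Bi)) = Y * ?c (F k) * 1\<^sub>m 1"
      unfolding Y_def by (rule curry_mult_kron[OF Bw f one_carrier_mat AB])
    then have 2: "?c ((- w \<cdot>\<^sub>m opb V) * F k * (opa P * Bi)) = Y * ?c (F k)"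
      using Y by (simp add: mult_assoc_dim)
    have "?c (F (Suc k)) = ?c (opa V * F k) + ?c ((- w \<cdot>\<^sub>m opb V) * F k * (opa P * Bi))"
      unfolding rec by (rule curry_add) (auto intro!: carrier_matI)
    then show ?thesis unfolding 1 2 using X Y by (simp add: add_mult_dim)
  qed
  have XY: "X + Y \<in> carrier_mat (?v * ?p) (?v * ?p)" using Y by simp
  have "?c (F k) = (X + Y) ^\<^sub>m k * ?c (F 0)" for k
  proof (induction k)
    case 0
    show ?case using carrier_matD[OF Y] by simp
  next
    case (Suc k)
    have "(X + Y) ^\<^sub>m Suc k * ?c (F 0) = (X + Y) * ((X + Y) ^\<^sub>m k * ?c (F 0))"
      unfolding pow_mat_mult_left[OF XY] using carrier_matD[OF XY] carrier_matD[OF pow_carrier_mat[OF XY]]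
      by (simp add: mult_assoc_dim)
    then show ?case unfolding step Suc by simp
  qed
  from this[of n] have "?c (F n) = 0\<^sub>m (?v * ?p) 1"
    unfolding q_commuting_nilpotent[OF q X Y YX Xn Yn] by simp
  then have "uncurry_mat ?v 1 ?p (?c (F n)) = uncurry_mat ?v 1 ?p (0\<^sub>m (?v * ?p) 1)" by simp
  moreover have "uncurry_mat ?v 1 ?p (?c (F n)) = F n" using Fc by (intro uncurry_curry) simp
  moreover have "uncurry_mat ?v 1 ?p (0\<^sub>m (?v * ?p) 1) = (0\<^sub>m ?v ?p :: 'k mat)"
    by (intro eq_matI) (auto simp: uncurry_mat_def index_less_mult)
  ultimately show ?thesis by simp
qed

text \<open>The equation for \<open>a\<close> determines all slices from the one at
  \<open>z_0\<close>. That slice is compatible with \<open>b\<close>, \<open>c\<close> and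
  \<open>d\<close> up to scalars, and since \<open>d\<close> connects the whole basis of
  \<open>V(j,u)\<close>, it is determined by its first row. Conversely a weight functional with
  \<open>v d^j = 0\<close> is extended to such a slice and then along the chain.\<close>

theorem mult_tensor_chain:
  assumes q: "primitive_root n q" and n: "n > 1" and P: "is_hmod n q P" and rec: "chain_rec q n (e + g) \<delta>"
    and j: "1 \<le> j" "j \<le> n"
  shows "mult q (P \<otimes>\<^sub>H chain_mod q n e g (\<lambda>_. 1) \<delta>) j u = rdim (hdim P) (fsp q P (u - e) (1 - u - int j - g) j n)"
proof -
  let ?p = "hdim P"
  define Z where "Z = chain_mod q n e g (\<lambda>_. 1) \<delta>"
  define V where "V = simple_mod q j u"
  define \<gamma> where "\<gamma> = chain_coeff q (1 - int j)"
  note pr = primitive_rootD[OF q] and q1 = root_ne_1[OF q n]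
  have Vc: "V = chain_mod q j u (1 - u - int j) (\<lambda>_. 1) \<gamma>" unfolding V_def \<gamma>_def by (rule simple_mod_chain[OF q1])
  have V: "is_hmod n q V" unfolding V_def by (rule simple_mod_hmod[OF q n j(2)])
  have Z: "is_hmod n q Z" unfolding Z_def by (rule chain_mod_hmod[OF q order.refl rec]) simp
  have Vd: "hdim V = j" and Zd: "hdim Z = n" by (simp_all add: V_def Z_def)
  have g0: "\<gamma> c \<noteq> 0" if "0 < c" "c < j" for c unfolding \<gamma>_def by (rule chain_coeff_simple_nonzero[OF q n that j(2)])
  let ?M = "P \<otimes>\<^sub>H Z"
  have M: "is_hmod n q ?M" by (rule htensor_hmod[OF q P Z])
  have Md: "hdim ?M = ?p * n" by (simp add: Zd)
  note cP = hmod_carrier[OF P] and cV = hmod_carrier[OF V, unfolded Vd] and cM = hmod_carrier[OF M, unfolded Md]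
  note [simp] = hmod_dim[OF P] hmod_dim[OF V, unfolded Vd]
  note row = chain_mod_row[of _ j q u "1 - u - int j" "\<lambda>_. 1" \<gamma>, folded Vc]
  have l0: "0 < j" using j by simp
  have d0: "\<delta> 0 = 0" and dS: "\<And>k. k < n \<Longrightarrow> \<delta> (Suc k) = q * \<delta> k + (1 - q powi (e + g + 2 * int k))"
    using rec by (auto simp: chain_rec_def)
  let ?sl = "\<lambda>f k. f * kron (1\<^sub>m ?p) (ucol n k)"
  have iff: "is_hom ?M V f \<longleftrightarrow> (\<forall>k<n.
     q powi (e + int k) \<cdot>\<^sub>m (F k * opa P) + (if Suc k < n then F (Suc k) else 0\<^sub>m j ?p) = opa V * F k \<and>
     q powi (e + int k) \<cdot>\<^sub>m (F k * opb P) = opb V * F k \<and>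
     q powi (g + int k) \<cdot>\<^sub>m (F k * opc P) = opc V * F k \<and>
     q powi (g + int k) \<cdot>\<^sub>m (F k * opd P) + (if k = 0 then 0\<^sub>m j ?p else \<delta> k \<cdot>\<^sub>m F (k - 1)) = opd V * F k)"
    if "f \<in> carrier_mat j (?p * n)" "\<And>k. k < n \<Longrightarrow> F k = ?sl f k" for f F
    using slice_hom_iff[OF hmod_square[OF P] hmod_square[OF V], of f n F q e g \<delta>] that unfolding Vd Z_def by blast
  let ?W = "simple_fsp q ?M j u"
  let ?L = "fsp q P (u - e) (1 - u - int j - g) j n"
  \<comment> \<open>Sends the last coordinate \<open>w\<close> of a homomorphism to the first row of
    its slice at \<open>z_0\<close>, as the first row of the homomorphism is
    \<open>w a^(j-1)\<close>.\<close>
  define T where "T = opa ?M ^\<^sub>m (j - 1) * kron (1\<^sub>m ?p) (ucol n 0)"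
  have kc: "kron (1\<^sub>m ?p) (ucol n k) \<in> carrier_mat (?p * n) ?p" for k
    using kron_carrier[OF one_carrier_mat special_carrier(2)] by simp
  have Tc: "T \<in> carrier_mat (?p * n) ?p" unfolding T_def by (rule mult_carrier_mat[OF pow_carrier_mat[OF cM(1)] kc])
  have first_row: "urow j 0 * ?sl f 0 = w * T"
    if wc: "w \<in> carrier_mat 1 (?p * n)" and fc: "f \<in> carrier_mat j (?p * n)" and f: "f = simple_hom ?M j w" for w f
  proof -
    have "urow j 0 * f = w * opa ?M ^\<^sub>m (j - 1 - 0)"
      unfolding f simple_hom_def Md by (rule urow_rows_mat[OF l0 mult_carrier_mat[OF wc pow_carrier_mat[OF cM(1)]]])
    then have r: "urow j 0 * f = w * opa ?M ^\<^sub>m (j - 1)" unfolding diff_zero .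
    have "urow j 0 * ?sl f 0 = (urow j 0 * f) * kron (1\<^sub>m ?p) (ucol n 0)"
      by (rule assoc_mult_mat[OF special_carrier(1) fc kc, symmetric])
    also have "\<dots> = w * T" unfolding r T_def by (rule assoc_mult_mat[OF wc pow_carrier_mat[OF cM(1)] kc])
    finally show ?thesis .
  qed
  have slice0: "\<exists>f. is_hom ?M V f \<and> f \<in> carrier_mat j (?p * n) \<and> urow j 0 * ?sl f 0 = w * T \<and> urow j (j - 1) * f = w"
    if w: "w \<in> ?W" for w
  proof (intro exI conjI)
    let ?f = "simple_hom ?M j w"
    note h = simple_hom[OF q n M j(1) w]
    show "is_hom ?M V ?f" unfolding V_def by (rule h(1))
    show fc: "?f \<in> carrier_mat j (?p * n)" using homD(1)[OF h(1)] unfolding Md simple_mod_sel .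
    show "urow j (j - 1) * ?f = w" by (rule h(2))
    have wc: "w \<in> carrier_mat 1 (?p * n)" using w fspD(1) Md unfolding simple_fsp_def by metis
    show "urow j 0 * ?sl ?f 0 = w * T" by (rule first_row[OF wc fc refl])
  qed
  \<comment> \<open>The coefficients of \<open>d\<close> on \<open>V(j,u)\<close> do not vanish, so
    row \<open>i\<close> of the slice is the first row times \<open>d^i\<close> up to a nonzero
    scalar.\<close>
  have chain: "\<exists>\<kappa>. \<kappa> \<noteq> 0 \<and> (urow j 0 * F0) * opd P ^\<^sub>m i = \<kappa> \<cdot>\<^sub>m (urow j i * F0)"
    and chain_end: "(urow j (j - 1) * F0) * opd P = 0\<^sub>m 1 ?p"
    if F0: "F0 \<in> carrier_mat j ?p" and D: "q powi g \<cdot>\<^sub>m (F0 * opd P) = opd V * F0" and i: "i < j" for F0 i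
  proof -
    have Dr: "(urow j i * F0) * opd P = q powi (- g) \<cdot>\<^sub>m (urow j i * opd V * F0)" if "i < j" for i
    proof -
      have "F0 * opd P = q powi (- g) \<cdot>\<^sub>m (opd V * F0)"
        unfolding D[symmetric] using pr(3) by (simp add: smult_smult_mat power_int_add[symmetric])
      then show ?thesis using F0 by (simp add: mat_alg)
    qed
    show "(urow j (j - 1) * F0) * opd P = 0\<^sub>m 1 ?p"
      using Dr[of "j - 1"] row(4)[of "j - 1"] l0 F0 by simp
    show "\<exists>\<kappa>. \<kappa> \<noteq> 0 \<and> (urow j 0 * F0) * opd P ^\<^sub>m i = \<kappa> \<cdot>\<^sub>m (urow j i * F0)" using i
    proof (induction i)
      case 0
      show ?case using F0 cP by (intro exI[of _ 1]) simp
    next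
      case (Suc i)
      then obtain \<kappa> where k: "\<kappa> \<noteq> 0" "(urow j 0 * F0) * opd P ^\<^sub>m i = \<kappa> \<cdot>\<^sub>m (urow j i * F0)" by auto
      have "(urow j 0 * F0) * opd P ^\<^sub>m Suc i = ((urow j 0 * F0) * opd P ^\<^sub>m i) * opd P"
        using F0 cP by (simp add: mult_assoc_dim)
      also have "\<dots> = \<kappa> \<cdot>\<^sub>m ((urow j i * F0) * opd P)" unfolding k(2) using F0 by (simp add: smult_mult_dim)
      also have "\<dots> = (\<kappa> * (q powi (- g) * \<gamma> (Suc i))) \<cdot>\<^sub>m (urow j (Suc i) * F0)"
        using Dr[of i] row(4)[of i] Suc.prems F0 by (simp add: smult_mult_dim smult_smult_mat)
      finally show ?case using k(1) g0[of "Suc i"] Suc.prems pr(3)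
        by (intro exI[of _ "\<kappa> * (q powi (- g) * \<gamma> (Suc i))"]) simp
    qed
  qed
  have D0: "q powi g \<cdot>\<^sub>m (?sl f 0 * opd P) = opd V * ?sl f 0" and B0: "q powi e \<cdot>\<^sub>m (?sl f 0 * opb P) = opb V * ?sl f 0"
    and C0: "q powi g \<cdot>\<^sub>m (?sl f 0 * opc P) = opc V * ?sl f 0" and A0: "\<And>k. Suc k < n \<Longrightarrow> q powi (e + int k) \<cdot>\<^sub>m (?sl f k * opa P) + ?sl f (Suc k) = opa V * ?sl f k"
    if f: "is_hom ?M V f" "f \<in> carrier_mat j (?p * n)" for f
  proof -
    have all: "\<forall>k<n. q powi (e + int k) \<cdot>\<^sub>m (?sl f k * opa P) + (if Suc k < n then ?sl f (Suc k) else 0\<^sub>m j ?p) = opa V * ?sl f k \<and>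
     q powi (e + int k) \<cdot>\<^sub>m (?sl f k * opb P) = opb V * ?sl f k \<and>
     q powi (g + int k) \<cdot>\<^sub>m (?sl f k * opc P) = opc V * ?sl f k \<and>
     q powi (g + int k) \<cdot>\<^sub>m (?sl f k * opd P) + (if k = 0 then 0\<^sub>m j ?p else \<delta> k \<cdot>\<^sub>m ?sl f (k - 1)) = opd V * ?sl f k"
      using iff[of f "?sl f", OF f(2)] f(1) by blast
    have n0: "0 < n" using n by simp
    have "?sl f 0 * opd P \<in> carrier_mat j ?p" by (rule mult_carrier_mat[OF mult_carrier_mat[OF f(2) kc] cP(4)])
    then show "q powi g \<cdot>\<^sub>m (?sl f 0 * opd P) = opd V * ?sl f 0" "q powi e \<cdot>\<^sub>m (?sl f 0 * opb P) = opb V * ?sl f 0"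
      "q powi g \<cdot>\<^sub>m (?sl f 0 * opc P) = opc V * ?sl f 0"
      using all[rule_format, OF n0] by simp_all
    show "q powi (e + int k) \<cdot>\<^sub>m (?sl f k * opa P) + ?sl f (Suc k) = opa V * ?sl f k" if "Suc k < n" for k
      using all[rule_format, of k] that by simp
  qed
  have inj: "w = 0\<^sub>m 1 (hdim ?M)" if w: "w \<in> ?W" "w * T = 0\<^sub>m 1 ?p" for w
  proof -
    obtain f where f: "is_hom ?M V f" "f \<in> carrier_mat j (?p * n)" "urow j 0 * ?sl f 0 = w * T" "urow j (j - 1) * f = w"
      using slice0[OF w(1)] by blast
    have s0: "?sl f 0 \<in> carrier_mat j ?p" by (rule mult_carrier_mat[OF f(2) kc])
    have "?sl f 0 = 0\<^sub>m j ?p"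
    proof (rule urow_eqI)
      fix i assume "i < dim_row (0\<^sub>m j ?p :: 'a mat)"
      then have i: "i < j" by simp
      obtain \<kappa> where k: "\<kappa> \<noteq> 0" "(urow j 0 * ?sl f 0) * opd P ^\<^sub>m i = \<kappa> \<cdot>\<^sub>m (urow j i * ?sl f 0)"
        using chain[OF s0 D0[OF f(1,2)] i] by blast
      have "\<kappa> \<cdot>\<^sub>m (urow j i * ?sl f 0) = \<kappa> \<cdot>\<^sub>m 0\<^sub>m 1 ?p"
        unfolding k(2)[symmetric] f(3) w(2) using cP by simp
      then have "urow j i * ?sl f 0 = 0\<^sub>m 1 ?p" using smult_cancel_mat[OF k(1)] by blast
      then show "urow (dim_row (0\<^sub>m j ?p :: 'a mat)) i * ?sl f 0 = urow (dim_row (0\<^sub>m j ?p :: 'a mat)) i * 0\<^sub>m j ?p" by simp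
    qed (use s0 in auto)
    then have "?sl f k = 0\<^sub>m j ?p" if "k < n" for k
      using that
    proof (induction k)
      case (Suc k)
      have sk: "?sl f (Suc k) \<in> carrier_mat j ?p" by (rule mult_carrier_mat[OF f(2) kc])
      have z: "?sl f k = 0\<^sub>m j ?p" using Suc by simp
      have "q powi (e + int k) \<cdot>\<^sub>m (0\<^sub>m j ?p * opa P) + ?sl f (Suc k) = opa V * 0\<^sub>m j ?p"
        using A0[OF f(1,2) Suc.prems(2)] unfolding z .
      then show ?case using carrier_matD[OF sk] by simp
    qed
    then have "f = 0\<^sub>m j (?p * n)" using kc by (intro slice_eqI[OF f(2)]) auto
    then have "w = 0\<^sub>m 1 (?p * n)" using f(4) by simp
    then show ?thesis unfolding Md .
  qed
  have im: "{w * T | w. w \<in> ?W} = ?L"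
  proof (intro equalityI subsetI)
    fix v assume "v \<in> {w * T | w. w \<in> ?W}"
    then obtain w where w: "w \<in> ?W" "v = w * T" by blast
    obtain f where f: "is_hom ?M V f" "f \<in> carrier_mat j (?p * n)" "urow j 0 * ?sl f 0 = w * T"
      using slice0[OF w(1)] by blast
    have s0: "?sl f 0 \<in> carrier_mat j ?p" by (rule mult_carrier_mat[OF f(2) kc])
    have v: "v = urow j 0 * ?sl f 0" using w(2) f(3) by simp
    have vc: "v \<in> carrier_mat 1 ?p" unfolding v by (rule mult_carrier_mat[OF special_carrier(1) s0])
    have wt: "v * S = q powi (z' - z) \<cdot>\<^sub>m v" if eq: "q powi z \<cdot>\<^sub>m (?sl f 0 * S) = R * ?sl f 0" and r: "urow j 0 * R = q powi z' \<cdot>\<^sub>m urow j 0"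
      and c: "S \<in> carrier_mat ?p ?p" "R \<in> carrier_mat j j" for S R z z'
    proof -
      have e1: "?sl f 0 * S = q powi (- z) \<cdot>\<^sub>m (R * ?sl f 0)"
        unfolding eq[symmetric] using pr(3) by (simp add: smult_smult_mat power_int_add[symmetric])
      have "v * S = urow j 0 * (?sl f 0 * S)"
        unfolding v using s0 c(1) by (intro assoc_mult_mat[of _ 1 j _ ?p _ ?p]) auto
      also have "\<dots> = q powi (- z) \<cdot>\<^sub>m ((urow j 0 * R) * ?sl f 0)"
        unfolding e1 using carrier_matD[OF s0] c(2) by (simp add: mult_smult_dim mult_assoc_dim)
      also have "\<dots> = q powi (z' - z) \<cdot>\<^sub>m v"
        unfolding r v using carrier_matD[OF s0] pr(3) by (simp add: smult_mult_dim smult_smult_mat power_int_add[symmetric])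
      finally show ?thesis .
    qed
    show "v \<in> ?L"
    proof (rule fspI[OF vc])
      show "v * opb P = q powi (u - e) \<cdot>\<^sub>m v"
        by (rule wt[OF B0[OF f(1,2)] _ cP(2) cV(2)]) (use row(2)[OF l0] in simp)
      show "v * opc P = q powi (1 - u - int j - g) \<cdot>\<^sub>m v"
        by (rule wt[OF C0[OF f(1,2)] _ cP(3) cV(3)]) (use row(3)[OF l0] in simp)
      show "v * opa P ^\<^sub>m n = 0\<^sub>m 1 ?p" using hmod_powers(1)[OF P] vc by simp
      have jj: "j - 1 < j" "Suc (j - 1) = j" using l0 by auto
      obtain \<kappa> where k: "v * opd P ^\<^sub>m (j - 1) = \<kappa> \<cdot>\<^sub>m (urow j (j - 1) * ?sl f 0)"
        using chain[OF s0 D0[OF f(1,2)] jj(1)] unfolding v by blast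
      have "v * opd P ^\<^sub>m Suc (j - 1) = (v * opd P ^\<^sub>m (j - 1)) * opd P" using vc cP by (simp add: mult_assoc_dim)
      also have "\<dots> = \<kappa> \<cdot>\<^sub>m ((urow j (j - 1) * ?sl f 0) * opd P)" unfolding k using carrier_matD[OF s0] by (simp add: smult_mult_dim)
      also have "\<dots> = 0\<^sub>m 1 ?p" unfolding chain_end[OF s0 D0[OF f(1,2)] jj(1)] by simp
      finally show "v * opd P ^\<^sub>m j = 0\<^sub>m 1 ?p" unfolding jj(2) .
    qed
  next
    fix v assume v: "v \<in> ?L"
    note d = fspD[OF v]
    note vc = d(1)
    note wt = functional_power_weights(3,4)[OF pr(3) P d(1-3)]
    \<comment> \<open>The normalisation forced by the equation for \<open>d\<close>: row
      \<open>i\<close> of the slice at \<open>z_0\<close> has to be this multiple of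
      \<open>v d^i\<close>.\<close>
    define \<kappa> where "\<kappa> i = (\<Prod>s<i. q powi g / \<gamma> (Suc s))" for i
    have kS: "\<gamma> (Suc i) * \<kappa> (Suc i) = q powi g * \<kappa> i" if "Suc i < j" for i
      using g0[of "Suc i"] that by (simp add: \<kappa>_def)
    have k0: "\<kappa> 0 = 1" by (simp add: \<kappa>_def)
    define G where "G i = \<kappa> i \<cdot>\<^sub>m (v * opd P ^\<^sub>m i)" for i
    have Gc: "G i \<in> carrier_mat 1 ?p" for i unfolding G_def
      using mult_carrier_mat[OF vc pow_carrier_mat[OF cP(4)]] by simp
    define F0 where "F0 = rows_mat j ?p G"
    have F0c: "F0 \<in> carrier_mat j ?p" by (simp add: F0_def)
    then have [simp]: "dim_row F0 = j" "dim_col F0 = ?p" by auto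
    have ur: "urow j i * F0 = G i" if "i < j" for i unfolding F0_def by (rule urow_rows_mat[OF that Gc])
    have R0: "z \<cdot>\<^sub>m (F0 * S) = R * F0" if c: "S \<in> carrier_mat ?p ?p" "R \<in> carrier_mat j j"
      and r: "\<And>i. i < j \<Longrightarrow> z \<cdot>\<^sub>m (G i * S) = urow j i * R * F0" for z S R
    proof (rule urow_eqI)
      fix i assume "i < dim_row (R * F0)"
      then have i: "i < j" using c by simp
      have "urow j i * (z \<cdot>\<^sub>m (F0 * S)) = z \<cdot>\<^sub>m ((urow j i * F0) * S)" using c by (simp add: mult_smult_dim mult_assoc_dim)
      also have "\<dots> = urow j i * (R * F0)" unfolding ur[OF i] r[OF i] using c by (simp add: mult_assoc_dim)
      finally show "urow (dim_row (R * F0)) i * (z \<cdot>\<^sub>m (F0 * S)) = urow (dim_row (R * F0)) i * (R * F0)" using c by simp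
    qed (use c in auto)
    have B0': "q powi e \<cdot>\<^sub>m (F0 * opb P) = opb V * F0"
    proof (rule R0[OF cP(2) cV(2)])
      fix i assume i: "i < j"
      have "q powi e \<cdot>\<^sub>m (G i * opb P) = (q powi e * q powi (u - e + int i)) \<cdot>\<^sub>m G i"
        unfolding G_def using wt(1)[of i] vc cP by (simp add: smult_mult_dim smult_smult_mat mult_ac)
      also have "q powi e * q powi (u - e + int i) = q powi (u + int i)" using pr(3) by (simp add: power_int_add[symmetric])
      finally show "q powi e \<cdot>\<^sub>m (G i * opb P) = urow j i * opb V * F0"
        unfolding row(2)[OF i] using ur[OF i] by (simp add: smult_mult_dim)
    qed
    have C0': "q powi g \<cdot>\<^sub>m (F0 * opc P) = opc V * F0"
    proof (rule R0[OF cP(3) cV(3)])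
      fix i assume i: "i < j"
      have "q powi g \<cdot>\<^sub>m (G i * opc P) = (q powi g * q powi (1 - u - int j - g + int i)) \<cdot>\<^sub>m G i"
        unfolding G_def using wt(2)[of i] vc cP by (simp add: smult_mult_dim smult_smult_mat mult_ac)
      also have "q powi g * q powi (1 - u - int j - g + int i) = q powi (1 - u - int j + int i)"
      proof -
        have "g + (1 - u - int j - g + int i) = 1 - u - int j + int i" by simp
        then show ?thesis using pr(3) by (metis power_int_add)
      qed
      finally show "q powi g \<cdot>\<^sub>m (G i * opc P) = urow j i * opc V * F0"
        unfolding row(3)[OF i] using ur[OF i] by (simp add: smult_mult_dim)
    qed
    have D0': "q powi g \<cdot>\<^sub>m (F0 * opd P) = opd V * F0"
    proof (rule R0[OF cP(4) cV(4)])
      fix i assume i: "i < j"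
      have GD: "G i * opd P = \<kappa> i \<cdot>\<^sub>m (v * opd P ^\<^sub>m Suc i)"
        unfolding G_def using vc cP by (simp add: smult_mult_dim mult_assoc_dim)
      show "q powi g \<cdot>\<^sub>m (G i * opd P) = urow j i * opd V * F0"
      proof (cases "Suc i < j")
        case True
        have "urow j i * opd V * F0 = \<gamma> (Suc i) \<cdot>\<^sub>m G (Suc i)"
          using row(4)[OF i] True ur[OF True] by (simp add: smult_mult_dim)
        also have "\<dots> = (q powi g * \<kappa> i) \<cdot>\<^sub>m (v * opd P ^\<^sub>m Suc i)"
          unfolding G_def smult_smult_mat kS[OF True] ..
        finally show ?thesis unfolding GD by (simp add: smult_smult_mat)
      next
        case False
        then have "Suc i = j" using i by simp
        then show ?thesis unfolding GD using d(4) row(4)[OF i] by simp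
      qed
    qed
    define F where "F = rec_nat F0 (\<lambda>k X. opa V * X - q powi (e + int k) \<cdot>\<^sub>m (X * opa P))"
    have FS: "F (Suc k) = opa V * F k - q powi (e + int k) \<cdot>\<^sub>m (F k * opa P)" and F_0: "F 0 = F0" for k
      by (simp_all add: F_def)
    have Fc: "F k \<in> carrier_mat j ?p" for k
    proof (induction k)
      case (Suc k)
      then show ?case unfolding FS by (intro carrier_matI) auto
    qed (simp add: F_0 F0c)
    then have Fd [simp]: "dim_row (F k) = j" "dim_col (F k) = ?p" for k using carrier_matD by blast+
    have qS: "q powi (z + (1 + int k)) = q * q powi (z + int k)" for z k using pr(3) by (simp add: power_int_add mult_ac)
    have FW: "opb V * F k = q powi (e + int k) \<cdot>\<^sub>m (F k * opb P)" "opc V * F k = q powi (g + int k) \<cdot>\<^sub>m (F k * opc P)" for k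
    proof (induction k)
      case (Suc k)
      have *: "R * F (Suc k) = q powi (z + int (Suc k)) \<cdot>\<^sub>m (F (Suc k) * S)"
        if IH: "R * F k = q powi (z + int k) \<cdot>\<^sub>m (F k * S)" and rel: "R * opa V = q \<cdot>\<^sub>m (opa V * R)" "S * opa P = q \<cdot>\<^sub>m (opa P * S)"
          and c: "R \<in> carrier_mat j j" "S \<in> carrier_mat ?p ?p" for R S z
      proof -
        note [simp] = carrier_matD[OF c(1)] carrier_matD[OF c(2)]
        have "R * F (Suc k) = (R * opa V) * F k - q powi (e + int k) \<cdot>\<^sub>m ((R * F k) * opa P)"
          unfolding FS by (simp add: mat_alg)
        also have "\<dots> = q \<cdot>\<^sub>m (opa V * (R * F k)) - q powi (e + int k) \<cdot>\<^sub>m ((R * F k) * opa P)"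
          unfolding rel by (simp add: mat_alg)
        also have "\<dots> = (q * q powi (z + int k)) \<cdot>\<^sub>m (opa V * F k * S) - (q powi (e + int k) * q powi (z + int k)) \<cdot>\<^sub>m (F k * (S * opa P))"
          unfolding IH by (simp add: mat_alg)
        also have "\<dots> = (q * q powi (z + int k)) \<cdot>\<^sub>m (opa V * F k * S) - (q * q powi (z + int k)) \<cdot>\<^sub>m (q powi (e + int k) \<cdot>\<^sub>m (F k * opa P * S))"
          unfolding rel by (simp add: mat_alg mult_ac)
        also have "\<dots> = (q * q powi (z + int k)) \<cdot>\<^sub>m (F (Suc k) * S)"
          unfolding FS by (simp add: minus_mult_dim smult_mult_dim) (rule eq_matI; simp add: algebra_simps del: index_mult_mat(1))
        finally show ?thesis using qS[of z k] by simp
      qed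
      show "opb V * F (Suc k) = q powi (e + int (Suc k)) \<cdot>\<^sub>m (F (Suc k) * opb P)"
        by (rule *[OF Suc(1) hmod_relations(1)[OF V] hmod_relations(1)[OF P] cV(2) cP(2)])
      show "opc V * F (Suc k) = q powi (g + int (Suc k)) \<cdot>\<^sub>m (F (Suc k) * opc P)"
        by (rule *[OF Suc(2) hmod_relations(3)[OF V] hmod_relations(3)[OF P] cV(3) cP(3)])
    qed (simp_all add: F_0 B0' C0')
    \<comment> \<open>At \<open>k = 0\<close> the index \<open>k - 1\<close> is 0 as well, and the
      last term vanishes as \<open>\<delta> 0 = 0\<close>. The induction step combines
      \<open>da = qad + 1 - bc\<close> on both \<open>V\<close> and \<open>P\<close> with the
      recursion for \<delta>.\<close>
    have FD: "opd V * F k = q powi (g + int k) \<cdot>\<^sub>m (F k * opd P) + \<delta> k \<cdot>\<^sub>m F (k - 1)" if "k < n" for k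
      using that
    proof (induction k)
      case 0
      show ?case by (simp add: F_0 D0' d0 zero_smult_mat)
    next
      case (Suc k)
      define \<beta> c where bc: "\<beta> = q powi (e + int k)" "c = q powi (g + int k)"
      have IH: "opd V * F k = c \<cdot>\<^sub>m (F k * opd P) + \<delta> k \<cdot>\<^sub>m F (k - 1)" using Suc by (simp add: bc)
      \<comment> \<open>The recursion for the slices solved for \<open>a F_(k-1)\<close>; the factor
        \<open>\<delta> k\<close> makes the equation true at \<open>k = 0\<close>.\<close>
      have prev: "\<delta> k \<cdot>\<^sub>m (q \<cdot>\<^sub>m (opa V * F (k - 1))) = \<delta> k \<cdot>\<^sub>m (q \<cdot>\<^sub>m F k + \<beta> \<cdot>\<^sub>m (F (k - 1) * opa P))"
      proof (cases k)
        case 0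
        then show ?thesis by (simp add: d0 zero_smult_mat)
      next
        case (Suc i)
        have "\<beta> = q * q powi (e + int i)" unfolding bc Suc using qS[of e i] by simp
        then have "q \<cdot>\<^sub>m F k + \<beta> \<cdot>\<^sub>m (F (k - 1) * opa P) = q \<cdot>\<^sub>m (opa V * F (k - 1))"
          unfolding Suc FS by (intro eq_matI) (simp_all add: algebra_simps del: index_mult_mat(1))
        then show ?thesis by simp
      qed
      have BC: "opb V * (opc V * F k) = (\<beta> * c) \<cdot>\<^sub>m (F k * (opb P * opc P))"
      proof -
        have "opb V * (opc V * F k) = c \<cdot>\<^sub>m ((opb V * F k) * opc P)" unfolding FW(2) bc by (simp add: mat_alg)
        then show ?thesis unfolding FW(1) bc[symmetric] by (simp add: mat_alg mult.commute)
      qed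
      have bcd: "q powi (e + g + 2 * int k) = \<beta> * c"
      proof -
        have "e + g + 2 * int k = (e + int k) + (g + int k)" by simp
        then show ?thesis unfolding bc using pr(3) by (metis power_int_add)
      qed
      have "opd V * F (Suc k) = (opd V * opa V) * F k - \<beta> \<cdot>\<^sub>m ((opd V * F k) * opa P)"
        unfolding FS bc by (simp add: mat_alg)
      also have "(opd V * opa V) * F k = q \<cdot>\<^sub>m (opa V * (opd V * F k)) + (F k - opb V * (opc V * F k))"
        unfolding hmod_da[OF V, unfolded Vd] by (simp add: mat_alg)
      also have "q \<cdot>\<^sub>m (opa V * (opd V * F k)) = (q * c) \<cdot>\<^sub>m (opa V * F k * opd P) + \<delta> k \<cdot>\<^sub>m (q \<cdot>\<^sub>m (opa V * F (k - 1)))"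
        unfolding IH by (simp add: mat_alg smult_add_mat mult.commute)
      also have "(opd V * F k) * opa P = c \<cdot>\<^sub>m (F k * (opd P * opa P)) + \<delta> k \<cdot>\<^sub>m (F (k - 1) * opa P)"
        unfolding IH by (simp add: mat_alg)
      also have "F k * (opd P * opa P) = q \<cdot>\<^sub>m (F k * opa P * opd P) + (F k - F k * (opb P * opc P))"
        unfolding hmod_da[OF P] by (simp add: mat_alg)
      finally have main: "opd V * F (Suc k) = (q * c) \<cdot>\<^sub>m (opa V * F k * opd P) + \<delta> k \<cdot>\<^sub>m (q \<cdot>\<^sub>m F k + \<beta> \<cdot>\<^sub>m (F (k - 1) * opa P))
          + (F k - (\<beta> * c) \<cdot>\<^sub>m (F k * (opb P * opc P))) - \<beta> \<cdot>\<^sub>m (c \<cdot>\<^sub>m (q \<cdot>\<^sub>m (F k * opa P * opd P) + (F k - F k * (opb P * opc P)))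
          + \<delta> k \<cdot>\<^sub>m (F (k - 1) * opa P))" unfolding prev BC .
      have goal: "F (Suc k) * opd P = opa V * F k * opd P - \<beta> \<cdot>\<^sub>m (F k * opa P * opd P)"
        unfolding FS bc by (simp add: mat_alg)
      have "opd V * F (Suc k) = (q * c) \<cdot>\<^sub>m (F (Suc k) * opd P) + \<delta> (Suc k) \<cdot>\<^sub>m F k"
        unfolding main goal dS[OF Suc_lessD[OF Suc.prems]] bcd
        by (intro eq_matI) (simp_all add: algebra_simps del: index_mult_mat(1))
      then show ?case using qS[of g k] by (simp add: bc)
    qed
    \<comment> \<open>\<open>F\<close> is defined for all indices, and this is the closing condition
      of the last slice.\<close>
    have Fn: "F n = 0\<^sub>m j ?p"
      using slice_recursion_stops[OF q P V, of F e] Fc[of 0] FS FW(1) unfolding Vd by blast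
    define f where "f = slice_mat j ?p n F"
    have fc: "f \<in> carrier_mat j (?p * n)" by (simp add: f_def)
    have fs: "F k = ?sl f k" if "k < n" for k unfolding f_def using slice_mat_ucol[OF that Fc] by simp
    have f: "is_hom ?M V f"
    proof (subst iff[OF fc fs], assumption, intro allI impI conjI)
      fix k assume k: "k < n"
      have "q powi (e + int k) \<cdot>\<^sub>m (F k * opa P) + F (Suc k) = opa V * F k"
        unfolding FS by (intro eq_matI) (simp_all del: index_mult_mat(1))
      moreover have "F (Suc k) = (if Suc k < n then F (Suc k) else 0\<^sub>m j ?p)"
        using Fn k by (cases "Suc k = n") auto
      ultimately show "q powi (e + int k) \<cdot>\<^sub>m (F k * opa P) + (if Suc k < n then F (Suc k) else 0\<^sub>m j ?p) = opa V * F k" by simp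
      show "q powi (e + int k) \<cdot>\<^sub>m (F k * opb P) = opb V * F k" "q powi (g + int k) \<cdot>\<^sub>m (F k * opc P) = opc V * F k"
        using FW[of k] by simp_all
      show "q powi (g + int k) \<cdot>\<^sub>m (F k * opd P) + (if k = 0 then 0\<^sub>m j ?p else \<delta> k \<cdot>\<^sub>m F (k - 1)) = opd V * F k"
        using FD[OF k] d0 by (auto simp: zero_smult_mat)
    qed
    define w where "w = urow j (j - 1) * f"
    have w: "w \<in> ?W" and wf: "simple_hom ?M j w = f"
      unfolding w_def by (rule simple_hom_functional[OF q n M j(1) f[unfolded V_def]])+
    have wc: "w \<in> carrier_mat 1 (?p * n)" using w fspD(1) Md unfolding simple_fsp_def by metis
    have "w * T = urow j 0 * ?sl f 0" by (rule first_row[OF wc fc wf[symmetric], symmetric])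
    also have "\<dots> = G 0" using fs[of 0] F_0 ur[OF l0] n by simp
    also have "\<dots> = v" using k0 vc cP by (simp add: G_def)
    finally show "v \<in> {w * T | w. w \<in> ?W}" using w by blast
  qed
  have "T \<in> carrier_mat (hdim ?M) ?p" unfolding Md by (rule Tc)
  then have "rdim ?p {w * T | w. w \<in> ?W} = rdim (hdim ?M) ?W"
    by (rule rdim_bij[OF simple_fsp_subspace[OF hmod_square[OF M]]]) (rule inj)
  then show ?thesis unfolding im mult_def Z_def[symmetric] by (rule sym)
qed

section \<open>Direct sums\<close>

lemma tensor_biprod:
  assumes b: "biprod S X Y i1 i2 p1 p2" and sq: "square_mod P" "square_mod S" "square_mod X" "square_mod Y"
  shows "biprod (P \<otimes>\<^sub>H S) (P \<otimes>\<^sub>H X) (P \<otimes>\<^sub>H Y) (kron (1\<^sub>m (hdim P)) i1) (kron (1\<^sub>m (hdim P)) i2)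
    (kron (1\<^sub>m (hdim P)) p1) (kron (1\<^sub>m (hdim P)) p2)"
proof -
  note d = biprodD[OF b]
  note [simp] = carrier_matD[OF homD(1)[OF d(1)]] carrier_matD[OF homD(1)[OF d(2)]] carrier_matD[OF homD(1)[OF d(3)]]
    carrier_matD[OF homD(1)[OF d(4)]]
  have "kron (1\<^sub>m (hdim P)) (i1 * p1) + kron (1\<^sub>m (hdim P)) (i2 * p2) = 1\<^sub>m (hdim P * hdim S)"
    unfolding kron_add_right[of "i1 * p1" "i2 * p2", symmetric, simplified] d(9) by simp
  then show ?thesis unfolding biprod_def
    using tensor_hom[OF d(1) sq(1,3,2)] tensor_hom[OF d(2) sq(1,4,2)] tensor_hom[OF d(3) sq(1,2,3)] tensor_hom[OF d(4) sq(1,2,4)]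
    by (simp add: kron_mult d(5-8))
qed

lemma biprod_projective:
  assumes b: "biprod S X Y i1 i2 p1 p2" and S: "is_hmod n q S" and X: "is_projective n q X" and Y: "is_projective n q Y"
  shows "is_projective n q S"
  unfolding is_projective_def
proof (intro conjI allI impI S)
  note d = biprodD[OF b]
  have hX: "is_hmod n q X" and hY: "is_hmod n q Y" using X Y by (simp_all add: is_projective_def)
  note sq = hmod_square[OF S] hmod_square[OF hX] hmod_square[OF hY]
  note c = homD(1)[OF d(1)] homD(1)[OF d(2)] homD(1)[OF d(3)] homD(1)[OF d(4)]
  fix A B g f
  assume *: "is_hmod n q A \<and> is_hmod n q B \<and> is_epi A B g \<and> is_hom S B f"
  then have A: "is_hmod n q A" and B: "is_hmod n q B" and g: "is_hom A B g" and f: "is_hom S B f" by (auto simp: is_epi_def)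
  note sqA = hmod_square[OF A] and sqB = hmod_square[OF B]
  obtain g' where g': "g' \<in> carrier_mat (hdim A) (hdim B)" "g * g' = 1\<^sub>m (hdim B)" using * epi_right_inverse by blast
  obtain h1 where h1: "is_hom X A h1" "g * h1 = f * i1" by (rule projectiveD[OF X A B hom_comp[OF d(1) f sq(2,1) sqB] g g'])
  obtain h2 where h2: "is_hom Y A h2" "g * h2 = f * i2" by (rule projectiveD[OF Y A B hom_comp[OF d(2) f sq(3,1) sqB] g g'])
  have "is_hom S A (h1 * p1 + h2 * p2)"
    by (rule hom_add[OF hom_comp[OF d(3) h1(1) sq(1,2) sqA] hom_comp[OF d(4) h2(1) sq(1,3) sqA] sq(1) sqA])
  moreover have "g * (h1 * p1 + h2 * p2) = (g * h1) * p1 + (g * h2) * p2"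
    using c homD(1)[OF h1(1)] homD(1)[OF h2(1)] homD(1)[OF g] by (simp add: mult_add_dim mult_assoc_dim)
  then have "g * (h1 * p1 + h2 * p2) = f * (i1 * p1 + i2 * p2)"
    unfolding h1(2) h2(2) using c homD(1)[OF f] by (simp add: mult_add_dim mult_assoc_dim)
  then have "g * (h1 * p1 + h2 * p2) = f" unfolding d(9) using homD(1)[OF f] by simp
  ultimately show "\<exists>h. is_hom S A h \<and> g * h = f" by blast
qed

lemma prl_mult:
  "X \<in> carrier_mat (a + b) c \<Longrightarrow> prl a b * X = mat a c (\<lambda>(i, j). X $$ (i, j))" for X :: "'a::semiring_1 mat"
  by (rule eq_matI) (auto simp: prl_def scalar_prod_def delta_mult sum.delta cong: if_cong)

lemma mult_prl:
  "X \<in> carrier_mat c a \<Longrightarrow> X * prl a b = mat c (a + b) (\<lambda>(i, j). if j < a then X $$ (i, j) else 0)" for X :: "'a::semiring_1 mat"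
  by (rule eq_matI) (auto simp: prl_def scalar_prod_def delta_mult sum.delta cong: if_cong)

lemma mult_inr:
  "X \<in> carrier_mat c (a + b) \<Longrightarrow> X * inr a b = mat c b (\<lambda>(i, j). X $$ (i, a + j))" for X :: "'a::semiring_1 mat"
  by (rule eq_matI) (auto simp: inr_def scalar_prod_def delta_mult sum.delta cong: if_cong)

lemma inr_mult:
  fixes X :: "'a::semiring_1 mat"
  assumes "X \<in> carrier_mat b c"
  shows "inr a b * X = mat (a + b) c (\<lambda>(i, j). if i < a then 0 else X $$ (i - a, j))"
proof (rule eq_matI)
  fix i j assume "i < dim_row (mat (a + b) c (\<lambda>(i, j). if i < a then 0 else X $$ (i - a, j)))" "j < dim_col (mat (a + b) c (\<lambda>(i, j). if i < a then 0 else X $$ (i - a, j)))"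
  then have ij: "i < a + b" "j < c" by auto
  show "(inr a b * X) $$ (i, j) = mat (a + b) c (\<lambda>(i, j). if i < a then 0 else X $$ (i - a, j)) $$ (i, j)"
  proof (cases "i < a")
    case False
    then obtain k where k: "i = a + k" using le_Suc_ex by (metis not_less)
    then show ?thesis using ij assms by (simp add: inr_def scalar_prod_def delta_mult sum.delta' cong: if_cong)
  qed (use ij assms in \<open>auto simp: inr_def scalar_prod_def\<close>)
qed (use assms in auto)

lemma four_block_embed:
  fixes A B :: "'a::field mat"
  assumes "A \<in> carrier_mat a a" "B \<in> carrier_mat b b"
  shows "four_block_mat A (0\<^sub>m a b) (0\<^sub>m b a) B = inl a b * A * prl a b + inr a b * B * prr a b" (is "?F = ?G")
proof -
  have G: "?G \<in> carrier_mat (a + b) (a + b)" using assms by (intro carrier_matI) auto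
  have F: "?F \<in> carrier_mat (a + b) (a + b)" using assms by auto
  have "?F * inl a b = inl a b * A"
    by (rule eq_matI) (use assms in \<open>auto simp: inl_def scalar_prod_def delta_mult sum.delta cong: if_cong\<close>)
  moreover have "?F * inr a b = inr a b * B"
    unfolding mult_inr[OF F] inr_mult[OF assms(2)] by (rule cong_mat) (use assms in auto)
  moreover have "(?F * inl a b) * prl a b + (?F * inr a b) * prr a b = ?F * (inl a b * prl a b + inr a b * prr a b)"
    using assms by (simp add: mult_add_dim mult_assoc_dim del: embed_simps)
  ultimately show ?thesis unfolding embed_simps(5) right_mult_one_mat[OF F] by simp
qed

lemma diag_block_carrier:
  assumes "\<And>X. X \<in> set Xs \<Longrightarrow> F X \<in> carrier_mat (d X) (d X)"
  shows "diag_block_mat (map F Xs) \<in> carrier_mat (sum_list (map d Xs)) (sum_list (map d Xs))"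
  using assms
proof (induction Xs)
  case (Cons X Xs)
  then have "F X \<in> carrier_mat (d X) (d X)" "diag_block_mat (map F Xs) \<in> carrier_mat (sum_list (map d Xs)) (sum_list (map d Xs))"
    by auto
  then show ?case by (auto simp: Let_def)
qed simp

lemma hsum_square: "(\<And>X. X \<in> set Xs \<Longrightarrow> square_mod X) \<Longrightarrow> square_mod (hsum Xs)"
  unfolding square_mod_def hsum_def hmod.sel by (intro conjI diag_block_carrier) auto

lemma hsum_Nil: "hdim (hsum []) = 0" "square_mod (hsum [])"
  by (auto simp: hsum_def square_mod_def)

text \<open>Makes the structure maps of the binary sum available for the block-diagonal sum of a
  list.\<close>

lemma hsum_Cons:
  assumes "square_mod X" "\<And>Y. Y \<in> set Xs \<Longrightarrow> square_mod Y"
  shows "hsum (X # Xs) = hplus X (hsum Xs)"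
proof -
  have sqs: "square_mod (hsum Xs)" by (rule hsum_square) (rule assms(2))
  note c = square_modD[OF assms(1)] and cs = square_modD[OF sqs]
  have sel: "hdim (hsum Xs) = sum_list (map hdim Xs)" "opa (hsum Xs) = diag_block_mat (map opa Xs)"
    "opb (hsum Xs) = diag_block_mat (map opb Xs)" "opc (hsum Xs) = diag_block_mat (map opc Xs)"
    "opd (hsum Xs) = diag_block_mat (map opd Xs)" by (simp_all add: hsum_def)
  have block: "diag_block_mat (F X # map F Xs) = inl (hdim X) (hdim (hsum Xs)) * F X * prl (hdim X) (hdim (hsum Xs)) +
      inr (hdim X) (hdim (hsum Xs)) * diag_block_mat (map F Xs) * prr (hdim X) (hdim (hsum Xs))"
    if F: "F X \<in> carrier_mat (hdim X) (hdim X)" and Fs: "diag_block_mat (map F Xs) \<in> carrier_mat (hdim (hsum Xs)) (hdim (hsum Xs))"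
    for F :: "'a hmod \<Rightarrow> 'a mat"
    unfolding four_block_embed[OF F Fs, symmetric] using carrier_matD[OF F] carrier_matD[OF Fs] by (simp add: Let_def)
  show ?thesis
    unfolding hplus_def Let_def hsum_def[of "X # Xs"] list.map hmod.inject sel(2-5)
    by (intro conjI block c cs[unfolded sel(2-5)]) (simp add: sel(1))
qed

lemma hsum_Nil_hmod: "is_hmod n q (hsum [])"
proof -
  have "opa (hsum [] :: 'a hmod) = 0\<^sub>m 0 0" "opb (hsum [] :: 'a hmod) = 0\<^sub>m 0 0" "opc (hsum [] :: 'a hmod) = 0\<^sub>m 0 0"
    "opd (hsum [] :: 'a hmod) = 0\<^sub>m 0 0" by (simp_all add: hsum_def)
  moreover have "A = B" if "A \<in> carrier_mat 0 0" "B \<in> carrier_mat 0 0" for A B :: "'a mat" using that by (intro eq_matI) auto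
  ultimately show ?thesis by (intro is_hmodI) (auto simp: hsum_Nil pow_carrier_mat)
qed

lemma hsum_Nil_projective: "is_projective n q (hsum [])"
  unfolding is_projective_def
proof (intro conjI allI impI hsum_Nil_hmod)
  fix A B g f
  assume *: "is_hmod n q A \<and> is_hmod n q B \<and> is_epi A B g \<and> is_hom (hsum []) B f"
  then have g: "is_hom A B g" and f: "is_hom (hsum []) B f" and A: "is_hmod n q A" by (auto simp: is_epi_def)
  have "f \<in> carrier_mat (hdim B) 0" using homD(1)[OF f] by (simp add: hsum_Nil)
  then have "g * 0\<^sub>m (hdim A) 0 = f" using homD(1)[OF g] by (intro eq_matI) auto
  then show "\<exists>h. is_hom (hsum []) A h \<and> g * h = f"
    using hom_zero[OF hsum_Nil(2) hmod_square[OF A]] by (auto simp: hsum_Nil)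
qed

lemma hsum_projective:
  assumes X: "\<And>X. X \<in> set Xs \<Longrightarrow> is_projective n q X"
  shows "is_projective n q (hsum Xs)"
  using X
proof (induction Xs)
  case Nil
  show ?case by (rule hsum_Nil_projective)
next
  case (Cons X Xs)
  have sq: "square_mod Y" if "Y \<in> set (X # Xs)" for Y
    using Cons.prems[OF that] hmod_square by (auto simp: is_projective_def)
  have p: "is_projective n q X" "is_projective n q (hsum Xs)" using Cons by auto
  then have h: "is_hmod n q X" "is_hmod n q (hsum Xs)" by (auto simp: is_projective_def)
  have "is_projective n q (hplus X (hsum Xs))"
    by (rule biprod_projective[OF hplus_biprod hplus_hmod[OF h] p]) (rule hmod_square[OF h(1)] hmod_square[OF h(2)])+
  then show ?case using hsum_Cons[of X Xs] sq by simp
qed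

lemma mult_dim_0: "square_mod X \<Longrightarrow> hdim X = 0 \<Longrightarrow> mult q X j u = 0"
proof -
  assume X: "square_mod X" "hdim X = 0"
  have "w = 0\<^sub>m 1 (hdim X)" if "w \<in> carrier_mat 1 (hdim X)" for w using that X(2) by (auto intro!: eq_matI)
  then have "simple_fsp q X j u = {0\<^sub>m 1 (hdim X)}" using row_subspaceD(1,2)[OF simple_fsp_subspace[OF X(1), of q j u]] by blast
  then show ?thesis by (simp add: mult_def rdim_zero)
qed

lemma mult_hsum:
  assumes "\<And>X. X \<in> set Xs \<Longrightarrow> square_mod X"
  shows "mult q (hsum Xs) j u = (\<Sum>X\<leftarrow>Xs. mult q X j u)"
  using assms
proof (induction Xs)
  case Nil
  show ?case using mult_dim_0[OF hsum_Nil(2,1)] by simp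
next
  case (Cons X Xs)
  have sq: "square_mod X" "square_mod (hsum Xs)" using Cons.prems by (auto intro: hsum_square)
  have "mult q (hplus X (hsum Xs)) j u = mult q X j u + mult q (hsum Xs) j u"
    by (rule mult_biprod[OF hplus_biprod[OF sq] hplus_square sq])
  then show ?case using Cons hsum_Cons[of X Xs] by simp
qed

lemma copies_square: "square_mod X \<Longrightarrow> square_mod (copies s X)"
  unfolding copies_def by (intro hsum_square) auto

lemma copies_projective: "is_projective n q X \<Longrightarrow> is_projective n q (copies s X)"
  unfolding copies_def by (intro hsum_projective) auto

lemma mult_copies:
  assumes "square_mod X" shows "mult q (copies s X) j u = s * mult q X j u"
proof -
  have "mult q (copies s X) j u = (\<Sum>X\<leftarrow>replicate s X. mult q X j u)"
    unfolding copies_def using assms by (intro mult_hsum) auto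
  then show ?thesis by (simp add: sum_list_replicate map_replicate)
qed

section \<open>The modules $M_s(l,r,\eta)$\<close>

lemma short_exactI:
  assumes mods: "is_hmod n q L" "is_hmod n q M" "is_hmod n q N" and f: "is_hom L M f" and g: "is_hom M N g"
    and f': "f' \<in> carrier_mat (hdim L) (hdim M)" "f' * f = 1\<^sub>m (hdim L)"
    and g': "g' \<in> carrier_mat (hdim M) (hdim N)" "g * g' = 1\<^sub>m (hdim N)"
    and gf: "g * f = 0\<^sub>m (hdim N) (hdim L)" and sum: "f * f' + g' * g = 1\<^sub>m (hdim M)"
  shows "is_short_exact n q L f M g N"
proof -
  note fc = homD(1)[OF f] and gc = homD(1)[OF g]
  have "f' *\<^sub>v (f *\<^sub>v v) = v" if "v \<in> carrier_vec (hdim L)" for v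
    using assoc_mult_mat_vec[OF f'(1) fc that] f'(2) that by simp
  then have "inj_on (\<lambda>v. f *\<^sub>v v) (carrier_vec (hdim L))" by (intro inj_on_inverseI[where g = "\<lambda>v. f' *\<^sub>v v"])
  then have "is_mono L M f" using f by (simp add: is_mono_def)
  moreover have "is_epi M N g" unfolding epi_right_inverse using g g' by blast
  moreover have "(\<lambda>v. f *\<^sub>v v) ` carrier_vec (hdim L) = mat_kernel g"
  proof (intro equalityI subsetI)
    fix w assume "w \<in> (\<lambda>v. f *\<^sub>v v) ` carrier_vec (hdim L)"
    then obtain v where v: "v \<in> carrier_vec (hdim L)" "w = f *\<^sub>v v" by blast
    have "g *\<^sub>v w = (g * f) *\<^sub>v v" unfolding v(2) using assoc_mult_mat_vec[OF gc fc v(1)] by simp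
    then have "g *\<^sub>v w = 0\<^sub>v (hdim N)" unfolding gf using v(1) by (intro eq_vecI) (auto simp: scalar_prod_def)
    then show "w \<in> mat_kernel g" using mult_mat_vec_carrier[OF fc v(1)] v(2) by (intro mat_kernelI[OF gc]) auto
  next
    fix w assume "w \<in> mat_kernel g"
    then have w: "w \<in> carrier_vec (hdim M)" "g *\<^sub>v w = 0\<^sub>v (hdim N)" using mat_kernelD[OF gc] by auto
    have "w = (f * f' + g' * g) *\<^sub>v w" unfolding sum using w(1) by simp
    also have "\<dots> = (f * f') *\<^sub>v w + (g' * g) *\<^sub>v w"
      by (rule add_mult_distrib_mat_vec[OF mult_carrier_mat[OF fc f'(1)] mult_carrier_mat[OF g'(1) gc] w(1)])
    also have "(f * f') *\<^sub>v w = f *\<^sub>v (f' *\<^sub>v w)" by (rule assoc_mult_mat_vec[OF fc f'(1) w(1)])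
    also have "(g' * g) *\<^sub>v w = g' *\<^sub>v (g *\<^sub>v w)" by (rule assoc_mult_mat_vec[OF g'(1) gc w(1)])
    also have "\<dots> = 0\<^sub>v (hdim M)" unfolding w(2) using g'(1) by (intro eq_vecI) (auto simp: scalar_prod_def)
    also have "f *\<^sub>v (f' *\<^sub>v w) + 0\<^sub>v (hdim M) = f *\<^sub>v (f' *\<^sub>v w)" using fc f'(1) w(1) by simp
    finally show "w \<in> (\<lambda>v. f *\<^sub>v v) ` carrier_vec (hdim L)" using mult_mat_vec_carrier[OF f'(1) w(1)] by blast
  qed
  ultimately show ?thesis unfolding is_short_exact_def using mods by blast
qed

lemma band1_dim [simp]: "hdim (band1 n q l r \<eta>) = n"
  by (simp add: band1_def)

lemma band1_square: "square_mod (band1 n q l r \<eta>)"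
  by (simp add: square_mod_def band1_def endo_def)

lemma band1_quotient:
  assumes q: "primitive_root n q" and l: "1 \<le> l" "l < n"
  shows "is_hom (band1 n q l r \<eta>) (simple_mod q (n - l) (r + int l)) (prl (n - l) l)"
proof -
  have nl: "n - l + l = n" using l by simp
  have qn: "q powi (x - r) = q powi (x - (r + int l) - int (n - l))" for x
    unfolding powi_eq_iff[OF q] mod_eq_dvd_iff using l by (simp add: of_nat_diff)
  show ?thesis
    unfolding is_hom_def band1_dim simple_mod_sel
  proof (intro conjI)
    show "prl (n - l) l \<in> carrier_mat (n - l) n" using nl special_carrier(8)[of "n - l" l] by simp
    have b: "Z \<in> carrier_mat n n \<Longrightarrow> prl (n - l) l * Z = mat (n - l) n (\<lambda>(i, j). Z $$ (i, j))" for Z :: "'a mat"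
      using prl_mult[of Z "n - l" l n] nl by simp
    have s: "Z \<in> carrier_mat (n - l) (n - l) \<Longrightarrow> Z * prl (n - l) l = mat (n - l) n (\<lambda>(i, j). if j < n - l then Z $$ (i, j) else 0)" for Z :: "'a mat"
      using mult_prl[of Z "n - l" "n - l" l] nl by simp
    note bq = square_modD[OF band1_square[of n q l r \<eta>], unfolded band1_dim]
    have V: "square_mod (simple_mod q (n - l) (r + int l))" by (simp add: square_mod_def simple_mod_def endo_def)
    note sV = square_modD[OF V, unfolded simple_mod_sel]
    show "prl (n - l) l * opa (band1 n q l r \<eta>) = opa (simple_mod q (n - l) (r + int l)) * prl (n - l) l"
      unfolding b[OF bq(1)] s[OF sV(1)] using l by (intro cong_mat refl) (auto simp: band1_def simple_mod_def endo_def split: proj_line.splits)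
    show "prl (n - l) l * opb (band1 n q l r \<eta>) = opb (simple_mod q (n - l) (r + int l)) * prl (n - l) l"
      unfolding b[OF bq(2)] s[OF sV(2)] using l by (intro cong_mat refl) (auto simp: band1_def simple_mod_def endo_def)
    show "prl (n - l) l * opc (band1 n q l r \<eta>) = opc (simple_mod q (n - l) (r + int l)) * prl (n - l) l"
      unfolding b[OF bq(3)] s[OF sV(3)] using l by (intro cong_mat refl) (auto simp: band1_def simple_mod_def endo_def intro!: qn simp del: of_nat_diff)
    show "prl (n - l) l * opd (band1 n q l r \<eta>) = opd (simple_mod q (n - l) (r + int l)) * prl (n - l) l"
      unfolding b[OF bq(4)] s[OF sV(4)] using l by (intro cong_mat refl) (auto simp: band1_def simple_mod_def endo_def)
  qed
qed

lemma band1_sub: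
  assumes q: "primitive_root n q" and n: "n = a + l" and a: "1 \<le> a"
  shows "is_hom (simple_mod q l r) (band1 n q l r \<eta>) (inr a l)"
proof -
  let ?V = "simple_mod q l r" and ?B = "band1 (a + l) q l r \<eta>"
  have qn: "q powi (r + int j) = q powi (r + (int l + (int a + int j)))"
    "q powi (1 + int j - r - int l) = q powi (1 + (int a + int j) - r)" for j
  proof -
    have s: "r + (int l + (int a + int j)) = r + int j + int n" "1 + (int a + int j) - r = 1 + int j - r - int l + int n"
      using n by simp_all
    show "q powi (r + int j) = q powi (r + (int l + (int a + int j)))"
      "q powi (1 + int j - r - int l) = q powi (1 + (int a + int j) - r)"
      unfolding s powi_eq_iff[OF q] by (simp_all only: mod_add_self2)
  qed
  have ext: "mat (a + l) l F = mat (a + l) l G" if "\<And>i j. i < a \<Longrightarrow> j < l \<Longrightarrow> F (i, j) = G (i, j)"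
    "\<And>k j. k < l \<Longrightarrow> j < l \<Longrightarrow> F (a + k, j) = G (a + k, j)" for F G :: "nat \<times> nat \<Rightarrow> 'a"
  proof (rule cong_mat; (rule refl)?)
    fix i j assume ij: "i < a + l" "j < l"
    show "F (i, j) = G (i, j)"
    proof (cases "i < a")
      case False
      then obtain k where "i = a + k" using le_Suc_ex by (metis not_less)
      then show ?thesis using that(2)[of k j] ij by simp
    qed (use that(1) ij in blast)
  qed
  note bq = square_modD[OF band1_square[of "a + l" q l r \<eta>], unfolded band1_dim]
  have "square_mod ?V" by (simp add: square_mod_def simple_mod_def endo_def)
  note sV = square_modD[OF this, unfolded simple_mod_sel]
  have A: "inr a l * opa ?V = opa ?B * inr a l"
    unfolding mult_inr[OF bq(1)] inr_mult[OF sV(1)]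
    by (rule ext; cases \<eta>) (use a in \<open>auto simp: band1_def simple_mod_def endo_def\<close>)
  have B: "inr a l * opb ?V = opb ?B * inr a l"
    unfolding mult_inr[OF bq(2)] inr_mult[OF sV(2)]
    by (rule ext) (auto simp: band1_def simple_mod_def endo_def qn(1))
  have C: "inr a l * opc ?V = opc ?B * inr a l"
    unfolding mult_inr[OF bq(3)] inr_mult[OF sV(3)]
    by (rule ext) (auto simp: band1_def simple_mod_def endo_def qn(2))
  have D: "inr a l * opd ?V = opd ?B * inr a l"
    unfolding mult_inr[OF bq(4)] inr_mult[OF sV(4)]
    by (rule ext; cases \<eta>) (use a in \<open>auto simp: band1_def simple_mod_def endo_def\<close>)
  show ?thesis unfolding is_hom_def n using A B C D by simp
qed

text \<open>\<eta> only enters the arrows from the first \<open>n - l\<close> basis vectors to the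
  last \<open>l\<close>, so neither the submodule nor the quotient depends on it.\<close>

lemma band1_short_exact:
  assumes q: "primitive_root n q" and l: "1 \<le> l" "l < n" and B: "is_hmod n q (band1 n q l r \<eta>)"
  shows "is_short_exact n q (simple_mod q l r) (inr (n - l) l) (band1 n q l r \<eta>) (prl (n - l) l) (simple_mod q (n - l) (r + int l))"
proof -
  have n: "n > 1" and nl: "n - l + l = n" using l by auto
  have V: "is_hmod n q (simple_mod q l r)" "is_hmod n q (simple_mod q (n - l) (r + int l))"
    using l by (auto intro: simple_mod_hmod[OF q n])
  have c: "prr (n - l) l \<in> carrier_mat l n" "inl (n - l) l \<in> carrier_mat n (n - l)"
    using special_carrier(6,9)[of "n - l" l] nl by simp_all
  have "inr (n - l) l * prr (n - l) l + inl (n - l) l * prl (n - l) l = (1\<^sub>m n :: 'a mat)"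
    using embed_simps(5)[of "n - l" l] nl by (subst add_commute_dim) (simp_all del: embed_simps)
  then show ?thesis
    by (intro short_exactI[OF V(1) B V(2) band1_sub[OF q nl[symmetric]] band1_quotient[OF q l], of "prr (n - l) l" "inl (n - l) l"])
      (use l in \<open>simp_all add: c\<close>)
qed

lemma iso_hmod:
  assumes iso: "M \<cong>\<^sub>H N" and M: "is_hmod n q M" and N: "square_mod N"
  shows "is_hmod n q N"
proof -
  obtain f g where f: "is_hom M N f" "is_hom N M g" "g * f = 1\<^sub>m (hdim M)" "f * g = 1\<^sub>m (hdim N)"
    using iso unfolding hmod_iso_def by blast
  note c = hmod_carrier[OF M] and cN = square_modD[OF N] and hf = homD[OF f(1)]
  have eq: "f * X * g = Y" if "f * X = Y * f" "Y \<in> carrier_mat (hdim N) (hdim N)" for X Y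
    unfolding that(1) using that(2) hf(1) homD(1)[OF f(2)] f(4) by (simp add: mult_assoc_dim)
  have "is_hmod n q (HMod (hdim N) (f * opa M * g) (f * opb M * g) (f * opc M * g) (f * opd M * g))"
    using c by (intro idempotent_image_hmod(1)[OF M homD(1)[OF f(2)] hf(1) f(4)]) (simp_all add: f(3))
  then show ?thesis unfolding eq[OF hf(2) cN(1)] eq[OF hf(3) cN(2)] eq[OF hf(4) cN(3)] eq[OF hf(5) cN(4)] by simp
qed

lemma mult_tensor_short_exact:
  assumes q: "primitive_root n q" and P: "is_projective n q P" and ex: "is_short_exact n q L f M g N"
  shows "mult q (P \<otimes>\<^sub>H M) j u = mult q (P \<otimes>\<^sub>H L) j u + mult q (P \<otimes>\<^sub>H N) j u"
proof -
  obtain i1 i2 p1 p2 where b: "biprod (P \<otimes>\<^sub>H M) (P \<otimes>\<^sub>H L) (P \<otimes>\<^sub>H N) i1 i2 p1 p2" by (rule tensor_short_exact[OF q P ex])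
  have h: "is_hmod n q P" "is_hmod n q L" "is_hmod n q M" "is_hmod n q N" using P ex by (auto simp: is_projective_def is_short_exact_def)
  note t = hmod_square[OF htensor_hmod[OF q h(1)]]
  show ?thesis by (rule mult_biprod[OF b t[OF h(3)] t[OF h(2)] t[OF h(4)]])
qed

lemma mult_tensor_hsum2:
  assumes P: "square_mod P" and X: "square_mod X" and Y: "square_mod Y"
  shows "mult q (P \<otimes>\<^sub>H hsum [X, Y]) j u = mult q (P \<otimes>\<^sub>H X) j u + mult q (P \<otimes>\<^sub>H Y) j u"
proof -
  have e: "hsum [X, Y] = hplus X (hplus Y (hsum []))"
    using hsum_Cons[of X "[Y]"] hsum_Cons[of Y "[]"] X Y by simp
  have sum: "mult q (P \<otimes>\<^sub>H hplus A B) j u = mult q (P \<otimes>\<^sub>H A) j u + mult q (P \<otimes>\<^sub>H B) j u" if "square_mod A" "square_mod B" for A B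
    by (rule mult_biprod[OF tensor_biprod[OF hplus_biprod[OF that] P hplus_square that]]) (rule htensor_square P hplus_square that)+
  have "mult q (P \<otimes>\<^sub>H hsum []) j u = 0"
    by (rule mult_dim_0) (simp_all add: htensor_square P hsum_Nil)
  then show ?thesis unfolding e sum[OF X hplus_square] sum[OF Y hsum_Nil(2)] by simp
qed

text \<open>Writing \<open>m i\<close> for the multiplicity belonging to
  \<open>P \<otimes> N i\<close>, the sequences give \<open>m (i - 1) + m (i + 1) = 2 * m i\<close>,
  and with \<open>m 0 = 0\<close> this makes \<open>m\<close> linear. That \<open>band1\<close> is a
  module is read off from the isomorphism with \<open>M\<close> for \<open>s = 1\<close> and from
  the first sequence otherwise.\<close>

lemma band_hmod_mult:
  assumes q: "primitive_root n q" and s: "s \<ge> 1" and P: "is_projective n q P" and M: "is_band n q l r \<eta> s M"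
  shows "is_hmod n q (band1 n q l r \<eta>)" "mult q (P \<otimes>\<^sub>H M) j u = s * mult q (P \<otimes>\<^sub>H band1 n q l r \<eta>) j u"
proof -
  have hM: "is_hmod n q M" and hP: "is_hmod n q P" using M P by (auto simp: is_band_def is_projective_def)
  note sP = hmod_square[OF hP]
  obtain N where N0: "N 0 = hsum []" and N1: "N 1 = band1 n q l r \<eta>" and MN: "M \<cong>\<^sub>H N s"
    and Ni: "\<And>i. 1 \<le> i \<Longrightarrow> i < s \<Longrightarrow> is_hmod n q (N (i + 1)) \<and> almost_split_sequence n q (N i) (hsum [N (i - 1), N (i + 1)]) (N i)"
    using M unfolding is_band_def by blast
  have h1: "is_hmod n q (N 1)"
  proof (cases "s = 1")
    case True
    then show ?thesis using iso_hmod[OF MN hM] band1_square[of n q l r \<eta>] N1 by simp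
  next
    case False
    then show ?thesis using Ni[of 1] s by (auto simp: almost_split_sequence_def is_short_exact_def)
  qed
  then show "is_hmod n q (band1 n q l r \<eta>)" unfolding N1 .
  have hN: "is_hmod n q (N i)" if i: "i \<le> s" for i
  proof -
    consider "i = 0" | "i = 1" | "i > 1" by linarith
    then show ?thesis
    proof cases
      case 3
      then show ?thesis using Ni[of "i - 1"] i by simp
    qed (use N0 hsum_Nil_hmod h1 in simp_all)
  qed
  let ?m = "\<lambda>i. mult q (P \<otimes>\<^sub>H N i) j u"
  have m0: "?m 0 = 0" unfolding N0 by (rule mult_dim_0) (simp_all add: htensor_square sP hsum_Nil)
  have step: "?m (i - 1) + ?m (Suc i) = 2 * ?m i" if i: "1 \<le> i" "i < s" for i
  proof -
    obtain f g where ex: "is_short_exact n q (N i) f (hsum [N (i - 1), N (Suc i)]) g (N i)"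
      using Ni[OF i] unfolding Suc_eq_plus1 almost_split_sequence_def by blast
    have "square_mod (N (i - 1))" "square_mod (N (Suc i))" using hmod_square[OF hN] i by simp_all
    from mult_tensor_hsum2[OF sP this, of q j u] mult_tensor_short_exact[OF q P ex, of j u] show ?thesis by simp
  qed
  have "i \<le> s \<Longrightarrow> ?m i = i * ?m 1" for i
  proof (induction i rule: less_induct)
    case (less i)
    consider "i = 0" | "i = 1" | "2 \<le> i" by linarith
    then show ?case
    proof cases
      case 3
      then obtain k where "i = 2 + k" using le_Suc_ex by blast
      then have 3: "i = Suc (Suc k)" by simp
      have k: "k < i" "Suc k < i" "k \<le> s" "Suc k \<le> s" using 3 less.prems by auto
      have "?m k = k * ?m 1" "?m (Suc k) = Suc k * ?m 1" by (rule less.IH[OF k(1,3)], rule less.IH[OF k(2,4)])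
      moreover have "?m k + ?m (Suc (Suc k)) = 2 * ?m (Suc k)" using step[of "Suc k"] less.prems 3 by simp
      ultimately show ?thesis unfolding 3 by simp
    qed (use m0 in simp_all)
  qed
  then have "?m s = s * ?m 1" by simp
  moreover have "mult q (P \<otimes>\<^sub>H M) j u = ?m s"
    using hmod_square[OF hN[of s]] hmod_square[OF hM]
    by (intro mult_iso[OF tensor_iso[OF MN sP]] htensor_square sP) simp_all
  ultimately show "mult q (P \<otimes>\<^sub>H M) j u = s * mult q (P \<otimes>\<^sub>H band1 n q l r \<eta>) j u" using N1 by simp
qed

text \<open>All the modules $M_1(l,r,\eta)$ have the same composition factors, and tensoring with a projective
  module only sees these.\<close>

lemma mult_tensor_band1:
  assumes q: "primitive_root n q" and l: "1 \<le> l" "l < n" and P: "is_projective n q P" and B: "is_hmod n q (band1 n q l r \<eta>)"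
  shows "mult q (P \<otimes>\<^sub>H band1 n q l r \<eta>) j u = mult q (P \<otimes>\<^sub>H band1 n q l r (Fin 0)) j u"
proof -
  have "is_hmod n q (band1 n q l r (Fin 0))" using l by (intro band1_zero_hmod[OF q]) auto
  from mult_tensor_short_exact[OF q P band1_short_exact[OF q l this], of j u]
    mult_tensor_short_exact[OF q P band1_short_exact[OF q l B], of j u]
  show ?thesis by simp
qed

section \<open>Functionals killed by $d$\<close>

text \<open>Rank and nullity of \<open>a^j\<close> on these functionals, with \<open>j\<close> tuned
  to the weights as in \<open>simple_quotient_exists\<close>; for \<open>j = n\<close> the image is
  zero.\<close>

lemma rdim_killed:
  assumes q: "primitive_root n q" and n: "n > 1" and P: "is_projective n q P" and j: "1 \<le> j" "j \<le> n"
    and dvd: "int n dvd x + y + 1 - int j"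
  shows "rdim (hdim P) (fsp q P x y 1 n) = mult q P j (- y) + (if j < n then mult q P (n - j) (int j - y) else 0)"
proof -
  have hP: "is_hmod n q P" using P by (simp add: is_projective_def)
  note sq = hmod_square[OF hP] and c = hmod_carrier[OF hP]
  let ?m = "hdim P"
  let ?T = "opa P ^\<^sub>m j"
  have Tc: "?T \<in> carrier_mat ?m ?m" by (rule pow_carrier_mat[OF c(1)])
  have An: "w * opa P ^\<^sub>m n = 0\<^sub>m 1 ?m" if "w \<in> carrier_mat 1 ?m" for w
    using hmod_powers(1)[OF hP] that by simp
  have d1: "w * opd P = 0\<^sub>m 1 ?m" if "w \<in> fsp q P x y 1 n" for w using fspD(4)[OF that] c(4) by simp
  have "(- y + int j - 1) mod int n = x mod int n"
    unfolding mod_eq_dvd_iff using dvd by (simp add: dvd_diff_commute algebra_simps)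
  then have xy: "simple_fsp q P j (- y) = fsp q P x y 1 j"
    unfolding simple_fsp_def by (rule fsp_cong[OF q]) simp
  have ker: "{w \<in> fsp q P x y 1 n. w * ?T = 0\<^sub>m 1 ?m} = simple_fsp q P j (- y)"
    unfolding xy using An by (auto simp: fsp_def)
  show ?thesis
  proof (cases "j < n")
    case True
    have im: "{w * ?T | w. w \<in> fsp q P x y 1 n} = simple_fsp q P (n - j) (int j - y)"
    proof (intro equalityI subsetI)
      fix v assume "v \<in> {w * ?T | w. w \<in> fsp q P x y 1 n}"
      then obtain w where w: "w \<in> fsp q P x y 1 n" "v = w * ?T" by blast
      show "v \<in> simple_fsp q P (n - j) (int j - y)"
        unfolding w(2) by (rule killed_functional_shift[OF q n hP fspD(1-3)[OF w(1)] d1[OF w(1)] j dvd])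
    next
      fix v assume v: "v \<in> simple_fsp q P (n - j) (int j - y)"
      have nj: "1 \<le> n - j" "n - j \<le> n" "n - j + j = n" using True by auto
      \<comment> \<open>Surjectivity: as \<open>P\<close> is projective, the homomorphism given by
        \<open>v\<close> lifts along the quotient map from \<open>M_1(j, -y, 0)\<close> to
        \<open>V(n - j, j - y)\<close>, and the last coordinate of the lift is the required
        preimage.\<close>
      let ?B = "band1 n q j (- y) (Fin 0)" and ?V = "simple_mod q (n - j) (int j - y)"
      have yj: "- y + int j = int j - y" by simp
      have hB: "is_hmod n q ?B" by (rule band1_zero_hmod[OF q n True])
      have V: "is_hmod n q ?V" by (rule simple_mod_hmod[OF q n nj(2)])
      have g: "is_hom ?B ?V (prl (n - j) j)" using band1_quotient[OF q j(1) True, of "- y" "Fin 0"] unfolding yj .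
      note f = simple_hom[OF q n hP nj(1) v]
      have g': "inl (n - j) j \<in> carrier_mat (hdim ?B) (hdim ?V)" using special_carrier(6)[of "n - j" j] nj by simp
      obtain h where h: "is_hom P ?B h" "prl (n - j) j * h = simple_hom P (n - j) v"
        by (rule projectiveD[OF P hB V f(1) g g']) simp
      note h' = h(1)[unfolded band1_zero_chain[OF q n True]]
      define w where "w = urow n (n - 1) * h"
      have "w \<in> fsp q P (- y + int j + int n - 1) (1 - (- y) + int n - 1) 1 n"
        unfolding w_def using n by (intro hom_functional[OF h' sq]) auto
      also have "\<dots> = fsp q P x y 1 n"
      proof (rule fsp_cong[OF q])
        have *: "- y + int j + int n - 1 - x = int n - (x + y + 1 - int j)" by simp
        show "(- y + int j + int n - 1) mod int n = x mod int n"
          unfolding mod_eq_dvd_iff * by (rule dvd_diff[OF dvd_refl dvd])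
      qed simp
      finally have w: "w \<in> fsp q P x y 1 n" .
      have nn: "n - 1 - (n - 1 - j) = j" "n - 1 - j < n" "n - j - 1 < n - j" "n - 1 - j = n - j - 1" using True by auto
      have hc: "h \<in> carrier_mat n ?m" using homD(1)[OF h(1)] by simp
      have "w * ?T = urow n (n - 1 - j) * h"
        unfolding w_def using hom_rows[OF h' sq nn(2)] unfolding nn(1) by simp
      \<comment> \<open>The coordinate reached from the last one after \<open>j\<close> steps of
        \<open>a\<close> is the last coordinate of the quotient.\<close>
      also have "(urow n (n - 1 - j) :: 'a mat) = urow (n - j) (n - j - 1) * prl (n - j) j"
      proof -
        have "urow (n - j) (n - j - 1) * prl (n - j) j = (mat 1 (n - j + j) (\<lambda>(a, b). if b < n - j then urow (n - j) (n - j - 1) $$ (a, b) else 0) :: 'a mat)"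
          by (rule mult_prl) simp
        also have "\<dots> = urow n (n - j - 1)" unfolding nj(3) using nn(3) by (intro eq_matI) (auto simp: urow_def)
        finally show ?thesis unfolding nn(4) by (rule sym)
      qed
      also have "\<dots> * h = urow (n - j) (n - j - 1) * (prl (n - j) j * h)"
        using hc nj by (simp add: mult_assoc_dim)
      also have "\<dots> = v" unfolding h(2) by (rule f(2))
      finally show "v \<in> {w * ?T | w. w \<in> fsp q P x y 1 n}" using w by blast
    qed
    show ?thesis using rdim_rank_nullity[OF fsp_subspace[OF sq] Tc, of q x y 1 n] True unfolding ker im mult_def by simp
  next
    case False
    then have jn: "j = n" using j by simp
    have "0\<^sub>m 1 ?m \<in> fsp q P x y 1 n" using row_subspaceD(2)[OF fsp_subspace[OF sq]] .
    moreover have "{w * ?T | w. w \<in> fsp q P x y 1 n} = (\<lambda>w. 0\<^sub>m 1 ?m) ` fsp q P x y 1 n"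
      unfolding Setcompr_eq_image jn by (intro image_cong refl An fspD(1))
    ultimately have im: "{w * ?T | w. w \<in> fsp q P x y 1 n} = {0\<^sub>m 1 ?m}" by auto
    show ?thesis using rdim_rank_nullity[OF fsp_subspace[OF sq] Tc, of q x y 1 n] False unfolding ker im mult_def by (simp add: rdim_zero)
  qed
qed

text \<open>\<open>V(l,r)\<close> is the only simple quotient of \<open>P\<close>, so the two terms
  of \<open>rdim_killed\<close> count for \<open>j = l\<close> and for \<open>n - j = l\<close>.
  Both conditions are translated back into congruences for \<open>x\<close> and \<open>y\<close>,
  which eliminates \<open>j\<close>.\<close>

lemma rdim_killed_cover:
  assumes q: "primitive_root n q" and l: "1 \<le> l" "l < n"
    and P: "is_projective_cover n q P (simple_mod q l r)"
  shows "rdim (hdim P) (fsp q P x y 1 n) =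
    of_bool (int n dvd x + y + 1 - int l \<and> int n dvd y + r) + of_bool (int n dvd x + y + 1 + int l \<and> int n dvd y + r + int l)"
proof -
  have n: "n > 1" using l by simp
  have pP: "is_projective n q P" using P by (simp add: is_projective_cover_def)
  define j where "j = nat ((x + y) mod int n) + 1"
  have "0 \<le> (x + y) mod int n" "(x + y) mod int n < int n" using n by simp_all
  then have j: "1 \<le> j" "j \<le> n" and ji: "int j = (x + y) mod int n + 1" by (auto simp: j_def)
  have dvd: "int n dvd x + y + 1 - int j" unfolding ji by (simp add: mod_eq_dvd_iff[symmetric])
  have eq: "int n dvd x + y + 1 - z \<longleftrightarrow> int n dvd int j - z" for z
  proof -
    have "x + y + 1 - z = (x + y + 1 - int j) + (int j - z)" by simp
    then show ?thesis using dvd by (metis dvd_add_right_iff)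
  qed
  have small: "int n dvd z \<longleftrightarrow> z = 0" if "\<bar>z\<bar> < int n" for z using that zdvd_not_zless[of "\<bar>z\<bar>" "int n"] by (cases "z = 0") auto
  have 1: "int n dvd x + y + 1 - int l \<longleftrightarrow> j = l" unfolding eq using small[of "int j - int l"] j l by auto
  have 2: "int n dvd x + y + 1 + int l \<longleftrightarrow> j < n \<and> n - j = l"
  proof -
    have "int n dvd int j + int l \<longleftrightarrow> int n dvd (int j + int l - int n)" by (metis dvd_add_left_iff dvd_refl diff_add_cancel)
    then have "int n dvd int j + int l \<longleftrightarrow> int j + int l = int n" using small[of "int j + int l - int n"] j l by auto
    then show ?thesis using eq[of "- int l"] j l by auto
  qed
  have r2: "(int j - y) mod int n = r mod int n \<longleftrightarrow> int n dvd y + r + int l" if "n - j = l" "j < n"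
  proof -
    have "int j - y - r = int n - (y + r + int l)" using that by (simp add: of_nat_diff)
    then show ?thesis unfolding mod_eq_dvd_iff by (metis dvd_diff_right_iff dvd_refl)
  qed
  have r1: "(- y) mod int n = r mod int n \<longleftrightarrow> int n dvd y + r"
  proof -
    have "- y - r = - (y + r)" by simp
    then show ?thesis unfolding mod_eq_dvd_iff by (metis dvd_minus_iff)
  qed
  show ?thesis
    unfolding rdim_killed[OF q n pP j dvd] 1 2
    using mult_cover[OF q n l(1) _ j P, of "- y"] mult_cover[OF q n l(1) _ _ _ P, of "n - j" "int j - y"] l j r1 r2
    by auto
qed

text \<open>The index \<open>k\<close> runs over the steps of the filtration by powers of
  \<open>d\<close>; the weights in step \<open>k\<close> are \<open>u - r' - l' + k\<close> and
  \<open>r' - u - j + k\<close>.\<close>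

theorem mult_tensor_zero_band:
  assumes q: "primitive_root n q" and l: "1 \<le> l" "l < n" and l': "1 \<le> l'" "l' < n" and j: "1 \<le> j" "j \<le> n"
    and P: "is_projective_cover n q P (simple_mod q l r)"
  shows "mult q (P \<otimes>\<^sub>H band1 n q l' r' (Fin 0)) j u =
    (\<Sum>k<j. of_bool (int n dvd 2 * int k + 1 - int l' - int j - int l \<and> int n dvd r + r' - u - int j + int k) +
      of_bool (int n dvd 2 * int k + 1 - int l' - int j + int l \<and> int n dvd r + r' - u - int j + int k + int l))"
proof -
  have n: "n > 1" using l by simp
  have pP: "is_projective n q P" using P by (simp add: is_projective_cover_def)
  then have hP: "is_hmod n q P" by (simp add: is_projective_def)
  have rec: "chain_rec q n (r' + int l' + (1 - r')) (chain_coeff q (1 + int l'))"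
  proof -
    have *: "r' + int l' + (1 - r') = 1 + int l'" by simp
    show ?thesis unfolding *
      by (rule chain_rec_coeff[OF primitive_rootD(3)[OF q] root_ne_1[OF q n]]) (simp add: primitive_rootD(2)[OF q])
  qed
  show ?thesis
    unfolding band1_zero_chain[OF q n l'(2)] mult_tensor_chain[OF q n hP rec j] rdim_fsp_d_filtration[OF q n pP j(2)]
      rdim_killed_cover[OF q l P]
    by (intro sum.cong refl) (simp add: algebra_simps)
qed

section \<open>Counting\<close>

text \<open>As \<open>j \<le> n\<close>, at most the representative of \<open>z\<close> between 0
  and \<open>n - 1\<close> contributes.\<close>

lemma sum_residue:
  assumes n: "n > 0" and j: "j \<le> n"
  shows "(\<Sum>k<j. of_bool (int n dvd int k - z)) = (of_bool (z mod int n < int j) :: nat)"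
proof -
  define k0 where "k0 = nat (z mod int n)"
  have k0: "int k0 = z mod int n" using n by (simp add: k0_def)
  have "int n dvd int k - z \<longleftrightarrow> k = k0" if "k < j" for k
    unfolding mod_eq_dvd_iff[symmetric] k0[symmetric] using that j by auto
  then have "(\<Sum>k<j. of_bool (int n dvd int k - z)) = (\<Sum>k<j. if k = k0 then 1 else 0 :: nat)"
    by (intro sum.cong refl) auto
  also have "\<dots> = of_bool (k0 < j)" by simp
  finally show ?thesis using k0 by auto
qed

text \<open>\<open>i\<close> is the residue of \<open>u - r - r'\<close>. The second congruence of
  each pair then fixes \<open>k\<close> modulo \<open>n\<close> as \<open>i + j\<close> or
  \<open>i + j - l\<close>; given this, the first one turns into a condition without
  \<open>k\<close>. The indicators decide whether the class has a representative below
  \<open>j\<close>.\<close>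

lemma sum_residue_pair:
  fixes l l' i j n :: nat
  assumes n: "l < n" and j: "j \<le> n" and i: "i < n" and u: "int n dvd r + r' + int i - u"
  shows "(\<Sum>k<j. of_bool (int n dvd 2 * int k + 1 - int l' - int j - int l \<and> int n dvd r + r' - u - int j + int k) +
      of_bool (int n dvd 2 * int k + 1 - int l' - int j + int l \<and> int n dvd r + r' - u - int j + int k + int l))
    = (if int n dvd int l + int l' - 1 - 2 * int i - int j
       then of_bool (n \<le> i + j) + of_bool (l \<le> i + j \<and> i < l) + of_bool (n + l \<le> i + j) else 0 :: nat)"
    (is "?S = (if ?E then _ else 0)")
proof -
  have 1: "int n dvd 2 * int k + 1 - int l' - int j - int l \<and> int n dvd r + r' - u - int j + int k
      \<longleftrightarrow> ?E \<and> int n dvd int k - int (i + j)" for k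
  proof -
    have a: "r + r' - u - int j + int k = (r + r' + int i - u) + (int k - int (i + j))" by simp
    have b: "2 * int k + 1 - int l' - int j - int l = 2 * (int k - int (i + j)) - (int l + int l' - 1 - 2 * int i - int j)" by simp
    have "int n dvd r + r' - u - int j + int k \<longleftrightarrow> int n dvd int k - int (i + j)" unfolding a using u by (rule dvd_add_right_iff)
    moreover have "int n dvd 2 * int k + 1 - int l' - int j - int l \<longleftrightarrow> ?E" if "int n dvd int k - int (i + j)"
      unfolding b using that by (intro dvd_diff_right_iff dvd_mult)
    ultimately show ?thesis by blast
  qed
  have 2: "int n dvd 2 * int k + 1 - int l' - int j + int l \<and> int n dvd r + r' - u - int j + int k + int l
      \<longleftrightarrow> ?E \<and> int n dvd int k - (int (i + j) - int l)" for k
  proof -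
    have a: "r + r' - u - int j + int k + int l = (r + r' + int i - u) + (int k - (int (i + j) - int l))" by simp
    have b: "2 * int k + 1 - int l' - int j + int l = 2 * (int k - (int (i + j) - int l)) - (int l + int l' - 1 - 2 * int i - int j)" by simp
    have "int n dvd r + r' - u - int j + int k + int l \<longleftrightarrow> int n dvd int k - (int (i + j) - int l)" unfolding a using u by (rule dvd_add_right_iff)
    moreover have "int n dvd 2 * int k + 1 - int l' - int j + int l \<longleftrightarrow> ?E" if "int n dvd int k - (int (i + j) - int l)"
      unfolding b using that by (intro dvd_diff_right_iff dvd_mult)
    ultimately show ?thesis by blast
  qed
  have n0: "n > 0" using n by simp
  have S: "?S = (\<Sum>k<j. of_bool (?E \<and> int n dvd int k - int (i + j))) + (\<Sum>k<j. of_bool (?E \<and> int n dvd int k - (int (i + j) - int l)))"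
    unfolding 1 2 by (rule sum.distrib)
  show ?thesis
  proof (cases ?E)
    case True
    have m1: "int (i + j) mod int n < int j \<longleftrightarrow> n \<le> i + j"
    proof (cases "i + j < n")
      case False
      then have "i + j - n < n" "(i + j) mod n = i + j - n" using i j by (auto simp: mod_if)
      then show ?thesis unfolding of_nat_mod[symmetric] using False i by auto
    qed (simp flip: of_nat_mod)
    \<comment> \<open>\<open>i + j - l\<close> lies strictly between \<open>- n\<close> and
      \<open>2 n\<close>; its residue arises by adding \<open>n\<close>, by no change, or by
      subtracting \<open>n\<close>.\<close>
    have m2: "of_bool ((int (i + j) - int l) mod int n < int j) = (of_bool (l \<le> i + j \<and> i < l) + of_bool (n + l \<le> i + j) :: nat)"
    proof -
      consider "i + j < l" | "l \<le> i + j" "i + j < n + l" | "n + l \<le> i + j" by linarith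
      then show ?thesis
      proof cases
        case 1
        have "(int (i + j) - int l) mod int n = (int (i + j) - int l + int n) mod int n" by simp
        also have "\<dots> = int (i + j) - int l + int n" using 1 n by (intro mod_pos_pos_trivial) auto
        finally show ?thesis using 1 n by simp
      next
        case 2
        then have "(int (i + j) - int l) mod int n = int (i + j) - int l" by (intro mod_pos_pos_trivial) auto
        then show ?thesis using 2 by auto
      next
        case 3
        have "(int (i + j) - int l) mod int n = (int (i + j) - int l - int n) mod int n" by simp
        also have "\<dots> = int (i + j) - int l - int n" using 3 i j by (intro mod_pos_pos_trivial) auto
        finally show ?thesis using 3 i j by auto
      qed
    qed
    have "?S = of_bool (n \<le> i + j) + (of_bool (l \<le> i + j \<and> i < l) + of_bool (n + l \<le> i + j))"
      unfolding S using True sum_residue[OF n0 j, of "int (i + j)"] sum_residue[OF n0 j, of "int (i + j) - int l"]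
      unfolding m1 m2 by simp
    then show ?thesis using True by simp
  qed (simp add: S)
qed

lemma ceil_half_eq: "ceil_half x = (x + 1) div 2"
  unfolding ceil_half_def by (metis floor_divide_of_int_eq of_int_numeral)

text \<open>Divisibility means \<open>l + l' - 1 - 2i - j = n m\<close>, and for reasons of size
  \<open>m\<close> is 1, 0, -1 or -2. The first two sums on the right belong to
  \<open>m = 0\<close>, the last two to \<open>m = -1\<close>.\<close>

lemma multiplicity_count:
  fixes l l' i j n t :: nat
  assumes l: "2 \<le> l" "l < n" "2 \<le> l'" "l' < n" and t: "int t = int l + int l' - (int n + 1)" and j: "1 \<le> j" "j \<le> n" and i: "i < n"
  shows "(if int n dvd int l + int l' - 1 - 2 * int i - int j
       then of_bool (n \<le> i + j) + of_bool (l \<le> i + j \<and> i < l) + of_bool (n + l \<le> i + j) else 0 :: nat) =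
    2 * of_bool ((t + 1) div 2 \<le> i \<and> i < t + 1 \<and> j = l + l' - 1 - 2 * i) +
    of_bool (t + 1 \<le> i \<and> i < min l l' \<and> j = l + l' - 1 - 2 * i) +
    of_bool (max l l' \<le> i \<and> i < n \<and> j = n + l + l' - 1 - 2 * i) +
    2 * of_bool ((l + l') div 2 \<le> i \<and> i < max l l' \<and> j = n + l + l' - 1 - 2 * i)" (is "?L = ?R")
proof (cases "int n dvd int l + int l' - 1 - 2 * int i - int j")
  case True
  then obtain m where m: "int l + int l' - 1 - 2 * int i - int j = int n * m" by (auto simp: dvd_def)
  have "int n * m < int n * 2" "int n * (- 3) < int n * m" unfolding m[symmetric] using l j i by auto
  then have "m < 2" "- 3 < m" using l by (simp_all only: mult_less_cancel_left_pos[of "int n"] of_nat_0_less_iff)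
  then consider "m = 1" | "m = 0" | "m = - 1" | "m = - 2" by linarith
  then have "of_bool (n \<le> i + j) + of_bool (l \<le> i + j \<and> i < l) + of_bool (n + l \<le> i + j) = ?R"
  proof cases
    \<comment> \<open>Then \<open>t = 2i + j\<close>, so that \<open>i + j \<le> t\<close> is below
      all thresholds and both sides are 0.\<close>
    case 1
    then have "int l + int l' - 1 - 2 * int i - int j = int n" using m by simp
    then have "t = 2 * i + j" using t by linarith
    moreover have "n + 1 + t = l + l'" using t by linarith
    ultimately have "\<not> n \<le> i + j" "\<not> l \<le> i + j" "\<not> n + l \<le> i + j" "\<not> (t + 1) div 2 \<le> i" "\<not> t + 1 \<le> i"
      "\<not> max l l' \<le> i" "\<not> (l + l') div 2 \<le> i" using l j i by auto
    then show ?thesis by simp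
  next
    \<comment> \<open>The middle indicator amounts to \<open>i < min l l'\<close> and the first one
      to \<open>i \<le> t\<close>; they overlap up to \<open>t\<close>, which produces the
      coefficient 2 there.\<close>
    case 2
    then have "int l + int l' - 1 - 2 * int i - int j = 0" using m by simp
    then have e: "2 * i + j + 1 = l + l'" by linarith
    moreover have "n + 1 + t = l + l'" using t by linarith
    ultimately have f: "n \<le> i + j \<longleftrightarrow> i < t + 1" "l \<le> i + j \<and> i < l \<longleftrightarrow> i < min l l'" "\<not> n + l \<le> i + j" "(t + 1) div 2 \<le> i"
      "j = l + l' - 1 - 2 * i" "j \<noteq> n + l + l' - 1 - 2 * i" "t + 1 \<le> i \<longleftrightarrow> \<not> i < t + 1" "i < t + 1 \<longrightarrow> i < min l l'"
      using l j i by auto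
    have "of_bool N + of_bool L + of_bool M = (2 * of_bool (A \<and> B \<and> C) + of_bool (D \<and> E \<and> C) + of_bool (F \<and> G \<and> H) + 2 * of_bool (I \<and> J \<and> H) :: nat)"
      if "N = B" "L = E" "\<not> M" A C "\<not> H" "D = (\<not> B)" "B \<longrightarrow> E" for A B C D E F G H I J L M N
      using that by (cases B; cases E) simp_all
    from this[OF f] show ?thesis .
  next
    \<comment> \<open>The first indicator is always 1, and the other two, which exclude each other,
      add 1 exactly for \<open>i < max l l'\<close>.\<close>
    case 3
    then have "int l + int l' - 1 - 2 * int i - int j = - int n" using m by simp
    then have e: "2 * i + j + 1 = n + l + l'" by linarith
    moreover have "n + 1 + t = l + l'" using t by linarith
    ultimately have f: "n \<le> i + j" "j \<noteq> l + l' - 1 - 2 * i" "max l l' \<le> i \<longleftrightarrow> \<not> i < max l l'" "(l + l') div 2 \<le> i"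
      "j = n + l + l' - 1 - 2 * i" "i < max l l' \<longleftrightarrow> (l \<le> i + j \<and> i < l) \<or> n + l \<le> i + j"
      "\<not> ((l \<le> i + j \<and> i < l) \<and> n + l \<le> i + j)" using l j i by auto
    have "of_bool N + of_bool L + of_bool M = (2 * of_bool (A \<and> B \<and> C) + of_bool (D \<and> E \<and> C) + of_bool (F \<and> G \<and> H) + 2 * of_bool (I \<and> J \<and> H) :: nat)"
      if N "\<not> C" "F = (\<not> J)" I H "J = (L \<or> M)" "\<not> (L \<and> M)" G for A B C D E F G H I J L M N
      using that by (cases L; cases M) simp_all
    from this[OF f i] show ?thesis .
  next
    \<comment> \<open>Impossible: \<open>2i + j + 1 < 3n\<close>, whereas
      \<open>2n + l + l' > 3n\<close> because \<open>t\<close> is nonnegative.\<close>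
    case 4
    then have "int l + int l' - 1 - 2 * int i - int j = - 2 * int n" using m by simp
    then have e: "2 * i + j + 1 = 2 * n + l + l'" by linarith
    moreover have "n + 1 + t = l + l'" using t by linarith
    ultimately show ?thesis using l j i by (auto simp: of_bool_def)
  qed
  then show ?thesis using True by simp
next
  case False
  have "\<not> (i < min l l' \<and> j = l + l' - 1 - 2 * i)"
  proof
    assume *: "i < min l l' \<and> j = l + l' - 1 - 2 * i"
    then have "int l + int l' - 1 - 2 * int i - int j = 0" by auto
    then show False using False by simp
  qed
  moreover have "\<not> (i < n \<and> j = n + l + l' - 1 - 2 * i)"
  proof
    assume *: "i < n \<and> j = n + l + l' - 1 - 2 * i"
    then have "int l + int l' - 1 - 2 * int i - int j = - int n" using j by auto
    then show False using False by simp
  qed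
  moreover have "t + 1 \<le> min l l'" "max l l' < n" using t l by auto
  ultimately show ?thesis using False i by auto
qed

section \<open>The four direct sums of the result and the final comparison\<close>

lemma projective_progression:
  assumes P: "\<forall>j u. 1 \<le> j \<and> j \<le> n \<longrightarrow> is_projective_cover n q (P j u) (simple_mod q j u)"
    and \<phi>: "\<forall>i. a \<le> i \<and> i < b \<longrightarrow> 1 \<le> \<phi> i \<and> \<phi> i \<le> n"
  shows "is_projective n q (hsum (map (\<lambda>i. copies k (P (\<phi> i) (r + int i))) [a..<b]))"
proof (rule hsum_projective)
  fix X assume "X \<in> set (map (\<lambda>i. copies k (P (\<phi> i) (r + int i))) [a..<b])"
  then obtain x where x: "a \<le> x" "x < b" "X = copies k (P (\<phi> x) (r + int x))" by auto
  have "is_projective n q (P (\<phi> x) (r + int x))" using P \<phi> x by (simp add: is_projective_cover_def)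
  then show "is_projective n q X" unfolding x(3) by (rule copies_projective)
qed

text \<open>The indices from \<open>a\<close> to \<open>b \<le> n\<close> are distinct modulo
  \<open>n\<close>, so \<open>u\<close> selects the single summand with index
  \<open>i\<close>.\<close>

lemma mult_progression:
  assumes q: "primitive_root n q" and n: "n > 1"
    and P: "\<forall>j u. 1 \<le> j \<and> j \<le> n \<longrightarrow> is_projective_cover n q (P j u) (simple_mod q j u)"
    and \<phi>: "\<forall>i. a \<le> i \<and> i < b \<longrightarrow> 1 \<le> \<phi> i \<and> \<phi> i \<le> n" and b: "b \<le> n"
    and i: "i < n" and u: "int n dvd r + int i - u" and j: "1 \<le> j" "j \<le> n"
  shows "mult q (hsum (map (\<lambda>i. copies k (P (\<phi> i) (r + int i))) [a..<b])) j u = k * of_bool (a \<le> i \<and> i < b \<and> j = \<phi> i)"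
proof -
  have sq: "square_mod (P (\<phi> x) (r + int x))" if "a \<le> x" "x < b" for x
  proof (rule hmod_square)
    show "is_hmod n q (P (\<phi> x) (r + int x))" using P \<phi> that by (simp add: is_projective_cover_def is_projective_def)
  qed
  have ui: "u mod int n = (r + int i) mod int n" using u by (metis mod_eq_dvd_iff)
  have one: "mult q (P (\<phi> x) (r + int x)) j u = (if x = i then of_bool (j = \<phi> i) else 0)" if x: "a \<le> x" "x < b" for x
  proof -
    have "u mod int n = (r + int x) mod int n \<longleftrightarrow> int n dvd (r + int i) - (r + int x)"
      unfolding ui by (rule mod_eq_dvd_iff)
    also have "(r + int i) - (r + int x) = int i - int x" by simp
    also have "int n dvd int i - int x \<longleftrightarrow> x = i"
      unfolding mod_eq_dvd_iff[symmetric] using x b i by auto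
    finally have eq: "u mod int n = (r + int x) mod int n \<longleftrightarrow> x = i" .
    have "1 \<le> \<phi> x" "\<phi> x \<le> n" "is_projective_cover n q (P (\<phi> x) (r + int x)) (simple_mod q (\<phi> x) (r + int x))"
      using P \<phi> x by simp_all
    from mult_cover[OF q n this(1,2) j this(3), of u] show ?thesis unfolding eq by auto
  qed
  have "mult q (hsum (map (\<lambda>i. copies k (P (\<phi> i) (r + int i))) [a..<b])) j u
      = (\<Sum>X\<leftarrow>map (\<lambda>i. copies k (P (\<phi> i) (r + int i))) [a..<b]. mult q X j u)"
  proof (rule mult_hsum)
    fix X assume "X \<in> set (map (\<lambda>i. copies k (P (\<phi> i) (r + int i))) [a..<b])"
    then obtain x where x: "a \<le> x" "x < b" "X = copies k (P (\<phi> x) (r + int x))" by auto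
    show "square_mod X" unfolding x(3) by (rule copies_square[OF sq[OF x(1,2)]])
  qed
  also have "\<dots> = (\<Sum>x\<in>{a..<b}. mult q (copies k (P (\<phi> x) (r + int x))) j u)"
    unfolding map_map o_def interv_sum_list_conv_sum_set_nat set_upt ..
  also have "\<dots> = (\<Sum>x\<in>{a..<b}. if x = i then k * of_bool (j = \<phi> i) else 0)"
  proof (rule sum.cong[OF refl])
    fix x assume "x \<in> {a..<b}"
    then have x: "a \<le> x" "x < b" by auto
    show "mult q (copies k (P (\<phi> x) (r + int x))) j u = (if x = i then k * of_bool (j = \<phi> i) else 0)"
      unfolding mult_copies[OF sq[OF x]] one[OF x] by simp
  qed
  also have "\<dots> = k * of_bool (a \<le> i \<and> i < b \<and> j = \<phi> i)" by auto
  finally show ?thesis .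
qed

theorem corollary4p8:
  fixes n :: nat and q :: "'k::alg_closed_field"
    and l l' s t l1 l2 :: nat and r r' :: int and \<eta> :: "'k proj_line"
    and P :: "nat \<Rightarrow> int \<Rightarrow> 'k hmod" and M :: "'k hmod"
  assumes "n > 2" and "primitive_root n q"
    and P: "\<And>j u. 1 \<le> j \<Longrightarrow> j \<le> n \<Longrightarrow> is_P n q j u (P j u)"
    and "2 \<le> l" and "l < n" and "2 \<le> l'" and "l' < n"
    and "s \<ge> 1" and M: "is_band n q l' r' \<eta> s M"
    and t: "int t = int l + int l' - (int n + 1)"
    and "l1 = min l l'" and "l2 = max l l'"
  shows "P l r \<otimes>\<^sub>H M \<cong>\<^sub>H hsum
    [hsum (map (\<lambda>i. copies (2 * s) (P (l + l' - 1 - 2 * i) (r + r' + int i)))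
        [nat (ceil_half (int t))..<t + 1]),
     hsum (map (\<lambda>i. copies s (P (l + l' - 1 - 2 * i) (r + r' + int i)))
        [t + 1..<l1]),
     hsum (map (\<lambda>i. copies s (P (n + l + l' - 1 - 2 * i) (r + r' + int i)))
        [l2..<n]),
     hsum (map (\<lambda>i. copies (2 * s) (P (n + l + l' - 1 - 2 * i) (r + r' + int i)))
        [nat (ceil_half (int (l + l' - 1)))..<l2])]"
proof -
  have n: "n > 1" "n > 0" and q: "primitive_root n q" using assms by auto
  have lb: "1 \<le> l" "l < n" "1 \<le> l'" "l' < n" "l \<le> n" using assms by auto
  have cover: "is_projective_cover n q (P j u) (simple_mod q j u)" if "1 \<le> j" "j \<le> n" for j u
    by (rule is_P_cover[OF q n(1) P[OF that]])
  have Pl: "is_projective_cover n q (P l r) (simple_mod q l r)" by (rule cover[OF lb(1,5)])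
  then have pP: "is_projective n q (P l r)" by (simp add: is_projective_cover_def)
  have hM: "is_hmod n q M" using M by (simp add: is_band_def)
  note band = band_hmod_mult[OF q \<open>s \<ge> 1\<close> pP M]
  have tn: "n + 1 + t = l + l'" using t by linarith
  have tl: "t + 1 \<le> l1" "l1 \<le> n" "l2 < n" "l2 \<le> n" using tn lb assms by auto
  have c1: "nat (ceil_half (int t)) = (t + 1) div 2" unfolding ceil_half_eq by (simp add: nat_div_distrib nat_add_distrib)
  \<comment> \<open>The shift by one inside \<open>ceil_half\<close> restores
    \<open>l + l'\<close>.\<close>
  have c2: "nat (ceil_half (int (l + l' - 1))) = (l + l') div 2"
  proof -
    have "int (l + l' - 1) + 1 = int (l + l')" using lb by simp
    then show ?thesis unfolding ceil_half_eq by (simp add: nat_div_distrib)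
  qed
  let ?A = "\<lambda>i. l + l' - 1 - 2 * i" and ?B = "\<lambda>i. n + l + l' - 1 - 2 * i"
  have lm: "l1 \<le> l" "l1 \<le> l'" "l \<le> l2" "l' \<le> l2" "l1 + l2 = l + l'" using assms by auto
  \<comment> \<open>The first arguments of \<open>P\<close> stay between 1 and \<open>n\<close>, the
    range covered by the assumption on \<open>P\<close>; being positive, they are not falsified by
    truncated subtraction.\<close>
  have A1: "\<forall>i. (t + 1) div 2 \<le> i \<and> i < t + 1 \<longrightarrow> 1 \<le> ?A i \<and> ?A i \<le> n" using tn lb by auto
  have A2: "\<forall>i. t + 1 \<le> i \<and> i < l1 \<longrightarrow> 1 \<le> ?A i \<and> ?A i \<le> n" using tn lb lm by auto
  have B1: "\<forall>i. l2 \<le> i \<and> i < n \<longrightarrow> 1 \<le> ?B i \<and> ?B i \<le> n" using tn lb lm by auto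
  have B2: "\<forall>i. (l + l') div 2 \<le> i \<and> i < l2 \<longrightarrow> 1 \<le> ?B i \<and> ?B i \<le> n" using tn lb lm tl by auto
  let ?S1 = "hsum (map (\<lambda>i. copies (2 * s) (P (?A i) (r + r' + int i))) [(t + 1) div 2..<t + 1])"
  let ?S2 = "hsum (map (\<lambda>i. copies s (P (?A i) (r + r' + int i))) [t + 1..<l1])"
  let ?S3 = "hsum (map (\<lambda>i. copies s (P (?B i) (r + r' + int i))) [l2..<n])"
  let ?S4 = "hsum (map (\<lambda>i. copies (2 * s) (P (?B i) (r + r' + int i))) [(l + l') div 2..<l2])"
  have tb: "t + 1 \<le> n" using tl by simp
  have cov: "\<forall>j u. 1 \<le> j \<and> j \<le> n \<longrightarrow> is_projective_cover n q (P j u) (simple_mod q j u)" using cover by blast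
  note S1 = mult_progression[OF q n(1) cov A1 tb]
  note S2 = mult_progression[OF q n(1) cov A2 tl(2)]
  note S3 = mult_progression[OF q n(1) cov B1 order.refl]
  note S4 = mult_progression[OF q n(1) cov B2 tl(4)]
  have pS: "is_projective n q X" if "X \<in> set [?S1, ?S2, ?S3, ?S4]" for X
  proof -
    consider "X = ?S1" | "X = ?S2" | "X = ?S3" | "X = ?S4" using \<open>X \<in> _\<close> unfolding list.set by blast
    then show ?thesis
    proof cases
      case 1
      show ?thesis unfolding 1 by (rule projective_progression[OF cov A1])
    next
      case 2
      show ?thesis unfolding 2 by (rule projective_progression[OF cov A2])
    next
      case 3
      show ?thesis unfolding 3 by (rule projective_progression[OF cov B1])
    next
      case 4
      show ?thesis unfolding 4 by (rule projective_progression[OF cov B2])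
    qed
  qed
  then have sqS: "square_mod X" if "X \<in> set [?S1, ?S2, ?S3, ?S4]" for X
    using that hmod_square unfolding is_projective_def by blast
  show ?thesis unfolding c1 c2
  proof (rule projective_iso[OF q n(1) cover projective_tensor[OF q pP hM] hsum_projective[OF pS]])
    fix j u assume j: "1 \<le> j" "j \<le> n"
    \<comment> \<open>The one index below \<open>n\<close>, hence in any of the four ranges, for
      which \<open>r + r' + i\<close> agrees with \<open>u\<close> modulo \<open>n\<close>.\<close>
    define i where "i = nat ((u - r - r') mod int n)"
    have ii: "int i = (u - r - r') mod int n" using n by (simp add: i_def)
    have i: "i < n" using ii n by (metis of_nat_0_less_iff of_nat_less_iff pos_mod_bound)
    have "int n dvd int i - (u - r - r')" unfolding ii mod_eq_dvd_iff[symmetric] by simp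
    then have u: "int n dvd r + r' + int i - u" by (simp add: algebra_simps)
    have "mult q (P l r \<otimes>\<^sub>H M) j u = s * mult q (P l r \<otimes>\<^sub>H band1 n q l' r' (Fin 0)) j u"
      unfolding band(2) mult_tensor_band1[OF q lb(3,4) pP band(1)] ..
    also have "mult q (P l r \<otimes>\<^sub>H band1 n q l' r' (Fin 0)) j u =
       2 * of_bool ((t + 1) div 2 \<le> i \<and> i < t + 1 \<and> j = ?A i) + of_bool (t + 1 \<le> i \<and> i < l1 \<and> j = ?A i) +
       of_bool (l2 \<le> i \<and> i < n \<and> j = ?B i) + 2 * of_bool ((l + l') div 2 \<le> i \<and> i < l2 \<and> j = ?B i)"
      unfolding mult_tensor_zero_band[OF q lb(1-4) j Pl] sum_residue_pair[OF lb(2) j(2) i u] \<open>l1 = _\<close> \<open>l2 = _\<close>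
      by (rule multiplicity_count) (use assms j i in auto)
    also have "s * \<dots> = mult q ?S1 j u + mult q ?S2 j u + mult q ?S3 j u + mult q ?S4 j u"
      unfolding S1[OF i u j] S2[OF i u j] S3[OF i u j] S4[OF i u j] by (simp add: algebra_simps)
    also have "\<dots> = mult q (hsum [?S1, ?S2, ?S3, ?S4]) j u"
      using mult_hsum[of "[?S1, ?S2, ?S3, ?S4]" q j u, OF sqS] by (simp only: list.map sum_list.Cons sum_list.Nil add_0_right add.assoc)
    finally show "mult q (P l r \<otimes>\<^sub>H M) j u = mult q (hsum [?S1, ?S2, ?S3, ?S4]) j u" .
  qed
qed

end
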